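(* Let $G=(V,E)$ be a directed graph with $n=|V|$ and a positive real weight $w(e)$ on each edge $e$, and let $\Sigma$ be a sequence of decremental updates on $G$. Then there is an algorithm that maintains, under the updates in $\Sigma$, the shortest path dag rooted at every vertex of $V$ (i.e., all-pairs all shortest paths), a representation of all locally shortest paths of the current graph, and the betweenness centrality scores of all vertices, in amortized time $O(\nu^{*2}\cdot \log n)$ per update, provided $|\Sigma| = \Omega(m^*/\nu^* )$.
   Context: A decremental update on a vertex $v$ either deletes a subset of the edges incident on $v$, or increases the weights (keeping them positive) of a subset of the edges incident on $v$ (deleting $v$ itself is also allowed). For $x,y\in V$, $d(x,y)$ denotes the shortest path distance (sum of edge weights) from $x$ to $y$. The shortest path dag rooted at $s$ is the subgraph consisting of all edges lying on some shortest path from $s$. A path $\pi_{xy}$ is a locally shortest path (LSP) if it consists of a single vertex or every proper subpath of it is a shortest path. $\nu^*$ denotes the maximum, over all vertices $v$, of the number of edges that lie on shortest paths through $v$ (this bound is taken to hold for the graphs arising during the update sequence), and $m^*$ denotes the number of edges of the graph that lie on some shortest path; it is assumed that $\nu^*=\Omega(n)$. For $s,t\in V$, $\sigma_{st}$ is the number of shortest paths from $s$ to $t$ and $\sigma_{st}(v)$ the number of those passing through $v$; the betweenness centrality of $v$ is $BC(v)=\sum_{s\neq v, t\neq v} \sigma_{st}(v)/\sigma_{st}$. *)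

theory Defs
  imports "Graph_Theory.Graph_Theory" Complex_Main
begin

section \<open>Shortest paths, locally shortest paths and betweenness centrality\<close>

text \<open>
  Paths are those of \<^theory>\<open>Graph_Theory.Arc_Walk\<close>: arc lists \<open>p\<close> with start vertex \<open>x\<close> and
  end vertex \<open>y\<close> whose vertices are pairwise distinct. The empty list is the path
  consisting of the single vertex \<open>x = y\<close>.
\<close>

definition shortest_path ::
    "'a pair_pre_digraph \<Rightarrow> ('a \<times> 'a) weight_fun \<Rightarrow> 'a \<Rightarrow> ('a \<times> 'a) awalk \<Rightarrow> 'a \<Rightarrow> bool" where
  "shortest_path G w x p y \<longleftrightarrow>
     pre_digraph.apath (with_proj G) x p y \<and>
     ereal (wf_digraph.awalk_cost w p) = wf_digraph.\<mu> (with_proj G) w x y"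

definition locally_shortest_path ::
    "'a pair_pre_digraph \<Rightarrow> ('a \<times> 'a) weight_fun \<Rightarrow> 'a \<Rightarrow> ('a \<times> 'a) awalk \<Rightarrow> 'a \<Rightarrow> bool" where
  "locally_shortest_path G w x p y \<longleftrightarrow>
     pre_digraph.apath (with_proj G) x p y \<and>
     (p = [] \<or>
      (\<forall>p1 q p2. p = p1 @ q @ p2 \<and> q \<noteq> p \<longrightarrow>
         shortest_path G w (pre_digraph.awlast (with_proj G) x p1) q
                           (pre_digraph.awlast (with_proj G) x (p1 @ q))))"

definition sp_dag :: "'a pair_pre_digraph \<Rightarrow> ('a \<times> 'a) weight_fun \<Rightarrow> 'a \<Rightarrow> ('a \<times> 'a) set" where
  "sp_dag G w s = {e. \<exists>p t. shortest_path G w s p t \<and> e \<in> set p}"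

definition sp_edges :: "'a pair_pre_digraph \<Rightarrow> ('a \<times> 'a) weight_fun \<Rightarrow> ('a \<times> 'a) set" where
  "sp_edges G w = {e. \<exists>x p y. shortest_path G w x p y \<and> e \<in> set p}"

definition sp_edges_through ::
    "'a pair_pre_digraph \<Rightarrow> ('a \<times> 'a) weight_fun \<Rightarrow> 'a \<Rightarrow> ('a \<times> 'a) set" where
  "sp_edges_through G w v =
     {e. \<exists>x p y. shortest_path G w x p y \<and>
                 v \<in> set (pre_digraph.awalk_verts (with_proj G) x p) \<and> e \<in> set p}"

definition m_star :: "'a pair_pre_digraph \<Rightarrow> ('a \<times> 'a) weight_fun \<Rightarrow> nat" where
  "m_star G w = card (sp_edges G w)"

text \<open>The inserted 0 only matters for the graph without vertices.\<close>

definition nu_star :: "'a pair_pre_digraph \<Rightarrow> ('a \<times> 'a) weight_fun \<Rightarrow> nat" where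
  "nu_star G w = Max (insert 0 ((\<lambda>v. card (sp_edges_through G w v)) ` pverts G))"

definition sigma :: "'a pair_pre_digraph \<Rightarrow> ('a \<times> 'a) weight_fun \<Rightarrow> 'a \<Rightarrow> 'a \<Rightarrow> nat" where
  "sigma G w s t = card {p. shortest_path G w s p t}"

definition sigma_via :: "'a pair_pre_digraph \<Rightarrow> ('a \<times> 'a) weight_fun \<Rightarrow> 'a \<Rightarrow> 'a \<Rightarrow> 'a \<Rightarrow> nat" where
  "sigma_via G w s t v =
     card {p. shortest_path G w s p t \<and> v \<in> set (pre_digraph.awalk_verts (with_proj G) s p)}"

text \<open>Pairs with \<open>t\<close> unreachable from \<open>s\<close> contribute \<open>0 / 0 = 0\<close>.\<close>

definition betweenness :: "'a pair_pre_digraph \<Rightarrow> ('a \<times> 'a) weight_fun \<Rightarrow> 'a \<Rightarrow> real" where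
  "betweenness G w v =
     (\<Sum>s\<in>pverts G - {v}. \<Sum>t\<in>pverts G - {v}. real (sigma_via G w s t v) / real (sigma G w s t))"

text \<open>
  A graph can have exponentially many locally shortest paths. They are represented by
  locally shortest tuples: the locally shortest paths from \<open>x\<close> to \<open>y\<close> with at least one edge
  are grouped by first edge \<open>(x, a)\<close> and last edge \<open>(b, y)\<close>, and each nonempty group is stored
  with the common weight \<open>c\<close> of its paths and their number \<open>k\<close>. A single edge \<open>(x, y)\<close> has
  \<open>a = y\<close> and \<open>b = x\<close>.
\<close>

definition lsp_group ::
    "'a pair_pre_digraph \<Rightarrow> ('a \<times> 'a) weight_fun \<Rightarrow> 'a \<Rightarrow> 'a \<Rightarrow> 'a \<Rightarrow> 'a \<Rightarrow> ('a \<times> 'a) awalk set" where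
  "lsp_group G w x a b y =
     {p. locally_shortest_path G w x p y \<and> p \<noteq> [] \<and> hd p = (x, a) \<and> last p = (b, y)}"

definition lsp_tuples ::
    "'a pair_pre_digraph \<Rightarrow> ('a \<times> 'a) weight_fun \<Rightarrow> 'a \<Rightarrow> 'a \<Rightarrow> ('a \<times> 'a \<times> real \<times> real) set" where
  "lsp_tuples G w x y =
     {(a, b, c, k). lsp_group G w x a b y \<noteq> {} \<and>
        (\<forall>p\<in>lsp_group G w x a b y. wf_digraph.awalk_cost w p = c) \<and>
        k = real (card (lsp_group G w x a b y))}"


section \<open>Decremental updates\<close>

type_synonym wgraph = "nat pair_pre_digraph \<times> (nat \<times> nat) weight_fun"

text \<open>A weight increase lists the affected edges together with their new weights.\<close>

datatype update =
    Delete_Vertex nat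
  | Delete_Edges nat "(nat \<times> nat) list"
  | Increase_Weights nat "((nat \<times> nat) \<times> real) list"

definition incident :: "nat \<Rightarrow> nat \<times> nat \<Rightarrow> bool" where
  "incident v e \<longleftrightarrow> fst e = v \<or> snd e = v"

fun valid_update :: "update \<Rightarrow> wgraph \<Rightarrow> bool" where
  "valid_update (Delete_Vertex v) (G, w) \<longleftrightarrow> v \<in> pverts G"
| "valid_update (Delete_Edges v es) (G, w) \<longleftrightarrow>
     v \<in> pverts G \<and> distinct es \<and> (\<forall>e\<in>set es. e \<in> parcs G \<and> incident v e)"
| "valid_update (Increase_Weights v ps) (G, w) \<longleftrightarrow>
     v \<in> pverts G \<and> distinct (map fst ps) \<and>
     (\<forall>(e, c)\<in>set ps. e \<in> parcs G \<and> incident v e \<and> w e < c)"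

fun apply_update :: "update \<Rightarrow> wgraph \<Rightarrow> wgraph" where
  "apply_update (Delete_Vertex v) (G, w) =
     (\<lparr>pverts = pverts G - {v}, parcs = {e \<in> parcs G. \<not> incident v e}\<rparr>, w)"
| "apply_update (Delete_Edges v es) (G, w) = (\<lparr>pverts = pverts G, parcs = parcs G - set es\<rparr>, w)"
| "apply_update (Increase_Weights v ps) (G, w) =
     (G, \<lambda>e. case map_of ps e of None \<Rightarrow> w e | Some c \<Rightarrow> c)"

definition graph_after :: "wgraph \<Rightarrow> update list \<Rightarrow> nat \<Rightarrow> wgraph" where
  "graph_after Gw us i = fold apply_update (take i us) Gw"

definition valid_updates :: "wgraph \<Rightarrow> update list \<Rightarrow> bool" where
  "valid_updates Gw us \<longleftrightarrow> (\<forall>i<length us. valid_update (us ! i) (graph_after Gw us i))"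

text \<open>
  Both parameters are taken over all graphs that arise, since neither is monotone
  under decremental updates: deleting a hub can turn a linear number of edges on shortest
  paths into a quadratic one.
\<close>

definition max_nu_star :: "wgraph \<Rightarrow> update list \<Rightarrow> nat" where
  "max_nu_star Gw us = Max ((\<lambda>i. case_prod nu_star (graph_after Gw us i)) ` {..length us})"

definition max_m_star :: "wgraph \<Rightarrow> update list \<Rightarrow> nat" where
  "max_m_star Gw us = Max ((\<lambda>i. case_prod m_star (graph_after Gw us i)) ` {..length us})"


section \<open>The machine model\<close>

text \<open>
  A unit-cost random access machine with two kinds of memory: natural-number words, all of
  which must stay below the word bound \<open>W\<close> (including addresses and intermediate results),
  and exact real numbers, as usual for algorithms on real edge weights. Reals
  support field arithmetic and comparison only; in particular they cannot be rounded or
  otherwise converted into words. Memory is organised into named arrays (a program mentions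
  only finitely many of them); a scalar is an array used at index 0.
\<close>

record state =
  words :: "string \<Rightarrow> nat \<Rightarrow> nat"
  reals :: "string \<Rightarrow> nat \<Rightarrow> real"

datatype wexp =
    WConst nat
  | WGet string wexp
  | WAdd wexp wexp
  | WSub wexp wexp
  | WMul wexp wexp
  | WDiv wexp wexp
  | WMod wexp wexp

datatype rexp =
    RZero
  | ROne
  | RGet string wexp
  | RAdd rexp rexp
  | RSub rexp rexp
  | RMul rexp rexp
  | RDiv rexp rexp

datatype test =
    WLess wexp wexp
  | WEq wexp wexp
  | RLess rexp rexp
  | REq rexp rexp
  | TNot test
  | TAnd test test

datatype com =
    Skip
  | WSet string wexp wexp
  | RSet string wexp rexp
  | Seq com com
  | Cond test com com
  | While test com

fun wval :: "state \<Rightarrow> wexp \<Rightarrow> nat" where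
  "wval s (WConst n) = n"
| "wval s (WGet x i) = words s x (wval s i)"
| "wval s (WAdd a b) = wval s a + wval s b"
| "wval s (WSub a b) = wval s a - wval s b"
| "wval s (WMul a b) = wval s a * wval s b"
| "wval s (WDiv a b) = wval s a div wval s b"
| "wval s (WMod a b) = wval s a mod wval s b"

fun rval :: "state \<Rightarrow> rexp \<Rightarrow> real" where
  "rval s RZero = 0"
| "rval s ROne = 1"
| "rval s (RGet x i) = reals s x (wval s i)"
| "rval s (RAdd a b) = rval s a + rval s b"
| "rval s (RSub a b) = rval s a - rval s b"
| "rval s (RMul a b) = rval s a * rval s b"
| "rval s (RDiv a b) = rval s a / rval s b"

fun tval :: "state \<Rightarrow> test \<Rightarrow> bool" where
  "tval s (WLess a b) \<longleftrightarrow> wval s a < wval s b"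
| "tval s (WEq a b) \<longleftrightarrow> wval s a = wval s b"
| "tval s (RLess a b) \<longleftrightarrow> rval s a < rval s b"
| "tval s (REq a b) \<longleftrightarrow> rval s a = rval s b"
| "tval s (TNot t) \<longleftrightarrow> \<not> tval s t"
| "tval s (TAnd t u) \<longleftrightarrow> tval s t \<and> tval s u"

text \<open>Every word occurring in the evaluation of an expression is below the bound.\<close>

fun wfits :: "nat \<Rightarrow> state \<Rightarrow> wexp \<Rightarrow> bool" where
  "wfits W s (WConst n) \<longleftrightarrow> n < W"
| "wfits W s (WGet x i) \<longleftrightarrow> wfits W s i \<and> wval s (WGet x i) < W"
| "wfits W s (WAdd a b) \<longleftrightarrow> wfits W s a \<and> wfits W s b \<and> wval s (WAdd a b) < W"
| "wfits W s (WSub a b) \<longleftrightarrow> wfits W s a \<and> wfits W s b"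
| "wfits W s (WMul a b) \<longleftrightarrow> wfits W s a \<and> wfits W s b \<and> wval s (WMul a b) < W"
| "wfits W s (WDiv a b) \<longleftrightarrow> wfits W s a \<and> wfits W s b"
| "wfits W s (WMod a b) \<longleftrightarrow> wfits W s a \<and> wfits W s b"

fun rfits :: "nat \<Rightarrow> state \<Rightarrow> rexp \<Rightarrow> bool" where
  "rfits W s RZero \<longleftrightarrow> True"
| "rfits W s ROne \<longleftrightarrow> True"
| "rfits W s (RGet x i) \<longleftrightarrow> wfits W s i"
| "rfits W s (RAdd a b) \<longleftrightarrow> rfits W s a \<and> rfits W s b"
| "rfits W s (RSub a b) \<longleftrightarrow> rfits W s a \<and> rfits W s b"
| "rfits W s (RMul a b) \<longleftrightarrow> rfits W s a \<and> rfits W s b"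
| "rfits W s (RDiv a b) \<longleftrightarrow> rfits W s a \<and> rfits W s b"

fun tfits :: "nat \<Rightarrow> state \<Rightarrow> test \<Rightarrow> bool" where
  "tfits W s (WLess a b) \<longleftrightarrow> wfits W s a \<and> wfits W s b"
| "tfits W s (WEq a b) \<longleftrightarrow> wfits W s a \<and> wfits W s b"
| "tfits W s (RLess a b) \<longleftrightarrow> rfits W s a \<and> rfits W s b"
| "tfits W s (REq a b) \<longleftrightarrow> rfits W s a \<and> rfits W s b"
| "tfits W s (TNot t) \<longleftrightarrow> tfits W s t"
| "tfits W s (TAnd t u) \<longleftrightarrow> tfits W s t \<and> tfits W s u"

text \<open>
  \<open>exec W c s t s'\<close>: started in \<open>s\<close>, the program \<open>c\<close> terminates in \<open>s'\<close> after \<open>t\<close> steps. There is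
  no such \<open>t\<close> and \<open>s'\<close> if the program diverges or violates the word bound. Expressions are
  part of the program text, so that charging one step for an assignment or a test
  counts elementary operations up to a factor depending on the program only.
\<close>

inductive exec :: "nat \<Rightarrow> com \<Rightarrow> state \<Rightarrow> nat \<Rightarrow> state \<Rightarrow> bool" for W :: nat where
  Skip: "exec W Skip s 1 s"
| WSet: "wfits W s i \<Longrightarrow> wfits W s a \<Longrightarrow>
    exec W (WSet x i a) s 1
      (s\<lparr>words := (words s)(x := (words s x)(wval s i := wval s a))\<rparr>)"
| RSet: "wfits W s i \<Longrightarrow> rfits W s a \<Longrightarrow>
    exec W (RSet x i a) s 1
      (s\<lparr>reals := (reals s)(x := (reals s x)(wval s i := rval s a))\<rparr>)"
| Seq: "exec W c s t s' \<Longrightarrow> exec W d s' u s'' \<Longrightarrow> exec W (Seq c d) s (t + u) s''"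
| CondTrue: "tfits W s b \<Longrightarrow> tval s b \<Longrightarrow> exec W c s t s' \<Longrightarrow> exec W (Cond b c d) s (1 + t) s'"
| CondFalse: "tfits W s b \<Longrightarrow> \<not> tval s b \<Longrightarrow> exec W d s t s' \<Longrightarrow> exec W (Cond b c d) s (1 + t) s'"
| WhileFalse: "tfits W s b \<Longrightarrow> \<not> tval s b \<Longrightarrow> exec W (While b c) s 1 s"
| WhileTrue: "tfits W s b \<Longrightarrow> tval s b \<Longrightarrow> exec W c s t s' \<Longrightarrow> exec W (While b c) s' u s'' \<Longrightarrow>
    exec W (While b c) s (1 + t + u) s''"


section \<open>Input and output conventions\<close>

definition scalar :: "'a::zero \<Rightarrow> nat \<Rightarrow> 'a" where
  "scalar a = (\<lambda>i. if i = 0 then a else 0)"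

definition array_of :: "'a::zero list \<Rightarrow> nat \<Rightarrow> 'a" where
  "array_of xs = (\<lambda>i. if i < length xs then xs ! i else 0)"

text \<open>The input graph has vertices \<open>0, ..., n - 1\<close> and its edges are listed in \<open>es\<close>.\<close>

definition initial_state :: "nat \<Rightarrow> (nat \<times> nat) list \<Rightarrow> (nat \<times> nat) weight_fun \<Rightarrow> state" where
  "initial_state n es w =
     \<lparr>words = (\<lambda>_ _. 0)
        (''n'' := scalar n,
         ''m'' := scalar (length es),
         ''src'' := array_of (map fst es),
         ''dst'' := array_of (map snd es)),
      reals = (\<lambda>_ _. 0)(''wt'' := array_of (map w es))\<rparr>"

fun load_update :: "update \<Rightarrow> state \<Rightarrow> state" where
  "load_update (Delete_Vertex v) s =
     s\<lparr>words := (words s)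
         (''upd_kind'' := scalar 0,
          ''upd_vertex'' := scalar v)\<rparr>"
| "load_update (Delete_Edges v es) s =
     s\<lparr>words := (words s)
         (''upd_kind'' := scalar 1,
          ''upd_vertex'' := scalar v,
          ''upd_len'' := scalar (length es),
          ''upd_src'' := array_of (map fst es),
          ''upd_dst'' := array_of (map snd es))\<rparr>"
| "load_update (Increase_Weights v ps) s =
     s\<lparr>words := (words s)
         (''upd_kind'' := scalar 2,
          ''upd_vertex'' := scalar v,
          ''upd_len'' := scalar (length ps),
          ''upd_src'' := array_of (map (fst \<circ> fst) ps),
          ''upd_dst'' := array_of (map (snd \<circ> fst) ps)),
       reals := (reals s)(''upd_wt'' := array_of (map snd ps))\<rparr>"

text \<open>
  Blocks of length \<open>n\<^sup>2\<close> hold the edges of the shortest path dag rooted at \<open>r\<close> and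
  the locally shortest tuples from \<open>x\<close> to \<open>y\<close>.
\<close>

definition read_dag :: "nat \<Rightarrow> state \<Rightarrow> nat \<Rightarrow> (nat \<times> nat) list" where
  "read_dag n s r =
     map (\<lambda>i. (words s ''dag_src'' (r * n^2 + i), words s ''dag_dst'' (r * n^2 + i)))
       [0..<words s ''dag_len'' r]"

definition read_tuples :: "nat \<Rightarrow> state \<Rightarrow> nat \<Rightarrow> nat \<Rightarrow> (nat \<times> nat \<times> real \<times> real) list" where
  "read_tuples n s x y =
     map (\<lambda>i. let j = (x * n + y) * n^2 + i
              in (words s ''lsp_a'' j, words s ''lsp_b'' j,
                  reals s ''lsp_weight'' j, reals s ''lsp_count'' j))
       [0..<words s ''lsp_len'' (x * n + y)]"

fun output_correct :: "nat \<Rightarrow> wgraph \<Rightarrow> state \<Rightarrow> bool" where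
  "output_correct n (G, w) s \<longleftrightarrow>
     (\<forall>r\<in>pverts G. distinct (read_dag n s r) \<and> set (read_dag n s r) = sp_dag G w r) \<and>
     (\<forall>x\<in>pverts G. \<forall>y\<in>pverts G.
        distinct (read_tuples n s x y) \<and> set (read_tuples n s x y) = lsp_tuples G w x y) \<and>
     (\<forall>v\<in>pverts G. reals s ''bc'' v = betweenness G w v)"

text \<open>
  An algorithm consists of an initialisation \<open>ini\<close>, run once on the input graph, and an update
  procedure \<open>upd\<close>, run once per update in the memory left by the previous run (so updates
  are processed online). \<open>S i\<close> is the memory after \<open>i\<close> updates and \<open>T i\<close> the
  running time of the update with index \<open>i\<close>; the time of the initialisation
  is not part of the update times.
\<close>

definition maintains ::
    "com \<Rightarrow> com \<Rightarrow> nat \<Rightarrow> nat \<Rightarrow> (nat \<times> nat) list \<Rightarrow> wgraph \<Rightarrow> update list \<Rightarrow>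
     (nat \<Rightarrow> nat) \<Rightarrow> bool" where
  "maintains ini upd W n es Gw us T \<longleftrightarrow>
     (\<exists>S t0.
        exec W ini (initial_state n es (snd Gw)) t0 (S 0) \<and>
        (\<forall>i<length us. exec W upd (load_update (us ! i) (S i)) (T i) (S (Suc i))) \<and>
        (\<forall>i\<le>length us. output_correct n (graph_after Gw us i) (S i)))"

definition valid_instance ::
    "nat \<Rightarrow> (nat \<times> nat) list \<Rightarrow> wgraph \<Rightarrow> update list \<Rightarrow> bool" where
  "valid_instance n es Gw us \<longleftrightarrow>
     pair_fin_digraph (fst Gw) \<and> pverts (fst Gw) = {..<n} \<and>
     distinct es \<and> set es = parcs (fst Gw) \<and>
     (\<forall>e\<in>parcs (fst Gw). 0 < snd Gw e) \<and>
     valid_updates Gw us"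

end

theory Submission
 imports Defs
begin

text \<open>
 Locally shortest tuples are stored by extending shortest paths: \<open>XE a b\<close> is the set of vertices
 \<open>x\<close> for which \<open>(x, a)\<close> followed by a shortest path from \<open>a\<close> to \<open>b\<close> is again shortest, \<open>YE a b\<close>
 is the analogous set at the other end, and the tuples with more than one edge are exactly the
 \<open>(x, a, b, y)\<close> with \<open>x \<in> XE a b\<close>, \<open>y \<in> YE a b\<close> and \<open>x \<noteq> y\<close>. An update at \<open>v\<close> first removes
 all extensions that pass through \<open>v\<close>; everything that remains is locally shortest in the new
 graph as well, with unchanged weights and counts. A Dijkstra-like phase then settles the vertex
 pairs in the order of their distances, the candidates for each pair being kept in tournament
 trees, and creates the missing extensions. Betweenness scores follow by Brandes' accumulation
 over the pairs in reverse order.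

 A tuple through \<open>v\<close> is determined by two edges on shortest paths through \<open>v\<close>, and a tuple with
 an end at \<open>v\<close> by a vertex \<open>a\<close> and an edge on a shortest path through \<open>a\<close>, so an update deletes
 \<open>O(\<nu>\<^sup>2 + n\<nu>)\<close> tuples. Insertions are paid for by later deletions, apart from the tuples present at the
 end, of which there are at most \<open>m\<^sup>*\<nu> + n\<^sup>2\<close>.
\<close>

text \<open>All shortest paths between two fixed vertices have the same length, so whether an edge
  may be put before or after one of them depends on the ends only; this is why four vertices can
  stand for a possibly exponential set of paths. An update lengthens only walks through
  \<open>v\<close>. A pair whose shortest paths avoid \<open>v\<close> therefore keeps its distance,
  its paths and its extensions away from \<open>v\<close>, and the stored weights and counts can be
  read as those of the new graph.

  The number of tuples can rise again after an update, because other paths become shortest. So it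
  serves as a potential, at the logarithmic rate \<open>18 * h + 52\<close> per tuple. Recomputing
  the distances of all pairs is affordable: the shortest path edges leaving or entering along paths
  of one vertex number at most \<nu>, so this takes order \<open>n * n + n * \<nu>\<close> tree
  operations. The assumption that \<nu> is at least proportional to \<open>n\<close> absorbs these
  terms, and the lower bound on the number of updates spreads the potential of the final graph over
  the whole sequence.\<close>

section \<open>Weakest preconditions\<close>

text \<open>The postcondition receives the step count, so time and result are proved together. The
  existential quantifier expresses total correctness: \<open>exec\<close> has no derivation for a
  run that diverges or exceeds the word bound.\<close>

definition wp :: "nat \<Rightarrow> com \<Rightarrow> (nat \<Rightarrow> state \<Rightarrow> bool) \<Rightarrow> state \<Rightarrow> bool" where
 "wp W c Q s \<longleftrightarrow> (\<exists>t s'. exec W c s t s' \<and> Q t s')"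

definition wupd :: "state \<Rightarrow> string \<Rightarrow> nat \<Rightarrow> nat \<Rightarrow> state" where
 "wupd s x i v = s\<lparr>words := (words s)(x := (words s x)(i := v))\<rparr>"

definition rupd :: "state \<Rightarrow> string \<Rightarrow> nat \<Rightarrow> real \<Rightarrow> state" where
 "rupd s x i v = s\<lparr>reals := (reals s)(x := (reals s x)(i := v))\<rparr>"

lemma upd_simps [simp]:
 "words (wupd s x i v) y = (if y = x then (words s x)(i := v) else words s y)"
 "reals (wupd s x i v) = reals s"
 "reals (rupd s x i r) y = (if y = x then (reals s x)(i := r) else reals s y)"
 "words (rupd s x i r) = words s"
 by (auto simp: wupd_def rupd_def)

fun word_writes :: "com \<Rightarrow> string set" where
 "word_writes Skip = {}"
| "word_writes (WSet x i a) = {x}"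
| "word_writes (RSet x i a) = {}"
| "word_writes (Seq c d) = word_writes c \<union> word_writes d"
| "word_writes (Cond b c d) = word_writes c \<union> word_writes d"
| "word_writes (While b c) = word_writes c"

fun real_writes :: "com \<Rightarrow> string set" where
 "real_writes Skip = {}"
| "real_writes (WSet x i a) = {}"
| "real_writes (RSet x i a) = {x}"
| "real_writes (Seq c d) = real_writes c \<union> real_writes d"
| "real_writes (Cond b c d) = real_writes c \<union> real_writes d"
| "real_writes (While b c) = real_writes c"

lemma exec_frame:
 "exec W c s t s' \<Longrightarrow>
  (\<forall>x. x \<notin> word_writes c \<longrightarrow> words s' x = words s x) \<and>
  (\<forall>x. x \<notin> real_writes c \<longrightarrow> reals s' x = reals s x)"
 by (induction rule: exec.induct) auto

text \<open>The frame property is built into the rule of consequence, so the specifications below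
  mention only the arrays whose new contents matter.\<close>

lemma wp_conseq:
 assumes "wp W c Q s"
  and "\<And>t s'. Q t s' \<Longrightarrow> (\<And>x. x \<notin> word_writes c \<Longrightarrow> words s' x = words s x) \<Longrightarrow>
     (\<And>x. x \<notin> real_writes c \<Longrightarrow> reals s' x = reals s x) \<Longrightarrow> Q' t s'"
 shows "wp W c Q' s"
 using assms exec_frame unfolding wp_def by meson

lemma wp_Skip: "Q 1 s \<Longrightarrow> wp W Skip Q s"
 unfolding wp_def using exec.Skip by blast

lemma wp_WSet:
 "wfits W s i \<Longrightarrow> wfits W s a \<Longrightarrow> Q 1 (wupd s x (wval s i) (wval s a)) \<Longrightarrow> wp W (WSet x i a) Q s"
 unfolding wp_def wupd_def using exec.WSet by blast

lemma wp_RSet: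
 "wfits W s i \<Longrightarrow> rfits W s a \<Longrightarrow> Q 1 (rupd s x (wval s i) (rval s a)) \<Longrightarrow> wp W (RSet x i a) Q s"
 unfolding wp_def rupd_def using exec.RSet by blast

lemma wp_Seq:
 "wp W c (\<lambda>t s'. wp W d (\<lambda>u. Q (t + u)) s') s \<Longrightarrow> wp W (Seq c d) Q s"
 unfolding wp_def using exec.Seq by blast

lemma wp_Cond:
 assumes "tfits W s b"
  "tval s b \<Longrightarrow> wp W c (\<lambda>t. Q (Suc t)) s"
  "\<not> tval s b \<Longrightarrow> wp W d (\<lambda>t. Q (Suc t)) s"
 shows "wp W (Cond b c d) Q s"
 using assms exec.CondTrue exec.CondFalse unfolding wp_def
 by (metis plus_1_eq_Suc)

text \<open>The elapsed time is an argument of the invariant, and the measure \<open>\<mu>\<close>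
  serves termination alone. Time bounds can thus be amortised inside \<open>I\<close> instead of
  being a round count times a worst case.\<close>

lemma wp_While:
 fixes \<mu> :: "state \<Rightarrow> nat"
 assumes I: "I 0 s"
  and fits: "\<And>t s. I t s \<Longrightarrow> tfits W s b"
  and body: "\<And>t s. I t s \<Longrightarrow> tval s b \<Longrightarrow> wp W c (\<lambda>u s'. I (t + u + 1) s' \<and> \<mu> s' < \<mu> s) s"
  and exit: "\<And>t s. I t s \<Longrightarrow> \<not> tval s b \<Longrightarrow> Q (t + 1) s"
 shows "wp W (While b c) Q s"
proof -
 have "I t s \<Longrightarrow> \<exists>u s'. exec W (While b c) s u s' \<and> Q (t + u) s'" for t s
 proof (induction "\<mu> s" arbitrary: s t rule: less_induct)
  case less
  show ?case
  proof (cases "tval s b")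
   case True
   obtain u s' where u: "exec W c s u s'" "I (t + u + 1) s'" "\<mu> s' < \<mu> s"
    using body[OF less.prems True] unfolding wp_def by blast
   obtain v s'' where v: "exec W (While b c) s' v s''" "Q (t + u + 1 + v) s''"
    using less.hyps[OF u(3,2)] by blast
   have "exec W (While b c) s (1 + u + v) s''"
    using exec.WhileTrue[OF fits[OF less.prems] True u(1) v(1)] .
   with v(2) show ?thesis by (auto simp: ac_simps intro!: exI[of _ "1+u+v"])
  next
   case False
   then show ?thesis using exec.WhileFalse fits exit less.prems by blast
  qed
 qed
 from this[OF I] show ?thesis unfolding wp_def by auto
qed

abbreviation C :: "nat \<Rightarrow> wexp" where "C \<equiv> WConst"
abbreviation V :: "string \<Rightarrow> wexp" where "V x \<equiv> WGet x (WConst 0)"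
abbreviation R :: "string \<Rightarrow> rexp" where "R x \<equiv> RGet x (WConst 0)"
abbreviation setw :: "string \<Rightarrow> wexp \<Rightarrow> com" (infix "::=" 61) where "x ::= e \<equiv> WSet x (WConst 0) e"
abbreviation setr :: "string \<Rightarrow> rexp \<Rightarrow> com" (infix "::=r" 61) where "x ::=r e \<equiv> RSet x (WConst 0) e"
notation Seq (infixr ";;" 60)

definition For :: "string \<Rightarrow> wexp \<Rightarrow> com \<Rightarrow> com" where
 "For i e c = (i ::= C 0 ;; While (WLess (V i) e) (c ;; i ::= WAdd (V i) (C 1)))"

lemma writes_For [simp]:
 "word_writes (For i e c) = insert i (word_writes c)"
 "real_writes (For i e c) = real_writes c"
 by (auto simp: For_def)

text \<open>In the invariant, the loop overhead of two steps per iteration is already deducted.\<close>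

lemma wp_For:
 assumes W: "m < W" "0 < W"
  and I0: "I 0 0 (wupd s i 0 0)"
  and e: "\<And>j t s. I j t s \<Longrightarrow> words s i 0 = j \<Longrightarrow> j \<le> m \<Longrightarrow> wfits W s e \<and> wval s e = m"
  and body: "\<And>j t s. I j t s \<Longrightarrow> words s i 0 = j \<Longrightarrow> j < m \<Longrightarrow>
   wp W c (\<lambda>u s'. words s' i 0 = j \<and> I (Suc j) (t + u) (wupd s' i 0 (Suc j))) s"
  and exit: "\<And>t s. I m t s \<Longrightarrow> words s i 0 = m \<Longrightarrow> Q (t + 2 * m + 2) s"
 shows "wp W (For i e c) Q s"
proof -
 let ?I = "\<lambda>t s. \<exists>j\<le>m. words s i 0 = j \<and> (\<exists>u. t = u + 2 * j \<and> I j u s)"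
 show ?thesis
  unfolding For_def
  apply (rule wp_Seq, rule wp_WSet)
  subgoal using W by simp
  subgoal using W by simp
  apply (rule wp_While[where I = ?I and \<mu> = "\<lambda>s. m - words s i 0"])
  subgoal using I0 by auto
  subgoal for t s using e W by (auto; fastforce)
  subgoal for t s
   apply clarsimp
   subgoal for u
    apply (rule wp_Seq)
    apply (rule wp_conseq[OF body[of "words s i 0" u s]])
    apply simp_all[2]
    subgoal using e[of "words s i 0" u s] by (auto)
    subgoal for t' s'
     apply (rule wp_WSet)
     subgoal using W by simp
     subgoal using W e[of "words s i 0" u s] by auto
     subgoal using e[of "words s i 0" u s] by (auto intro!: exI[of _ "u + t'"])
     done
    done
   done
  subgoal for t s using exit e by (auto; fastforce simp: not_less)
  done
qed

section \<open>Tournament trees\<close>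

text \<open>
 Entry \<open>0\<close> of a node means that no leaf below it is present, and \<open>i + 1\<close> that \<open>i\<close> is a present
 leaf of minimal key below it. The leaves are the nodes \<open>sz, ..., 2 * sz - 1\<close>; the number \<open>sz\<close>
 need not be a power of two.
\<close>

definition better :: "(nat \<Rightarrow> real) \<Rightarrow> nat \<Rightarrow> nat \<Rightarrow> nat" where
 "better K u v = (if u \<noteq> 0 \<and> \<not> (v \<noteq> 0 \<and> K (v - 1) < K (u - 1)) then u else v)"

definition tree :: "(nat \<Rightarrow> nat) \<Rightarrow> (nat \<Rightarrow> real) \<Rightarrow> nat \<Rightarrow> nat \<Rightarrow> nat \<Rightarrow> nat set \<Rightarrow> (nat \<Rightarrow> real) \<Rightarrow> bool" where
 "tree A K sz b k P key \<longleftrightarrow>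
   P \<subseteq> {..<sz} \<and>
   (\<forall>i<sz. A (b + (sz + i)) = (if i \<in> P then i + 1 else 0)) \<and>
   (\<forall>i\<in>P. K (k + i) = key i) \<and>
   (\<forall>j. 1 \<le> j \<and> j < sz \<longrightarrow> A (b + j) = better (\<lambda>i. K (k + i)) (A (b + 2 * j)) (A (b + (2 * j + 1))))"

lemma treeD:
 assumes "tree A K sz b k P key"
 shows "P \<subseteq> {..<sz}" "\<And>i. i < sz \<Longrightarrow> A (b + (sz + i)) = (if i \<in> P then i + 1 else 0)"
  "\<And>i. i \<in> P \<Longrightarrow> K (k + i) = key i"
  "\<And>j. 1 \<le> j \<Longrightarrow> j < sz \<Longrightarrow>
    A (b + j) = better (\<lambda>i. K (k + i)) (A (b + 2 * j)) (A (b + (2 * j + 1)))"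
 using assms unfolding tree_def by auto

text \<open>Each nonzero entry was copied by \<open>better\<close> from a child, so following the
  copies downwards ends at the leaf that the entry names. Ancestors appear as iterated halves
  because the parent of node \<open>l\<close> is \<open>l div 2\<close>.\<close>

lemma tree_node:
 assumes "tree A K sz b k P key" "1 \<le> j" "j < 2 * sz" "A (b + j) \<noteq> 0"
 shows "A (b + j) - 1 \<in> P \<and> (\<exists>e. (sz + (A (b + j) - 1)) div 2 ^ e = j)"
 using assms(2-)
proof (induction "2 * sz - j" arbitrary: j rule: less_induct)
 case less
 show ?case
 proof (cases "j < sz")
  case False
  then obtain i where "j = sz + i" "i < sz" using less.prems
   by (intro that[of "j - sz"]) auto
  then show ?thesis using treeD(2)[OF assms(1), of i] less.prems(3)
   by (auto split: if_splits intro: exI[of _ 0])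
 next
  case True
  have "A (b + j) = A (b + 2 * j) \<or> A (b + j) = A (b + (2 * j + 1))"
   using treeD(4)[OF assms(1), of j] True less.prems(1) unfolding better_def by presburger
  then obtain l where l: "l = 2 * j \<or> l = 2 * j + 1" "A (b + j) = A (b + l)" by blast
  have "2 * sz - l < 2 * sz - j" "1 \<le> l" "l < 2 * sz" using l(1) True less.prems(1) by auto
  from less.hyps[OF this] obtain e where e: "A (b + l) - 1 \<in> P" "(sz + (A (b + l) - 1)) div 2 ^ e = l"
   using l(2) less.prems(3) by auto
  have "(sz + (A (b + l) - 1)) div 2 ^ Suc e = j"
   using e(2) l(1) by (simp add: div_mult2_eq power_Suc2 del: power_Suc) auto
  with e(1) l(2) show ?thesis by (metis)
 qed
qed

text \<open>Induction along the path from leaf \<open>i\<close> to the root: at each step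
  \<open>better\<close> keeps the smaller of two keys, so the winner's key never exceeds that of
  \<open>i\<close>.\<close>

lemma tree_le:
 assumes "tree A K sz b k P key" "i \<in> P" "1 \<le> (sz + i) div 2 ^ e"
 shows "A (b + (sz + i) div 2 ^ e) \<noteq> 0 \<and> key (A (b + (sz + i) div 2 ^ e) - 1) \<le> key i"
 using assms(3)
proof (induction e)
 case 0
 then show ?case using treeD(1,2)[OF assms(1)] assms(2) by auto
next
 case (Suc e)
 let ?l = "(sz + i) div 2 ^ e" and ?j = "(sz + i) div 2 ^ Suc e"
 have j: "?j = ?l div 2" by (simp add: div_mult2_eq power_Suc2 del: power_Suc)
 have i: "i < sz" using treeD(1)[OF assms(1)] assms(2) by auto
 have j1: "1 \<le> ?j" using Suc.prems .
 then have l1: "1 \<le> ?l" unfolding j by linarith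
 have lsz: "?l < 2 * sz" using i div_le_dividend[of "sz + i" "2 ^ e"] by linarith
 then have jsz: "?j < sz" unfolding j by linarith
 note IH = Suc.IH[OF l1]
 have eq: "A (b + ?j) = better (\<lambda>i. K (k + i)) (A (b + 2 * ?j)) (A (b + (2 * ?j + 1)))"
  by (rule treeD(4)[OF assms(1) j1 jsz])
 have key: "A (b + m) \<noteq> 0 \<Longrightarrow> K (k + (A (b + m) - 1)) = key (A (b + m) - 1)"
  if "1 \<le> m" "m < 2 * sz" for m
  using tree_node[OF assms(1) that] treeD(3)[OF assms(1)] by blast
 have k1: "A (b + 2 * ?j) \<noteq> 0 \<Longrightarrow> K (k + (A (b + 2 * ?j) - 1)) = key (A (b + 2 * ?j) - 1)"
  using j1 jsz by (intro key) auto
 have k2: "A (b + (2 * ?j + 1)) \<noteq> 0 \<Longrightarrow> K (k + (A (b + (2 * ?j + 1)) - 1)) = key (A (b + (2 * ?j + 1)) - 1)"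
  using j1 jsz by (intro key) auto
 have "?l = 2 * ?j \<or> ?l = 2 * ?j + 1" unfolding j by linarith
 then show ?case
 proof
  assume "?l = 2 * ?j"
  then show ?thesis using IH eq k1 k2 unfolding better_def by (auto split: if_splits)
 next
  assume "?l = 2 * ?j + 1"
  then show ?thesis using IH eq k1 k2 unfolding better_def by (auto split: if_splits)
 qed
qed

lemma div_power_1:
 fixes l :: nat assumes "1 \<le> l" shows "\<exists>e. l div 2 ^ e = 1"
 using assms
proof (induction l rule: less_induct)
 case (less l)
 show ?case
 proof (cases "l = 1")
  case True then show ?thesis by (intro exI[of _ 0]) auto
 next
  case False
  then have "l div 2 < l" "1 \<le> l div 2" using less.prems by auto
  from less.IH[OF this] obtain e where "l div 2 div 2 ^ e = 1" by blast
  then have "l div 2 ^ Suc e = 1" by (simp add: div_mult2_eq)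
  then show ?thesis by blast
 qed
qed

lemma tree_root_None:
 assumes "tree A K sz b k P key" "0 < sz"
 shows "A (b + 1) = 0 \<longleftrightarrow> P = {}"
proof
 assume 0: "A (b + 1) = 0"
 { fix i assume "i \<in> P"
  obtain e where e: "(sz + i) div 2 ^ e = 1" using div_power_1[of "sz + i"] assms by auto
  have False using tree_le[OF assms(1) \<open>i \<in> P\<close>, of e] 0 unfolding e by simp }
 then show "P = {}" by blast
next
 assume "P = {}"
 then show "A (b + 1) = 0" using tree_node[OF assms(1), of 1] assms(2) by (cases "sz = 1") auto
qed

lemma tree_root_Some:
 assumes "tree A K sz b k P key" "0 < sz" "A (b + 1) \<noteq> 0"
 shows "A (b + 1) - 1 \<in> P" "K (k + (A (b + 1) - 1)) = key (A (b + 1) - 1)"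
  "\<And>i. i \<in> P \<Longrightarrow> key (A (b + 1) - 1) \<le> key i"
proof -
 show *: "A (b + 1) - 1 \<in> P" using tree_node[OF assms(1), of 1] assms(2,3) by auto
 then show "K (k + (A (b + 1) - 1)) = key (A (b + 1) - 1)" by (rule treeD(3)[OF assms(1)])
 fix i assume "i \<in> P"
 obtain e where e: "(sz + i) div 2 ^ e = 1" using div_power_1[of "sz + i"] assms by auto
 show "key (A (b + 1) - 1) \<le> key i" using tree_le[OF assms(1) \<open>i \<in> P\<close>, of e] unfolding e by simp
qed

lemma tree_entry_le:
 assumes "tree A K sz b k P key" "1 \<le> j" "j < 2 * sz"
 shows "A (b + j) \<le> sz"
proof (cases "A (b + j) = 0")
 case False
 have "A (b + j) - 1 < sz" using tree_node[OF assms False] treeD(1)[OF assms(1)] by auto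
 then show ?thesis by simp
qed simp

lemma tree_cong:
 assumes "\<And>j. b \<le> j \<Longrightarrow> j < b + 2 * sz \<Longrightarrow> A' j = A j" "\<And>j. k \<le> j \<Longrightarrow> j < k + sz \<Longrightarrow> K' j = K j"
  "\<And>i. i \<in> P \<Longrightarrow> key' i = key i" "tree A K sz b k P key"
 shows "tree A' K' sz b k P key'"
proof -
 have A: "A' (b + j) = A (b + j)" if "j < 2 * sz" for j using assms(1) that by auto
 have K: "K' (k + j) = K (k + j)" if "j < sz" for j using assms(2) that by auto
 \<comment> \<open>Nonzero entries lie between 1 and \<open>sz\<close>, so the keys that
   \<open>better\<close> compares belong to the block on which \<open>K\<close> and
   \<open>K'\<close> agree.\<close>
 have bt: "better (\<lambda>i. K' (k + i)) (A (b + 2 * j)) (A (b + (2 * j + 1))) =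
    better (\<lambda>i. K (k + i)) (A (b + 2 * j)) (A (b + (2 * j + 1)))" if "1 \<le> j" "j < sz" for j
 proof -
  have "A (b + 2 * j) \<le> sz" "A (b + (2 * j + 1)) \<le> sz"
   using tree_entry_le[OF assms(4), of "2*j"] tree_entry_le[OF assms(4), of "2*j+1"] that by auto
  then show ?thesis using K[of "A (b + 2 * j) - 1"] K[of "A (b + (2 * j + 1)) - 1"] unfolding better_def by fastforce
 qed
 have P: "P \<subseteq> {..<sz}" using treeD(1)[OF assms(4)] .
 show ?thesis unfolding tree_def
 proof (intro conjI allI impI ballI)
  fix j assume j: "1 \<le> j \<and> j < sz"
  then show "A' (b + j) = better (\<lambda>i. K' (k + i)) (A' (b + 2 * j)) (A' (b + (2 * j + 1)))"
   using treeD(4)[OF assms(4), of j] bt[of j] A[of j] A[of "2 * j"] A[of "2 * j + 1"] by simp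
 qed (use treeD(2,3)[OF assms(4)] P assms(3) A K in auto)
qed

lemma tree_empty:
 "(\<And>j. A j = 0) \<Longrightarrow> tree A K sz b k {} key"
 by (auto simp: tree_def better_def)

definition tree_up :: "string \<Rightarrow> string \<Rightarrow> com" where
 "tree_up A K =
   While (WLess (C 1) (V ''ti''))
   (''ti'' ::= WDiv (V ''ti'') (C 2) ;;
    ''tu'' ::= WGet A (WAdd (V ''tb'') (WMul (C 2) (V ''ti''))) ;;
    ''tv'' ::= WGet A (WAdd (V ''tb'') (WAdd (WMul (C 2) (V ''ti'')) (C 1))) ;;
    Cond (TAnd (TNot (WEq (V ''tu'') (C 0)))
        (TNot (TAnd (TNot (WEq (V ''tv'') (C 0)))
         (RLess (RGet K (WAdd (V ''tk'') (WSub (V ''tv'') (C 1))))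
             (RGet K (WAdd (V ''tk'') (WSub (V ''tu'') (C 1))))))))
     (WSet A (WAdd (V ''tb'') (V ''ti'')) (V ''tu''))
     (WSet A (WAdd (V ''tb'') (V ''ti'')) (V ''tv'')))"

lemma writes_tree_up [simp]:
 "word_writes (tree_up A K) = {A, ''ti'', ''tu'', ''tv''}" "real_writes (tree_up A K) = {}"
 by (auto simp: tree_up_def)

text \<open>Repairs the nodes above \<open>i\<close>, the only ones that may be wrong.\<close>

lemma tree_up_wp:
 fixes f :: "nat \<Rightarrow> nat"
 assumes A: "A \<notin> {''ti'', ''tu'', ''tv'', ''tb'', ''tk''}"
  and s: "words s ''tb'' 0 = b" "words s ''tk'' 0 = k" "words s ''ti'' 0 = i"
  and i: "1 \<le> i" "i < 2 * sz" "2 * sz \<le> 2 ^ h"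
  and W: "b + 2 * sz + 3 < W" "k + sz + 3 < W"
  and le: "\<And>j. 1 \<le> j \<Longrightarrow> j < 2 * sz \<Longrightarrow> words s A (b + j) \<le> sz"
  and ok: "\<And>j. 1 \<le> j \<Longrightarrow> j < sz \<Longrightarrow> (\<forall>e. j \<noteq> i div 2 ^ Suc e) \<Longrightarrow>
   words s A (b + j) = better (\<lambda>i. reals s K (k + i)) (words s A (b + 2 * j)) (words s A (b + (2 * j + 1)))"
 shows "wp W (tree_up A K) (\<lambda>t s'. t \<le> 6 * h + 1 \<and>
   (\<forall>j. j < b + 1 \<or> j \<ge> b + sz \<longrightarrow> words s' A j = words s A j) \<and>
   (\<forall>j. 1 \<le> j \<and> j < sz \<longrightarrow>
   words s' A (b + j) = better (\<lambda>i. reals s K (k + i)) (words s' A (b + 2 * j)) (words s' A (b + (2 * j + 1))))) s"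
proof -
 \<comment> \<open>The exponent \<open>c\<close> with \<open>i < 2 ^ c\<close> bounds the rounds
   that remain, and a round costs six steps including its test. The proper ancestors of
   \<open>i\<close> are exempt from the tournament equation.\<close>
 define I where "I t s' \<longleftrightarrow> (\<exists>c i. words s' ''ti'' 0 = i \<and> 1 \<le> i \<and> i < 2 * sz \<and> i < 2 ^ c \<and> t + 6 * c \<le> 6 * h \<and>
   words s' ''tb'' 0 = b \<and> words s' ''tk'' 0 = k \<and> reals s' = reals s \<and>
   (\<forall>j. 1 \<le> j \<and> j < 2 * sz \<longrightarrow> words s' A (b + j) \<le> sz) \<and>
   (\<forall>j. j < b + 1 \<or> j \<ge> b + sz \<longrightarrow> words s' A j = words s A j) \<and>
   (\<forall>j. 1 \<le> j \<and> j < sz \<and> (\<forall>e. j \<noteq> i div 2 ^ Suc e) \<longrightarrow>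
   words s' A (b + j) = better (\<lambda>i. reals s K (k + i)) (words s' A (b + 2 * j)) (words s' A (b + (2 * j + 1)))))" for t and s' :: state
 have An: "A \<noteq> ''ti''" "A \<noteq> ''tu''" "A \<noteq> ''tv''" "A \<noteq> ''tb''" "A \<noteq> ''tk''"
   "''ti'' \<noteq> A" "''tu'' \<noteq> A" "''tv'' \<noteq> A" "''tb'' \<noteq> A" "''tk'' \<noteq> A" using A by auto
 show ?thesis
  unfolding tree_up_def
 proof (rule wp_While[where I = I and \<mu> = "\<lambda>s. words s ''ti'' 0"])
  show "I 0 s" unfolding I_def using s i le ok by (intro exI[of _ h] exI[of _ i]) auto
 next
  fix t s' assume "I t s'"
  then show "tfits W s' (WLess (C 1) (V ''ti''))" unfolding I_def using W by auto
 next
  fix t s' assume "I t s'" "\<not> tval s' (WLess (C 1) (V ''ti''))"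
  \<comment> \<open>At the root all further halves are zero, so no inner node is exempt any
    longer.\<close>
  moreover have "Suc 0 div (2 * 2 ^ e) = 0" for e :: nat
  proof -
   have "(1::nat) \<le> 2 ^ e" by simp
   then show ?thesis by (intro div_less) linarith
  qed
  ultimately show "t + 1 \<le> 6 * h + 1 \<and>
   (\<forall>j. j < b + 1 \<or> j \<ge> b + sz \<longrightarrow> words s' A j = words s A j) \<and>
   (\<forall>j. 1 \<le> j \<and> j < sz \<longrightarrow>
   words s' A (b + j) = better (\<lambda>i. reals s K (k + i)) (words s' A (b + 2 * j)) (words s' A (b + (2 * j + 1))))"
   unfolding I_def by (auto simp: not_less le_Suc_eq)
 next
  fix t s' assume I: "I t s'" and t: "tval s' (WLess (C 1) (V ''ti''))"
  obtain c i where st: "words s' ''ti'' 0 = i" "words s' ''tb'' 0 = b" "words s' ''tk'' 0 = k" "reals s' = reals s"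
   and i: "1 \<le> i" "i < 2 * sz" "i < 2 ^ c" "t + 6 * c \<le> 6 * h"
   and le: "\<And>j. 1 \<le> j \<Longrightarrow> j < 2 * sz \<Longrightarrow> words s' A (b + j) \<le> sz"
   and un: "\<And>j. j < b + 1 \<or> j \<ge> b + sz \<Longrightarrow> words s' A j = words s A j"
   and ok: "\<And>j. 1 \<le> j \<Longrightarrow> j < sz \<Longrightarrow> (\<forall>e. j \<noteq> i div 2 ^ Suc e) \<Longrightarrow>
   words s' A (b + j) = better (\<lambda>i. reals s K (k + i)) (words s' A (b + 2 * j)) (words s' A (b + (2 * j + 1)))"
   using I unfolding I_def by blast
  have i2: "2 \<le> i" using t st by simp
  obtain c' where c: "c = Suc c'" using i i2 by (cases c) auto
  define p where "p = i div 2"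
  have p: "1 \<le> p" "p < sz" "p < i" "p < 2 ^ c'"
   using i i2 c by (auto simp: p_def)
  have p': "2 * p < 2 * sz" "2 * p + 1 < 2 * sz" using p(2) by linarith+
  define u where "u = words s' A (b + 2 * p)"
  define v where "v = words s' A (b + (2 * p + 1))"
  have uv: "u \<le> sz" "v \<le> sz" unfolding u_def v_def using le[of "2 * p"] le[of "2 * p + 1"] p p' by auto
  define f where "f = (words s' A)(b + p := better (\<lambda>i. reals s K (k + i)) u v)"
  have fin: "I (Suc (Suc (Suc (Suc (Suc (Suc t)))))) s'' \<and> p < i"
   if "words s'' ''ti'' 0 = p" "words s'' A = f" "words s'' ''tb'' 0 = b" "words s'' ''tk'' 0 = k" "reals s'' = reals s" for s''
   unfolding I_def
  proof (rule conjI, rule exI[of _ c'], rule exI[of _ p], intro conjI)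
   show "\<forall>j. 1 \<le> j \<and> j < sz \<and> (\<forall>e. j \<noteq> p div 2 ^ Suc e) \<longrightarrow>
     words s'' A (b + j) = better (\<lambda>i. reals s K (k + i)) (words s'' A (b + 2 * j)) (words s'' A (b + (2 * j + 1)))"
   proof (intro allI impI)
    fix j assume j: "1 \<le> j \<and> j < sz \<and> (\<forall>e. j \<noteq> p div 2 ^ Suc e)"
    \<comment> \<open>A node other than \<open>p\<close> reads the changed entry only if it is the
      parent of \<open>p\<close>, and that parent is still exempt.\<close>
    then have "j \<noteq> p div 2" by (metis power_one_right One_nat_def)
    then have nj: "2 * j \<noteq> p" "2 * j + 1 \<noteq> p" by auto
    show "words s'' A (b + j) = better (\<lambda>i. reals s K (k + i)) (words s'' A (b + 2 * j)) (words s'' A (b + (2 * j + 1)))"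
    proof (cases "j = p")
     case True
     then show ?thesis unfolding that f_def u_def v_def using nj by simp
    next
     case False
     have ie: "i div 2 ^ Suc e = (if e = 0 then p else p div 2 ^ Suc (e - 1))" for e
      by (cases e) (simp_all add: p_def flip: div_mult2_eq)
     have "\<forall>e. j \<noteq> i div 2 ^ Suc e" unfolding ie using False j by (auto simp del: power_Suc simp: gr0_conv_Suc)
     then show ?thesis unfolding that f_def using ok[of j] j nj False by simp
    qed
   qed
  next
   show "\<forall>j. 1 \<le> j \<and> j < 2 * sz \<longrightarrow> words s'' A (b + j) \<le> sz"
    unfolding that f_def using le uv by (auto simp: better_def)
  qed (use that st p i c un in \<open>auto simp: f_def\<close>)
  have W': "b + p < W" "b + 2 * p < W" "b + (2 * p + 1) < W" "2 * p + 1 < W" "2 * p < W" "k + sz < W" "u < W" "v < W"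
    "k < W" "i < W" "p < W" "2 < W" "1 < W" "0 < W" "k + (v - 1) < W" "k + (u - 1) < W" "b < W" "Suc (2 * p) < W" "Suc (b + 2 * p) < W"
   using W p p' i uv by auto
  have pi: "i div 2 = p" by (simp add: p_def)
  have u': "words s' A (b + 2 * p) = u" and v': "words s' A (Suc (b + 2 * p)) = v" by (auto simp: u_def v_def)
  show "wp W (''ti'' ::= WDiv (V ''ti'') (C 2) ;;
    ''tu'' ::= WGet A (WAdd (V ''tb'') (WMul (C 2) (V ''ti''))) ;;
    ''tv'' ::= WGet A (WAdd (V ''tb'') (WAdd (WMul (C 2) (V ''ti'')) (C 1))) ;;
    Cond (TAnd (TNot (WEq (V ''tu'') (C 0)))
        (TNot (TAnd (TNot (WEq (V ''tv'') (C 0)))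
         (RLess (RGet K (WAdd (V ''tk'') (WSub (V ''tv'') (C 1))))
             (RGet K (WAdd (V ''tk'') (WSub (V ''tu'') (C 1))))))))
     (WSet A (WAdd (V ''tb'') (V ''ti'')) (V ''tu''))
     (WSet A (WAdd (V ''tb'') (V ''ti'')) (V ''tv'')))
    (\<lambda>u s''. I (t + u + 1) s'' \<and> words s'' ''ti'' 0 < words s' ''ti'' 0) s'"
   apply (rule wp_Seq, rule wp_WSet)
   subgoal using W' by simp
   subgoal using W' by (simp add: st)
   apply (rule wp_Seq, rule wp_WSet)
   subgoal using W' by simp
   subgoal using W' by (simp add: st An pi u')
   apply (rule wp_Seq, rule wp_WSet)
   subgoal using W' by simp
   subgoal using W' by (simp add: st An pi v')
   apply (rule wp_Cond)
   subgoal using W' by (simp add: st An pi v' u')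
   subgoal
    apply (rule wp_WSet)
    subgoal using W' by (simp add: st An pi v' u')
    subgoal using W' by (simp add: st An pi v' u')
    subgoal
     by (simp add: st An pi v' u')
       (rule fin, auto simp: st An pi v' u' f_def better_def)
    done
   subgoal
    apply (rule wp_WSet)
    subgoal using W' by (simp add: st An pi v' u')
    subgoal using W' by (simp add: st An pi v' u')
    subgoal
     by (simp add: st An pi v' u')
       (rule fin, auto simp: st An pi v' u' f_def better_def)
    done
   done
 qed
qed

definition tree_insert :: "string \<Rightarrow> string \<Rightarrow> com" where
 "tree_insert A K =
   (RSet K (WAdd (V ''tk'') (V ''tj'')) (R ''rk'') ;;
   ''ti'' ::= WAdd (V ''ts'') (V ''tj'') ;;
   WSet A (WAdd (V ''tb'') (V ''ti'')) (WAdd (V ''tj'') (C 1)) ;;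
   tree_up A K)"

definition tree_delete :: "string \<Rightarrow> string \<Rightarrow> com" where
 "tree_delete A K =
   (''ti'' ::= WAdd (V ''ts'') (V ''tj'') ;;
   WSet A (WAdd (V ''tb'') (V ''ti'')) (C 0) ;;
   tree_up A K)"

lemma writes_tree_insert [simp]:
 "word_writes (tree_insert A K) = {A, ''ti'', ''tu'', ''tv''}" "real_writes (tree_insert A K) = {K}"
 by (auto simp: tree_insert_def)

lemma writes_tree_delete [simp]:
 "word_writes (tree_delete A K) = {A, ''ti'', ''tu'', ''tv''}" "real_writes (tree_delete A K) = {}"
 by (auto simp: tree_delete_def)

lemma tree_insert_wp:
 assumes A: "A \<notin> {''ti'', ''tu'', ''tv'', ''tb'', ''tk'', ''ts'', ''tj''}" and K: "K \<noteq> ''rk''"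
  and s: "words s ''tb'' 0 = b" "words s ''tk'' 0 = k" "words s ''tj'' 0 = l" "words s ''ts'' 0 = sz" "reals s ''rk'' 0 = r"
  and i: "l < sz" "2 * sz \<le> 2 ^ h"
  and W: "b + 2 * sz + 3 < W" "k + sz + 3 < W"
  and T: "tree (words s A) (reals s K) sz b k P key"
 shows "wp W (tree_insert A K) (\<lambda>t s'. t \<le> 6 * h + 4 \<and>
   (\<forall>j. j < b \<or> j \<ge> b + 2 * sz \<longrightarrow> words s' A j = words s A j) \<and>
   reals s' K = (reals s K)(k + l := r) \<and>
   tree (words s' A) (reals s' K) sz b k (insert l P) (key(l := r))) s"
proof -
 have An: "A \<noteq> ''ti''" "A \<noteq> ''tu''" "A \<noteq> ''tv''" "A \<noteq> ''tb''" "A \<noteq> ''tk''" "A \<noteq> ''ts''" "A \<noteq> ''tj''"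
   "''ti'' \<noteq> A" "''tu'' \<noteq> A" "''tv'' \<noteq> A" "''tb'' \<noteq> A" "''tk'' \<noteq> A" "''ts'' \<noteq> A" "''tj'' \<noteq> A" using A by auto
 have le: "words s A (b + j) \<le> sz" if "1 \<le> j" "j < 2 * sz" for j
  using tree_entry_le[OF T that] .
 \<comment> \<open>If a child names leaf \<open>l\<close>, then by \<open>tree_node\<close> it is an
   ancestor of \<open>l\<close>, and so is its parent. Nodes off the path from \<open>l\<close> to
   the root thus never compare the overwritten key.\<close>
 have un: "better (\<lambda>i. if i = l then r else reals s K (k + i)) (words s A (b + 2 * j)) (words s A (Suc (b + 2 * j)))
   = better (\<lambda>i. reals s K (k + i)) (words s A (b + 2 * j)) (words s A (Suc (b + 2 * j)))"
  if j: "1 \<le> j" "j < sz" "\<forall>e. j \<noteq> (sz + l) div 2 ^ Suc e" for j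
 proof -
  have "words s A (b + m) \<noteq> 0 \<longrightarrow> words s A (b + m) - 1 \<noteq> l" if m: "m = 2 * j \<or> m = 2 * j + 1" for m
  proof (intro impI notI)
   assume "words s A (b + m) \<noteq> 0" "words s A (b + m) - 1 = l"
   moreover have "1 \<le> m" "m < 2 * sz" using m j by auto
   ultimately obtain e where "(sz + l) div 2 ^ e = m" using tree_node[OF T, of m] by metis
   then have "(sz + l) div 2 ^ Suc e = j" using m by (simp add: div_mult2_eq power_Suc2 del: power_Suc) auto
   then show False using j(3) by blast
  qed
  from this[of "2*j"] this[of "2*j+1"] show ?thesis by (auto simp: better_def)
 qed
 have nb: "2 * j \<noteq> sz + l \<and> Suc (2 * j) \<noteq> sz + l" if "\<forall>e. j \<noteq> (sz + l) div 2 ^ Suc e" for j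
 proof -
  have "j \<noteq> (sz + l) div 2" using that[rule_format, of 0] by simp
  then show ?thesis by presburger
 qed
 show ?thesis
  unfolding tree_insert_def
  apply (rule wp_Seq, rule wp_RSet)
  subgoal using W i by (simp add: s)
  subgoal using W i by (simp add: s)
  apply (rule wp_Seq, rule wp_WSet)
  subgoal using W i by (simp add: s)
  subgoal using W i by (simp add: s)
  apply (rule wp_Seq, rule wp_WSet)
  subgoal using W i by (simp add: s An)
  subgoal using W i by (simp add: s An)
  apply (rule wp_conseq)
   apply (rule tree_up_wp[where b = b and k = k and i = "sz + l" and sz = sz and h = h])
  subgoal using A by simp
  subgoal using W i by (simp add: s An)
  subgoal using W i by (simp add: s An)
  subgoal using W i by (simp add: s An)
  subgoal using i by simp
  subgoal using i by simp
  subgoal using i by simp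
  subgoal using W by simp
  subgoal using W by simp
  subgoal for j using W i le[of j] by (simp add: s An)
  subgoal for j
   using treeD(4)[OF T, of j] un[of j] nb[of j] i by (simp add: s An)
  subgoal for t s'
   unfolding tree_def using treeD(1-3)[OF T] i
   by (simp add: s An; force)
  done
qed

lemma tree_delete_wp:
 assumes A: "A \<notin> {''ti'', ''tu'', ''tv'', ''tb'', ''tk'', ''ts'', ''tj''}"
  and s: "words s ''tb'' 0 = b" "words s ''tk'' 0 = k" "words s ''tj'' 0 = l" "words s ''ts'' 0 = sz"
  and i: "l < sz" "2 * sz \<le> 2 ^ h"
  and W: "b + 2 * sz + 3 < W" "k + sz + 3 < W"
  and T: "tree (words s A) (reals s K) sz b k P key"
 shows "wp W (tree_delete A K) (\<lambda>t s'. t \<le> 6 * h + 4 \<and>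
   (\<forall>j. j < b \<or> j \<ge> b + 2 * sz \<longrightarrow> words s' A j = words s A j) \<and>
   tree (words s' A) (reals s' K) sz b k (P - {l}) key) s"
proof -
 have An: "A \<noteq> ''ti''" "A \<noteq> ''tu''" "A \<noteq> ''tv''" "A \<noteq> ''tb''" "A \<noteq> ''tk''" "A \<noteq> ''ts''" "A \<noteq> ''tj''"
   "''ti'' \<noteq> A" "''tu'' \<noteq> A" "''tv'' \<noteq> A" "''tb'' \<noteq> A" "''tk'' \<noteq> A" "''ts'' \<noteq> A" "''tj'' \<noteq> A" using A by auto
 have le: "words s A (b + j) \<le> sz" if "1 \<le> j" "j < 2 * sz" for j
  using tree_entry_le[OF T that] .
 have nb: "2 * j \<noteq> sz + l \<and> Suc (2 * j) \<noteq> sz + l" if "\<forall>e. j \<noteq> (sz + l) div 2 ^ Suc e" for j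
 proof -
  have "j \<noteq> (sz + l) div 2" using that[rule_format, of 0] by simp
  then show ?thesis by presburger
 qed
 show ?thesis
  unfolding tree_delete_def
  apply (rule wp_Seq, rule wp_WSet)
  subgoal using W i by (simp add: s)
  subgoal using W i by (simp add: s)
  apply (rule wp_Seq, rule wp_WSet)
  subgoal using W i by (simp add: s An)
  subgoal using W i by (simp add: s An)
  apply (rule wp_conseq)
   apply (rule tree_up_wp[where b = b and k = k and i = "sz + l" and sz = sz and h = h])
  subgoal using A by simp
  subgoal using W i by (simp add: s An)
  subgoal using W i by (simp add: s An)
  subgoal using W i by (simp add: s An)
  subgoal using i by simp
  subgoal using i by simp
  subgoal using i by simp
  subgoal using W by simp
  subgoal using W by simp
  subgoal for j using W i le[of j] by (simp add: s An)
  subgoal for j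
   using treeD(4)[OF T, of j] nb[of j] i by (simp add: s An)
  subgoal for t s'
   unfolding tree_def using treeD(1-3)[OF T] i
   by (simp add: s An; force)
  done
qed

text \<open>As a congruence rule this confines the simplifier to the state, so that symbolic
  execution with \<open>wp_simps\<close> does not descend into the rest of the program or into the
  postcondition.\<close>

lemma wp_cong [cong]: "s = s' \<Longrightarrow> wp W c Q s = wp W c Q s'" by simp

inductive_cases exec_WSet [elim!]: "exec W (WSet x i a) s t s'"
inductive_cases exec_RSet [elim!]: "exec W (RSet x i a) s t s'"
inductive_cases exec_Seq [elim!]: "exec W (Seq c d) s t s'"
inductive_cases exec_Cond [elim!]: "exec W (Cond b c d) s t s'"
inductive_cases exec_Skip [elim!]: "exec W Skip s t s'"

lemma wp_simps:
 "wp W Skip Q s = Q 1 s"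
 "wp W (WSet x i a) Q s \<longleftrightarrow> wfits W s i \<and> wfits W s a \<and> Q 1 (wupd s x (wval s i) (wval s a))"
 "wp W (RSet x i r) Q s \<longleftrightarrow> wfits W s i \<and> rfits W s r \<and> Q 1 (rupd s x (wval s i) (rval s r))"
 "wp W (Seq c d) Q s = wp W c (\<lambda>t s'. wp W d (\<lambda>u. Q (t + u)) s') s"
 "wp W (Cond b c d) Q s \<longleftrightarrow>
   tfits W s b \<and> (if tval s b then wp W c (\<lambda>t. Q (Suc t)) s else wp W d (\<lambda>t. Q (Suc t)) s)"
proof -
 show "wp W Skip Q s = Q 1 s" by (rule iffI, (auto simp: wp_def)[1], erule wp_Skip)
 show "wp W (WSet x i a) Q s \<longleftrightarrow> wfits W s i \<and> wfits W s a \<and> Q 1 (wupd s x (wval s i) (wval s a))"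
  by (rule iffI, (auto simp: wp_def wupd_def)[1], blast intro: wp_WSet)
 show "wp W (RSet x i r) Q s \<longleftrightarrow> wfits W s i \<and> rfits W s r \<and> Q 1 (rupd s x (wval s i) (rval s r))"
  by (rule iffI, (auto simp: wp_def rupd_def)[1], blast intro: wp_RSet)
 show "wp W (Seq c d) Q s = wp W c (\<lambda>t s'. wp W d (\<lambda>u. Q (t + u)) s') s"
  unfolding wp_def by (blast intro: exec.intros)
 have "wp W (Cond b c d) Q s \<Longrightarrow> tfits W s b \<and> (if tval s b then wp W c (\<lambda>t. Q (Suc t)) s else wp W d (\<lambda>t. Q (Suc t)) s)"
  unfolding wp_def by auto
 moreover have "tfits W s b \<and> (if tval s b then wp W c (\<lambda>t. Q (Suc t)) s else wp W d (\<lambda>t. Q (Suc t)) s) \<Longrightarrow> wp W (Cond b c d) Q s"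
  by (auto intro: wp_Cond split: if_splits)
 ultimately show "wp W (Cond b c d) Q s \<longleftrightarrow>
   tfits W s b \<and> (if tval s b then wp W c (\<lambda>t. Q (Suc t)) s else wp W d (\<lambda>t. Q (Suc t)) s)" by blast
qed

lemma digit_eq [simp]:
 fixes i i' k p p' :: nat
 assumes "i < k" "i' < k" shows "p * k + i = p' * k + i' \<longleftrightarrow> p = p' \<and> i = i'"
proof
 assume "p * k + i = p' * k + i'"
 then have "(p * k + i) div k = (p' * k + i') div k" "(p * k + i) mod k = (p' * k + i') mod k" by simp_all
 then show "p = p' \<and> i = i'" using assms by simp
qed simp

lemma digit_less:
 fixes i k p m :: nat
 assumes "p < m" "i < k" shows "p * k + i < m * k"
proof -
 have "p * k + i < Suc p * k" using assms(2) by simp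
 also have "\<dots> \<le> m * k" using assms(1) by (intro mult_le_mono1) simp
 finally show ?thesis .
qed

lemma digit_range:
 fixes p p' k j :: nat
 assumes "p \<noteq> p'" "p * k \<le> j" "j < p * k + k" shows "j < p' * k \<or> j \<ge> p' * k + k"
proof (cases "p < p'")
 case True
 then have "Suc p * k \<le> p' * k" by (intro mult_le_mono1) simp
 then show ?thesis using assms by simp
next
 case False
 then have "Suc p' * k \<le> p * k" using assms(1) by (intro mult_le_mono1) simp
 then show ?thesis using assms by simp
qed

section \<open>The store of locally shortest tuples\<close>

type_synonym tup = "nat \<times> nat \<times> nat \<times> nat"
type_synonym tupval = "nat \<Rightarrow> nat \<Rightarrow> nat \<Rightarrow> nat \<Rightarrow> real"

definition ix4 :: "nat \<Rightarrow> nat \<Rightarrow> nat \<Rightarrow> nat \<Rightarrow> nat \<Rightarrow> nat" where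
 "ix4 n x a b y = ((x * n + a) * n + b) * n + y"

lemma ix4_eq [simp]:
 assumes "a < n" "b < n" "y < n" "a' < n" "b' < n" "y' < n"
 shows "ix4 n x a b y = ix4 n x' a' b' y' \<longleftrightarrow> x = x' \<and> a = a' \<and> b = b' \<and> y = y'"
 using assms by (auto simp: ix4_def)

definition quads :: "nat \<Rightarrow> tup set" where
 "quads n = {..<n} \<times> {..<n} \<times> {..<n} \<times> {..<n}"

text \<open>The two quantified conditions make \<open>ps\<close> and the reading of slots mutually
  inverse. This excludes duplicates and lets a tuple be found in constant time. \<open>ps\<close> is
  constrained at members of \<open>T\<close> only, so entries of deleted tuples may stay
  behind.\<close>

definition blocks ::
  "nat \<Rightarrow> (nat \<Rightarrow> nat) \<Rightarrow> (nat \<Rightarrow> nat) \<Rightarrow> (nat \<Rightarrow> nat) \<Rightarrow> (nat \<Rightarrow> nat) \<Rightarrow> (nat \<Rightarrow> real) \<Rightarrow> (nat \<Rightarrow> real) \<Rightarrow>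
   tup set \<Rightarrow> tupval \<Rightarrow> tupval \<Rightarrow> bool" where
 "blocks n la lb nl ps lw lc T wt ct \<longleftrightarrow>
   T \<subseteq> quads n \<and>
   (\<forall>x<n. \<forall>y<n. \<forall>i<nl (x * n + y).
    (x, la ((x * n + y) * (n * n) + i), lb ((x * n + y) * (n * n) + i), y) \<in> T \<and>
    ps (ix4 n x (la ((x * n + y) * (n * n) + i)) (lb ((x * n + y) * (n * n) + i)) y) = i \<and>
    lw ((x * n + y) * (n * n) + i) =
     wt x (la ((x * n + y) * (n * n) + i)) (lb ((x * n + y) * (n * n) + i)) y \<and>
    lc ((x * n + y) * (n * n) + i) =
     ct x (la ((x * n + y) * (n * n) + i)) (lb ((x * n + y) * (n * n) + i)) y) \<and>
   (\<forall>x a b y. (x, a, b, y) \<in> T \<longrightarrow>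
    ps (ix4 n x a b y) < nl (x * n + y) \<and>
    la ((x * n + y) * (n * n) + ps (ix4 n x a b y)) = a \<and>
    lb ((x * n + y) * (n * n) + ps (ix4 n x a b y)) = b)"

lemma blocksD:
 assumes "blocks n la lb nl ps lw lc T wt ct"
 shows "T \<subseteq> quads n"
  "\<And>x y i. x < n \<Longrightarrow> y < n \<Longrightarrow> i < nl (x * n + y) \<Longrightarrow>
    (x, la ((x * n + y) * (n * n) + i), lb ((x * n + y) * (n * n) + i), y) \<in> T \<and>
    ps (ix4 n x (la ((x * n + y) * (n * n) + i)) (lb ((x * n + y) * (n * n) + i)) y) = i \<and>
    lw ((x * n + y) * (n * n) + i) = wt x (la ((x * n + y) * (n * n) + i)) (lb ((x * n + y) * (n * n) + i)) y \<and>
    lc ((x * n + y) * (n * n) + i) = ct x (la ((x * n + y) * (n * n) + i)) (lb ((x * n + y) * (n * n) + i)) y"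
  "\<And>x a b y. (x, a, b, y) \<in> T \<Longrightarrow> x < n \<and> a < n \<and> b < n \<and> y < n \<and> ps (ix4 n x a b y) < nl (x * n + y) \<and>
    la ((x * n + y) * (n * n) + ps (ix4 n x a b y)) = a \<and>
    lb ((x * n + y) * (n * n) + ps (ix4 n x a b y)) = b"
 using assms unfolding blocks_def quads_def by blast+

text \<open>The occupied slots of a block show distinct pairs \<open>(a, b)\<close>, so there are at
  most \<open>n * n\<close> of them and blocks do not run into each other. A pair that is absent
  proves that one more slot is free.\<close>

lemma blocks_len:
 assumes B: "blocks n la lb nl ps lw lc T wt ct" and x: "x < n" "y < n"
 shows "nl (x * n + y) \<le> n * n"
  and "\<lbrakk>(x, a, b, y) \<notin> T; a < n; b < n\<rbrakk> \<Longrightarrow> nl (x * n + y) < n * n"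
proof -
 let ?f = "\<lambda>i. (la ((x * n + y) * (n * n) + i), lb ((x * n + y) * (n * n) + i))"
 have inj: "inj_on ?f {..<nl (x * n + y)}"
  by (rule inj_onI) (metis (no_types, lifting) blocksD(2)[OF B x] lessThan_iff prod.inject)
 have sub: "?f ` {..<nl (x * n + y)} \<subseteq> {(a, b). (x, a, b, y) \<in> T}"
  using blocksD(2)[OF B x] by auto
 have sub2: "{(a, b). (x, a, b, y) \<in> T} \<subseteq> {..<n} \<times> {..<n}" using blocksD(3)[OF B] by auto
 have "card (?f ` {..<nl (x * n + y)}) \<le> card ({..<n} \<times> {..<n})"
  using sub sub2 by (intro card_mono) auto
 then show "nl (x * n + y) \<le> n * n" using card_image[OF inj] by simp
 assume new: "(x, a, b, y) \<notin> T" "a < n" "b < n"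
 have "card (?f ` {..<nl (x * n + y)}) < card ({..<n} \<times> {..<n})"
 proof (intro psubset_card_mono psubsetI)
  show "?f ` {..<nl (x * n + y)} \<noteq> {..<n} \<times> {..<n}" using sub new by blast
 qed (use sub sub2 in auto)
 then show "nl (x * n + y) < n * n" using card_image[OF inj] by simp
qed

lemma blocks_insert:
 assumes B: "blocks n la lb nl ps lw lc T wt ct"
  and x: "x < n" "y < n" "a < n" "b < n" and new: "(x, a, b, y) \<notin> T"
  and j: "j = (x * n + y) * (n * n) + nl (x * n + y)"
  and wc: "r = wt x a b y" "c = ct x a b y"
 shows "blocks n (la(j := a)) (lb(j := b)) (nl(x * n + y := Suc (nl (x * n + y))))
   (ps(ix4 n x a b y := nl (x * n + y))) (lw(j := r)) (lc(j := c)) (insert (x, a, b, y) T) wt ct"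
proof -
 note D = blocksD[OF B]
 have len: "nl (x * n + y) < n * n" using blocks_len(2)[OF B x(1,2) new x(3,4)] .
 have le: "i < n * n" if "x' < n" "y' < n" "i < nl (x' * n + y')" for x' y' i
  using blocks_len(1)[OF B that(1,2)] that(3) by simp
 have ne: "(x' * n + y') * (n * n) + i \<noteq> j" if "x' < n" "y' < n" "i < nl (x' * n + y')" for x' y' i
  unfolding j using le[OF that] len that by (auto simp: x)
 have in_T: "(x', a', b', y') \<noteq> (x, a, b, y)" if "(x', a', b', y') \<in> T" for x' a' b' y' using new that by auto
 show ?thesis
  unfolding blocks_def
 proof (intro conjI allI impI)
  show "insert (x, a, b, y) T \<subseteq> quads n" using D(1) x by (auto simp: quads_def)
 next
  fix x' y' i assume x': "x' < n" "y' < n" and i: "i < (nl(x * n + y := Suc (nl (x * n + y)))) (x' * n + y')"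
  let ?j = "(x' * n + y') * (n * n) + i"
  have "(x' = x \<and> y' = y \<and> i = nl (x * n + y)) \<or> i < nl (x' * n + y')"
   using i x x' by (auto split: if_splits simp: less_Suc_eq)
  then have "(x', (la(j := a)) ?j, (lb(j := b)) ?j, y') \<in> insert (x, a, b, y) T \<and>
   (ps(ix4 n x a b y := nl (x * n + y))) (ix4 n x' ((la(j := a)) ?j) ((lb(j := b)) ?j) y') = i \<and>
   (lw(j := r)) ?j = wt x' ((la(j := a)) ?j) ((lb(j := b)) ?j) y' \<and>
   (lc(j := c)) ?j = ct x' ((la(j := a)) ?j) ((lb(j := b)) ?j) y'"
  proof
   assume "x' = x \<and> y' = y \<and> i = nl (x * n + y)"
   then show ?thesis using wc by (simp add: j)
  next
   assume i: "i < nl (x' * n + y')"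
   note DD = D(2)[OF x' i] and N = ne[OF x' i]
   have "ix4 n x' (la ?j) (lb ?j) y' \<noteq> ix4 n x a b y"
    using D(3)[of x' "la ?j" "lb ?j" y'] DD in_T x by auto
   then show ?thesis using DD N by simp
  qed
  then show "(x', (la(j := a)) ?j, (lb(j := b)) ?j, y') \<in> insert (x, a, b, y) T"
   "(ps(ix4 n x a b y := nl (x * n + y))) (ix4 n x' ((la(j := a)) ?j) ((lb(j := b)) ?j) y') = i"
   "(lw(j := r)) ?j = wt x' ((la(j := a)) ?j) ((lb(j := b)) ?j) y'"
   "(lc(j := c)) ?j = ct x' ((la(j := a)) ?j) ((lb(j := b)) ?j) y'" by blast+
 next
  fix x' a' b' y' assume T': "(x', a', b', y') \<in> insert (x, a, b, y) T"
  let ?p = "(ps(ix4 n x a b y := nl (x * n + y))) (ix4 n x' a' b' y')"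
  have "?p < (nl(x * n + y := Suc (nl (x * n + y)))) (x' * n + y') \<and>
   (la(j := a)) ((x' * n + y') * (n * n) + ?p) = a' \<and> (lb(j := b)) ((x' * n + y') * (n * n) + ?p) = b'"
  proof (cases "(x', a', b', y') = (x, a, b, y)")
   case True
   then show ?thesis by (auto simp: j)
  next
   case False
   then have T'': "(x', a', b', y') \<in> T" using T' by auto
   note DD = D(3)[OF T'']
   have "ix4 n x' a' b' y' \<noteq> ix4 n x a b y" using DD False x by auto
   then show ?thesis using DD ne[of x' y' "ps (ix4 n x' a' b' y')"] by auto
  qed
  then show "?p < (nl(x * n + y := Suc (nl (x * n + y)))) (x' * n + y')"
   "(la(j := a)) ((x' * n + y') * (n * n) + ?p) = a'" "(lb(j := b)) ((x' * n + y') * (n * n) + ?p) = b'" by blast+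
 qed
qed

text \<open>The last slot of the block is moved into the gap. If the deleted tuple is itself in the
  last slot, the moves copy that slot to itself and only the length changes.\<close>

lemma blocks_delete:
 assumes B: "blocks n la lb nl ps lw lc T wt ct"
  and mem: "(x, a, b, y) \<in> T"
  and i: "i = (x * n + y) * (n * n) + ps (ix4 n x a b y)"
  and l: "l = (x * n + y) * (n * n) + (nl (x * n + y) - 1)"
 shows "blocks n (la(i := la l)) (lb(i := lb l)) (nl(x * n + y := nl (x * n + y) - 1))
   (ps(ix4 n x (la l) (lb l) y := ps (ix4 n x a b y))) (lw(i := lw l)) (lc(i := lc l)) (T - {(x, a, b, y)}) wt ct"
proof -
 note D = blocksD[OF B]
 note M = D(3)[OF mem]
 have x: "x < n" "y < n" "a < n" "b < n" using M by auto
 define k where "k = ps (ix4 n x a b y)"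
 define z where "z = nl (x * n + y) - 1"
 have len: "nl (x * n + y) = Suc z" using M unfolding z_def by auto
 have k: "k \<le> z" using M len by (auto simp: k_def)
 have zz: "z < n * n" using blocks_len(1)[OF B x(1,2)] len by simp
 have le: "i < n * n" if "x' < n" "y' < n" "i < nl (x' * n + y')" for x' y' i
  using blocks_len(1)[OF B that(1,2)] that(3) by simp
 have i': "i = (x * n + y) * (n * n) + k" and l': "l = (x * n + y) * (n * n) + z"
  using i l by (auto simp: k_def z_def)
 note L = D(2)[OF x(1,2), of z, folded l']
 have L: "(x, la l, lb l, y) \<in> T" "ps (ix4 n x (la l) (lb l) y) = z"
  "lw l = wt x (la l) (lb l) y" "lc l = ct x (la l) (lb l) y" "la l < n" "lb l < n"
  using L D(3) len by auto
 have ne: "((x' * n + y') * (n * n) + m = i) = (x' = x \<and> y' = y \<and> m = k)"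
  if "x' < n" "y' < n" "m < nl (x' * n + y')" for x' y' m
  unfolding i' using le[OF that] k zz that by (auto simp: x)
 have ab: "la i = a" "lb i = b" using M unfolding i by auto
 show ?thesis
  unfolding blocks_def k_def[symmetric] z_def[symmetric]
 proof (intro conjI allI impI)
  show "T - {(x, a, b, y)} \<subseteq> quads n" using D(1) by auto
 next
  fix x' y' m assume x': "x' < n" "y' < n" and m: "m < (nl(x * n + y := z)) (x' * n + y')"
  let ?j = "(x' * n + y') * (n * n) + m"
  have mo: "m < nl (x' * n + y')" using m len by (auto split: if_splits)
  note DD = D(2)[OF x' mo]
  have mz: "m \<noteq> z" if "x' = x" "y' = y" using m that by auto
  have "(x', (la(i := la l)) ?j, (lb(i := lb l)) ?j, y') \<in> T - {(x, a, b, y)} \<and>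
   (ps(ix4 n x (la l) (lb l) y := k)) (ix4 n x' ((la(i := la l)) ?j) ((lb(i := lb l)) ?j) y') = m \<and>
   (lw(i := lw l)) ?j = wt x' ((la(i := la l)) ?j) ((lb(i := lb l)) ?j) y' \<and>
   (lc(i := lc l)) ?j = ct x' ((la(i := la l)) ?j) ((lb(i := lb l)) ?j) y'"
  proof (cases "?j = i")
   case True
   then have e: "x' = x" "y' = y" "m = k" using ne[OF x' mo] by auto
   then have "k \<noteq> z" using mz by auto
   then have "(la l, lb l) \<noteq> (a, b)" using L(2) by (auto simp: k_def)
   then show ?thesis using True e L by auto
  next
   case False
   have "ix4 n x' (la ?j) (lb ?j) y' \<noteq> ix4 n x (la l) (lb l) y"
   proof
    assume eq: "ix4 n x' (la ?j) (lb ?j) y' = ix4 n x (la l) (lb l) y"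
    moreover have "la ?j < n" "lb ?j < n" using D(3) DD by auto
    ultimately have "x' = x" "y' = y" using x x' L by auto
    moreover have "m = z" using eq DD L(2) by auto
    ultimately show False using mz by auto
   qed
   moreover have "(x', la ?j, lb ?j, y') \<noteq> (x, a, b, y)"
   proof
    assume "(x', la ?j, lb ?j, y') = (x, a, b, y)"
    then have "x' = x" "y' = y" "m = k" using DD by (auto simp: k_def)
    then show False using False i' by auto
   qed
   ultimately show ?thesis using DD False by simp
  qed
  then show "(x', (la(i := la l)) ?j, (lb(i := lb l)) ?j, y') \<in> T - {(x, a, b, y)}"
   "(ps(ix4 n x (la l) (lb l) y := k)) (ix4 n x' ((la(i := la l)) ?j) ((lb(i := lb l)) ?j) y') = m"
   "(lw(i := lw l)) ?j = wt x' ((la(i := la l)) ?j) ((lb(i := lb l)) ?j) y'"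
   "(lc(i := lc l)) ?j = ct x' ((la(i := la l)) ?j) ((lb(i := lb l)) ?j) y'" by blast+
 next
  fix x' a' b' y' assume T': "(x', a', b', y') \<in> T - {(x, a, b, y)}"
  let ?p = "(ps(ix4 n x (la l) (lb l) y := k)) (ix4 n x' a' b' y')"
  note DD = D(3)[of x' a' b' y']
  have DD: "x' < n" "a' < n" "b' < n" "y' < n" "ps (ix4 n x' a' b' y') < nl (x' * n + y')"
    "la ((x' * n + y') * (n * n) + ps (ix4 n x' a' b' y')) = a'"
    "lb ((x' * n + y') * (n * n) + ps (ix4 n x' a' b' y')) = b'" using DD T' by auto
  have "?p < (nl(x * n + y := z)) (x' * n + y') \<and>
   (la(i := la l)) ((x' * n + y') * (n * n) + ?p) = a' \<and> (lb(i := lb l)) ((x' * n + y') * (n * n) + ?p) = b'"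
  proof (cases "(x', a', b', y') = (x, la l, lb l, y)")
   case True
   then have "(la l, lb l) \<noteq> (a, b)" using T' by auto
   then have "k \<noteq> z" using ab i' l' by auto
   then show ?thesis using True k by (auto simp: i')
  next
   case False
   then have "ix4 n x' a' b' y' \<noteq> ix4 n x (la l) (lb l) y" using DD L x by auto
   then have p: "?p = ps (ix4 n x' a' b' y')" by simp
   have 1: "(x' * n + y') * (n * n) + ps (ix4 n x' a' b' y') \<noteq> i"
    using ne[OF DD(1,4,5)] DD(6,7) ab i' T' by auto
   have 2: "ps (ix4 n x' a' b' y') \<noteq> z" if "x' = x" "y' = y"
    using False that DD(6,7) l' by auto
   then show ?thesis unfolding p using 1 DD len by (auto simp: less_Suc_eq x)
  qed
  then show "?p < (nl(x * n + y := z)) (x' * n + y')"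
   "(la(i := la l)) ((x' * n + y') * (n * n) + ?p) = a'" "(lb(i := lb l)) ((x' * n + y') * (n * n) + ?p) = b'" by blast+
 qed
qed

definition trees :: "(nat \<Rightarrow> nat) \<Rightarrow> (nat \<Rightarrow> real) \<Rightarrow> nat \<Rightarrow> (nat \<Rightarrow> nat \<Rightarrow> nat set) \<Rightarrow> (nat \<Rightarrow> nat \<Rightarrow> nat \<Rightarrow> real) \<Rightarrow> bool" where
 "trees A K n P key \<longleftrightarrow>
   (\<forall>x<n. \<forall>y<n. tree A K n ((x * n + y) * (2 * n)) ((x * n + y) * n) (P x y) (key x y))"

lemma trees_upd:
 assumes T: "trees A K n P key" and xy: "x < n" "y < n"
  and A: "\<And>j. j < (x * n + y) * (2 * n) \<or> j \<ge> (x * n + y) * (2 * n) + 2 * n \<Longrightarrow> A' j = A j"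
  and K: "\<And>j. j < (x * n + y) * n \<or> j \<ge> (x * n + y) * n + n \<Longrightarrow> K' j = K j"
  and T': "tree A' K' n ((x * n + y) * (2 * n)) ((x * n + y) * n) (P' x y) (key x y)"
  and P: "\<And>x' y'. (x', y') \<noteq> (x, y) \<Longrightarrow> P' x' y' = P x' y'"
 shows "trees A' K' n P' key"
 unfolding trees_def
proof (intro allI impI)
 fix x' y' assume x': "x' < n" "y' < n"
 show "tree A' K' n ((x' * n + y') * (2 * n)) ((x' * n + y') * n) (P' x' y') (key x' y')"
 proof (cases "(x', y') = (x, y)")
  case True
  then show ?thesis using T' by simp
 next
  case False
  then have ne: "x' * n + y' \<noteq> x * n + y" using x' xy by auto
  show ?thesis
   unfolding P[OF False]
  proof (rule tree_cong[where A = A and K = K and key = "key x' y'"])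
   show "A' j = A j" if "(x' * n + y') * (2 * n) \<le> j" "j < (x' * n + y') * (2 * n) + 2 * n" for j
    using A digit_range[OF ne that] by blast
   show "K' j = K j" if "(x' * n + y') * n \<le> j" "j < (x' * n + y') * n + n" for j
    using K digit_range[OF ne that] by blast
  qed (use T x' in \<open>auto simp: trees_def\<close>)
 qed
qed

definition cell_counts :: "nat \<Rightarrow> (nat \<Rightarrow> nat) \<Rightarrow> (nat \<Rightarrow> nat) \<Rightarrow> tup set \<Rightarrow> bool" where
 "cell_counts n cl cf T \<longleftrightarrow>
   (\<forall>x<n. \<forall>y<n. \<forall>z<n. cl ((x * n + y) * n + z) = card {a. (x, a, z, y) \<in> T} \<and>
    cf ((x * n + y) * n + z) = card {b. (x, z, b, y) \<in> T})"

lemma quads_fibre: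
 assumes "T \<subseteq> quads n"
 shows "{a. (x, a, b, y) \<in> T} \<subseteq> {..<n}" "{b. (x, a, b, y) \<in> T} \<subseteq> {..<n}"
  "finite {a. (x, a, b, y) \<in> T}" "finite {b. (x, a, b, y) \<in> T}"
proof -
 show 1: "{a. (x, a, b, y) \<in> T} \<subseteq> {..<n}" and 2: "{b. (x, a, b, y) \<in> T} \<subseteq> {..<n}"
  using assms by (auto simp: quads_def)
 show "finite {a. (x, a, b, y) \<in> T}" "finite {b. (x, a, b, y) \<in> T}"
  using finite_subset[OF 1] finite_subset[OF 2] by auto
qed

lemma cell_counts_insert:
 assumes c: "cell_counts n cl cf T" and T: "T \<subseteq> quads n" "(x, a, b, y) \<notin> T" and x: "x < n" "a < n" "b < n" "y < n"
 shows "cell_counts n (cl((x * n + y) * n + b := Suc (cl ((x * n + y) * n + b))))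
   (cf((x * n + y) * n + a := Suc (cf ((x * n + y) * n + a)))) (insert (x, a, b, y) T)"
 unfolding cell_counts_def
proof (intro allI impI)
 fix x' y' z assume z: "x' < n" "y' < n" "z < n"
 have 1: "{a'. (x', a', z, y') \<in> insert (x, a, b, y) T} =
   (if x' = x \<and> y' = y \<and> z = b then insert a {a. (x, a, b, y) \<in> T} else {a'. (x', a', z, y') \<in> T})" by auto
 have 2: "{b'. (x', z, b', y') \<in> insert (x, a, b, y) T} =
   (if x' = x \<and> y' = y \<and> z = a then insert b {b. (x, a, b, y) \<in> T} else {b'. (x', z, b', y') \<in> T})" by auto
 have "cl ((x' * n + y') * n + z) = card {a. (x', a, z, y') \<in> T} \<and>
    cf ((x' * n + y') * n + z) = card {b. (x', z, b, y') \<in> T}" using c z by (auto simp: cell_counts_def)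
 then show "(cl((x * n + y) * n + b := Suc (cl ((x * n + y) * n + b)))) ((x' * n + y') * n + z)
   = card {a'. (x', a', z, y') \<in> insert (x, a, b, y) T} \<and>
   (cf((x * n + y) * n + a := Suc (cf ((x * n + y) * n + a)))) ((x' * n + y') * n + z)
   = card {b'. (x', z, b', y') \<in> insert (x, a, b, y) T}"
  unfolding 1 2 using z x T quads_fibre[OF T(1)] by (auto simp: card_insert_if)
qed

lemma cell_counts_delete:
 assumes c: "cell_counts n cl cf T" and T: "T \<subseteq> quads n" "(x, a, b, y) \<in> T" and x: "x < n" "a < n" "b < n" "y < n"
 shows "cell_counts n (cl((x * n + y) * n + b := cl ((x * n + y) * n + b) - 1))
   (cf((x * n + y) * n + a := cf ((x * n + y) * n + a) - 1)) (T - {(x, a, b, y)})"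
 unfolding cell_counts_def
proof (intro allI impI)
 fix x' y' z assume z: "x' < n" "y' < n" "z < n"
 have 1: "{a'. (x', a', z, y') \<in> T - {(x, a, b, y)}} =
   (if x' = x \<and> y' = y \<and> z = b then {a. (x, a, b, y) \<in> T} - {a} else {a'. (x', a', z, y') \<in> T})" by auto
 have 2: "{b'. (x', z, b', y') \<in> T - {(x, a, b, y)}} =
   (if x' = x \<and> y' = y \<and> z = a then {b. (x, a, b, y) \<in> T} - {b} else {b'. (x', z, b', y') \<in> T})" by auto
 have "cl ((x' * n + y') * n + z) = card {a. (x', a, z, y') \<in> T} \<and>
    cf ((x' * n + y') * n + z) = card {b. (x', z, b, y') \<in> T}" using c z by (auto simp: cell_counts_def)
 then show "(cl((x * n + y) * n + b := cl ((x * n + y) * n + b) - 1)) ((x' * n + y') * n + z)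
   = card {a'. (x', a', z, y') \<in> T - {(x, a, b, y)}} \<and>
   (cf((x * n + y) * n + a := cf ((x * n + y) * n + a) - 1)) ((x' * n + y') * n + z)
   = card {b'. (x', z, b', y') \<in> T - {(x, a, b, y)}}"
  unfolding 1 2 using z x T quads_fibre[OF T(1)] by (auto simp: card_Diff_singleton)
qed

definition PL :: "tup set \<Rightarrow> nat \<Rightarrow> nat \<Rightarrow> nat set" where "PL T x y = {b. \<exists>a. (x, a, b, y) \<in> T}"
definition PF :: "tup set \<Rightarrow> nat \<Rightarrow> nat \<Rightarrow> nat set" where "PF T x y = {a. \<exists>b. (x, a, b, y) \<in> T}"

lemma PL_insert: "PL (insert (x, a, b, y) T) x' y' = (if x' = x \<and> y' = y then insert b (PL T x y) else PL T x' y')"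
 and PF_insert: "PF (insert (x, a, b, y) T) x' y' = (if x' = x \<and> y' = y then insert a (PF T x y) else PF T x' y')"
 by (auto simp: PL_def PF_def)

text \<open>A leaf goes only with the last tuple behind it; inclusion in a singleton is the set form
  of the counter test in \<open>del\<close>.\<close>

lemma PL_delete: "PL (T - {(x, a, b, y)}) x' y' =
  (if x' = x \<and> y' = y \<and> {a. (x, a, b, y) \<in> T} \<subseteq> {a} then PL T x y - {b} else PL T x' y')"
 and PF_delete: "PF (T - {(x, a, b, y)}) x' y' =
  (if x' = x \<and> y' = y \<and> {b. (x, a, b, y) \<in> T} \<subseteq> {b} then PF T x y - {a} else PF T x' y')"
 by (auto simp: PL_def PF_def)

text \<open>A locally shortest path is a shortest path to \<open>b\<close> followed by one edge, so
  the weight does not depend on \<open>a\<close>. Hence one leaf per last edge, keyed by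
  \<open>KL\<close>, can stand for all tuples that share this edge.\<close>

definition twt :: "(nat \<Rightarrow> nat \<Rightarrow> real) \<Rightarrow> (nat \<times> nat \<Rightarrow> real) \<Rightarrow> tupval" where
 "twt D w x a b y = D x b + w (b, y)"
text \<open>The paths of a group share both outer edges and differ in the shortest path from
  \<open>a\<close> to \<open>b\<close> between them. A single edge has no such middle part, and its
  \<open>a\<close> and \<open>b\<close> are the ends interchanged, hence the separate value.\<close>

definition tct :: "(nat \<Rightarrow> nat \<Rightarrow> real) \<Rightarrow> tupval" where
 "tct g x a b y = (if a = y \<and> b = x then 1 else g a b)"
definition KL :: "(nat \<Rightarrow> nat \<Rightarrow> real) \<Rightarrow> (nat \<times> nat \<Rightarrow> real) \<Rightarrow> nat \<Rightarrow> nat \<Rightarrow> nat \<Rightarrow> real" where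
 "KL D w x y b = D x b + w (b, y)"
definition KF :: "(nat \<Rightarrow> nat \<Rightarrow> real) \<Rightarrow> (nat \<times> nat \<Rightarrow> real) \<Rightarrow> nat \<Rightarrow> nat \<Rightarrow> nat \<Rightarrow> real" where
 "KF D w x y a = w (x, a) + D a y"

section \<open>Machine parameters and word bounds\<close>

abbreviation ix2 :: "wexp \<Rightarrow> wexp \<Rightarrow> wexp" where "ix2 a b \<equiv> WAdd (WMul a (V ''n'')) b"

text \<open>\<open>2 ^ h\<close> is at least the node count of every tree, the largest having
  \<open>n * n\<close> leaves; \<open>h\<close> occurs in time bounds and not in programs. The
  exponent 8 leaves room for the largest indices, which are of order \<open>n ^ 4\<close>, with
  constant factors.\<close>

locale ram =
 fixes n h W :: nat
 assumes W_def: "W = (n + 2) ^ 8" and h: "4 * (n + 1) * (n + 1) \<le> 2 ^ h"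
begin

text \<open>Half of the exponent supplies the factor 16, since \<open>n + 2\<close> is at least 2,
  and the other half is expanded.\<close>

lemma W_big: "16 * (n * n * n * n) + 16 * (n * n * n) + 16 * (n * n) + 16 * n + 256 \<le> W"
proof -
 have "(2::nat) ^ 4 \<le> (n + 2) ^ 4" by (rule power_mono) auto
 then have "16 * (n + 2) ^ 4 \<le> (n + 2) ^ 4 * (n + 2) ^ 4" by (intro mult_le_mono1) simp
 also have "\<dots> = W" unfolding W_def by (simp flip: power_add)
 finally have "16 * (n + 2) ^ 4 \<le> W" .
 moreover have "(n + 2) ^ 4 = n * n * n * n + 8 * (n * n * n) + 24 * (n * n) + 32 * n + 16"
  by (simp add: eval_nat_numeral algebra_simps)
 ultimately show ?thesis by simp
qed

lemma W_const [simp]: "0 < W" "Suc 0 < W" "1 < W" "2 < W" "3 < W" "n < W" "n * n < W" "2 * n < W" "Suc n < W" "Suc (n * n) < W" "n * 2 < W" "W > n * n * n"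
 using W_big by linarith+

lemma in_W:
 "p < n \<Longrightarrow> p < W" "p < n * n \<Longrightarrow> p < W" "p < n * n * n \<Longrightarrow> p < W" "p < n * n * n * n \<Longrightarrow> p < W"
 "p < n \<Longrightarrow> Suc p < W" "p < n * n \<Longrightarrow> Suc p < W"
 "p < n * n \<Longrightarrow> i < n * n \<Longrightarrow> p * (n * n) + i < W" "p < n * n \<Longrightarrow> i \<le> n * n \<Longrightarrow> p * (n * n) + i < W"
proof -
 show 1: "p < n * n \<Longrightarrow> i \<le> n * n \<Longrightarrow> p * (n * n) + i < W" for i
 proof -
  assume p: "p < n * n" "i \<le> n * n"
  have "p * (n * n) \<le> n * n * n * n" using mult_le_mono1[of p "n * n" "n * n"] p by (simp add: mult.assoc)
  then show "p * (n * n) + i < W" using W_big p by linarith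
 qed
 then show "p < n * n \<Longrightarrow> i < n * n \<Longrightarrow> p * (n * n) + i < W" by simp
qed (use W_big in linarith)+

lemma mult_W:
 "p < n \<Longrightarrow> p * n < W" "p < n * n \<Longrightarrow> p * n < W" "p < n * n * n \<Longrightarrow> p * n < W" "p < n * n \<Longrightarrow> p * (n * n) < W"
 "p < n * n \<Longrightarrow> p * (2 * n) < W" "p < n * n \<Longrightarrow> p * (n * 2) < W"
 "p < n * n \<Longrightarrow> p * (2 * n) + 2 * n + 3 < W" "p < n * n \<Longrightarrow> p * n + n + 3 < W"
proof -
 { assume p: "p < n * n"
  have "p * n \<le> n * n * n" using p by (intro mult_le_mono1) simp
  moreover have "p * (n * n) \<le> n * n * n * n" "p * (2 * n) \<le> 2 * (n * n * n)" "p * (n * 2) = p * (2 * n)"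
   using p mult_le_mono1[of p "n * n" "n * n"] mult_le_mono1[of p "n * n" "2 * n"] by (simp_all add: mult.assoc)
  ultimately have "p * n < W" "p * (n * n) < W" "p * (2 * n) < W" "p * (n * 2) < W" "p * (2 * n) + 2 * n + 3 < W" "p * n + n + 3 < W"
   using W_big by linarith+ }
 note * = this
 from * show "p < n * n \<Longrightarrow> p * n < W" "p < n * n \<Longrightarrow> p * (n * n) < W"
 "p < n * n \<Longrightarrow> p * (2 * n) < W" "p < n * n \<Longrightarrow> p * (n * 2) < W"
 "p < n * n \<Longrightarrow> p * (2 * n) + 2 * n + 3 < W" "p < n * n \<Longrightarrow> p * n + n + 3 < W" by auto
 { assume p: "p < n * n * n"
  have "p * n \<le> n * n * n * n" using p by (intro mult_le_mono1) simp
  then show "p * n < W" using W_big by linarith }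
 { assume p: "p < n"
  have "p * n \<le> n * n" using p by (intro mult_le_mono1) simp
  then show "p * n < W" using W_big by linarith }
qed

lemmas bnd = in_W mult_W digit_less

text \<open>
 The block of \<open>(x, y)\<close> in the arrays \<open>lsp_*\<close> is unordered; \<open>pos\<close> locates a tuple in its block.
 The trees \<open>tl\<close> and \<open>tf\<close> hold the last and the first edges occurring in a block, keyed by path
 weight; \<open>cl\<close> and \<open>cf\<close> count the tuples behind a leaf, which is removed when the count drops to 0.
\<close>

definition store :: "state \<Rightarrow> tup set \<Rightarrow> (nat \<Rightarrow> nat \<Rightarrow> real) \<Rightarrow> (nat \<times> nat \<Rightarrow> real) \<Rightarrow> (nat \<Rightarrow> nat \<Rightarrow> real) \<Rightarrow> bool" where
 "store s T D w g \<longleftrightarrow>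
   blocks n (words s ''lsp_a'') (words s ''lsp_b'') (words s ''lsp_len'') (words s ''pos'')
    (reals s ''lsp_weight'') (reals s ''lsp_count'') T (twt D w) (tct g) \<and>
   cell_counts n (words s ''cl'') (words s ''cf'') T \<and>
   trees (words s ''tl'') (reals s ''kl'') n (PL T) (KL D w) \<and>
   trees (words s ''tf'') (reals s ''kf'') n (PF T) (KF D w)"

abbreviation store_words :: "string set" where
 "store_words \<equiv> {''lsp_a'', ''lsp_b'', ''lsp_len'', ''pos'', ''cl'', ''cf'', ''tl'', ''tf''}"
abbreviation store_reals :: "string set" where
 "store_reals \<equiv> {''lsp_weight'', ''lsp_count'', ''kl'', ''kf''}"

lemma store_cong:
 "(\<And>x. x \<in> store_words \<Longrightarrow> words s' x = words s x) \<Longrightarrow> (\<And>x. x \<in> store_reals \<Longrightarrow> reals s' x = reals s x) \<Longrightarrow>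
   store s' T D w g = store s T D w g"
 by (simp add: store_def)

lemma store_upd [simp]:
 "x \<notin> store_words \<Longrightarrow> store (wupd s x i v) T D w g = store s T D w g"
 "x \<notin> store_reals \<Longrightarrow> store (rupd s x i r) T D w g = store s T D w g"
 by (rule store_cong; auto)+

lemma storeD:
 assumes "store s T D w g"
 shows "blocks n (words s ''lsp_a'') (words s ''lsp_b'') (words s ''lsp_len'') (words s ''pos'')
    (reals s ''lsp_weight'') (reals s ''lsp_count'') T (twt D w) (tct g)"
  "cell_counts n (words s ''cl'') (words s ''cf'') T"
  "trees (words s ''tl'') (reals s ''kl'') n (PL T) (KL D w)"
  "trees (words s ''tf'') (reals s ''kf'') n (PF T) (KF D w)"
  "T \<subseteq> quads n"
 using assms blocksD(1)[of n "words s ''lsp_a''"] unfolding store_def by blast+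

section \<open>Inserting and deleting one tuple\<close>

definition load_pair :: com where
 "load_pair = (''ts'' ::= V ''n'' ;; ''tb'' ::= WMul (V ''qp'') (WMul (C 2) (V ''n'')) ;; ''tk'' ::= WMul (V ''qp'') (V ''n''))"

definition slot :: "wexp \<Rightarrow> wexp" where
 "slot i = WAdd (WMul (V ''qp'') (WMul (V ''n'') (V ''n''))) i"

abbreviation qpos :: wexp where "qpos \<equiv> ix2 (ix2 (ix2 (WGet ''q'' (C 0)) (V ''qa'')) (V ''qb'')) (WGet ''q'' (C 1))"

definition add :: com where
 "add =
   (''qp'' ::= ix2 (WGet ''q'' (C 0)) (WGet ''q'' (C 1)) ;;
   ''qi'' ::= WGet ''lsp_len'' (V ''qp'') ;;
   WSet ''lsp_a'' (slot (V ''qi'')) (V ''qa'') ;;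
   WSet ''lsp_b'' (slot (V ''qi'')) (V ''qb'') ;;
   RSet ''lsp_weight'' (slot (V ''qi'')) (R ''qw'') ;;
   RSet ''lsp_count'' (slot (V ''qi'')) (R ''qc'') ;;
   WSet ''pos'' qpos (V ''qi'') ;;
   WSet ''lsp_len'' (V ''qp'') (WAdd (V ''qi'') (C 1)) ;;
   WSet ''cl'' (ix2 (V ''qp'') (V ''qb'')) (WAdd (WGet ''cl'' (ix2 (V ''qp'') (V ''qb''))) (C 1)) ;;
   WSet ''cf'' (ix2 (V ''qp'') (V ''qa'')) (WAdd (WGet ''cf'' (ix2 (V ''qp'') (V ''qa''))) (C 1)) ;;
   load_pair ;;
   ''rk'' ::=r R ''qw'' ;;
   ''tj'' ::= V ''qb'' ;; tree_insert ''tl'' ''kl'' ;;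
   ''tj'' ::= V ''qa'' ;; tree_insert ''tf'' ''kf'')"

lemma writes_add [simp]:
 "word_writes add = {''qp'', ''qi'', ''lsp_a'', ''lsp_b'', ''pos'', ''lsp_len'', ''cl'', ''cf'', ''ts'', ''tb'', ''tk'', ''tj'', ''tl'', ''tf'', ''ti'', ''tu'', ''tv''}"
 "real_writes add = {''lsp_weight'', ''lsp_count'', ''rk'', ''kl'', ''kf''}"
 by (auto simp: add_def load_pair_def)

lemma two_n_le: "2 * n \<le> 2 ^ h"
 using h by (auto intro: order_trans[rotated])

text \<open>The same number is inserted into the tree of last edges and into the tree of first
  edges; this is why the two decompositions of the weight have to agree.\<close>

lemma add_wp:
 assumes S: "store s T D w g" and nn: "words s ''n'' 0 = n"
  and new: "(x, a, b, y) \<notin> T"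
  and x: "x < n" "a < n" "b < n" "y < n"
  and q: "words s ''q'' 0 = x" "words s ''qa'' 0 = a" "words s ''qb'' 0 = b" "words s ''q'' (Suc 0) = y"
  and r: "reals s ''qw'' 0 = D x b + w (b, y)" "D x b + w (b, y) = w (x, a) + D a y" "reals s ''qc'' 0 = tct g x a b y"
 shows "wp W add (\<lambda>t s'. t \<le> 12 * h + 30 \<and> store s' (insert (x, a, b, y) T) D w g) s"
proof -
 note st = storeD[OF S]
 define p where "p = x * n + y"
 have p: "p < n * n" unfolding p_def by (rule digit_less) (use x in auto)
 have len: "words s ''lsp_len'' p < n * n" unfolding p_def using blocks_len(2)[OF st(1) x(1,4) new] x by auto
 have cl: "words s ''cl'' (p * n + b) \<le> n" "words s ''cf'' (p * n + a) \<le> n"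
  using st(2) x card_mono[OF _ quads_fibre(1)[OF st(5), of x b y]] card_mono[OF _ quads_fibre(2)[OF st(5), of x a y]]
  by (auto simp: cell_counts_def p_def)
 have cl': "Suc (words s ''cl'' (p * n + b)) < W" "Suc (words s ''cf'' (p * n + a)) < W"
   "words s ''cl'' (p * n + b) < W" "words s ''cf'' (p * n + a) < W"
  using cl W_big by auto
 have pn: "p * n < W" "p * n + a < W" "p * n + b < W" "p * (n * n) < W" "p * (n * n) + words s ''lsp_len'' p < W"
   "x * n < W" "x * n + y < W" "p * (2 * n) < W" "p < W"
  using p x len by (auto simp: bnd p_def)
 have ixW: "x * n + a < W" "(x * n + a) * n < W" "(x * n + a) * n + b < W" "((x * n + a) * n + b) * n < W" "((x * n + a) * n + b) * n + y < W"
  using x by (auto simp: bnd)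
 have ix: "((x * n + a) * n + b) * n + y = ix4 n x a b y" by (simp add: ix4_def)
 have tl: "tree (words s ''tl'') (reals s ''kl'') n (p * (2 * n)) (p * n) (PL T x y) (KL D w x y)"
  "tree (words s ''tf'') (reals s ''kf'') n (p * (2 * n)) (p * n) (PF T x y) (KF D w x y)"
  using st(3,4) x by (auto simp: trees_def p_def)
 \<comment> \<open>The inserted keys are already the values of the key functions, so the function
   update produced by \<open>tree_insert_wp\<close> changes nothing.\<close>
 have KL: "(KL D w x y)(b := D x b + w (b, y)) = KL D w x y" by (auto simp: KL_def)
 have KF: "(KF D w x y)(a := D x b + w (b, y)) = KF D w x y" by (auto simp: KF_def r)
 show ?thesis
  unfolding add_def
  apply (simp add: wp_simps nn q slot_def load_pair_def pn ixW x in_W cl' len flip: p_def)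
  apply (rule wp_conseq, rule tree_insert_wp[where b = "p * (2 * n)" and k = "p * n" and l = b and sz = n and h = h])
  apply (simp_all add: nn q x two_n_le mult_W p tl)
  apply (rule tl)
  apply (simp add: wp_simps nn q slot_def load_pair_def pn ixW x in_W cl' len flip: p_def)
  apply (rule wp_conseq, rule tree_insert_wp[where b = "p * (2 * n)" and k = "p * n" and l = a and sz = n and h = h])
  apply (simp_all add: nn q x two_n_le mult_W p tl)
  apply (rule tl)
  subgoal premises P for t1 s1 t2 s2
  proof -
   note W = P(2) P(5) and Re = P(3) P(6)
   let ?j = "p * (n * n) + words s ''lsp_len'' p"
   have arr: "words s2 ''lsp_a'' = (words s ''lsp_a'')(?j := a)" "words s2 ''lsp_b'' = (words s ''lsp_b'')(?j := b)"
    "words s2 ''lsp_len'' = (words s ''lsp_len'')(p := Suc (words s ''lsp_len'' p))"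
    "words s2 ''pos'' = (words s ''pos'')(ix4 n x a b y := words s ''lsp_len'' p)"
    "reals s2 ''lsp_weight'' = (reals s ''lsp_weight'')(?j := reals s ''qw'' 0)"
    "reals s2 ''lsp_count'' = (reals s ''lsp_count'')(?j := reals s ''qc'' 0)"
    "words s2 ''cl'' = (words s ''cl'')(p * n + b := Suc (words s ''cl'' (p * n + b)))"
    "words s2 ''cf'' = (words s ''cf'')(p * n + a := Suc (words s ''cf'' (p * n + a)))"
    "words s2 ''tl'' = words s1 ''tl''" "reals s2 ''kl'' = reals s1 ''kl''"
    by (simp_all add: W Re ix)
   have "blocks n (words s2 ''lsp_a'') (words s2 ''lsp_b'') (words s2 ''lsp_len'') (words s2 ''pos'')
     (reals s2 ''lsp_weight'') (reals s2 ''lsp_count'') (insert (x, a, b, y) T) (twt D w) (tct g)"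
    unfolding arr p_def by (rule blocks_insert[OF st(1)]) (use x new r in \<open>auto simp: twt_def\<close>)
   moreover have "cell_counts n (words s2 ''cl'') (words s2 ''cf'') (insert (x, a, b, y) T)"
    unfolding arr p_def by (rule cell_counts_insert[OF st(2,5) new x])
   moreover have "trees (words s2 ''tl'') (reals s2 ''kl'') n (PL (insert (x, a, b, y) T)) (KL D w)"
    unfolding arr
    by (rule trees_upd[OF st(3) x(1,4), folded p_def])
     (use P(1) KL x in \<open>auto simp: PL_insert r\<close>)
   moreover have "trees (words s2 ''tf'') (reals s2 ''kf'') n (PF (insert (x, a, b, y) T)) (KF D w)"
    by (rule trees_upd[OF st(4) x(1,4), folded p_def])
     (use P(4) KF x in \<open>auto simp: PF_insert r\<close>)
   ultimately show ?thesis using P(1,4) by (simp add: store_def)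
  qed
  done
qed

definition tree_prune :: "test \<Rightarrow> string \<Rightarrow> string \<Rightarrow> com" where
 "tree_prune b A K = Cond b (tree_delete A K) Skip"

lemma writes_tree_prune [simp]:
 "word_writes (tree_prune b A K) = {A, ''ti'', ''tu'', ''tv''}" "real_writes (tree_prune b A K) = {}"
 by (auto simp: tree_prune_def)

definition del :: com where
 "del =
   (''qp'' ::= ix2 (WGet ''q'' (C 0)) (WGet ''q'' (C 1)) ;;
   ''qi'' ::= WGet ''pos'' qpos ;;
   ''qj'' ::= WSub (WGet ''lsp_len'' (V ''qp'')) (C 1) ;;
   ''qs'' ::= WGet ''lsp_a'' (slot (V ''qj'')) ;;
   ''qt'' ::= WGet ''lsp_b'' (slot (V ''qj'')) ;;
   WSet ''lsp_a'' (slot (V ''qi'')) (V ''qs'') ;;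
   WSet ''lsp_b'' (slot (V ''qi'')) (V ''qt'') ;;
   RSet ''lsp_weight'' (slot (V ''qi'')) (RGet ''lsp_weight'' (slot (V ''qj''))) ;;
   RSet ''lsp_count'' (slot (V ''qi'')) (RGet ''lsp_count'' (slot (V ''qj''))) ;;
   WSet ''pos'' (ix2 (ix2 (ix2 (WGet ''q'' (C 0)) (V ''qs'')) (V ''qt'')) (WGet ''q'' (C 1))) (V ''qi'') ;;
   WSet ''lsp_len'' (V ''qp'') (V ''qj'') ;;
   WSet ''cl'' (ix2 (V ''qp'') (V ''qb'')) (WSub (WGet ''cl'' (ix2 (V ''qp'') (V ''qb''))) (C 1)) ;;
   WSet ''cf'' (ix2 (V ''qp'') (V ''qa'')) (WSub (WGet ''cf'' (ix2 (V ''qp'') (V ''qa''))) (C 1)) ;;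
   load_pair ;;
   ''tj'' ::= V ''qb'' ;;
   tree_prune (WEq (WGet ''cl'' (ix2 (V ''qp'') (V ''qb''))) (C 0)) ''tl'' ''kl'' ;;
   ''tj'' ::= V ''qa'' ;;
   tree_prune (WEq (WGet ''cf'' (ix2 (V ''qp'') (V ''qa''))) (C 0)) ''tf'' ''kf'')"

lemma writes_del [simp]:
 "word_writes del = {''qp'', ''qi'', ''qj'', ''qs'', ''qt'', ''lsp_a'', ''lsp_b'', ''pos'', ''lsp_len'', ''cl'', ''cf'', ''ts'', ''tb'', ''tk'', ''tj'', ''tl'', ''tf'', ''ti'', ''tu'', ''tv''}"
 "real_writes del = {''lsp_weight'', ''lsp_count''}"
 by (auto simp: del_def load_pair_def)

lemma tree_prune_wp:
 assumes A: "A \<notin> {''ti'', ''tu'', ''tv'', ''tb'', ''tk'', ''ts'', ''tj''}"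
  and s: "words s ''tb'' 0 = p * (2 * n)" "words s ''tk'' 0 = p * n" "words s ''tj'' 0 = l" "words s ''ts'' 0 = n"
  and p: "p < n * n" "l < n" and b: "tfits W s b"
  and T: "tree (words s A) (reals s K) n (p * (2 * n)) (p * n) P key"
 shows "wp W (tree_prune b A K) (\<lambda>t s'. t \<le> 6 * h + 5 \<and>
   (\<forall>j. j < p * (2 * n) \<or> j \<ge> p * (2 * n) + 2 * n \<longrightarrow> words s' A j = words s A j) \<and>
   tree (words s' A) (reals s' K) n (p * (2 * n)) (p * n) (if tval s b then P - {l} else P) key) s"
proof (cases "tval s b")
 case True
 show ?thesis
  unfolding tree_prune_def
  apply (simp add: wp_simps b True)
  apply (rule wp_conseq, rule tree_delete_wp[OF A s p(2) two_n_le _ _ T])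
  using p mult_W by auto
next
 case False
 then show ?thesis using T b unfolding tree_prune_def by (simp add: wp_simps)
qed

lemma del_wp:
 assumes S: "store s T D w g" and nn: "words s ''n'' 0 = n"
  and mem: "(x, a, b, y) \<in> T"
  and q: "words s ''q'' 0 = x" "words s ''qa'' 0 = a" "words s ''qb'' 0 = b" "words s ''q'' (Suc 0) = y"
 shows "wp W del (\<lambda>t s'. t \<le> 12 * h + 40 \<and> store s' (T - {(x, a, b, y)}) D w g) s"
proof -
 note st = storeD[OF S]
 have x: "x < n" "a < n" "b < n" "y < n" and ps: "words s ''pos'' (ix4 n x a b y) < words s ''lsp_len'' (x * n + y)"
  using blocksD(3)[OF st(1) mem] by auto
 define p where "p = x * n + y"
 have p: "p < n * n" unfolding p_def by (rule digit_less) (use x in auto)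
 define i where "i = words s ''pos'' (ix4 n x a b y)"
 define len where "len = words s ''lsp_len'' p"
 have i: "i < len" "len \<le> n * n" "len - 1 < len" using blocks_len(1)[OF st(1) x(1,4)] ps by (auto simp: i_def len_def p_def)
 define j where "j = p * (n * n) + (len - 1)"
 define u where "u = words s ''lsp_a'' j"
 define v where "v = words s ''lsp_b'' j"
 have "(x, u, v, y) \<in> T" unfolding u_def v_def j_def len_def p_def
  using blocksD(2)[OF st(1) x(1,4), of "words s ''lsp_len'' (x * n + y) - 1"] ps by auto
 then have uv: "u < n" "v < n" using blocksD(3)[OF st(1)] by auto
 have fb: "finite {a. (x, a, b, y) \<in> T}" "finite {b. (x, a, b, y) \<in> T}" using quads_fibre(3,4)[OF st(5)] by auto
 have cl: "words s ''cl'' (p * n + b) = card {a. (x, a, b, y) \<in> T}" "words s ''cf'' (p * n + a) = card {b. (x, a, b, y) \<in> T}"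
  using st(2) x by (auto simp: cell_counts_def p_def)
 have cln: "words s ''cl'' (p * n + b) \<le> n" "words s ''cf'' (p * n + a) \<le> n"
  unfolding cl using card_mono[OF _ quads_fibre(1)[OF st(5), of x b y]] card_mono[OF _ quads_fibre(2)[OF st(5), of x a y]]
  by auto
 \<comment> \<open>After the decrement the program tests whether \<open>card - 1\<close> is 0. As
   the deleted tuple was counted, this says that it was alone behind its leaf.\<close>
 have cl0: "(card {a. (x, a, b, y) \<in> T} \<le> Suc 0) = ({a. (x, a, b, y) \<in> T} \<subseteq> {a})"
  "(card {b. (x, a, b, y) \<in> T} \<le> Suc 0) = ({b. (x, a, b, y) \<in> T} \<subseteq> {b})"
  using fb mem by (auto simp: card_le_Suc0_iff_eq)
 have cl': "words s ''cl'' (p * n + b) < W" "words s ''cf'' (p * n + a) < W"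
   "words s ''cl'' (p * n + b) - Suc 0 < W" "words s ''cf'' (p * n + a) - Suc 0 < W"
  using cln W_big by auto
 have "p * (n * n) + (len - 1) < W" "p * (n * n) + i < W"
  by (rule in_W(8)[OF p], use i in simp)+
 moreover have "len < W" using i(2) W_const(7) by (rule le_less_trans)
 ultimately have pn: "p * n < W" "p * n + a < W" "p * n + b < W" "p * (n * n) < W" "p * (n * n) + (len - Suc 0) < W" "p * (n * n) + i < W"
   "x * n < W" "x * n + y < W" "p * (2 * n) < W" "p < W" "j < W" "len < W" "len - Suc 0 < W" "i < W"
  using p x i by (auto simp: bnd p_def j_def)
 have ixW: "x * n + a < W" "(x * n + a) * n < W" "(x * n + a) * n + b < W" "((x * n + a) * n + b) * n < W" "((x * n + a) * n + b) * n + y < W"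
  "x * n + u < W" "(x * n + u) * n < W" "(x * n + u) * n + v < W" "((x * n + u) * n + v) * n < W" "((x * n + u) * n + v) * n + y < W"
  "u < W" "v < W" "x < W" "a < W" "b < W" "y < W"
  using x uv by (auto simp: bnd)
 have ix: "((x * n + a) * n + b) * n + y = ix4 n x a b y" "((x * n + u) * n + v) * n + y = ix4 n x u v y" by (simp_all add: ix4_def)
 have rd: "words s ''pos'' (ix4 n x a b y) = i" "words s ''lsp_len'' p = len" "words s ''lsp_a'' j = u" "words s ''lsp_b'' j = v"
  by (auto simp: i_def len_def u_def v_def)
 have tl: "tree (words s ''tl'') (reals s ''kl'') n (p * (2 * n)) (p * n) (PL T x y) (KL D w x y)"
  "tree (words s ''tf'') (reals s ''kf'') n (p * (2 * n)) (p * n) (PF T x y) (KF D w x y)"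
  using st(3,4) x by (auto simp: trees_def p_def)
 have jj: "p * (n * n) + (len - Suc 0) = j" by (simp add: j_def)
 show ?thesis
  unfolding del_def
  apply (simp add: wp_simps nn q slot_def load_pair_def pn ixW x in_W cl' rd jj ix[symmetric] flip: p_def)
  apply (simp add: wp_simps nn q slot_def load_pair_def pn ixW x in_W cl' rd jj ix flip: p_def)
  apply (rule wp_conseq, rule tree_prune_wp[where p = p and l = b])
  apply (simp_all add: nn q x p pn cl' ixW)
  apply (rule tl)
  apply (simp add: wp_simps nn q x p pn cl' ixW)
  apply (rule wp_conseq, rule tree_prune_wp[where p = p and l = a])
  apply (simp_all add: nn q x p pn cl' ixW)
  apply (rule tl)
  subgoal premises P for t1 s1 t2 s2
  proof -
   note W = P(2) P(5) and Re = P(3) P(6)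
   let ?i = "p * (n * n) + i"
   have arr: "words s2 ''lsp_a'' = (words s ''lsp_a'')(?i := words s ''lsp_a'' j)" "words s2 ''lsp_b'' = (words s ''lsp_b'')(?i := words s ''lsp_b'' j)"
    "words s2 ''lsp_len'' = (words s ''lsp_len'')(p := words s ''lsp_len'' p - 1)"
    "words s2 ''pos'' = (words s ''pos'')(ix4 n x (words s ''lsp_a'' j) (words s ''lsp_b'' j) y := words s ''pos'' (ix4 n x a b y))"
    "reals s2 ''lsp_weight'' = (reals s ''lsp_weight'')(?i := reals s ''lsp_weight'' j)"
    "reals s2 ''lsp_count'' = (reals s ''lsp_count'')(?i := reals s ''lsp_count'' j)"
    "words s2 ''cl'' = (words s ''cl'')(p * n + b := words s ''cl'' (p * n + b) - 1)"
    "words s2 ''cf'' = (words s ''cf'')(p * n + a := words s ''cf'' (p * n + a) - 1)"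
    "words s2 ''tl'' = words s1 ''tl''" "reals s2 ''kl'' = reals s1 ''kl''" "reals s2 ''kf'' = reals s ''kf''" "reals s1 ''kl'' = reals s ''kl''"
    by (simp_all add: W Re ix rd)
   have "blocks n (words s2 ''lsp_a'') (words s2 ''lsp_b'') (words s2 ''lsp_len'') (words s2 ''pos'')
     (reals s2 ''lsp_weight'') (reals s2 ''lsp_count'') (T - {(x, a, b, y)}) (twt D w) (tct g)"
    unfolding arr p_def by (rule blocks_delete[OF st(1) mem]) (auto simp: j_def len_def p_def i_def)
   moreover have "cell_counts n (words s2 ''cl'') (words s2 ''cf'') (T - {(x, a, b, y)})"
    unfolding arr p_def by (rule cell_counts_delete[OF st(2,5) mem x])
   moreover have "trees (words s2 ''tl'') (reals s2 ''kl'') n (PL (T - {(x, a, b, y)})) (KL D w)"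
    unfolding arr
    by (rule trees_upd[OF st(3) x(1,4), folded p_def])
     (use P(1) cl cl0 arr in \<open>auto simp: PL_delete\<close>)
   moreover have "trees (words s2 ''tf'') (reals s2 ''kf'') n (PF (T - {(x, a, b, y)})) (KF D w)"
    unfolding arr
    by (rule trees_upd[OF st(4) x(1,4), folded p_def])
     (use P(4) cl cl0 arr in \<open>auto simp: PF_delete W\<close>)
   ultimately show ?thesis using P(1,4) by (simp add: store_def)
  qed
  done
qed

end

section \<open>First and last edges of shortest paths\<close>

text \<open>
 The two families are held together: \<open>Z 0 a b\<close> contains the \<open>x\<close> such that \<open>(x, a)\<close> starts a
 shortest path to \<open>b\<close>, and \<open>Z 1 a b\<close> the \<open>y\<close> such that \<open>(b, y)\<close> ends a shortest path from \<open>a\<close>.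
\<close>

type_synonym fam = "nat \<Rightarrow> nat \<Rightarrow> nat \<Rightarrow> nat set"

definition ix3 :: "nat \<Rightarrow> nat \<Rightarrow> nat \<Rightarrow> nat \<Rightarrow> nat" where "ix3 n sd a b = (sd * n + a) * n + b"

lemma ix3_eq [simp]:
 "a < n \<Longrightarrow> b < n \<Longrightarrow> a' < n \<Longrightarrow> b' < n \<Longrightarrow> ix3 n sd a b = ix3 n sd' a' b' \<longleftrightarrow> sd = sd' \<and> a = a' \<and> b = b'"
 by (auto simp: ix3_def)

lemma ix3_less: "sd < 2 \<Longrightarrow> a < n \<Longrightarrow> b < n \<Longrightarrow> ix3 n sd a b < 2 * n * n"
 by (auto simp: ix3_def intro!: digit_less)

definition seg :: "nat \<Rightarrow> (nat \<Rightarrow> nat) \<Rightarrow> nat \<Rightarrow> nat \<Rightarrow> nat list" where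
 "seg n l r k = map (\<lambda>i. l (r * n + i)) [0..<k]"

lemma length_seg [simp]: "length (seg n l r k) = k" by (simp add: seg_def)

lemma seg_nth [simp]: "i < k \<Longrightarrow> seg n l r k ! i = l (r * n + i)" by (simp add: seg_def)

lemma seg_cong: "(\<And>i. i < k \<Longrightarrow> l (r * n + i) = l' (r * n + i)) \<Longrightarrow> seg n l r k = seg n l' r k"
 by (simp add: seg_def)

lemma seg_Suc [simp]: "seg n l r (Suc k) = seg n l r k @ [l (r * n + k)]" by (simp add: seg_def)

lemma seg_0 [simp]: "seg n l r 0 = []" by (simp add: seg_def)

lemma seg_upd_other: "k \<le> n \<Longrightarrow> i < n \<Longrightarrow> r \<noteq> r' \<Longrightarrow> seg n (l(r' * n + i := v)) r k = seg n l r k"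
 by (rule seg_cong) auto

text \<open>Each set is held twice: as a flag array, for membership tests, and as a list without
  duplicates, for enumeration in time proportional to its size.\<close>

definition fam :: "nat \<Rightarrow> (nat \<Rightarrow> nat) \<Rightarrow> (nat \<Rightarrow> nat) \<Rightarrow> (nat \<Rightarrow> nat) \<Rightarrow> fam \<Rightarrow> bool" where
 "fam n ff fl fc Z \<longleftrightarrow>
   (\<forall>sd<2. \<forall>a<n. \<forall>b<n.
    Z sd a b \<subseteq> {..<n} \<and>
    (\<forall>x<n. ff (ix3 n sd a b * n + x) \<noteq> 0 \<longleftrightarrow> x \<in> Z sd a b) \<and>
    distinct (seg n fl (ix3 n sd a b) (fc (ix3 n sd a b))) \<and>
    set (seg n fl (ix3 n sd a b) (fc (ix3 n sd a b))) = Z sd a b)"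

lemma famD:
 assumes "fam n ff fl fc Z" "sd < 2" "a < n" "b < n"
 shows "Z sd a b \<subseteq> {..<n}" "finite (Z sd a b)"
  "\<And>x. x < n \<Longrightarrow> ff (ix3 n sd a b * n + x) \<noteq> 0 \<longleftrightarrow> x \<in> Z sd a b"
  "distinct (seg n fl (ix3 n sd a b) (fc (ix3 n sd a b)))"
  "set (seg n fl (ix3 n sd a b) (fc (ix3 n sd a b))) = Z sd a b"
  "fc (ix3 n sd a b) = card (Z sd a b)" "card (Z sd a b) \<le> n"
  "\<And>i. i < card (Z sd a b) \<Longrightarrow> fl (ix3 n sd a b * n + i) \<in> Z sd a b"
  "\<And>x. x < n \<Longrightarrow> x \<notin> Z sd a b \<Longrightarrow> card (Z sd a b) < n"
proof -
 show 1: "Z sd a b \<subseteq> {..<n}" "\<And>x. x < n \<Longrightarrow> ff (ix3 n sd a b * n + x) \<noteq> 0 \<longleftrightarrow> x \<in> Z sd a b"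
  and 2: "distinct (seg n fl (ix3 n sd a b) (fc (ix3 n sd a b)))"
  and 3: "set (seg n fl (ix3 n sd a b) (fc (ix3 n sd a b))) = Z sd a b"
  using assms unfolding fam_def by blast+
 show "finite (Z sd a b)" using finite_subset[OF 1(1)] by auto
 show 4: "fc (ix3 n sd a b) = card (Z sd a b)" using distinct_card[OF 2] 3 by simp
 show "card (Z sd a b) \<le> n" using card_mono[OF _ 1(1)] by simp
 show "fl (ix3 n sd a b * n + i) \<in> Z sd a b" if "i < card (Z sd a b)" for i
  using nth_mem[of i "seg n fl (ix3 n sd a b) (fc (ix3 n sd a b))"] 3 4 that by simp
 show "card (Z sd a b) < n" if "x < n" "x \<notin> Z sd a b" for x
 proof -
  have "card (Z sd a b) < card {..<n}" by (rule psubset_card_mono) (use 1 that in auto)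
  then show ?thesis by simp
 qed
qed

definition upd3 :: "fam \<Rightarrow> nat \<Rightarrow> nat \<Rightarrow> nat \<Rightarrow> nat set \<Rightarrow> fam" where
 "upd3 Z sd a b A = (\<lambda>sd' a' b'. if sd' = sd \<and> a' = a \<and> b' = b then A else Z sd' a' b')"

lemma fam_insert:
 assumes F: "fam n ff fl fc Z" and i: "sd < 2" "a < n" "b < n" and r: "r = ix3 n sd a b"
  and x: "x < n" "x \<notin> Z sd a b"
 shows "fam n (ff(r * n + x := Suc 0)) (fl(r * n + fc r := x)) (fc(r := Suc (fc r))) (upd3 Z sd a b (insert x (Z sd a b)))"
 unfolding fam_def
proof (intro allI impI)
 fix sd' a' b' :: nat assume i': "sd' < 2" "a' < n" "b' < n"
 note D = famD[OF F i'] and D0 = famD[OF F i]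
 have k: "fc r < n" using D0(6) D0(9)[OF x] r by simp
 show "upd3 Z sd a b (insert x (Z sd a b)) sd' a' b' \<subseteq> {..<n} \<and>
    (\<forall>xa<n. ((ff(r * n + x := Suc 0)) (ix3 n sd' a' b' * n + xa) \<noteq> 0) = (xa \<in> upd3 Z sd a b (insert x (Z sd a b)) sd' a' b')) \<and>
    distinct (seg n (fl(r * n + fc r := x)) (ix3 n sd' a' b') ((fc(r := Suc (fc r))) (ix3 n sd' a' b'))) \<and>
    set (seg n (fl(r * n + fc r := x)) (ix3 n sd' a' b') ((fc(r := Suc (fc r))) (ix3 n sd' a' b'))) =
    upd3 Z sd a b (insert x (Z sd a b)) sd' a' b'"
 proof (cases "sd' = sd \<and> a' = a \<and> b' = b")
  case True
  have "seg n (fl(r * n + fc r := x)) r (fc r) = seg n fl r (fc r)"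
   by (rule seg_cong) (use k in auto)
  then show ?thesis using True D D0 x r by (simp add: upd3_def)
 next
  case False
  then have ne: "ix3 n sd' a' b' \<noteq> r" unfolding r using i i' by auto
  have "seg n (fl(r * n + fc r := x)) (ix3 n sd' a' b') (fc (ix3 n sd' a' b')) = seg n fl (ix3 n sd' a' b') (fc (ix3 n sd' a' b'))"
   by (rule seg_upd_other) (use ne k D in auto)
  moreover have u: "upd3 Z sd a b (insert x (Z sd a b)) sd' a' b' = Z sd' a' b'" using False by (auto simp: upd3_def)
  ultimately show ?thesis using ne D x by (simp add: u)
 qed
qed

lemma fam_delete:
 assumes F: "fam n ff fl fc Z" and i: "sd < 2" "a < n" "b < n" and r: "r = ix3 n sd a b"
  and x: "k < fc r" "x = fl (r * n + k)"
 shows "fam n (ff(r * n + x := 0)) (fl(r * n + k := fl (r * n + (fc r - 1)))) (fc(r := fc r - 1)) (upd3 Z sd a b (Z sd a b - {x}))"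
 unfolding fam_def
proof (intro allI impI)
 fix sd' a' b' :: nat assume i': "sd' < 2" "a' < n" "b' < n"
 note D = famD[OF F i'] and D0 = famD[OF F i]
 have kn: "k < n" using x D0(6,7) r by simp
 have xn: "x < n" using x D0(8)[of k] D0(1,6) r by auto
 show "upd3 Z sd a b (Z sd a b - {x}) sd' a' b' \<subseteq> {..<n} \<and>
    (\<forall>xa<n. ((ff(r * n + x := 0)) (ix3 n sd' a' b' * n + xa) \<noteq> 0) = (xa \<in> upd3 Z sd a b (Z sd a b - {x}) sd' a' b')) \<and>
    distinct (seg n (fl(r * n + k := fl (r * n + (fc r - 1)))) (ix3 n sd' a' b') ((fc(r := fc r - 1)) (ix3 n sd' a' b'))) \<and>
    set (seg n (fl(r * n + k := fl (r * n + (fc r - 1)))) (ix3 n sd' a' b') ((fc(r := fc r - 1)) (ix3 n sd' a' b'))) =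
    upd3 Z sd a b (Z sd a b - {x}) sd' a' b'"
 proof (cases "sd' = sd \<and> a' = a \<and> b' = b")
  case True
  obtain m where m: "fc r = Suc m" using x by (cases "fc r") auto
  let ?xs = "seg n fl r (Suc m)" and ?ys = "seg n (fl(r * n + k := fl (r * n + m))) r m"
  have d: "distinct ?xs" "set ?xs = Z sd a b" using D0(4,5) r m by simp_all
  have ys: "?ys = (take m ?xs)[k := ?xs ! m]"
   by (rule nth_equalityI) (auto simp: nth_list_update seg_def nth_append)
  \<comment> \<open>Removing the last entry merely shortens the list; otherwise the last entry fills
    the gap at \<open>k\<close>.\<close>
  have "distinct ?ys \<and> set ?ys = set ?xs - {x}"
  proof (cases "k = m")
   case True
   then have "?ys = seg n fl r m" using ys by (simp add: seg_def)
   then show ?thesis using d x m True by auto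
  next
   case False
   then have km: "k < m" using x m by simp
   have sd: "distinct (seg n fl r m)" "fl (r * n + m) \<notin> set (seg n fl r m)" using d by auto
   have xk: "x = seg n fl r m ! k" using km x by simp
   have "set ((seg n fl r m)[k := fl (r * n + m)]) = insert (fl (r * n + m)) (set (seg n fl r m) - {x})"
    unfolding xk by (rule set_update_distinct) (use sd km in auto)
   moreover have "distinct ((seg n fl r m)[k := fl (r * n + m)])"
    by (rule distinct_list_update) (use sd in auto)
   moreover have "x \<noteq> fl (r * n + m)" using sd xk km nth_mem[of k "seg n fl r m"] by auto
   moreover have "?ys = (seg n fl r m)[k := fl (r * n + m)]" using ys by (simp add: nth_append)
   moreover have "set ?xs = insert (fl (r * n + m)) (set (seg n fl r m))" by simp
   ultimately show ?thesis by (metis insert_Diff_if singletonD)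
  qed
  then have ys: "distinct ?ys" "set ?ys = Z sd a b - {x}" using d by auto
  have u: "upd3 Z sd a b (Z sd a b - {x}) sd' a' b' = Z sd a b - {x}" using True by (auto simp: upd3_def)
  have f: "((ff(r * n + x := 0)) (r * n + xa) \<noteq> 0) = (xa \<in> Z sd a b - {x})" if "xa < n" for xa
   using D0(3)[OF that] r by simp
  have r': "ix3 n sd' a' b' = r" using True r by simp
  show ?thesis unfolding u r' using ys f m D0(1) by auto
 next
  case False
  then have ne: "ix3 n sd' a' b' \<noteq> r" unfolding r using i i' by auto
  have "seg n (fl(r * n + k := v)) (ix3 n sd' a' b') (fc (ix3 n sd' a' b')) = seg n fl (ix3 n sd' a' b') (fc (ix3 n sd' a' b'))" for v
   by (rule seg_upd_other) (use ne kn D in auto)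
  moreover have u: "upd3 Z sd a b (Z sd a b - {x}) sd' a' b' = Z sd' a' b'" using False by (auto simp: upd3_def)
  ultimately show ?thesis using ne D xn by (simp add: u)
 qed
qed

text \<open>The pairs with \<open>x = y\<close> are left out because the vertices of a path are
  distinct: extending at both ends by the same vertex closes a cycle.\<close>

definition tuples :: "nat \<Rightarrow> fam \<Rightarrow> (nat \<times> nat) set \<Rightarrow> tup set" where
 "tuples n Z S = {(x, a, b, y). a < n \<and> b < n \<and> x \<in> Z 0 a b \<and> y \<in> Z 1 a b \<and> x \<noteq> y} \<union>
   {(x, a, b, y). a = y \<and> b = x \<and> (x, y) \<in> S}"

text \<open>\<open>sd\<close> tells at which end \<open>e\<close> is attached, so that the two
  families share one program and one proof.\<close>

definition tp :: "nat \<Rightarrow> nat \<Rightarrow> nat \<Rightarrow> nat \<Rightarrow> nat \<Rightarrow> tup" where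
 "tp sd e a b z = (if sd = 0 then (e, a, b, z) else (z, a, b, e))"

lemma tp_eq [simp]: "tp sd e a b z = tp sd e' a' b' z' \<longleftrightarrow> e = e' \<and> a = a' \<and> b = b' \<and> z = z'"
 by (auto simp: tp_def)

text \<open>With \<open>A\<close> the opposite family at \<open>(a, b)\<close>, these are the tuples
  that come and go with the membership of \<open>e\<close> in \<open>Z sd a b\<close>.\<close>

definition row :: "nat \<Rightarrow> nat \<Rightarrow> nat \<Rightarrow> nat \<Rightarrow> nat set \<Rightarrow> tup set" where
 "row sd e a b A = tp sd e a b ` (A - {e})"

text \<open>A tuple with \<open>b = x\<close> and \<open>a = y\<close> could not be told from a single edge.\<close>

definition fam_ok :: "nat \<Rightarrow> fam \<Rightarrow> bool" where
 "fam_ok n Z \<longleftrightarrow> (\<forall>a b. b \<notin> Z 0 a b \<and> a \<notin> Z 1 a b)"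

text \<open>By \<open>fam_ok\<close> a row contains no tuple that also represents a single edge, so
  subtracting the row leaves the single edges alone.\<close>

lemma tuples_remove:
 assumes "sd < 2" "a < n" "b < n" "e \<in> Z sd a b" "fam_ok n Z"
 shows "tuples n (upd3 Z sd a b (Z sd a b - {e})) S = tuples n Z S - row sd e a b (Z (1 - sd) a b)"
  "row sd e a b (Z (1 - sd) a b) \<subseteq> tuples n Z S"
proof -
 have "sd = 0 \<or> sd = 1" using assms by auto
 then show "tuples n (upd3 Z sd a b (Z sd a b - {e})) S = tuples n Z S - row sd e a b (Z (1 - sd) a b)"
  "row sd e a b (Z (1 - sd) a b) \<subseteq> tuples n Z S"
  using assms(2-) by (elim disjE; auto simp: tuples_def row_def tp_def upd3_def fam_ok_def image_iff split: if_splits)+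
qed

lemma tuples_insert:
 assumes "sd < 2" "a < n" "b < n" "e \<notin> Z sd a b" "fam_ok n Z" "e \<noteq> (if sd = 0 then b else a)"
 shows "tuples n (upd3 Z sd a b (insert e (Z sd a b))) S = tuples n Z S \<union> row sd e a b (Z (1 - sd) a b)"
  "row sd e a b (Z (1 - sd) a b) \<inter> tuples n Z S = {}"
proof -
 have "sd = 0 \<or> sd = 1" using assms by auto
 then show "tuples n (upd3 Z sd a b (insert e (Z sd a b))) S = tuples n Z S \<union> row sd e a b (Z (1 - sd) a b)"
  "row sd e a b (Z (1 - sd) a b) \<inter> tuples n Z S = {}"
  using assms(2-) by (elim disjE; auto simp: tuples_def row_def tp_def upd3_def fam_ok_def image_iff split: if_splits)+
qed

lemma fam_ok_mono: "fam_ok n Z \<Longrightarrow> A \<subseteq> Z sd a b \<Longrightarrow> fam_ok n (upd3 Z sd a b A)"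
 by (auto simp: fam_ok_def upd3_def)

text \<open>Converts the length of an enumerated set into the number of tuples that change; the
  extra 1 accounts for the omitted element \<open>e\<close>.\<close>

lemma card_row: "finite A \<Longrightarrow> card A \<le> card (row sd e a b A) + 1"
proof -
 assume "finite A"
 have "inj_on (tp sd e a b) (A - {e})" by (auto intro: inj_onI)
 then have "card (row sd e a b A) = card (A - {e})" unfolding row_def by (rule card_image)
 then show ?thesis using card_Diff1_le[of A e] by (auto simp: card_Diff_singleton_if)
qed

section \<open>Removing rows of tuples and purging the families\<close>

context ram begin

lemma in_W_fam: "r < 2 * n * n \<Longrightarrow> r < W" "r < 2 * n * n \<Longrightarrow> r * n < W" "r < 2 * n * n \<Longrightarrow> i \<le> n \<Longrightarrow> r * n + i < W"
proof -
 { assume r: "r < 2 * n * n"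
  have "r * n \<le> 2 * (n * n * n)" using r mult_le_mono1[of r "2 * n * n" n] by (simp add: mult.assoc)
  moreover from r have "r \<le> 2 * (n * n)" by simp
  ultimately have "r < W" "r * n < W" "i \<le> n \<Longrightarrow> r * n + i < W" using W_big by linarith+ }
 then show "r < 2 * n * n \<Longrightarrow> r < W" "r < 2 * n * n \<Longrightarrow> r * n < W" "r < 2 * n * n \<Longrightarrow> i \<le> n \<Longrightarrow> r * n + i < W" by auto
qed

definition del_elem :: com where
 "del_elem = Cond (WEq (WGet ''q'' (C 0)) (WGet ''q'' (C 1))) Skip del"

lemma writes_del_elem [simp]: "word_writes del_elem = word_writes del" "real_writes del_elem = real_writes del"
 by (auto simp: del_elem_def)

lemma del_elem_wp:
 assumes S: "store s T D w g" and nn: "words s ''n'' 0 = n"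
  and x: "x < n" "y < n" and mem: "x \<noteq> y \<Longrightarrow> (x, a, b, y) \<in> T"
  and q: "words s ''q'' 0 = x" "words s ''qa'' 0 = a" "words s ''qb'' 0 = b" "words s ''q'' (Suc 0) = y"
 shows "wp W del_elem (\<lambda>t s'. t \<le> 12 * h + 41 \<and> store s' (if x = y then T else T - {(x, a, b, y)}) D w g) s"
proof (cases "x = y")
 case True
 then show ?thesis unfolding del_elem_def using S x by (simp add: wp_simps q in_W)
next
 case False
 then show ?thesis unfolding del_elem_def using x
  apply (simp add: wp_simps q in_W)
  apply (rule wp_conseq, rule del_wp[OF S nn mem[OF False] q])
  by auto
qed

definition del_row :: com where
 "del_row = For ''li'' (WGet ''fc'' (V ''ro''))
   (WSet ''q'' (WSub (C 1) (V ''sd'')) (WGet ''fl'' (ix2 (V ''ro'') (V ''li''))) ;; del_elem)"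

lemma writes_del_row [simp]:
 "word_writes del_row = {''li'', ''q''} \<union> word_writes del" "real_writes del_row = real_writes del"
 by (auto simp: del_row_def)

lemma del_row_wp:
 assumes S: "store s T D w g" and nn: "words s ''n'' 0 = n"
  and F: "fam n ff (words s ''fl'') (words s ''fc'') Z" and i: "sd < 2" "a < n" "b < n"
  and r: "words s ''ro'' 0 = ix3 n (1 - sd) a b"
  and q: "words s ''q'' sd = e" "words s ''qa'' 0 = a" "words s ''qb'' 0 = b" "words s ''sd'' 0 = sd" and e: "e < n"
  and sub: "row sd e a b (Z (1 - sd) a b) \<subseteq> T"
 shows "wp W del_row (\<lambda>t s'. t \<le> (12 * h + 44) * card (Z (1 - sd) a b) + 2 \<and>
   store s' (T - row sd e a b (Z (1 - sd) a b)) D w g \<and> words s' ''q'' sd = e) s"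
proof -
 have sd': "1 - sd < 2" by simp
 note FD = famD[OF F sd' i(2,3)]
 define r where "r = ix3 n (1 - sd) a b"
 define m where "m = card (Z (1 - sd) a b)"
 have rr: "r < 2 * n * n" unfolding r_def by (rule ix3_less) (use i in auto)
 have m: "m \<le> n" "m < W" using FD(7) in_W_fam(3)[OF rr, of n] W_const(6) unfolding m_def by linarith+
 have fcr: "words s ''fc'' r = m" using FD(6) by (simp add: r_def m_def)
 define zs where "zs = seg n (words s ''fl'') r m"
 have zs: "set zs = Z (1 - sd) a b" "distinct zs" "length zs = m" using FD(4,5,6) by (simp_all add: zs_def r_def m_def)
 let ?I = "\<lambda>j t s'. store s' (T - row sd e a b (set (take j zs))) D w g \<and> t \<le> (12 * h + 42) * j \<and>
   words s' ''q'' sd = e \<and> words s' ''n'' 0 = n \<and> words s' ''ro'' 0 = r \<and> words s' ''qa'' 0 = a \<and> words s' ''qb'' 0 = b \<and>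
   words s' ''sd'' 0 = sd \<and> words s' ''fl'' = words s ''fl'' \<and> words s' ''fc'' = words s ''fc''"
 show ?thesis
  unfolding del_row_def
 proof (rule wp_For[where m = m and I = ?I])
  show "?I 0 0 (wupd s ''li'' 0 0)" using S nn r q by (simp add: row_def r_def)
 next
  fix j t s' assume "?I j t s'" "words s' ''li'' 0 = j" "j \<le> m"
  then show "wfits W s' (WGet ''fc'' (V ''ro'')) \<and> wval s' (WGet ''fc'' (V ''ro'')) = m"
   using m fcr in_W_fam(1)[OF rr] by simp
 next
  fix j t s' assume I: "?I j t s'" and j: "words s' ''li'' 0 = j" "j < m"
  have I': "store s' (T - row sd e a b (set (take j zs))) D w g" "t \<le> (12 * h + 42) * j"
   "words s' ''q'' sd = e" "words s' ''n'' 0 = n" "words s' ''ro'' 0 = r" "words s' ''qa'' 0 = a" "words s' ''qb'' 0 = b"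
   "words s' ''sd'' 0 = sd" "words s' ''fl'' = words s ''fl''" "words s' ''fc'' = words s ''fc''"
   using I by blast+
  define z where "z = zs ! j"
  have z: "words s ''fl'' (r * n + j) = z" using j by (simp add: z_def zs_def)
  have zin: "z \<in> Z (1 - sd) a b" unfolding z_def zs(1)[symmetric] by (rule nth_mem) (use j(2) zs(3) in simp)
  then have zn: "z < n" using FD(1) by auto
  have tk: "set (take (Suc j) zs) = insert z (set (take j zs))" using j(2) zs(3) by (simp add: z_def take_Suc_conv_app_nth)
  have "z \<notin> set (take j zs)" using zs(2,3) j(2) by (auto simp: z_def in_set_conv_nth nth_eq_iff_index_eq)
  then have mem: "z \<noteq> e \<Longrightarrow> tp sd e a b z \<in> T - row sd e a b (set (take j zs))"
   using sub zin by (auto simp: row_def)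
  have rw: "T - row sd e a b (set (take (Suc j) zs)) =
   (if z = e then T - row sd e a b (set (take j zs)) else T - row sd e a b (set (take j zs)) - {tp sd e a b z})"
   unfolding tk by (auto simp: row_def)
  have eq1: "((if sd = 0 then e else z) = (if sd = 0 then z else e)) = (z = e)"
   and eq2: "((if sd = 0 then e else z), a, b, (if sd = 0 then z else e)) = tp sd e a b z"
   by (auto simp: tp_def)
  have sdn: "sd \<noteq> Suc 0 - sd" "Suc 0 - sd \<noteq> sd" by presburger+
  have WW: "r * n < W" "r * n + j < W" "r < W" "j < W" "z < W" "sd < W" "Suc 0 - sd < W"
   using in_W_fam[OF rr] j m zn i W_big by auto
  show "wp W (WSet ''q'' (WSub (C 1) (V ''sd'')) (WGet ''fl'' (ix2 (V ''ro'') (V ''li''))) ;; del_elem)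
    (\<lambda>u s''. words s'' ''li'' 0 = j \<and> ?I (Suc j) (t + u) (wupd s'' ''li'' 0 (Suc j))) s'"
   apply (simp add: wp_simps I' j WW z)
   apply (rule wp_conseq, rule del_elem_wp[where T = "T - row sd e a b (set (take j zs))" and a = a and b = b
      and x = "if sd = 0 then e else z" and y = "if sd = 0 then z else e" and D = D and w = w and g = g])
   apply (simp_all add: I')[2]
   subgoal using e zn by simp
   subgoal using e zn by simp
   subgoal using mem eq1 by (simp only: eq2) simp
   subgoal using I'(3) sdn i by (auto simp: less_Suc_eq numeral_2_eq_2)
   apply (simp_all add: I')[2]
   subgoal using I'(3) sdn i by (auto simp: less_Suc_eq numeral_2_eq_2)
   subgoal premises P for u s''
   proof -
    have time: "Suc (t + u) \<le> (12 * h + 42) * Suc j" using P(1) I'(2) by (simp add: algebra_simps)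
    have "store s'' (T - row sd e a b (set (take (Suc j) zs))) D w g"
     using P(1) unfolding rw eq1 eq2 by (rule conjunct2)
    then show ?thesis using time by (simp add: P(2) I'(3-) j sdn)
   qed
   done
 next
  fix t s' assume I: "?I m t s'" "words s' ''li'' 0 = m"
  then show "t + 2 * m + 2 \<le> (12 * h + 44) * card (Z (1 - sd) a b) + 2 \<and>
   store s' (T - row sd e a b (Z (1 - sd) a b)) D w g \<and> words s' ''q'' sd = e"
   using zs by (simp add: m_def algebra_simps)
 qed (use m in auto)
qed

end

context ram begin

definition str :: "state \<Rightarrow> fam \<Rightarrow> (nat \<times> nat) set \<Rightarrow> (nat \<Rightarrow> nat \<Rightarrow> real) \<Rightarrow> (nat \<times> nat \<Rightarrow> real) \<Rightarrow> (nat \<Rightarrow> nat \<Rightarrow> real) \<Rightarrow> bool" where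
 "str s Z S D w g \<longleftrightarrow> store s (tuples n Z S) D w g \<and> fam n (words s ''ff'') (words s ''fl'') (words s ''fc'') Z \<and> fam_ok n Z"

abbreviation str_words :: "string set" where
 "str_words \<equiv> store_words \<union> {''ff'', ''fl'', ''fc''}"

lemma str_cong:
 "(\<And>x. x \<in> str_words \<Longrightarrow> words s' x = words s x) \<Longrightarrow> (\<And>x. x \<in> store_reals \<Longrightarrow> reals s' x = reals s x) \<Longrightarrow>
   str s' Z S D w g = str s Z S D w g"
 unfolding str_def using store_cong[of s' s] by simp

lemma str_upd [simp]:
 "x \<notin> str_words \<Longrightarrow> str (wupd s x i v) Z S D w g = str s Z S D w g"
 "x \<notin> store_reals \<Longrightarrow> str (rupd s x i r) Z S D w g = str s Z S D w g"
 by (rule str_cong; auto)+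

lemma strD:
 assumes "str s Z S D w g"
 shows "store s (tuples n Z S) D w g" "fam n (words s ''ff'') (words s ''fl'') (words s ''fc'') Z" "fam_ok n Z"
  "tuples n Z S \<subseteq> quads n" "finite (tuples n Z S)"
proof -
 show a: "store s (tuples n Z S) D w g" "fam n (words s ''ff'') (words s ''fl'') (words s ''fc'') Z" "fam_ok n Z"
  using assms by (auto simp: str_def)
 show q: "tuples n Z S \<subseteq> quads n" using storeD(5)[OF a(1)] .
 show "finite (tuples n Z S)" by (rule finite_subset[OF q]) (simp add: quads_def)
qed

definition purge :: com where
 "purge =
   (''ci'' ::= C 0 ;;
   While (WLess (V ''ci'') (WGet ''fc'' (V ''rr'')))
    (WSet ''q'' (V ''sd'') (WGet ''fl'' (ix2 (V ''rr'') (V ''ci''))) ;;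
    Cond (TAnd (WEq (V ''vf'') (C 0)) (TNot (WEq (WGet ''q'' (V ''sd'')) (V ''uv''))))
     (''ci'' ::= WAdd (V ''ci'') (C 1))
     (del_row ;;
     WSet ''ff'' (ix2 (V ''rr'') (WGet ''q'' (V ''sd''))) (C 0) ;;
     WSet ''fc'' (V ''rr'') (WSub (WGet ''fc'' (V ''rr'')) (C 1)) ;;
     WSet ''fl'' (ix2 (V ''rr'') (V ''ci'')) (WGet ''fl'' (ix2 (V ''rr'') (WGet ''fc'' (V ''rr'')))))))"

lemma writes_purge [simp]:
 "word_writes purge = {''ci'', ''ff'', ''fc'', ''fl'', ''li'', ''q''} \<union> word_writes del" "real_writes purge = real_writes del"
 by (auto simp: purge_def)

text \<open>A kept entry advances \<open>ci\<close>, while a removed one is overwritten by the last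
  entry of the list and \<open>ci\<close> stays. Every deleted tuple and every examined entry pays
  at the same rate. With \<open>f = 1\<close> all entries go, with \<open>f = 0\<close> only
  \<open>v\<close> does.\<close>

lemma purge_wp:
 assumes S: "str s Z S D w g" and nn: "words s ''n'' 0 = n"
  and i: "sd < 2" "a < n" "b < n"
  and r: "words s ''rr'' 0 = ix3 n sd a b" "words s ''ro'' 0 = ix3 n (1 - sd) a b"
  and q: "words s ''qa'' 0 = a" "words s ''qb'' 0 = b" "words s ''sd'' 0 = sd" "words s ''uv'' 0 = v" "words s ''vf'' 0 = f"
  and v: "v < n" "f < 2"
 defines "A0 \<equiv> Z sd a b \<inter> (if f = 0 then - {v} else {})"
 shows "wp W purge (\<lambda>t s'. str s' (upd3 Z sd a b A0) S D w g \<and>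
   t + (12 * h + 60) * card (tuples n (upd3 Z sd a b A0) S) \<le> (12 * h + 60) * (card (tuples n Z S) + card (Z sd a b)) + 2) s"
proof -
 define k where "k = 12 * h + 60"
 define keep where "keep = (if f = 0 then - {v} else {})"
 have sdn: "sd \<noteq> Suc 0 - sd" "Suc 0 - sd \<noteq> sd" by presburger+
 define r where "r = ix3 n sd a b"
 have rn: "r < 2 * n * n" unfolding r_def by (rule ix3_less[OF i])
 let ?Z = "\<lambda>A. upd3 Z sd a b A"
 \<comment> \<open>\<open>A\<close> is what is left of the set, and its first \<open>c\<close> list
   entries are known to be kept. The potential counts the remaining tuples and the entries not yet
   examined.\<close>
 let ?I = "\<lambda>t s'. \<exists>A c. A \<subseteq> Z sd a b \<and> Z sd a b - A \<subseteq> - keep \<and> str s' (?Z A) S D w g \<and>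
   words s' ''ci'' 0 = c \<and> c \<le> card A \<and> (\<forall>i<c. words s' ''fl'' (r * n + i) \<in> keep) \<and>
   t + k * card (tuples n (?Z A) S) + k * (card A - c) \<le> k * (card (tuples n Z S) + card (Z sd a b)) \<and>
   words s' ''n'' 0 = n \<and> words s' ''rr'' 0 = r \<and> words s' ''ro'' 0 = ix3 n (1 - sd) a b \<and>
   words s' ''qa'' 0 = a \<and> words s' ''qb'' 0 = b \<and> words s' ''sd'' 0 = sd \<and> words s' ''uv'' 0 = v \<and> words s' ''vf'' 0 = f"
 have ZZ: "?Z (Z sd a b) = Z" by (auto simp: upd3_def fun_eq_iff)
 have upd: "upd3 (?Z A) sd a b B = ?Z B" for A B by (auto simp: upd3_def fun_eq_iff)
 have Zs: "?Z A sd a b = A" "?Z A (1 - sd) a b = Z (1 - sd) a b" "?Z A (Suc 0 - sd) a b = Z (Suc 0 - sd) a b" for A using sdn by (auto simp: upd3_def)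
 have cardA: "words s' ''fc'' r = card A" "card A \<le> n" "A \<subseteq> {..<n}" "finite A" if "str s' (?Z A) S D w g" for s' A
  using famD(1,2,6,7)[OF strD(2)[OF that] i] by (simp_all add: Zs r_def)
 show ?thesis
  unfolding purge_def k_def[symmetric]
 proof (rule wp_Seq, rule wp_WSet, simp, simp, simp only: wval.simps, rule wp_While[where I = ?I and \<mu> = "\<lambda>s. words s ''fc'' r - words s ''ci'' 0"])
  show "?I 0 (wupd s ''ci'' 0 0)"
   using S nn r q i by (intro exI[of _ "Z sd a b"] exI[of _ 0]) (simp add: ZZ r_def algebra_simps)
 next
  fix t s' assume "?I t s'"
  then obtain A c where A: "str s' (?Z A) S D w g" "words s' ''ci'' 0 = c" "c \<le> card A" "words s' ''rr'' 0 = r" by blast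
  note cA = cardA[OF A(1)]
  have "card A < W" "c < W" "r < W" using cA(2) A(3) W_const(6) in_W_fam(1)[OF rn] by linarith+
  then show "tfits W s' (WLess (V ''ci'') (WGet ''fc'' (V ''rr'')))" using A cA by simp
 next
  fix t s' assume "?I t s'" and nt: "\<not> tval s' (WLess (V ''ci'') (WGet ''fc'' (V ''rr'')))"
  then obtain A c where A: "A \<subseteq> Z sd a b" "Z sd a b - A \<subseteq> - keep" "str s' (?Z A) S D w g" "words s' ''ci'' 0 = c" "c \<le> card A"
   "\<forall>i<c. words s' ''fl'' (r * n + i) \<in> keep" "words s' ''rr'' 0 = r"
   "t + k * card (tuples n (?Z A) S) + k * (card A - c) \<le> k * (card (tuples n Z S) + card (Z sd a b))" by blast
  note cA = cardA[OF A(3)]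
  have c: "c = card A" using nt A cA by simp
  have "set (seg n (words s' ''fl'') r (card A)) = A"
   using famD(5)[OF strD(2)[OF A(3)] i] cA by (simp add: Zs r_def)
  moreover have "set (seg n (words s' ''fl'') r (card A)) \<subseteq> keep" using A(6) c by (auto simp: seg_def)
  ultimately have "A \<subseteq> keep" by simp
  then have "A = A0" using A(1,2) unfolding A0_def keep_def[symmetric] by blast
  then show "str s' (?Z A0) S D w g \<and> 1 + (t + 1) + k * card (tuples n (?Z A0) S) \<le> k * (card (tuples n Z S) + card (Z sd a b)) + 2"
   using A(3,8) by simp
 next
  fix t s' assume "?I t s'" and tt: "tval s' (WLess (V ''ci'') (WGet ''fc'' (V ''rr'')))"
  then obtain A c where A: "A \<subseteq> Z sd a b" "Z sd a b - A \<subseteq> - keep" "str s' (?Z A) S D w g" "words s' ''ci'' 0 = c" "c \<le> card A"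
   "\<forall>i<c. words s' ''fl'' (r * n + i) \<in> keep"
   "t + k * card (tuples n (?Z A) S) + k * (card A - c) \<le> k * (card (tuples n Z S) + card (Z sd a b))"
   and st: "words s' ''n'' 0 = n" "words s' ''rr'' 0 = r" "words s' ''ro'' 0 = ix3 n (1 - sd) a b"
   "words s' ''qa'' 0 = a" "words s' ''qb'' 0 = b" "words s' ''sd'' 0 = sd" "words s' ''uv'' 0 = v" "words s' ''vf'' 0 = f" by blast
  note cA = cardA[OF A(3)]
  note fm = strD(2)[OF A(3)]
  have c: "c < card A" using tt A cA st by simp
  define e where "e = words s' ''fl'' (r * n + c)"
  have e: "e \<in> A" using famD(8)[OF fm i, of c] c by (simp add: Zs r_def e_def)
  then have en: "e < n" using cA(3) by auto
  have WW: "r * n < W" "r * n + c < W" "c < W" "Suc c < W" "r < W" "e < W" "sd < W" "v < W" "f < W" "r * n + e < W"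
    "card A < W" "card A - Suc 0 < W" "r * n + (card A - Suc 0) < W"
   using in_W_fam[OF rn] in_W_fam(3)[OF rn, of "card A - Suc 0"] c cA(2) en i v W_big by (auto simp del: add_diff_assoc)
  have eq: "words s' ''fl'' (r * n + c) = e" by (simp add: e_def)
  let ?T = "tuples n (?Z A) S"
  let ?R = "row sd e a b (Z (1 - sd) a b)"
  have T': "tuples n (?Z (A - {e})) S = ?T - ?R" and Rsub: "?R \<subseteq> ?T"
   using tuples_remove[OF i, of e "?Z A" S] e strD(3)[OF A(3)] by (simp_all only: Zs upd)
  have fT: "finite ?T" using strD(5)[OF A(3)] .
  have cT: "card ?T = card (?T - ?R) + card ?R"
   using card_Diff_subset[OF finite_subset[OF Rsub fT] Rsub] card_mono[OF fT Rsub] by simp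
  have fZ: "finite (Z (1 - sd) a b)" using famD(2)[OF fm _ i(2,3), of "1 - sd"] by (simp add: Zs)
  note cR = card_row[OF fZ, of sd e a b]
  show "wp W (WSet ''q'' (V ''sd'') (WGet ''fl'' (ix2 (V ''rr'') (V ''ci''))) ;;
    Cond (TAnd (WEq (V ''vf'') (C 0)) (TNot (WEq (WGet ''q'' (V ''sd'')) (V ''uv''))))
     (''ci'' ::= WAdd (V ''ci'') (C 1))
     (del_row ;;
     WSet ''ff'' (ix2 (V ''rr'') (WGet ''q'' (V ''sd''))) (C 0) ;;
     WSet ''fc'' (V ''rr'') (WSub (WGet ''fc'' (V ''rr'')) (C 1)) ;;
     WSet ''fl'' (ix2 (V ''rr'') (V ''ci'')) (WGet ''fl'' (ix2 (V ''rr'') (WGet ''fc'' (V ''rr''))))))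
   (\<lambda>u s''. ?I (t + u + 1) s'' \<and> words s'' ''fc'' r - words s'' ''ci'' 0 < words s' ''fc'' r - words s' ''ci'' 0) s'"
  proof (cases "f = 0 \<and> e \<noteq> v")
   case True
   then have ek: "e \<in> keep" by (simp add: keep_def)
   have less: "\<forall>i<Suc c. words s' ''fl'' (r * n + i) \<in> keep" using A(6) ek eq by (auto simp: less_Suc_eq)
   have "card A - c = Suc (card A - Suc c)" using c by simp
   then have "k * (card A - c) = k + k * (card A - Suc c)" by (simp only: mult_Suc_right)
   moreover have "4 \<le> k" by (simp add: k_def)
   ultimately have time: "Suc (Suc (Suc (Suc t))) + k * card ?T + k * (card A - Suc c) \<le> k * (card (tuples n Z S) + card (Z sd a b))"
    using A(7) by linarith
   show ?thesis
    apply (simp add: wp_simps st A(4) WW eq True)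
    apply (intro conjI exI[of _ A])
    using A(1,2,3) c less time cA by (simp_all add: st A(4) True)
  next
   case False
   then have nk: "e \<notin> keep" using v by (auto simp: keep_def)
   have tv: "\<not> (f = 0 \<and> e \<noteq> v)" using False .
   show ?thesis
    apply (simp add: wp_simps st A(4) WW eq tv)
    apply (rule wp_conseq, rule del_row_wp[where T = ?T and Z = "?Z A" and sd = sd and a = a and b = b and e = e and ff = "words s' ''ff''"
       and D = D and w = w and g = g])
    subgoal using strD(1)[OF A(3)] by simp
    apply ((simp add: st))
    subgoal using fm by simp
    subgoal by (rule i)
    subgoal by (rule i)
    subgoal by (rule i)
    apply (simp_all add: st)[5]
    subgoal by (rule en)
    subgoal using Rsub by (simp add: Zs)
    subgoal premises P for u s1
    proof -
     have fr: "words s1 ''ff'' = words s' ''ff''" "words s1 ''fl'' = words s' ''fl''" "words s1 ''fc'' = words s' ''fc''"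
      "words s1 ''rr'' 0 = r" "words s1 ''ci'' 0 = c" "words s1 ''q'' sd = e" "words s1 ''sd'' 0 = sd" "words s1 ''n'' 0 = n"
      "words s1 ''ro'' 0 = ix3 n (Suc 0 - sd) a b" "words s1 ''qa'' 0 = a" "words s1 ''qb'' 0 = b" "words s1 ''uv'' 0 = v" "words s1 ''vf'' 0 = f"
      using P(1) by (simp_all add: P(2) st A(4))
     let ?s2 = "wupd (wupd (wupd s1 ''ff'' (r * n + e) 0) ''fc'' r (card A - Suc 0)) ''fl'' (r * n + c) (words s' ''fl'' (r * n + (card A - Suc 0)))"
     have "fam n (words ?s2 ''ff'') (words ?s2 ''fl'') (words ?s2 ''fc'') (upd3 (?Z A) sd a b (?Z A sd a b - {e}))"
      using fam_delete[OF fm i r_def, of c e] c eq by (simp add: fr cA)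
     then have s2: "str ?s2 (?Z (A - {e})) S D w g"
      using P(1) T' fam_ok_mono[OF strD(3)[OF A(3)], of "A - {e}" sd a b]
      unfolding str_def upd by (simp add: Zs Diff_subset)
     have "words s' ''fl'' (r * n + (card A - Suc 0)) \<in> A"
      using famD(8)[OF fm i, of "card A - Suc 0"] c by (simp add: Zs r_def)
     then have lastW: "words s' ''fl'' (r * n + (card A - Suc 0)) < W" using cA(3) W_const(6) by (meson in_mono lessThan_iff less_trans)
     have cAe: "card (A - {e}) = card A - Suc 0" using e cA(4) by simp
     have "card A - c = Suc (card A - Suc 0 - c)" using c by simp
     then have "k * (card A - c) = k + k * (card A - Suc 0 - c)" by (simp only: mult_Suc_right)
     moreover have "k * card ?T = k * card (?T - ?R) + k * card ?R" unfolding cT by (simp add: algebra_simps)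
     moreover have "u \<le> (12 * h + 44) * (card ?R + 1) + 2"
      using P(1) mult_le_mono2[OF cR, of "12 * h + 44"] by (simp add: Zs)
     \<comment> \<open>The slack of 16 above the rate of \<open>del_row\<close> covers its additive
       constant and the bookkeeping of the round.\<close>
     moreover have "(12 * h + 44) * (card ?R + 1) + 16 \<le> k * card ?R + k" unfolding k_def by (simp add: algebra_simps)
     ultimately have time: "Suc (Suc (Suc (Suc (Suc (Suc (t + u)))))) + k * card (?T - ?R) + k * (card A - Suc 0 - c) \<le> k * (card (tuples n Z S) + card (Z sd a b))"
      using A(7) by linarith
     have less: "\<forall>i<c. words s' ''fl'' (r * n + i) \<in> keep" using A(6) .
     show ?thesis
      apply (simp add: wp_simps fr WW cA lastW)
      apply (intro conjI exI[of _ "A - {e}"])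
      subgoal using A(1) by blast
      subgoal using A(2) nk by blast
      subgoal using s2 by simp
      subgoal using c cAe by simp
      subgoal using less by simp
      subgoal using time T' cAe by simp
      subgoal using c by simp
      done
    qed
    done
  qed
 qed
qed

definition load_rows :: com where
 "load_rows = (''rr'' ::= ix2 (ix2 (V ''sd'') (V ''qa'')) (V ''qb'') ;;
   ''ro'' ::= ix2 (ix2 (WSub (C 1) (V ''sd'')) (V ''qa'')) (V ''qb''))"

definition via_test :: com where
 "via_test = Cond (TAnd (TNot (WEq (WGet ''rc'' (ix2 (V ''qa'') (V ''uv''))) (C 0)))
    (TAnd (TNot (WEq (WGet ''rc'' (ix2 (V ''uv'') (V ''qb''))) (C 0)))
    (REq (RAdd (RGet ''d'' (ix2 (V ''qa'') (V ''uv''))) (RGet ''d'' (ix2 (V ''uv'') (V ''qb'')))) (RGet ''d'' (ix2 (V ''qa'') (V ''qb''))))))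
   (''vf'' ::= C 1) (''vf'' ::= C 0)"

definition cleanup :: com where
 "cleanup =
   For ''cp'' (WMul (V ''n'') (V ''n''))
   (''qa'' ::= WDiv (V ''cp'') (V ''n'') ;; ''qb'' ::= WMod (V ''cp'') (V ''n'') ;;
    via_test ;;
    ''sd'' ::= C 0 ;; load_rows ;; purge ;;
    ''sd'' ::= C 1 ;; load_rows ;; purge)"

lemma writes_cleanup [simp]:
 "word_writes cleanup = {''cp'', ''qa'', ''qb'', ''sd'', ''rr'', ''ro'', ''vf'', ''ci'', ''ff'', ''fc'', ''fl'', ''li'', ''q''} \<union> word_writes del"
 "real_writes cleanup = real_writes del"
 by (auto simp: cleanup_def load_rows_def via_test_def)

definition prune :: "nat \<Rightarrow> (nat \<Rightarrow> nat \<Rightarrow> bool) \<Rightarrow> (nat \<times> nat) set \<Rightarrow> fam \<Rightarrow> fam" where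
 "prune v vf P Z = (\<lambda>sd a b. if sd < 2 \<and> (a, b) \<in> P then Z sd a b \<inter> (if vf a b then {} else - {v}) else Z sd a b)"

lemma prune_insert:
 assumes "(a, b) \<notin> P"
 shows "upd3 (upd3 (prune v vf P Z) 0 a b (Z 0 a b \<inter> (if vf a b then {} else - {v}))) (Suc 0) a b
   (Z (Suc 0) a b \<inter> (if vf a b then {} else - {v})) = prune v vf (insert (a, b) P) Z"
 using assms by (auto simp: prune_def upd3_def fun_eq_iff less_2_cases_iff)

definition pairs_below :: "nat \<Rightarrow> (nat \<times> nat) set" where
 "pairs_below j = {(a, b). a < n \<and> b < n \<and> a * n + b < j}"

lemma pairs_below_0 [simp]: "pairs_below 0 = {}" by (simp add: pairs_below_def)

lemma pairs_below_Suc: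
 assumes "j < n * n"
 shows "pairs_below (Suc j) = insert (j div n, j mod n) (pairs_below j)" "(j div n, j mod n) \<notin> pairs_below j"
  "j div n < n" "j mod n < n" "j div n * n + j mod n = j"
proof -
 have n: "0 < n" using assms by (cases n) auto
 show 1: "j div n < n" "j mod n < n" "j div n * n + j mod n = j"
  using assms n by (simp_all add: div_less_iff_less_mult)
 have iff: "a * n + b < Suc j \<longleftrightarrow> a * n + b < j \<or> a = j div n \<and> b = j mod n" if "b < n" for a b
 proof -
  have "a * n + b = j \<Longrightarrow> a = j div n \<and> b = j mod n" using that n by auto
  then show ?thesis using 1(3) unfolding less_Suc_eq by blast
 qed
 show "pairs_below (Suc j) = insert (j div n, j mod n) (pairs_below j)"
 proof (intro set_eqI)
  fix z :: "nat \<times> nat"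
  obtain a b where z: "z = (a, b)" by (cases z)
  show "z \<in> pairs_below (Suc j) \<longleftrightarrow> z \<in> insert (j div n, j mod n) (pairs_below j)"
   using iff[of b a] 1(1,2) unfolding z pairs_below_def by blast
 qed
 show "(j div n, j mod n) \<notin> pairs_below j" using 1 by (simp add: pairs_below_def)
qed

lemma pairs_below_all: "pairs_below (n * n) = {..<n} \<times> {..<n}"
 using digit_less by (auto simp: pairs_below_def)

text \<open>This test is evaluated on the distance arrays left by the previous run, so it refers to
  the graph before the update.\<close>

definition vias :: "state \<Rightarrow> nat \<Rightarrow> nat \<Rightarrow> nat \<Rightarrow> bool" where
 "vias s v a b \<longleftrightarrow> words s ''rc'' (a * n + v) \<noteq> 0 \<and> words s ''rc'' (v * n + b) \<noteq> 0 \<and>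
   reals s ''d'' (a * n + v) + reals s ''d'' (v * n + b) = reals s ''d'' (a * n + b)"

definition fam_size :: "fam \<Rightarrow> nat \<Rightarrow> nat" where
 "fam_size Z j = card (Z 0 (j div n) (j mod n)) + card (Z (Suc 0) (j div n) (j mod n))"

text \<open>Telescoping over the pairs in row-major order: each pair pays for examining its own two
  sets, and deletions are paid for by the drop in the number of tuples.\<close>

lemma cleanup_wp:
 assumes S: "str s Z S D w g" and nn: "words s ''n'' 0 = n" and v: "words s ''uv'' 0 = v" "v < n"
  and rc: "\<And>p. p < n * n \<Longrightarrow> words s ''rc'' p < W"
 shows "wp W cleanup (\<lambda>t s'. str s' (prune v (vias s v) ({..<n} \<times> {..<n}) Z) S D w g \<and>
   t + (12 * h + 60) * card (tuples n (prune v (vias s v) ({..<n} \<times> {..<n}) Z) S) \<le>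
    (12 * h + 60) * (card (tuples n Z S) + (\<Sum>j<n * n. fam_size Z j)) + 42 * (n * n) + 2) s"
proof -
 define k where "k = 12 * h + 60"
 define vf where "vf = vias s v"
 let ?Z = "\<lambda>j. prune v vf (pairs_below j) Z"
 let ?I = "\<lambda>j t s'. str s' (?Z j) S D w g \<and>
   t + k * card (tuples n (?Z j) S) \<le> k * (card (tuples n Z S) + (\<Sum>i<j. fam_size Z i)) + 40 * j \<and>
   words s' ''n'' 0 = n \<and> words s' ''uv'' 0 = v \<and> words s' ''rc'' = words s ''rc'' \<and> reals s' ''d'' = reals s ''d''"
 have Z0: "?Z 0 = Z" by (simp add: prune_def fun_eq_iff)
 show ?thesis
  unfolding cleanup_def k_def[symmetric] vf_def[symmetric]
 proof (rule wp_For[where m = "n * n" and I = ?I])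
  show "?I 0 0 (wupd s ''cp'' 0 0)" unfolding Z0 using S nn v by simp
 next
  fix j t s' assume "?I j t s'"
  then show "wfits W s' (WMul (V ''n'') (V ''n'')) \<and> wval s' (WMul (V ''n'') (V ''n'')) = n * n" by simp
 next
  fix j t s' assume "?I j t s'" and j: "words s' ''cp'' 0 = j" "j < n * n"
  then have I: "str s' (?Z j) S D w g"
   and time: "t + k * card (tuples n (?Z j) S) \<le> k * (card (tuples n Z S) + (\<Sum>i<j. fam_size Z i)) + 40 * j"
   and st: "words s' ''n'' 0 = n" "words s' ''uv'' 0 = v" "words s' ''rc'' = words s ''rc''" "reals s' ''d'' = reals s ''d''" by blast+
  define a where "a = j div n"
  define b where "b = j mod n"
  note pb = pairs_below_Suc[OF j(2), folded a_def b_def]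
  have ab: "a < n" "b < n" using pb by auto
  have q3: "(n + a) * n + b < 2 * n * n" using ix3_less[of 1 a n b] ab by (simp add: ix3_def)
  have "(n + a) * n + b < W" by (rule in_W_fam(1)[OF q3])
  moreover from this have "(n + a) * n < W" by simp
  moreover have "n + a < W" using ab W_const(8) by linarith
  ultimately have WW: "a < W" "b < W" "v < W" "a * n < W" "a * n + v < W" "v * n < W" "v * n + b < W" "a * n + b < W" "j < W"
   "n + a < W" "(n + a) * n < W" "(n + a) * n + b < W"
   using ab v(2) j(2) by (auto simp: bnd)
  have rW: "words s ''rc'' (a * n + v) < W" "words s ''rc'' (v * n + b) < W"
   using ab v by (auto intro!: rc digit_less)
  have div: "j div n = a" "j mod n = b" by (simp_all add: a_def b_def)
  define f where "f = (if vf a b then Suc 0 else 0)"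
  define keep where "keep = (if f = 0 then - {v} else {})"
  have keep: "keep = (if vf a b then {} else - {v})" by (simp add: keep_def f_def)
  have test: "wp W via_test Q s1 \<longleftrightarrow> Q 2 (wupd s1 ''vf'' 0 f)"
   if "words s1 ''n'' 0 = n" "words s1 ''uv'' 0 = v" "words s1 ''rc'' = words s ''rc''" "reals s1 ''d'' = reals s ''d''"
    "words s1 ''qa'' 0 = a" "words s1 ''qb'' 0 = b" for Q s1
   unfolding via_test_def f_def vf_def vias_def
   by (simp add: wp_simps that WW rW numeral_2_eq_2)
  have nP: "?Z j sd a b = Z sd a b" for sd using pb(2) by (simp add: prune_def)
  let ?Z1 = "upd3 (?Z j) 0 a b (Z 0 a b \<inter> keep)"
  have Z2: "upd3 ?Z1 (Suc 0) a b (Z (Suc 0) a b \<inter> keep) = ?Z (Suc j)"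
   unfolding pb(1) keep by (rule prune_insert[OF pb(2)])
  have Z1: "?Z1 (Suc 0) a b = Z (Suc 0) a b" by (simp add: upd3_def nP)
  have ix: "b + a * n = ix3 n 0 a b" "a * n + b = ix3 n 0 a b" "(n + a) * n + b = ix3 n (Suc 0) a b" by (simp_all add: ix3_def)
  show "wp W (''qa'' ::= WDiv (V ''cp'') (V ''n'') ;; ''qb'' ::= WMod (V ''cp'') (V ''n'') ;;
    via_test ;;
    ''sd'' ::= C 0 ;; load_rows ;; purge ;;
    ''sd'' ::= C 1 ;; load_rows ;; purge) (\<lambda>u s''. words s'' ''cp'' 0 = j \<and> ?I (Suc j) (t + u) (wupd s'' ''cp'' 0 (Suc j))) s'"
   unfolding load_rows_def
   apply (simp add: wp_simps st j WW div)
   apply (simp add: test st j)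
   apply (simp add: wp_simps st j WW div)
   apply (rule wp_conseq, rule purge_wp[where Z = "?Z j" and sd = 0 and a = a and b = b and v = v and f = f and D = D and w = w and g = g and S = S])
   subgoal using I by simp
   apply ((simp add: st))
   apply (simp)
   subgoal by (rule ab)
   subgoal by (rule ab)
   apply (simp_all add: ix3_def)[2]
   apply simp_all[3]
   apply ((simp add: st))
   apply (simp)
   subgoal by (rule v(2))
   apply ((simp add: f_def))
   subgoal premises P for u s1
   proof -
    have fr: "words s1 ''n'' 0 = n" "words s1 ''uv'' 0 = v" "words s1 ''rc'' = words s ''rc''" "reals s1 ''d'' = reals s ''d''"
     "words s1 ''qa'' 0 = a" "words s1 ''qb'' 0 = b" "words s1 ''cp'' 0 = j" "words s1 ''vf'' 0 = f"
     by (simp_all add: P(2,3) st j)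
    have s1: "str s1 ?Z1 S D w g" and t1: "u + k * card (tuples n ?Z1 S) \<le> k * (card (tuples n (?Z j) S) + card (Z 0 a b)) + 2"
     using P(1) by (simp_all add: nP keep_def[symmetric] k_def)
    show ?thesis
     apply (simp add: wp_simps fr WW)
     apply (rule wp_conseq, rule purge_wp[where Z = ?Z1 and sd = "Suc 0" and a = a and b = b and v = v and f = f and D = D and w = w and g = g and S = S])
     subgoal using s1 by simp
     apply ((simp add: fr))
     apply (simp)
     subgoal by (rule ab)
     subgoal by (rule ab)
     apply (simp_all add: ix3_def)[2]
     apply (simp_all add: fr)[2]
     apply (simp)
     apply (simp_all add: fr)[2]
     subgoal by (rule v(2))
     apply ((simp add: f_def))
     subgoal premises R for u2 s2
     proof -
      have fr2: "words s2 ''n'' 0 = n" "words s2 ''uv'' 0 = v" "words s2 ''rc'' = words s ''rc''" "reals s2 ''d'' = reals s ''d''"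
       "words s2 ''cp'' 0 = j"
       by (simp_all add: R(2,3) fr)
      have s2: "str s2 (?Z (Suc j)) S D w g"
       and t2: "u2 + k * card (tuples n (?Z (Suc j)) S) \<le> k * (card (tuples n ?Z1 S) + card (Z (Suc 0) a b)) + 2"
       using R(1) by (simp_all add: Z1 keep_def[symmetric] k_def Z2)
      have "fam_size Z j = card (Z 0 a b) + card (Z (Suc 0) a b)" by (simp add: fam_size_def div)
      then have "t + 20 + u + u2 + k * card (tuples n (?Z (Suc j)) S) \<le> k * (card (tuples n Z S) + (\<Sum>i<Suc j. fam_size Z i)) + 40 * Suc j"
       using time t1 t2 by (simp add: algebra_simps)
      then show ?thesis using s2 by (simp add: fr2)
     qed
     done
   qed
   done
 next
  fix t s' assume "?I (n * n) t s'"
  then show "str s' (prune v vf ({..<n} \<times> {..<n}) Z) S D w g \<and>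
   t + 2 * (n * n) + 2 + k * card (tuples n (prune v vf ({..<n} \<times> {..<n}) Z) S) \<le>
    k * (card (tuples n Z S) + (\<Sum>j<n * n. fam_size Z j)) + 42 * (n * n) + 2"
   unfolding pairs_below_all by simp
 qed simp_all
qed

end

section \<open>Shortest walks in a positively weighted graph\<close>

text \<open>Walks are taken without distinctness, so that they can be split and joined freely. With
  positive weights the shortest ones have distinct vertices anyway, see
  \<open>SP_distinct\<close>.\<close>

fun walk :: "('a \<times> 'a) set \<Rightarrow> 'a \<Rightarrow> ('a \<times> 'a) list \<Rightarrow> 'a \<Rightarrow> bool" where
 "walk E x [] y \<longleftrightarrow> x = y"
| "walk E x (e # p) y \<longleftrightarrow> e \<in> E \<and> fst e = x \<and> walk E (snd e) p y"

definition cost :: "('a \<Rightarrow> real) \<Rightarrow> 'a list \<Rightarrow> real" where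
 "cost w p = sum_list (map w p)"

lemma cost_simps [simp]: "cost w [] = 0" "cost w (e # p) = w e + cost w p" "cost w (p @ q) = cost w p + cost w q"
 by (simp_all add: cost_def)

lemma walk_append: "walk E x (p @ q) y \<longleftrightarrow> (\<exists>z. walk E x p z \<and> walk E z q y)"
 by (induction p arbitrary: x) auto

lemma walk_append_mid: "walk E x p z \<Longrightarrow> walk E x (p @ q) y \<longleftrightarrow> walk E z q y"
 by (induction p arbitrary: x) auto

lemma walk_set: "walk E x p y \<Longrightarrow> set p \<subseteq> E"
 by (induction p arbitrary: x) auto

lemma walk_mono: "walk E x p y \<Longrightarrow> E \<subseteq> E' \<Longrightarrow> walk E' x p y"
 by (induction p arbitrary: x) auto

lemma walk_verts_iff:
 "walk E x p y \<Longrightarrow> z \<in> set (pawalk_verts x p) \<longleftrightarrow> (\<exists>q r. p = q @ r \<and> walk E x q z \<and> walk E z r y)"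
proof (induction p arbitrary: x)
 case Nil
 then show ?case by auto
next
 case (Cons e p)
 then have "z \<in> set (pawalk_verts x (e # p)) \<longleftrightarrow> z = x \<or> (\<exists>q r. p = q @ r \<and> walk E (snd e) q z \<and> walk E z r y)" by auto
 also have "\<dots> \<longleftrightarrow> (\<exists>q r. e # p = q @ r \<and> walk E x q z \<and> walk E z r y)"
 proof
  assume "z = x \<or> (\<exists>q r. p = q @ r \<and> walk E (snd e) q z \<and> walk E z r y)"
  then show "\<exists>q r. e # p = q @ r \<and> walk E x q z \<and> walk E z r y"
  proof
   assume "z = x"
   then show ?thesis using Cons.prems by (intro exI[of _ "[]"] exI[of _ "e # p"]) auto
  next
   assume "\<exists>q r. p = q @ r \<and> walk E (snd e) q z \<and> walk E z r y"
   then obtain q r where "p = q @ r" "walk E (snd e) q z" "walk E z r y" by blast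
   then show ?thesis using Cons.prems by (intro exI[of _ "e # q"] exI[of _ r]) auto
  qed
 next
  assume "\<exists>q r. e # p = q @ r \<and> walk E x q z \<and> walk E z r y"
  then obtain q r where qr: "e # p = q @ r" "walk E x q z" "walk E z r y" by blast
  then show "z = x \<or> (\<exists>q r. p = q @ r \<and> walk E (snd e) q z \<and> walk E z r y)"
   by (cases q) auto
 qed
 finally show ?case .
qed

lemma pair_wf_walk:
 assumes "pair_wf_digraph G"
 shows "pre_digraph.awalk (with_proj G) x p y \<longleftrightarrow> x \<in> pverts G \<and> walk (parcs G) x p y"
proof -
 interpret pair_wf_digraph G by fact
 show ?thesis
 proof (induction p arbitrary: x)
  case Nil
  then show ?case by (auto simp: awalk_Nil_iff)
 next
  case (Cons e p)
  have "e \<in> parcs G \<Longrightarrow> fst e \<in> pverts G \<and> snd e \<in> pverts G" using arc_fst_in_verts arc_snd_in_verts by blast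
  then show ?case by (auto simp: awalk_Cons_iff Cons.IH)
 qed
qed

locale wgraph =
 fixes E :: "(nat \<times> nat) set" and w :: "nat \<times> nat \<Rightarrow> real"
 assumes fin: "finite E" and pos: "\<And>e. e \<in> E \<Longrightarrow> 0 < w e"
begin

definition reach :: "nat \<Rightarrow> nat \<Rightarrow> bool" where "reach x y \<longleftrightarrow> (\<exists>p. walk E x p y)"
text \<open>A real-valued distance, to match the machine. It is meaningful for reachable pairs only,
  which is why \<open>reach\<close> accompanies it in the definitions below.\<close>

definition spd :: "nat \<Rightarrow> nat \<Rightarrow> real" where "spd x y = Inf (cost w ` {p. walk E x p y})"
definition SP :: "nat \<Rightarrow> nat \<Rightarrow> (nat \<times> nat) list set" where "SP x y = {p. walk E x p y \<and> cost w p = spd x y}"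
definition sg :: "nat \<Rightarrow> nat \<Rightarrow> nat" where "sg x y = card (SP x y)"
definition XE :: "nat \<Rightarrow> nat \<Rightarrow> nat set" where
 "XE a b = {x. (x, a) \<in> E \<and> reach a b \<and> w (x, a) + spd a b = spd x b}"
definition YE :: "nat \<Rightarrow> nat \<Rightarrow> nat set" where
 "YE a b = {y. (b, y) \<in> E \<and> reach a b \<and> spd a b + w (b, y) = spd a y}"
definition via :: "nat \<Rightarrow> nat \<Rightarrow> nat \<Rightarrow> bool" where
 "via a v b \<longleftrightarrow> reach a v \<and> reach v b \<and> spd a v + spd v b = spd a b"

lemma cost_nonneg: "set p \<subseteq> E \<Longrightarrow> 0 \<le> cost w p"
 by (induction p) (auto simp: add_nonneg_nonneg less_imp_le pos)

lemma cost_pos: "set p \<subseteq> E \<Longrightarrow> p \<noteq> [] \<Longrightarrow> 0 < cost w p"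
 by (cases p) (auto intro!: add_pos_nonneg pos cost_nonneg)

lemma reach_refl [simp]: "reach x x" unfolding reach_def by (rule exI[of _ "[]"]) simp

lemma reach_trans: "reach x y \<Longrightarrow> reach y z \<Longrightarrow> reach x z" unfolding reach_def by (metis walk_append)

lemma reach_edge: "(x, y) \<in> E \<Longrightarrow> reach x y" unfolding reach_def by (rule exI[of _ "[(x, y)]"]) simp

lemma spd_le: "walk E x p y \<Longrightarrow> spd x y \<le> cost w p"
 unfolding spd_def by (rule cInf_lower) (auto intro!: bdd_belowI[of _ 0] dest: walk_set cost_nonneg)

lemma shortest_walk_exists:
 assumes "reach x y" shows "\<exists>p. walk E x p y \<and> (\<forall>q. walk E x q y \<longrightarrow> cost w p \<le> cost w q)"
proof -
 \<comment> \<open>The start is added as a vertex because it may have no edge at all, and then the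
   empty walk still has to count.\<close>
 define G where "G = \<lparr>pverts = insert x (fst ` E \<union> snd ` E), parcs = E\<rparr>"
 interpret G: pair_fin_digraph G by standard (auto simp: G_def fin)
 have aw: "G.awalk x p y \<longleftrightarrow> walk E x p y" for p y
  using pair_wf_walk[OF G.pair_wf_digraph_axioms] by (auto simp: G_def)
 have cst: "G.awalk_cost w p = cost w p" for p by (simp add: G.awalk_cost_def cost_def)
 obtain q where "walk E x q y" using assms by (auto simp: reach_def)
 then have "x \<rightarrow>\<^sup>*\<^bsub>with_proj G\<^esub> y" using aw G.reachable_awalk by blast
 moreover have "\<And>e. e \<in> parcs G \<Longrightarrow> 0 \<le> w e" using pos by (auto simp: G_def less_imp_le)
 ultimately obtain p where p: "G.apath x p y" "G.\<mu> w x y = G.awalk_cost w p"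
  using G.min_cost_awalk[of x y w] by auto
 have "walk E x p y" using p(1) aw by (auto simp: G.apath_def)
 moreover have "cost w p \<le> cost w q" if "walk E x q y" for q
  using G.min_cost_le_walk_cost[of x q y w] that aw p(2) cst by auto
 ultimately show ?thesis by blast
qed

lemma SP_exists: assumes "reach x y" shows "\<exists>p. p \<in> SP x y"
proof -
 obtain p where p: "walk E x p y" "\<And>q. walk E x q y \<Longrightarrow> cost w p \<le> cost w q"
  using shortest_walk_exists[OF assms] by blast
 have "spd x y = cost w p" unfolding spd_def
  by (rule cInf_eq_minimum) (use p in auto)
 then show ?thesis using p by (auto simp: SP_def)
qed

lemma SP_reach: "p \<in> SP x y \<Longrightarrow> reach x y" by (auto simp: SP_def reach_def)

lemma SP_walk: "p \<in> SP x y \<Longrightarrow> walk E x p y" "p \<in> SP x y \<Longrightarrow> cost w p = spd x y" by (auto simp: SP_def)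

lemma spd_nonneg: "reach x y \<Longrightarrow> 0 \<le> spd x y"
 using SP_exists[of x y] SP_walk walk_set cost_nonneg by metis

lemma spd_refl [simp]: "spd x x = 0"
 using spd_le[of x "[]" x] spd_nonneg[of x x] by simp

lemma spd_triangle: "reach x y \<Longrightarrow> reach y z \<Longrightarrow> spd x z \<le> spd x y + spd y z"
proof -
 assume "reach x y" "reach y z"
 then obtain p q where "p \<in> SP x y" "q \<in> SP y z" using SP_exists by blast
 then show ?thesis using spd_le[of x "p @ q" z] by (auto simp: SP_def walk_append)
qed

lemma spd_edge: "(x, y) \<in> E \<Longrightarrow> spd x y \<le> w (x, y)"
 using spd_le[of x "[(x, y)]" y] by simp

text \<open>Neither part costs less than the distance between its ends, and the triangle inequality
  leaves no slack, so all these inequalities are equalities.\<close>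

lemma SP_split:
 assumes "p @ q \<in> SP x y" "walk E x p z"
 shows "p \<in> SP x z" "q \<in> SP z y" "via x z y"
proof -
 have q: "walk E z q y" using assms walk_append_mid by (fastforce simp: SP_def)
 have r: "reach x z" "reach z y" using assms(2) q by (auto simp: reach_def)
 have "cost w p + cost w q = spd x y" using assms by (simp add: SP_def)
 moreover have "spd x z \<le> cost w p" "spd z y \<le> cost w q" using spd_le assms(2) q by auto
 moreover have "spd x y \<le> spd x z + spd z y" using spd_triangle r by auto
 ultimately show "p \<in> SP x z" "q \<in> SP z y" "via x z y" using assms(2) q r by (auto simp: SP_def via_def)
qed

lemma SP_join: "p \<in> SP x z \<Longrightarrow> q \<in> SP z y \<Longrightarrow> spd x z + spd z y = spd x y \<Longrightarrow> p @ q \<in> SP x y"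
 by (auto simp: SP_def walk_append)

lemma SP_refl [simp]: "SP x x = {[]}"
proof -
 have "p = []" if "p \<in> SP x x" for p
 proof (rule ccontr)
  assume "p \<noteq> []"
  then have "0 < cost w p" by (intro cost_pos walk_set[OF SP_walk(1)[OF that]])
  then show False using SP_walk(2)[OF that] by simp
 qed
 then show ?thesis by (auto simp: SP_def)
qed

text \<open>If the start occurred again, the rest of the walk from there would be cheaper by at
  least the positive weight of the first edge.\<close>

lemma SP_distinct: "p \<in> SP x y \<Longrightarrow> distinct (pawalk_verts x p)"
proof (induction p arbitrary: x)
 case Nil then show ?case by simp
next
 case (Cons e p)
 have wk: "walk E x [e] (snd e)" using Cons.prems by (auto simp: SP_def)
 have p: "p \<in> SP (snd e) y" "[e] \<in> SP x (snd e)" using SP_split[of "[e]" p x y, OF _ wk] Cons.prems by auto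
 have "x \<notin> set (pawalk_verts (snd e) p)"
 proof
  assume "x \<in> set (pawalk_verts (snd e) p)"
  then obtain q r where qr: "p = q @ r" "walk E (snd e) q x" "walk E x r y"
   using walk_verts_iff[OF SP_walk(1)[OF p(1)], of x] by blast
  have "spd x y \<le> cost w r" by (rule spd_le[OF qr(3)])
  moreover have "w e + cost w p = spd x y" using SP_walk(2)[OF Cons.prems] by simp
  moreover have "0 < w e" using wk pos by simp
  moreover have "0 \<le> cost w q" by (rule cost_nonneg[OF walk_set[OF qr(2)]])
  ultimately show False using qr(1) by simp
 qed
 then show ?case using Cons.IH[OF p(1)] wk by simp
qed

text \<open>The least edge weight \<open>c\<close> is positive, so a shortest walk has at most
  \<open>spd x y / c\<close> edges.\<close>

lemma finite_SP: "finite (SP x y)"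
proof (cases "E = {}")
 case True
 have "p = []" if "p \<in> SP x y" for p using walk_set[OF SP_walk(1)[OF that]] True by simp
 then have "SP x y \<subseteq> {[]}" by blast
 then show ?thesis by (rule finite_subset) simp
next
 case False
 define c where "c = Min (w ` E)"
 have c: "0 < c" "\<And>e. e \<in> E \<Longrightarrow> c \<le> w e" using fin False pos by (auto simp: c_def)
 have len: "set p \<subseteq> E \<Longrightarrow> c * real (length p) \<le> cost w p" for p
  by (induction p) (auto simp: algebra_simps c(2) add_mono)
 have "SP x y \<subseteq> {p. set p \<subseteq> E \<and> length p \<le> nat \<lceil>spd x y / c\<rceil>}"
 proof
  fix p assume p: "p \<in> SP x y"
  then have s: "set p \<subseteq> E" by (intro walk_set[OF SP_walk(1)])
  have "real (length p) \<le> spd x y / c" using len[OF s] SP_walk(2)[OF p] c(1) by (simp add: field_simps)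
  then show "p \<in> {p. set p \<subseteq> E \<and> length p \<le> nat \<lceil>spd x y / c\<rceil>}" using s by simp linarith
 qed
 then show ?thesis by (rule finite_subset) (rule finite_lists_length_le[OF fin])
qed

lemma sg_refl [simp]: "sg x x = 1" by (simp add: sg_def)

lemma sg_pos: "reach x y \<Longrightarrow> 0 < sg x y"
 using SP_exists[of x y] finite_SP[of x y] by (auto simp: sg_def card_gt_0_iff)

lemma sg_unreach: "\<not> reach x y \<Longrightarrow> sg x y = 0"
proof -
 assume "\<not> reach x y"
 then have "SP x y = {}" using SP_reach by blast
 then show "sg x y = 0" by (simp add: sg_def)
qed

lemma XE_reach: "x \<in> XE a b \<Longrightarrow> reach x b"
 using reach_edge reach_trans unfolding XE_def by blast

lemma YE_reach: "y \<in> YE a b \<Longrightarrow> reach a y"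
 using reach_edge reach_trans unfolding YE_def by blast

lemma XE_SP: "x \<in> XE a b \<Longrightarrow> p \<in> SP a b \<Longrightarrow> (x, a) # p \<in> SP x b"
 by (auto simp: XE_def SP_def)

lemma YE_SP: "y \<in> YE a b \<Longrightarrow> p \<in> SP a b \<Longrightarrow> p @ [(b, y)] \<in> SP a y"
 by (auto simp: YE_def SP_def walk_append)

lemma SP_Cons: "e # p \<in> SP x y \<Longrightarrow> fst e = x \<and> x \<in> XE (snd e) y \<and> p \<in> SP (snd e) y"
proof -
 assume a: "e # p \<in> SP x y"
 then have wk: "walk E x [e] (snd e)" by (auto simp: SP_def)
 note s = SP_split[of "[e]" p x y, OF _ wk]
 have p: "p \<in> SP (snd e) y" using s(2) a by simp
 moreover have "w e + spd (snd e) y = spd x y" using SP_walk[OF a] SP_walk[OF p] by simp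
 ultimately show ?thesis using wk SP_reach by (auto simp: XE_def)
qed

lemma SP_snoc: "p @ [e] \<in> SP x y \<Longrightarrow> snd e = y \<and> y \<in> YE x (fst e) \<and> p \<in> SP x (fst e)"
proof -
 assume a: "p @ [e] \<in> SP x y"
 then have wk: "walk E x p (fst e)" "e \<in> E" "snd e = y" by (auto simp: SP_def walk_append)
 have p: "p \<in> SP x (fst e)" using SP_split(1)[OF a wk(1)] .
 moreover have "spd x (fst e) + w e = spd x y" using SP_walk[OF a] SP_walk[OF p] by simp
 ultimately show ?thesis using wk SP_reach by (auto simp: YE_def)
qed

lemma ex_YE: assumes "reach x y" "x \<noteq> y" shows "\<exists>b. y \<in> YE x b"
proof -
 obtain p where p: "p \<in> SP x y" using SP_exists assms by blast
 then have "p \<noteq> []" using assms by (auto simp: SP_def)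
 then obtain q e where "p = q @ [e]" by (cases p rule: rev_cases) auto
 then show ?thesis using SP_snoc p by blast
qed

text \<open>Take a shortest path from \<open>x\<close> to \<open>b\<close> and let \<open>a\<close>
  be its second vertex. Dropping the first edge of the extended path keeps it shortest, so the last
  edge extends the pair \<open>(a, b)\<close> as well. This turns a predecessor into a
  tuple.\<close>

lemma YE_middle:
 assumes "y \<in> YE x b" "b \<noteq> x" shows "\<exists>a. x \<in> XE a b \<and> y \<in> YE a b"
proof -
 obtain p where p: "p \<in> SP x b" using assms SP_exists by (auto simp: YE_def)
 then obtain e q where q: "p = e # q" using assms by (cases p) (auto simp: SP_def)
 have "e # (q @ [(b, y)]) \<in> SP x y" using YE_SP[OF assms(1) p] q by simp
 from SP_Cons[OF this] have "q @ [(b, y)] \<in> SP (snd e) y" by blast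
 from SP_snoc[OF this] SP_Cons[of e q x b] p q show ?thesis by auto
qed

lemma XE_middle:
 assumes "x \<in> XE a y" "a \<noteq> y" shows "\<exists>b. x \<in> XE a b \<and> y \<in> YE a b"
proof -
 obtain p where p: "p \<in> SP a y" using assms SP_exists by (auto simp: XE_def)
 then obtain q e where q: "p = q @ [e]" using assms by (cases p rule: rev_cases) (auto simp: SP_def)
 have "((x, a) # q) @ [e] \<in> SP x y" using XE_SP[OF assms(1) p] q by simp
 from SP_snoc[OF this] have "(x, a) # q \<in> SP x (fst e)" by blast
 from SP_Cons[OF this] SP_snoc[of q e a y] p q show ?thesis by auto
qed

lemma YE_less: "y \<in> YE x b \<Longrightarrow> spd x b < spd x y"
 using pos by (fastforce simp: YE_def)

lemma XE_less: "x \<in> XE a y \<Longrightarrow> spd a y < spd x y"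
 using pos by (fastforce simp: XE_def)

lemma finite_YE: "finite {b. y \<in> YE x b}" and finite_XE: "finite {a. x \<in> XE a y}"
proof -
 have "{b. y \<in> YE x b} \<subseteq> fst ` E" "{a. x \<in> XE a y} \<subseteq> snd ` E" by (force simp: YE_def XE_def)+
 then show "finite {b. y \<in> YE x b}" "finite {a. x \<in> XE a y}" using fin finite_subset by blast+
qed

lemma sg_last: assumes "x \<noteq> y" shows "sg x y = (\<Sum>b | y \<in> YE x b. sg x b)"
proof -
 have "SP x y = (\<Union>b\<in>{b. y \<in> YE x b}. (\<lambda>q. q @ [(b, y)]) ` SP x b)"
 proof (intro set_eqI iffI)
  fix p assume p: "p \<in> SP x y"
  then have "p \<noteq> []" using assms by (auto simp: SP_def)
  then obtain q e where q: "p = q @ [e]" by (cases p rule: rev_cases) auto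
  from SP_snoc[of q e x y] p q show "p \<in> (\<Union>b\<in>{b. y \<in> YE x b}. (\<lambda>q. q @ [(b, y)]) ` SP x b)"
   by (cases e) auto
 qed (use YE_SP in auto)
 moreover have "card (\<Union>b\<in>{b. y \<in> YE x b}. (\<lambda>q. q @ [(b, y)]) ` SP x b) =
   (\<Sum>b | y \<in> YE x b. card ((\<lambda>q. q @ [(b, y)]) ` SP x b))"
  by (rule card_UN_disjoint) (use finite_YE finite_SP in auto)
 ultimately show ?thesis by (simp add: sg_def card_image inj_on_def)
qed

lemma sg_first: assumes "x \<noteq> y" shows "sg x y = (\<Sum>a | x \<in> XE a y. sg a y)"
proof -
 have "SP x y = (\<Union>a\<in>{a. x \<in> XE a y}. (\<lambda>q. (x, a) # q) ` SP a y)"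
 proof (intro set_eqI iffI)
  fix p assume p: "p \<in> SP x y"
  then obtain e q where q: "p = e # q" using assms by (cases p) (auto simp: SP_def)
  from SP_Cons[of e q x y] p q show "p \<in> (\<Union>a\<in>{a. x \<in> XE a y}. (\<lambda>q. (x, a) # q) ` SP a y)"
   by (cases e) auto
 qed (use XE_SP in auto)
 moreover have "card (\<Union>a\<in>{a. x \<in> XE a y}. (\<lambda>q. (x, a) # q) ` SP a y) =
   (\<Sum>a | x \<in> XE a y. card ((\<lambda>q. (x, a) # q) ` SP a y))"
  by (rule card_UN_disjoint) (use finite_XE finite_SP in auto)
 ultimately show ?thesis by (simp add: sg_def card_image inj_on_def)
qed

lemma SP_via: "p \<in> SP x y \<Longrightarrow> v \<in> set (pawalk_verts x p) \<Longrightarrow> via x v y"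
proof -
 assume p: "p \<in> SP x y" "v \<in> set (pawalk_verts x p)"
 then obtain q r where "p = q @ r" "walk E x q v" using walk_verts_iff[OF SP_walk(1)[OF p(1)], of v] by blast
 then show "via x v y" using SP_split(3)[of q r x y v] p by blast
qed

text \<open>Concatenation at \<open>v\<close> is a bijection. The splitting point is unique: two
  prefixes of one path that both end at \<open>v\<close> have equal cost, and a nonempty difference
  between them would cost something.\<close>

lemma card_SP_via:
 "card {p \<in> SP x y. v \<in> set (pawalk_verts x p)} = (if via x v y then sg x v * sg v y else 0)"
proof (cases "via x v y")
 case True
 have "bij_betw (\<lambda>(q, r). q @ r) (SP x v \<times> SP v y) {p \<in> SP x y. v \<in> set (pawalk_verts x p)}"
 proof (rule bij_betw_imageI)
  have *: "us = []" if "walk E x q v" "walk E x (q @ us) v" "cost w (q @ us) = cost w q" for q us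
   using that walk_append_mid[of E x q v us v] cost_pos[of us] walk_set by fastforce
  show "inj_on (\<lambda>(q, r). q @ r) (SP x v \<times> SP v y)"
  proof (rule inj_onI, clarify)
   fix q r q' r' assume qr: "q \<in> SP x v" "r \<in> SP v y" "q' \<in> SP x v" "r' \<in> SP v y" "q @ r = q' @ r'"
   from qr(5) obtain us where "(q = q' @ us \<and> us @ r = r') \<or> (q @ us = q' \<and> r = us @ r')"
    by (auto simp: append_eq_append_conv2)
   then show "q = q' \<and> r = r'" using *[of q us] *[of q' us] qr by (auto simp: SP_def)
  qed
  show "(\<lambda>(q, r). q @ r) ` (SP x v \<times> SP v y) = {p \<in> SP x y. v \<in> set (pawalk_verts x p)}"
  proof (intro set_eqI iffI)
   fix p assume "p \<in> (\<lambda>(q, r). q @ r) ` (SP x v \<times> SP v y)"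
   then obtain q r where qr: "p = q @ r" "q \<in> SP x v" "r \<in> SP v y" by auto
   then have "p \<in> SP x y" using SP_join[of q x v r y] True qr by (auto simp: via_def)
   moreover have "v \<in> set (pawalk_verts x p)"
    using walk_verts_iff[OF SP_walk(1)[OF \<open>p \<in> SP x y\<close>], of v] qr SP_walk(1) by blast
   ultimately show "p \<in> {p \<in> SP x y. v \<in> set (pawalk_verts x p)}" by blast
  next
   fix p assume p: "p \<in> {p \<in> SP x y. v \<in> set (pawalk_verts x p)}"
   then obtain q r where qr: "p = q @ r" "walk E x q v" "walk E v r y"
    using walk_verts_iff[of E x p y v] SP_walk by auto
   then show "p \<in> (\<lambda>(q, r). q @ r) ` (SP x v \<times> SP v y)" using SP_split(1,2)[of q r x y v] p by auto
  qed
 qed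
 then show ?thesis using True by (simp add: sg_def card_cartesian_product flip: bij_betw_same_card)
next
 case False
 then have none: "{p \<in> SP x y. v \<in> set (pawalk_verts x p)} = {}" using SP_via by blast
 show ?thesis unfolding none using False by simp
qed

text \<open>Brandes' dependency of \<open>s\<close> on \<open>v\<close>: the fractions of shortest
  paths that pass through \<open>v\<close>, summed over the targets in \<open>U\<close>.\<close>

definition dep :: "nat set \<Rightarrow> nat \<Rightarrow> nat \<Rightarrow> real" where
 "dep U s v = (\<Sum>t\<in>U - {v}. if via s v t then real (sg s v * sg v t) / real (sg s t) else 0)"

text \<open>Both sides say that a shortest path to \<open>v\<close>, the edge \<open>(v, y)\<close>
  and a shortest path from \<open>y\<close> to \<open>t\<close> fit together without loss; in each
  direction two triangle inequalities are forced to be equalities.\<close>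

lemma via_step:
 assumes "t \<noteq> v"
 shows "via s v t \<and> v \<in> XE y t \<longleftrightarrow> y \<in> YE s v \<and> via s y t"
proof
 assume a: "via s v t \<and> v \<in> XE y t"
 then have r: "reach s v" "(v, y) \<in> E" "reach y t" "spd s v + spd v t = spd s t" "w (v, y) + spd y t = spd v t"
  by (auto simp: via_def XE_def)
 have sy: "reach s y" using r reach_edge reach_trans by blast
 have "spd s t \<le> spd s y + spd y t" using spd_triangle sy r by auto
 moreover have "spd s y \<le> spd s v + w (v, y)"
  using spd_triangle[of s v y] spd_edge[OF r(2)] reach_edge[OF r(2)] r(1) by linarith
 ultimately show "y \<in> YE s v \<and> via s y t" using r sy by (auto simp: YE_def via_def)
next
 assume a: "y \<in> YE s v \<and> via s y t"
 then have r: "reach s v" "(v, y) \<in> E" "reach y t" "spd s v + w (v, y) = spd s y" "spd s y + spd y t = spd s t"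
  by (auto simp: via_def YE_def)
 have vt: "reach v t" using r reach_edge reach_trans by blast
 have "spd s t \<le> spd s v + spd v t" using spd_triangle vt r by auto
 moreover have "spd v t \<le> w (v, y) + spd y t"
  using spd_triangle[of v y t] spd_edge[OF r(2)] reach_edge[OF r(2)] r(3) by linarith
 ultimately show "via s v t \<and> v \<in> XE y t" using r vt by (auto simp: XE_def via_def)
qed

lemma via_not_back: "y \<in> YE s v \<Longrightarrow> \<not> via s y v"
 using YE_less spd_nonneg by (fastforce simp: via_def)

text \<open>Brandes' recursion. A shortest path from \<open>s\<close> through \<open>v\<close> to
  another target leaves \<open>v\<close> towards some \<open>y\<close> in \<open>YE s v\<close>.
  Sorting by \<open>y\<close> and exchanging the sums gives the formula, the target \<open>y\<close>
  itself being the summand 1.\<close>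

lemma dep_rec:
 assumes U: "finite U" "fst ` E \<union> snd ` E \<subseteq> U"
 shows "dep U s v = (\<Sum>y\<in>YE s v. real (sg s v) / real (sg s y) * (1 + dep U s y))"
proof -
 have finY: "finite (YE s v)"
 proof (rule finite_subset)
  show "YE s v \<subseteq> snd ` E" by (force simp: YE_def)
 qed (use fin in simp)
 have YU: "YE s v \<subseteq> U" using U by (force simp: YE_def)
 have 1: "(if via s v t then real (sg s v * sg v t) / real (sg s t) else 0) =
   (\<Sum>y\<in>YE s v. if via s y t then real (sg s v) * real (sg y t) / real (sg s t) else 0)" if t: "t \<in> U - {v}" for t
 proof (cases "via s v t")
  case True
  have tv: "t \<noteq> v" using t by auto
  have "{y. v \<in> XE y t} = {y \<in> YE s v. via s y t}" using via_step[OF tv, of s] True by auto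
  then have "sg v t = (\<Sum>y\<in>{y \<in> YE s v. via s y t}. sg y t)" using sg_first[of v t] tv by simp
  then have "real (sg s v * sg v t) / real (sg s t) = (\<Sum>y\<in>{y \<in> YE s v. via s y t}. real (sg s v) * real (sg y t) / real (sg s t))"
   by (simp add: sum_distrib_left sum_divide_distrib)
  also have "\<dots> = (\<Sum>y\<in>YE s v. if via s y t then real (sg s v) * real (sg y t) / real (sg s t) else 0)"
   using finY by (simp add: sum.inter_filter)
  finally show ?thesis using True by simp
 next
  case False
  then have "\<not> via s y t" if "y \<in> YE s v" for y using via_step[of t v s y] t that by auto
  then show ?thesis using False by simp
 qed
 have 2: "(\<Sum>t\<in>U - {v}. if via s y t then real (sg s v) * real (sg y t) / real (sg s t) else 0) =
   real (sg s v) / real (sg s y) * (1 + dep U s y)" if y: "y \<in> YE s v" for y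
 proof -
  have sy: "reach s y" using YE_reach y by blast
  have vy: "via s y y" using sy by (simp add: via_def)
  \<comment> \<open>The target \<open>v\<close> may be added: it contributes nothing, because no
    shortest path from \<open>s\<close> to \<open>v\<close> passes through the farther vertex
    \<open>y\<close>.\<close>
  have "(\<Sum>t\<in>U - {v}. if via s y t then real (sg s v) * real (sg y t) / real (sg s t) else 0) =
    (\<Sum>t\<in>U. if via s y t then real (sg s v) * real (sg y t) / real (sg s t) else 0)"
   by (rule sum.mono_neutral_left) (use U via_not_back[OF y] in auto)
  also have "\<dots> = real (sg s v) / real (sg s y) + (\<Sum>t\<in>U - {y}. if via s y t then real (sg s v) * real (sg y t) / real (sg s t) else 0)"
   using y YU U vy by (subst sum.remove[of U y]) auto
  also have "(\<Sum>t\<in>U - {y}. if via s y t then real (sg s v) * real (sg y t) / real (sg s t) else 0) = real (sg s v) / real (sg s y) * dep U s y"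
   unfolding dep_def sum_distrib_left using sg_pos[OF sy] by (intro sum.cong) auto
  finally show ?thesis by (simp add: algebra_simps add_divide_distrib)
 qed
 have "dep U s v = (\<Sum>t\<in>U - {v}. \<Sum>y\<in>YE s v. if via s y t then real (sg s v) * real (sg y t) / real (sg s t) else 0)"
  unfolding dep_def by (rule sum.cong) (use 1 in auto)
 also have "\<dots> = (\<Sum>y\<in>YE s v. \<Sum>t\<in>U - {v}. if via s y t then real (sg s v) * real (sg y t) / real (sg s t) else 0)"
  by (rule sum.swap)
 also have "\<dots> = (\<Sum>y\<in>YE s v. real (sg s v) / real (sg s y) * (1 + dep U s y))"
  by (rule sum.cong) (use 2 in auto)
 finally show ?thesis .
qed

end

section \<open>Creating new tuples\<close>

definition gkey :: "tup set \<Rightarrow> (nat \<Rightarrow> nat \<Rightarrow> real) \<Rightarrow> (nat \<times> nat \<Rightarrow> real) \<Rightarrow> nat \<Rightarrow> nat \<Rightarrow> real" where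
 "gkey T D w x y = Min (KL D w x y ` PL T x y)"

context ram begin

text \<open>The global tree has one leaf per pair, whose key is that of the root of the pair's own
  tree of last edges. A settled pair must not enter again, hence the test of
  \<open>rc\<close>.\<close>

definition gput :: com where
 "gput =
   (''gp'' ::= ix2 (WGet ''q'' (C 0)) (WGet ''q'' (C 1)) ;;
   ''gj'' ::= WGet ''tl'' (WAdd (WMul (V ''gp'') (WMul (C 2) (V ''n''))) (C 1)) ;;
   Cond (TAnd (WEq (WGet ''rc'' (V ''gp'')) (C 0)) (TNot (WEq (V ''gj'') (C 0))))
    (''rk'' ::=r RGet ''kl'' (WAdd (WMul (V ''gp'') (V ''n'')) (WSub (V ''gj'') (C 1))) ;;
    ''ts'' ::= WMul (V ''n'') (V ''n'') ;; ''tb'' ::= C 0 ;; ''tk'' ::= C 0 ;; ''tj'' ::= V ''gp'' ;;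
    tree_insert ''tg'' ''kg'')
    Skip)"

lemma writes_gput [simp]:
 "word_writes gput = {''gp'', ''gj'', ''ts'', ''tb'', ''tk'', ''tj'', ''tg'', ''ti'', ''tu'', ''tv''}" "real_writes gput = {''rk'', ''kg''}"
 by (auto simp: gput_def)

definition gpres :: "state \<Rightarrow> tup set \<Rightarrow> nat set" where
 "gpres s T = {p. p < n * n \<and> words s ''rc'' p = 0 \<and> PL T (p div n) (p mod n) \<noteq> {}}"

definition gok :: "state \<Rightarrow> tup set \<Rightarrow> (nat \<Rightarrow> nat \<Rightarrow> real) \<Rightarrow> (nat \<times> nat \<Rightarrow> real) \<Rightarrow> bool" where
 "gok s T D w \<longleftrightarrow> tree (words s ''tg'') (reals s ''kg'') (n * n) 0 0 (gpres s T) (\<lambda>p. gkey T D w (p div n) (p mod n))"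

lemma gok_cong:
 "words s' ''tg'' = words s ''tg'' \<Longrightarrow> reals s' ''kg'' = reals s ''kg'' \<Longrightarrow> words s' ''rc'' = words s ''rc'' \<Longrightarrow>
   gok s' T D w = gok s T D w"
 by (simp add: gok_def gpres_def)

lemma gok_upd [simp]:
 "x \<noteq> ''tg'' \<Longrightarrow> x \<noteq> ''rc'' \<Longrightarrow> gok (wupd s x i v) T D w = gok s T D w"
 "x \<noteq> ''kg'' \<Longrightarrow> gok (rupd s x i r) T D w = gok s T D w"
 by (rule gok_cong; simp)+

lemma two_nn_le: "2 * (n * n) \<le> 2 ^ h"
proof -
 have "2 * (n * n) \<le> 4 * (n + 1) * (n + 1)" by (simp add: algebra_simps)
 then show ?thesis using h by (rule le_trans)
qed

lemma finite_PL: "T \<subseteq> quads n \<Longrightarrow> finite (PL T x y)"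
proof -
 assume "T \<subseteq> quads n"
 then have "PL T x y \<subseteq> {..<n}" by (auto simp: PL_def quads_def)
 then show ?thesis by (rule finite_subset) simp
qed

lemma gput_wp:
 assumes S: "store s T D w g" and nn: "words s ''n'' 0 = n" and x: "x < n" "y < n"
  and q: "words s ''q'' 0 = x" "words s ''q'' (Suc 0) = y" and rc: "words s ''rc'' (x * n + y) < W"
  and G: "tree (words s ''tg'') (reals s ''kg'') (n * n) 0 0 P key"
 shows "wp W gput (\<lambda>t s'. t \<le> 6 * h + 14 \<and>
   tree (words s' ''tg'') (reals s' ''kg'') (n * n) 0 0
    (if words s ''rc'' (x * n + y) = 0 \<and> PL T x y \<noteq> {} then insert (x * n + y) P else P)
    (if words s ''rc'' (x * n + y) = 0 \<and> PL T x y \<noteq> {} then key(x * n + y := gkey T D w x y) else key)) s"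
proof -
 define p where "p = x * n + y"
 have p: "p < n * n" unfolding p_def by (rule digit_less) (use x in auto)
 have tr: "tree (words s ''tl'') (reals s ''kl'') n (p * (2 * n)) (p * n) (PL T x y) (KL D w x y)"
  using storeD(3)[OF S] x by (auto simp: trees_def p_def)
 define j where "j = words s ''tl'' (p * (2 * n) + 1)"
 have n: "0 < n" using x by simp
 have j: "j \<le> n" unfolding j_def using tree_entry_le[OF tr, of 1] n by simp
 have j0: "j = 0 \<longleftrightarrow> PL T x y = {}" unfolding j_def using tree_root_None[OF tr n] by simp
 have key: "reals s ''kl'' (p * n + (j - Suc 0)) = gkey T D w x y" if "j \<noteq> 0"
 proof -
  note r = tree_root_Some[OF tr n that[unfolded j_def], folded j_def]
  show ?thesis unfolding gkey_def using r finite_PL[OF storeD(5)[OF S]]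
   by (intro Min_eqI[symmetric]) auto
 qed
 have WS: "Suc (p * (2 * n)) < W" using mult_W(7)[OF p] by linarith
 have WW: "x * n < W" "p < W" "p * (2 * n) < W" "p * n < W" "j < W" "j - Suc 0 < W" "p * n + (j - Suc 0) < W" "x < W" "y < W"
  "2 * (n * n) < W"
  using p x j mult_W(7,8)[OF p] W_big W_const(6) by (auto simp: bnd simp del: add_diff_assoc)
 have rd: "words s ''tl'' (Suc (p * (2 * n))) = j" by (simp add: j_def)
 show ?thesis
 proof (cases "words s ''rc'' p = 0 \<and> j \<noteq> 0")
  case True
  then have T2: "words s ''rc'' p = 0 \<and> PL T x y \<noteq> {}" using j0 by auto
  show ?thesis
   unfolding gput_def p_def[symmetric] if_P[OF T2]
   apply (simp add: wp_simps nn q WW WS rc[folded p_def] rd True flip: p_def)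
   apply (rule wp_conseq, rule tree_insert_wp[where b = 0 and k = 0 and sz = "n * n" and h = h and l = p and r = "gkey T D w x y" and P = P and key = key])
   apply simp_all[6]
   subgoal using key True by simp
   subgoal by (rule p)
   subgoal by (rule two_nn_le)
   subgoal using W_big by simp
   subgoal using W_big by simp
   subgoal using G by simp
   subgoal premises Q for t s'
   proof -
    have "t \<le> 6 * h + 4" "tree (words s' ''tg'') (reals s' ''kg'') (n * n) 0 0 (insert p P) (key(p := gkey T D w x y))"
     using Q(1) by blast+
    then show ?thesis by simp
   qed
   done
 next
  case False
  then have F: "\<not> (words s ''rc'' p = 0 \<and> 0 < j)" by simp
  then have F2: "\<not> (words s ''rc'' p = 0 \<and> PL T x y \<noteq> {})" using j0 by auto
  show ?thesis
   unfolding gput_def p_def[symmetric] if_not_P[OF F2]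
   using G by (simp add: wp_simps nn q WW WS rc[folded p_def] rd F flip: p_def)
 qed
qed

definition add_elem :: com where
 "add_elem = Cond (WEq (WGet ''q'' (C 0)) (WGet ''q'' (C 1))) Skip
   (''qw'' ::=r RAdd (RAdd (RGet ''w'' (ix2 (WGet ''q'' (C 0)) (V ''qa''))) (RGet ''d'' (ix2 (V ''qa'') (V ''qb''))))
     (RGet ''w'' (ix2 (V ''qb'') (WGet ''q'' (C 1)))) ;;
   ''qc'' ::=r RGet ''sg'' (ix2 (V ''qa'') (V ''qb'')) ;;
   add ;; gput)"

lemma writes_add_elem [simp]:
 "word_writes add_elem = word_writes add \<union> word_writes gput" "real_writes add_elem = {''qw'', ''qc''} \<union> real_writes add \<union> real_writes gput"
 by (auto simp: add_elem_def)

lemma gok_insert: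
 assumes G: "gok s T D w" and T: "T \<subseteq> quads n" and x: "x < n" "y < n" "a < n" "b < n"
  and tr: "tree A K (n * n) 0 0 (if words s ''rc'' (x * n + y) = 0 \<and> PL (insert (x, a, b, y) T) x y \<noteq> {} then insert (x * n + y) (gpres s T) else gpres s T)
    (if words s ''rc'' (x * n + y) = 0 \<and> PL (insert (x, a, b, y) T) x y \<noteq> {}
    then (\<lambda>p. gkey T D w (p div n) (p mod n))(x * n + y := gkey (insert (x, a, b, y) T) D w x y)
    else (\<lambda>p. gkey T D w (p div n) (p mod n)))"
  and s': "words s' ''tg'' = A" "reals s' ''kg'' = K" "words s' ''rc'' = words s ''rc''"
 shows "gok s' (insert (x, a, b, y) T) D w"
proof -
 let ?T = "insert (x, a, b, y) T"
 let ?p = "x * n + y"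
 have n: "0 < n" and p: "?p < n * n" "?p div n = x" "?p mod n = y" using x digit_less[of x n y n] by auto
 have eq: "p = ?p" if "p div n = x" "p mod n = y" for p using that by (metis div_mult_mod_eq)
 have ne: "PL ?T x y \<noteq> {}" by (auto simp: PL_insert)
 have PL': "PL ?T (q div n) (q mod n) = PL T (q div n) (q mod n)" if "q \<noteq> ?p" for q
  using eq[of q] that by (auto simp: PL_insert)
 have pres: "gpres s' ?T = (if words s ''rc'' ?p = 0 then insert ?p (gpres s T) else gpres s T)"
 proof (intro set_eqI)
  fix q
  show "q \<in> gpres s' ?T \<longleftrightarrow> q \<in> (if words s ''rc'' ?p = 0 then insert ?p (gpres s T) else gpres s T)"
   using PL'[of q] ne p by (cases "q = ?p") (auto simp: gpres_def s')
 qed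
 show ?thesis
  unfolding gok_def s' pres
 proof (rule tree_cong)
  show "tree A K (n * n) 0 0 (if words s ''rc'' ?p = 0 then insert ?p (gpres s T) else gpres s T)
    (if words s ''rc'' ?p = 0 then (\<lambda>p. gkey T D w (p div n) (p mod n))(?p := gkey ?T D w x y) else (\<lambda>p. gkey T D w (p div n) (p mod n)))"
   using tr ne by simp
 next
  fix i assume i: "i \<in> (if words s ''rc'' ?p = 0 then insert ?p (gpres s T) else gpres s T)"
  show "gkey ?T D w (i div n) (i mod n) = (if words s ''rc'' ?p = 0 then (\<lambda>p. gkey T D w (p div n) (p mod n))(?p := gkey ?T D w x y)
    else (\<lambda>p. gkey T D w (p div n) (p mod n))) i"
  proof (cases "i = ?p")
   case True
   then show ?thesis using i p by (auto simp: gpres_def split: if_splits)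
  next
   case False
   then show ?thesis by (simp add: gkey_def PL')
  qed
 qed simp_all
qed

end

section \<open>Inserting tuples for a fixed graph\<close>

locale alg = ram n h W + wgraph E w for n h W :: nat and E :: "(nat \<times> nat) set" and w :: "nat \<times> nat \<Rightarrow> real" +
 assumes E_n: "E \<subseteq> {..<n} \<times> {..<n}"
begin

abbreviation rsg :: "nat \<Rightarrow> nat \<Rightarrow> real" where "rsg a b \<equiv> real (sg a b)"

definition warr :: "state \<Rightarrow> bool" where
 "warr s \<longleftrightarrow> (\<forall>x y. (x, y) \<in> E \<longrightarrow> reals s ''w'' (x * n + y) = w (x, y))"

definition sound :: "fam \<Rightarrow> bool" where
 "sound Z \<longleftrightarrow> (\<forall>a b. Z 0 a b \<subseteq> XE a b \<and> Z (Suc 0) a b \<subseteq> YE a b)"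

lemma XE_n: "x \<in> XE a b \<Longrightarrow> x < n \<and> a < n" and YE_n: "y \<in> YE a b \<Longrightarrow> y < n \<and> b < n"
 using E_n by (auto simp: XE_def YE_def)

text \<open>Such an extension would be a closed walk of positive cost between vertices at distance
  zero. This is what gives sound families the property \<open>fam_ok\<close>.\<close>

lemma XE_not_refl: "b \<notin> XE a b" and YE_not_refl: "a \<notin> YE a b"
 using XE_less[of b a b] YE_less[of a a b] spd_nonneg[of a b] by (auto simp: XE_def YE_def)

lemma add_elem_wp:
 assumes S: "store s T spd w rsg" and G: "gok s T spd w" and nn: "words s ''n'' 0 = n" and wa: "warr s"
  and x: "a < n" "b < n" "x \<in> XE a b" "y \<in> YE a b" and new: "x \<noteq> y \<Longrightarrow> (x, a, b, y) \<notin> T"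
  and q: "words s ''q'' 0 = x" "words s ''qa'' 0 = a" "words s ''qb'' 0 = b" "words s ''q'' (Suc 0) = y"
  and d: "reals s ''d'' (a * n + b) = spd a b" "reals s ''sg'' (a * n + b) = rsg a b" and rc: "words s ''rc'' (x * n + y) < W"
 shows "wp W add_elem (\<lambda>t s'. t \<le> 18 * h + 48 \<and> store s' (if x = y then T else insert (x, a, b, y) T) spd w rsg \<and>
   gok s' (if x = y then T else insert (x, a, b, y) T) spd w) s"
proof -
 have xy: "x < n" "y < n" using x XE_n YE_n by auto
 have WW: "x < W" "y < W" "a < W" "b < W" "x * n < W" "x * n + a < W" "a * n < W" "a * n + b < W" "b * n < W" "b * n + y < W"
  using x xy by (auto simp: bnd)
 show ?thesis
 proof (cases "x = y")
  case True
  then show ?thesis unfolding add_elem_def using S G by (simp add: wp_simps q WW)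
 next
  case False
  have wv: "reals s ''w'' (x * n + a) = w (x, a)" "reals s ''w'' (b * n + y) = w (b, y)"
   using wa x by (auto simp: warr_def XE_def YE_def)
  have eq: "w (x, a) + spd a b = spd x b" "spd a b + w (b, y) = spd a y" using x by (auto simp: XE_def YE_def)
  have nr: "\<not> (a = y \<and> b = x)" using x XE_not_refl by auto
  let ?T = "insert (x, a, b, y) T"
  show ?thesis
   unfolding add_elem_def if_not_P[OF False]
   apply (simp add: wp_simps q WW wv d False nn)
   apply (rule wp_conseq, rule add_wp[where T = T and D = spd and w = w and g = rsg and x = x and a = a and b = b and y = y])
   subgoal using S by simp
   apply ((simp add: nn))
   subgoal using new False by simp
   subgoal by (rule xy)
   subgoal by (rule x)
   subgoal by (rule x)
   subgoal by (rule xy)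
   apply (simp_all add: q)[4]
   subgoal using eq by simp
   subgoal using eq by simp
   subgoal using nr by (auto simp: tct_def)
   subgoal premises P for t1 s1
   proof -
    have fr: "words s1 ''n'' 0 = n" "words s1 ''q'' 0 = x" "words s1 ''q'' (Suc 0) = y" "words s1 ''rc'' = words s ''rc''"
     "words s1 ''tg'' = words s ''tg''" "reals s1 ''kg'' = reals s ''kg''"
     by (simp_all add: P(2,3) nn q)
    show ?thesis
     apply (rule wp_conseq, rule gput_wp[where T = ?T and D = spd and w = w and g = rsg and x = x and y = y and P = "gpres s T"
       and key = "\<lambda>p. gkey T spd w (p div n) (p mod n)"])
     subgoal using P(1) by simp
     apply ((simp add: fr))
     subgoal by (rule xy)
     subgoal by (rule xy)
     apply (simp_all add: fr)[2]
     subgoal using rc by (simp add: fr)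
     subgoal using G by (simp add: fr gok_def)
     subgoal premises R for t2 s2
     proof -
      have "store s2 ?T spd w rsg = store s1 ?T spd w rsg" by (rule store_cong) (auto simp: R(2,3))
      moreover have "gok s2 ?T spd w"
       by (rule gok_insert[OF G storeD(5)[OF S] xy x(1,2) conjunct2[OF R(1), unfolded fr]]) (simp_all add: R(2) fr)
      ultimately show ?thesis using P(1) R(1) by simp
     qed
     done
   qed
   done
 qed
qed

definition add_row :: com where
 "add_row = For ''li'' (WGet ''fc'' (V ''ro''))
   (WSet ''q'' (WSub (C 1) (V ''sd'')) (WGet ''fl'' (ix2 (V ''ro'') (V ''li''))) ;; add_elem)"

lemma writes_add_row [simp]:
 "word_writes add_row = {''li'', ''q''} \<union> word_writes add_elem" "real_writes add_row = real_writes add_elem"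
 by (auto simp: add_row_def)

lemma add_row_wp:
 assumes S: "store s T spd w rsg" and G: "gok s T spd w" and nn: "words s ''n'' 0 = n" and wa: "warr s"
  and F: "fam n ff (words s ''fl'') (words s ''fc'') Z" and i: "sd < 2" "a < n" "b < n"
  and r: "words s ''ro'' 0 = ix3 n (1 - sd) a b"
  and q: "words s ''q'' sd = e" "words s ''qa'' 0 = a" "words s ''qb'' 0 = b" "words s ''sd'' 0 = sd"
  and e: "if sd = 0 then e \<in> XE a b else e \<in> YE a b" and Z: "sound Z"
  and new: "row sd e a b (Z (1 - sd) a b) \<inter> T = {}"
  and d: "reals s ''d'' (a * n + b) = spd a b" "reals s ''sg'' (a * n + b) = rsg a b" and rc: "\<And>p. p < n * n \<Longrightarrow> words s ''rc'' p < W"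
 shows "wp W add_row (\<lambda>t s'. t \<le> (18 * h + 52) * card (Z (1 - sd) a b) + 2 \<and>
   store s' (T \<union> row sd e a b (Z (1 - sd) a b)) spd w rsg \<and> gok s' (T \<union> row sd e a b (Z (1 - sd) a b)) spd w) s"
proof -
 have sd': "1 - sd < 2" by simp
 have sdn: "sd \<noteq> Suc 0 - sd" "Suc 0 - sd \<noteq> sd" by presburger+
 note FD = famD[OF F sd' i(2,3)]
 define r where "r = ix3 n (1 - sd) a b"
 define m where "m = card (Z (1 - sd) a b)"
 have rr: "r < 2 * n * n" unfolding r_def by (rule ix3_less) (use i in auto)
 have m: "m \<le> n" "m < W" using FD(7) in_W_fam(3)[OF rr, of n] W_const(6) unfolding m_def by linarith+
 have fcr: "words s ''fc'' r = m" using FD(6) by (simp add: r_def m_def)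
 define zs where "zs = seg n (words s ''fl'') r m"
 have zs: "set zs = Z (1 - sd) a b" "distinct zs" "length zs = m" using FD(4,5,6) by (simp_all add: zs_def r_def m_def)
 have en: "e < n" using e XE_n YE_n by (auto split: if_splits)
 let ?T = "\<lambda>j. T \<union> row sd e a b (set (take j zs))"
 let ?I = "\<lambda>j t s'. store s' (?T j) spd w rsg \<and> gok s' (?T j) spd w \<and> t \<le> (18 * h + 50) * j \<and>
   words s' ''q'' sd = e \<and> words s' ''n'' 0 = n \<and> words s' ''ro'' 0 = r \<and> words s' ''qa'' 0 = a \<and> words s' ''qb'' 0 = b \<and>
   words s' ''sd'' 0 = sd \<and> words s' ''fl'' = words s ''fl'' \<and> words s' ''fc'' = words s ''fc'' \<and> warr s' \<and>
   reals s' ''d'' = reals s ''d'' \<and> reals s' ''sg'' = reals s ''sg'' \<and> words s' ''rc'' = words s ''rc''"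
 show ?thesis
  unfolding add_row_def
 proof (rule wp_For[where m = m and I = ?I])
  show "?I 0 0 (wupd s ''li'' 0 0)" using S G nn r q wa by (simp add: row_def r_def warr_def)
 next
  fix j t s' assume "?I j t s'" "words s' ''li'' 0 = j" "j \<le> m"
  then show "wfits W s' (WGet ''fc'' (V ''ro'')) \<and> wval s' (WGet ''fc'' (V ''ro'')) = m"
   using m fcr in_W_fam(1)[OF rr] by simp
 next
  fix j t s' assume I: "?I j t s'" and j: "words s' ''li'' 0 = j" "j < m"
  have I': "store s' (?T j) spd w rsg" "gok s' (?T j) spd w" "t \<le> (18 * h + 50) * j" "warr s'"
   and st: "words s' ''q'' sd = e" "words s' ''n'' 0 = n" "words s' ''ro'' 0 = r" "words s' ''qa'' 0 = a" "words s' ''qb'' 0 = b"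
   "words s' ''sd'' 0 = sd" "words s' ''fl'' = words s ''fl''" "words s' ''fc'' = words s ''fc''"
   "reals s' ''d'' = reals s ''d''" "reals s' ''sg'' = reals s ''sg''" "words s' ''rc'' = words s ''rc''"
   using I by blast+
  define z where "z = zs ! j"
  have z: "words s ''fl'' (r * n + j) = z" using j by (simp add: z_def zs_def)
  have zin: "z \<in> Z (1 - sd) a b" unfolding z_def zs(1)[symmetric] by (rule nth_mem) (use j(2) zs(3) in simp)
  then have zn: "z < n" using FD(1) by auto
  have tk: "set (take (Suc j) zs) = insert z (set (take j zs))" using j(2) zs(3) by (simp add: z_def take_Suc_conv_app_nth)
  have "z \<notin> set (take j zs)" using zs(2,3) j(2) by (auto simp: z_def in_set_conv_nth nth_eq_iff_index_eq)
  then have mem: "z \<noteq> e \<Longrightarrow> tp sd e a b z \<notin> ?T j"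
   using new zin by (auto simp: row_def)
  have rw: "?T (Suc j) = (if z = e then ?T j else insert (tp sd e a b z) (?T j))"
   unfolding tk by (auto simp: row_def)
  have zs2: "if sd = 0 then z \<in> YE a b else z \<in> XE a b"
  proof -
   have "Z 0 a b \<subseteq> XE a b" "Z (Suc 0) a b \<subseteq> YE a b" using Z unfolding sound_def by blast+
   then show ?thesis using zin i(1) by (auto simp: less_2_cases_iff)
  qed
  have eq1: "((if sd = 0 then e else z) = (if sd = 0 then z else e)) = (z = e)"
   and eq2: "((if sd = 0 then e else z), a, b, (if sd = 0 then z else e)) = tp sd e a b z"
   by (auto simp: tp_def)
  have WW: "r * n < W" "r * n + j < W" "r < W" "j < W" "z < W" "sd < W" "Suc 0 - sd < W"
   using in_W_fam[OF rr] j m zn i W_big by auto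
  show "wp W (WSet ''q'' (WSub (C 1) (V ''sd'')) (WGet ''fl'' (ix2 (V ''ro'') (V ''li''))) ;; add_elem)
    (\<lambda>u s''. words s'' ''li'' 0 = j \<and> ?I (Suc j) (t + u) (wupd s'' ''li'' 0 (Suc j))) s'"
   apply (simp add: wp_simps st j WW z)
   apply (rule wp_conseq, rule add_elem_wp[where T = "?T j" and a = a and b = b
      and x = "if sd = 0 then e else z" and y = "if sd = 0 then z else e"])
   subgoal using I' by simp
   subgoal using I' by simp
   apply ((simp add: st))
   subgoal using I' by (simp add: warr_def)
   subgoal by (rule i)
   subgoal by (rule i)
   subgoal using e zs2 by (auto split: if_splits)
   subgoal using e zs2 by (auto split: if_splits)
   subgoal using mem eq1 by (simp only: eq2) simp
   subgoal using st(1) sdn i by (auto simp: less_Suc_eq numeral_2_eq_2)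
   apply (simp_all add: st)[2]
   subgoal using st(1) sdn i by (auto simp: less_Suc_eq numeral_2_eq_2)
   subgoal using d by (simp add: st)
   subgoal using d by (simp add: st)
   subgoal using en zn by (auto simp: st intro!: rc digit_less)
   subgoal premises P for u s''
   proof -
    have time: "Suc (t + u) \<le> (18 * h + 50) * Suc j" using P(1) I'(3) by (simp add: algebra_simps)
    have "store s'' (?T (Suc j)) spd w rsg" "gok s'' (?T (Suc j)) spd w"
     using P(1) unfolding rw eq1 eq2 by blast+
    moreover have "warr s''" using I'(4) by (simp add: P(3) warr_def)
    ultimately show ?thesis using time by (simp add: P(2,3) st j sdn warr_def)
   qed
   done
 next
  fix t s' assume I: "?I m t s'" "words s' ''li'' 0 = m"
  then show "t + 2 * m + 2 \<le> (18 * h + 52) * card (Z (1 - sd) a b) + 2 \<and>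
   store s' (T \<union> row sd e a b (Z (1 - sd) a b)) spd w rsg \<and> gok s' (T \<union> row sd e a b (Z (1 - sd) a b)) spd w"
   using zs by (simp add: m_def algebra_simps)
 qed (use m in auto)
qed

definition new_elem :: com where
 "new_elem = (load_rows ;;
   Cond (WEq (WGet ''ff'' (ix2 (V ''rr'') (WGet ''q'' (V ''sd'')))) (C 0))
   (WSet ''ff'' (ix2 (V ''rr'') (WGet ''q'' (V ''sd''))) (C 1) ;;
   WSet ''fl'' (ix2 (V ''rr'') (WGet ''fc'' (V ''rr''))) (WGet ''q'' (V ''sd'')) ;;
   WSet ''fc'' (V ''rr'') (WAdd (WGet ''fc'' (V ''rr'')) (C 1)) ;;
   add_row)
   Skip)"

lemma writes_new_elem [simp]:
 "word_writes new_elem = {''rr'', ''ro'', ''ff'', ''fl'', ''fc''} \<union> word_writes add_row" "real_writes new_elem = real_writes add_row"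
 by (auto simp: new_elem_def load_rows_def)

text \<open>Enumerating the opposite family is charged to the tuples it creates; by
  \<open>card_row\<close> only the omitted element escapes, which goes into the additive constant.
  An element that is already present costs only the test.\<close>

lemma new_elem_wp:
 assumes S: "str s Z S spd w rsg" and G: "gok s (tuples n Z S) spd w" and nn: "words s ''n'' 0 = n" and wa: "warr s"
  and i: "sd < 2" "a < n" "b < n"
  and q: "words s ''q'' sd = e" "words s ''qa'' 0 = a" "words s ''qb'' 0 = b" "words s ''sd'' 0 = sd"
  and e: "if sd = 0 then e \<in> XE a b else e \<in> YE a b" and Z: "sound Z"
  and d: "reals s ''d'' (a * n + b) = spd a b" "reals s ''sg'' (a * n + b) = rsg a b" and rc: "\<And>p. p < n * n \<Longrightarrow> words s ''rc'' p < W"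
  and ffW: "\<And>p. words s ''ff'' p \<le> 1"
 defines "Z' \<equiv> upd3 Z sd a b (insert e (Z sd a b))"
 shows "wp W new_elem (\<lambda>t s'. str s' Z' S spd w rsg \<and> gok s' (tuples n Z' S) spd w \<and> sound Z' \<and> (\<forall>p. words s' ''ff'' p \<le> 1) \<and>
   t + (18 * h + 52) * card (tuples n Z S) \<le> (18 * h + 52) * card (tuples n Z' S) + (18 * h + 62)) s"
proof -
 have sdn: "sd \<noteq> Suc 0 - sd" "Suc 0 - sd \<noteq> sd" by presburger+
 define r where "r = ix3 n sd a b"
 define r' where "r' = ix3 n (1 - sd) a b"
 have rn: "r < 2 * n * n" "r' < 2 * n * n" unfolding r_def r'_def by (rule ix3_less; use i in simp)+
 have en: "e < n" using e XE_n YE_n by (auto split: if_splits)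
 note fm = strD(2)[OF S]
 note FD = famD[OF fm i]
 define m where "m = words s ''fc'' r"
 have m: "m \<le> n" using FD(6,7) by (simp add: m_def r_def)
 have ffr: "words s ''ff'' (r * n + e) < W" using ffW[of "r * n + e"] W_big by simp
 have WW: "r < W" "r' < W" "r * n < W" "r' * n < W" "r * n + e < W" "m < W" "Suc m < W" "e < W" "sd < W" "Suc 0 - sd < W" "a < W" "b < W" "r * n + m < W"
  using in_W_fam[OF rn(1)] in_W_fam[OF rn(2)] m en i W_big by auto
 have lt: "sd * n + a < 2 * n" "(Suc 0 - sd) * n + a < 2 * n" by (rule digit_less; use i in simp)+
 have "sd * n + a < W" "(Suc 0 - sd) * n + a < W" using lt W_const(8) by linarith+
 then have WW2: "(sd * n + a) * n < W" "((Suc 0 - sd) * n + a) * n < W" "sd * n + a < W" "(Suc 0 - sd) * n + a < W" "sd * n < W" "(Suc 0 - sd) * n < W"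
  using WW(1,2) unfolding r_def r'_def ix3_def by auto
 have ix: "(sd * n + a) * n + b = r" "((Suc 0 - sd) * n + a) * n + b = r'" by (simp_all add: r_def r'_def ix3_def)
 have memff: "(words s ''ff'' (r * n + e) = 0) = (e \<notin> Z sd a b)" using FD(3)[OF en] by (auto simp: r_def)
 have ZZ: "Z' = Z" if "e \<in> Z sd a b" using that by (auto simp: Z'_def upd3_def fun_eq_iff insert_absorb)
 have sZ: "sound Z'" using Z e by (auto simp: sound_def Z'_def upd3_def split: if_splits)
 have ok': "fam_ok n Z'" using sZ XE_not_refl YE_not_refl by (fastforce simp: fam_ok_def sound_def)
 show ?thesis
 proof (cases "e \<in> Z sd a b")
  case True
  then have f1: "words s ''ff'' (r * n + e) > 0" using memff by simp
  then show ?thesis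
   unfolding new_elem_def load_rows_def ZZ[OF True]
   using S G Z ffW by (simp add: wp_simps q nn WW WW2 ix ffr)
 next
  case False
  then have f0: "words s ''ff'' (r * n + e) = 0" using memff by simp
  have e': "e \<noteq> (if sd = 0 then b else a)" using e XE_not_refl YE_not_refl by auto
  let ?R = "row sd e a b (Z (1 - sd) a b)"
  note TI = tuples_insert[OF i False strD(3)[OF S] e', of S]
  have T': "tuples n Z' S = tuples n Z S \<union> ?R" and dis: "?R \<inter> tuples n Z S = {}" using TI by (simp_all add: Z'_def)
  have fZ: "finite (Z (1 - sd) a b)" using famD(2)[OF fm _ i(2,3), of "1 - sd"] by simp
  have cT: "card (tuples n Z' S) = card (tuples n Z S) + card ?R"
   unfolding T' using dis strD(5)[OF S] fZ by (subst card_Un_disjoint) (auto simp: row_def)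
  note cR = card_row[OF fZ, of sd e a b]
  have fam': "fam n ((words s ''ff'')(r * n + e := Suc 0)) ((words s ''fl'')(r * n + m := e)) ((words s ''fc'')(r := Suc m)) Z'"
   using fam_insert[OF fm i r_def en False] by (simp add: Z'_def m_def)
  have Zo: "Z' (1 - sd) a b = Z (1 - sd) a b" using sdn by (auto simp: Z'_def upd3_def)
  show ?thesis
   unfolding new_elem_def load_rows_def
   apply (simp add: wp_simps q nn WW WW2 ix f0 m_def[symmetric])
   apply (rule wp_conseq, rule add_row_wp[where T = "tuples n Z S" and Z = Z' and sd = sd and a = a and b = b and e = e
      and ff = "(words s ''ff'')(r * n + e := Suc 0)"])
   subgoal using strD(1)[OF S] by simp
   subgoal using G by simp
   apply ((simp add: nn))
   subgoal using wa by (simp add: warr_def)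
   subgoal using fam' by simp
   subgoal by (rule i)
   subgoal by (rule i)
   subgoal by (rule i)
   apply ((simp add: r'_def))
   apply (simp_all add: q)[4]
   subgoal by (rule e)
   subgoal by (rule sZ)
   subgoal using dis by (simp only: Zo)
   subgoal using d by simp
   subgoal using d by simp
   subgoal using rc by simp
   subgoal premises P for u s1
   proof -
    have "store s1 (tuples n Z' S) spd w rsg" "gok s1 (tuples n Z' S) spd w" "u \<le> (18 * h + 52) * card (Z (1 - sd) a b) + 2"
     using P(1) unfolding Zo T' by blast+
    moreover have "fam n (words s1 ''ff'') (words s1 ''fl'') (words s1 ''fc'') Z'" using fam' by (simp add: P(2))
    moreover have "\<forall>p. words s1 ''ff'' p \<le> 1" using ffW by (simp add: P(2))
    moreover have "(18 * h + 52) * card (Z (1 - sd) a b) \<le> (18 * h + 52) * card ?R + (18 * h + 52)"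
     using mult_le_mono2[OF cR, of "18 * h + 52"] by simp
    moreover have "(18 * h + 52) * card (tuples n Z' S) = (18 * h + 52) * card (tuples n Z S) + (18 * h + 52) * card ?R"
     unfolding cT by (rule distrib_left)
    ultimately show ?thesis using sZ ok' by (simp add: str_def)
   qed
   done
 qed
qed

end

section \<open>Recomputing all distances\<close>

context ram begin

text \<open>The root of a tournament names only one of several leaves of equal minimal key. All of
  them are therefore extracted one by one into the list \<open>B\<close> and then put back, which
  keeps the tree as it was but touches each minimal leaf twice.\<close>

definition collect :: "string \<Rightarrow> string \<Rightarrow> string \<Rightarrow> string \<Rightarrow> com" where
 "collect A K B N =
   (''ts'' ::= V ''n'' ;; ''tb'' ::= WMul (V ''fp'') (WMul (C 2) (V ''n'')) ;; ''tk'' ::= WMul (V ''fp'') (V ''n'') ;;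
   WSet N (V ''fp'') (C 0) ;;
   While (TAnd (TNot (WEq (WGet A (WAdd (V ''tb'') (C 1))) (C 0)))
     (REq (RGet K (WAdd (V ''tk'') (WSub (WGet A (WAdd (V ''tb'') (C 1))) (C 1)))) (R ''kap'')))
    (''tj'' ::= WSub (WGet A (WAdd (V ''tb'') (C 1))) (C 1) ;;
    WSet B (ix2 (V ''fp'') (WGet N (V ''fp''))) (V ''tj'') ;;
    WSet N (V ''fp'') (WAdd (WGet N (V ''fp'')) (C 1)) ;;
    tree_delete A K) ;;
   ''rk'' ::=r R ''kap'' ;;
   For ''fi'' (WGet N (V ''fp'')) (''tj'' ::= WGet B (ix2 (V ''fp'') (V ''fi'')) ;; tree_insert A K))"

lemma writes_collect [simp]:
 "word_writes (collect A K B N) = {A, B, N, ''ts'', ''tb'', ''tk'', ''tj'', ''ti'', ''tu'', ''tv'', ''fi''}"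
 "real_writes (collect A K B N) = {K, ''rk''}"
 by (auto simp: collect_def)

lemma collect_wp:
 assumes names: "(A, K, B, N) = (''tl'', ''kl'', ''bl'', ''bn'') \<or> (A, K, B, N) = (''tf'', ''kf'', ''ml'', ''mn'')"
  and nn: "words s ''n'' 0 = n" and p: "words s ''fp'' 0 = p" "p < n * n" and ka: "reals s ''kap'' 0 = \<kappa>"
  and T: "tree (words s A) (reals s K) n (p * (2 * n)) (p * n) P key" and mn: "\<And>i. i \<in> P \<Longrightarrow> \<kappa> \<le> key i"
 defines "M \<equiv> {i \<in> P. key i = \<kappa>}"
 shows "wp W (collect A K B N) (\<lambda>t s'. t \<le> (12 * h + 20) * card M + 10 \<and> words s' N p = card M \<and> card M \<le> n \<and>
   distinct (seg n (words s' B) p (card M)) \<and> set (seg n (words s' B) p (card M)) = M \<and>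
   (\<forall>q. q \<noteq> p \<longrightarrow> words s' N q = words s N q) \<and>
   (\<forall>j. j < p * n \<or> j \<ge> p * n + n \<longrightarrow> words s' B j = words s B j) \<and>
   (\<forall>j. j < p * n \<or> j \<ge> p * n + n \<longrightarrow> reals s' K j = reals s K j) \<and>
   (\<forall>j. j < p * (2 * n) \<or> j \<ge> p * (2 * n) + 2 * n \<longrightarrow> words s' A j = words s A j) \<and>
   tree (words s' A) (reals s' K) n (p * (2 * n)) (p * n) P key) s"
proof -
 have An:
  "A \<noteq> ''ts''" "''ts'' \<noteq> A" "A \<noteq> ''tb''" "''tb'' \<noteq> A" "A \<noteq> ''tk''" "''tk'' \<noteq> A" "A \<noteq> ''tj''" "''tj'' \<noteq> A" "A \<noteq> ''ti''" "''ti'' \<noteq> A" "A \<noteq> ''tu''" "''tu'' \<noteq> A"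
  "A \<noteq> ''tv''" "''tv'' \<noteq> A" "A \<noteq> ''fp''" "''fp'' \<noteq> A" "A \<noteq> ''fi''" "''fi'' \<noteq> A" "A \<noteq> ''n''" "''n'' \<noteq> A" "B \<noteq> ''ts''" "''ts'' \<noteq> B" "B \<noteq> ''tb''" "''tb'' \<noteq> B"
  "B \<noteq> ''tk''" "''tk'' \<noteq> B" "B \<noteq> ''tj''" "''tj'' \<noteq> B" "B \<noteq> ''ti''" "''ti'' \<noteq> B" "B \<noteq> ''tu''" "''tu'' \<noteq> B" "B \<noteq> ''tv''" "''tv'' \<noteq> B" "B \<noteq> ''fp''" "''fp'' \<noteq> B"
  "B \<noteq> ''fi''" "''fi'' \<noteq> B" "B \<noteq> ''n''" "''n'' \<noteq> B" "N \<noteq> ''ts''" "''ts'' \<noteq> N" "N \<noteq> ''tb''" "''tb'' \<noteq> N" "N \<noteq> ''tk''" "''tk'' \<noteq> N" "N \<noteq> ''tj''" "''tj'' \<noteq> N"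
  "N \<noteq> ''ti''" "''ti'' \<noteq> N" "N \<noteq> ''tu''" "''tu'' \<noteq> N" "N \<noteq> ''tv''" "''tv'' \<noteq> N" "N \<noteq> ''fp''" "''fp'' \<noteq> N" "N \<noteq> ''fi''" "''fi'' \<noteq> N" "N \<noteq> ''n''" "''n'' \<noteq> N"
  "A \<noteq> B" "B \<noteq> A" "A \<noteq> N" "N \<noteq> A" "B \<noteq> N" "N \<noteq> B" "K \<noteq> ''rk''" "''rk'' \<noteq> K" "K \<noteq> ''kap''" "''kap'' \<noteq> K"
  using names by auto
 have n: "0 < n" using p by (cases n) auto
 have Pn: "P \<subseteq> {..<n}" using treeD(1)[OF T] .
 have fP: "finite P" using finite_subset[OF Pn] by simp
 have fM: "finite M" "M \<subseteq> P" "card M \<le> n"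
  using fP card_mono[of "{..<n}" M] Pn by (auto simp: M_def)
 have WW: "p < W" "p * n < W" "p * (2 * n) < W" "p * (2 * n) + 2 * n + 3 < W" "p * n + n + 3 < W" using p(2) by (auto simp: bnd)
 let ?b = "p * (2 * n)" and ?k = "p * n"
 define fix_out where "fix_out s' \<longleftrightarrow> (\<forall>q. q \<noteq> p \<longrightarrow> words s' N q = words s N q) \<and>
   (\<forall>j. j < p * n \<or> j \<ge> p * n + n \<longrightarrow> words s' B j = words s B j) \<and>
   (\<forall>j. j < p * n \<or> j \<ge> p * n + n \<longrightarrow> reals s' K j = reals s K j) \<and>
   (\<forall>j. j < p * (2 * n) \<or> j \<ge> p * (2 * n) + 2 * n \<longrightarrow> words s' A j = words s A j) \<and>
   words s' ''n'' 0 = n \<and> words s' ''fp'' 0 = p \<and> reals s' ''kap'' 0 = \<kappa> \<and> words s' ''tb'' 0 = ?b \<and> words s' ''tk'' 0 = ?k \<and> words s' ''ts'' 0 = n" for s' :: state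
 let ?I = "\<lambda>t s'. \<exists>L. distinct L \<and> set L \<subseteq> M \<and> words s' N p = length L \<and> seg n (words s' B) p (length L) = L \<and>
   tree (words s' A) (reals s' K) n ?b ?k (P - set L) key \<and> t \<le> (6 * h + 8) * length L \<and> fix_out s'"
 \<comment> \<open>In the second loop the leaves that are still missing after \<open>j\<close>
   rounds are those in \<open>drop j L\<close>.\<close>
 let ?J = "\<lambda>L j t s'. words s' N p = length L \<and> seg n (words s' B) p (length L) = L \<and>
   tree (words s' A) (reals s' K) n ?b ?k (P - set (drop j L)) key \<and> t \<le> (6 * h + 8) * j \<and> fix_out s' \<and> reals s' ''rk'' 0 = \<kappa>"
 have len: "length L \<le> card M" if "distinct L" "set L \<subseteq> M" for L
  using card_mono[OF fM(1) that(2)] distinct_card[OF that(1)] by simp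
 show ?thesis
  unfolding collect_def
  apply (simp add: wp_simps nn p WW An)
  apply (rule wp_While[where I = ?I and \<mu> = "\<lambda>s. n - words s N p"])
  subgoal using T by (intro exI[of _ "[]"]) (simp add: An fix_out_def nn p ka)
  subgoal premises I for t s'
  proof -
   obtain L where L: "tree (words s' A) (reals s' K) n ?b ?k (P - set L) key" "fix_out s'" using I by blast
   have le: "words s' A (?b + 1) \<le> n" using tree_entry_le[OF L(1), of 1] n by simp
   have "?k + (words s' A (?b + 1) - 1) < W" "?b + 1 < W" using WW le by linarith+
   moreover have "words s' A (?b + 1) < W" using le W_const(6) by linarith
   ultimately show ?thesis using L(2) WW by (simp add: fix_out_def)
  qed
  subgoal premises I for t s'
  proof -
   obtain L where L: "distinct L" "set L \<subseteq> M" "words s' N p = length L" "seg n (words s' B) p (length L) = L"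
    "tree (words s' A) (reals s' K) n ?b ?k (P - set L) key" "t \<le> (6 * h + 8) * length L" "fix_out s'" using I(1) by blast
   define i where "i = words s' A (?b + 1) - 1"
   have st: "words s' ''n'' 0 = n" "words s' ''fp'' 0 = p" "reals s' ''kap'' 0 = \<kappa>" "words s' ''tb'' 0 = ?b" "words s' ''tk'' 0 = ?k" "words s' ''ts'' 0 = n"
    using L(7) by (simp_all add: fix_out_def)
   have r0: "words s' A (?b + 1) \<noteq> 0" and rk: "reals s' K (?k + i) = \<kappa>"
    using I(2) st by (simp_all add: i_def del: add_diff_assoc)
   note R = tree_root_Some[OF L(5) n r0, folded i_def]
   have i: "i \<in> M" "i \<notin> set L" "i < n" using R(1,2) rk Pn by (auto simp: M_def)
   have Ln: "length L < card M"
    using len[of "i # L"] i L(1,2) by simp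
   have WL: "?k + length L < W" "length L < W" "Suc (length L) < W" "i < W" "Suc ?b < W" "words s' A (Suc ?b) < W"
    using WW Ln fM(3) i(3) W_const(6) tree_entry_le[OF L(5), of 1] n by auto
   have ri: "words s' A (Suc ?b) - Suc 0 = i" by (simp add: i_def)
   have kL: "length L < n" using Ln fM(3) by simp
   show ?thesis
    apply (simp add: wp_simps st An WW WL ri L(3))
    apply (rule wp_conseq, rule tree_delete_wp[where b = ?b and k = ?k and l = i and sz = n and h = h and P = "P - set L" and key = key])
    apply ((simp add: An))
    apply (simp_all add: st An)[4]
    subgoal by (rule i(3))
    subgoal by (rule two_n_le)
    subgoal by (rule WW)
    subgoal by (rule WW)
    subgoal using L(5) by (simp add: An)
    subgoal premises Q for u s''
    proof -
     have wN: "words s'' N = (words s' N)(p := Suc (length L))" and wB: "words s'' B = (words s' B)(?k + length L := i)"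
      and o: "reals s'' K = reals s' K" "words s'' ''n'' 0 = n" "words s'' ''fp'' 0 = p" "reals s'' ''kap'' 0 = \<kappa>" "words s'' ''tb'' 0 = ?b"
       "words s'' ''tk'' 0 = ?k" "words s'' ''ts'' 0 = n"
      by (simp_all add: Q(2,3) An st)
     have "seg n (words s'' B) p (length L) = seg n (words s' B) p (length L)"
      unfolding wB by (rule seg_cong) simp
     then have sg: "seg n (words s'' B) p (Suc (length L)) = L @ [i]" using L(4) by (simp add: wB)
     have fo: "fix_out s''"
      using L(7) Q(1) kL unfolding fix_out_def by (simp add: wN wB o An)
     have Pd: "P - insert i (set L) = P - set L - {i}" by auto
     have time: "Suc (t + (3 + u)) \<le> (6 * h + 8) * Suc (length L)" using Q(1) L(6) by (simp add: algebra_simps)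
     show ?thesis
      apply (intro conjI exI[of _ "L @ [i]"])
      using L(1,2) i fo Q(1) time sg kL by (simp_all add: wN Pd L(3))
    qed
    done
  qed
  subgoal premises I for t s'
  proof -
   obtain L where L: "distinct L" "set L \<subseteq> M" "words s' N p = length L" "seg n (words s' B) p (length L) = L"
    "tree (words s' A) (reals s' K) n ?b ?k (P - set L) key" "t \<le> (6 * h + 8) * length L" "fix_out s'" using I(1) by blast
   have st: "words s' ''n'' 0 = n" "words s' ''fp'' 0 = p" "reals s' ''kap'' 0 = \<kappa>" "words s' ''tb'' 0 = ?b" "words s' ''tk'' 0 = ?k" "words s' ''ts'' 0 = n"
    using L(7) by (simp_all add: fix_out_def)
   \<comment> \<open>The loop ends when the tree is empty or its root has a key other than
     \<open>\<kappa>\<close>. Since no key is below \<open>\<kappa>\<close>, a leaf of key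
     \<open>\<kappa>\<close> left behind would force the root to have this key.\<close>
   have "M \<subseteq> set L"
   proof
    fix i assume i: "i \<in> M"
    show "i \<in> set L"
    proof (rule ccontr)
     assume "i \<notin> set L"
     then have ip: "i \<in> P - set L" using i by (simp add: M_def)
     then have r0: "words s' A (?b + 1) \<noteq> 0" using tree_root_None[OF L(5) n] by auto
     note R = tree_root_Some[OF L(5) n r0]
     have "key (words s' A (?b + 1) - 1) = \<kappa>" using R(3)[OF ip] R(1) mn i by (force simp: M_def)
     then show False using I(2) R(2) r0 st by (simp del: add_diff_assoc)
    qed
   qed
   then have LM: "set L = M" using L(2) by blast
   have cL: "length L = card M" using distinct_card[OF L(1)] LM by simp
   have lW: "length L < W" using cL fM(3) W_const(6) by linarith
   show ?thesis
    apply (simp add: wp_simps st)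
    apply (rule wp_For[where m = "length L" and I = "?J L"])
    subgoal by (rule lW)
    apply (simp)
    subgoal using L by (simp add: An fix_out_def)
    subgoal premises J for j u s1
     using J(1) lW WW by (simp add: fix_out_def)
    subgoal premises J for j u s1
    proof -
     define i where "i = L ! j"
     have iL: "i \<in> set L" using J(3) by (simp add: i_def)
     then have i: "i \<in> M" "i < n" using LM Pn by (auto simp: M_def)
     have J1: "tree (words s1 A) (reals s1 K) n ?b ?k (P - set (drop j L)) key" "u \<le> (6 * h + 8) * j" "fix_out s1" "reals s1 ''rk'' 0 = \<kappa>"
      "words s1 N p = length L" "seg n (words s1 B) p (length L) = L"
      using J(1) by blast+
     have st1: "words s1 ''n'' 0 = n" "words s1 ''fp'' 0 = p" "reals s1 ''kap'' 0 = \<kappa>" "words s1 ''tb'' 0 = ?b" "words s1 ''tk'' 0 = ?k" "words s1 ''ts'' 0 = n"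
      using J1(3) by (simp_all add: fix_out_def)
     have Bi: "words s1 B (?k + j) = i" using arg_cong[OF J1(6), of "\<lambda>l. l ! j"] J(3) by (simp add: i_def)
     have jW: "?k + j < W" "j < W" "i < W" using J(3) cL fM(3) WW i(2) W_const(6) by linarith+
     have dr: "drop j L = i # drop (Suc j) L" using J(3) by (simp add: i_def Cons_nth_drop_Suc)
     have Pi: "insert i (P - set (drop j L)) = P - set (drop (Suc j) L)"
      using L(1) i(1) distinct_drop[OF L(1), of j] unfolding dr by (auto simp: M_def)
     have ki: "key(i := \<kappa>) = key" using i(1) by (auto simp: M_def)
     show ?thesis
      apply (simp add: wp_simps st1 An WW jW J(2) Bi)
      apply (rule wp_conseq, rule tree_insert_wp[where b = ?b and k = ?k and l = i and sz = n and h = h and P = "P - set (drop j L)" and key = key and r = \<kappa>])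
      apply (simp_all add: An)[2]
      apply (simp_all add: st1 An)[4]
      subgoal using J1(4) by simp
      subgoal by (rule i(2))
      subgoal by (rule two_n_le)
      subgoal by (rule WW)
      subgoal by (rule WW)
      subgoal using J1(1) by (simp add: An)
      subgoal premises Q for v s2
      proof -
       have o: "words s2 N = words s1 N" "words s2 B = words s1 B" "words s2 ''n'' 0 = n" "words s2 ''fp'' 0 = p" "reals s2 ''kap'' 0 = \<kappa>"
        "words s2 ''tb'' 0 = ?b" "words s2 ''tk'' 0 = ?k" "words s2 ''ts'' 0 = n" "reals s2 ''rk'' 0 = \<kappa>" "words s2 ''fi'' 0 = j"
        by (simp_all add: Q(2,3) An st1 J(2) J1(4))
       have "fix_out s2" using J1(3) Q(1) i(2) unfolding fix_out_def by (simp add: o An)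
       then have fo: "fix_out (wupd s2 ''fi'' 0 (Suc j))" by (simp add: fix_out_def An)
       have time: "u + (1 + v) \<le> (6 * h + 8) * Suc j" using Q(1) J1(2) by (simp add: algebra_simps)
       have tr: "tree (words s2 A) (reals s2 K) n ?b ?k (P - set (drop (Suc j) L)) key" using Q(1) unfolding Pi ki by blast
       show ?thesis using J1(5,6) fo time tr by (simp add: o An)
      qed
      done
    qed
    subgoal premises J for u s1
    proof -
     have J1: "tree (words s1 A) (reals s1 K) n ?b ?k P key" "u \<le> (6 * h + 8) * card M" "fix_out s1"
      "words s1 N p = card M" "seg n (words s1 B) p (card M) = L"
      using J(1) cL by simp_all
     have time: "4 + (t + 1) + (1 + (u + 2 * card M + 2)) \<le> (12 * h + 20) * card M + 10" using J1(2) L(6) cL by (simp add: algebra_simps)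
     show ?thesis using J1 time L(1) LM fM(3) cL by (simp add: fix_out_def)
    qed
    done
  qed
  done
qed

end

section \<open>Why the nearest unsettled pair already has its tuples\<close>

context alg begin

abbreviation E1 :: "(nat \<times> nat) set" where "E1 \<equiv> {(x, y) \<in> E. x \<noteq> y}"

definition complete :: "fam \<Rightarrow> (nat \<times> nat) set \<Rightarrow> bool" where
 "complete Z P \<longleftrightarrow> (\<forall>x y. (x, y) \<in> P \<longrightarrow> (\<forall>a. x \<in> XE a y \<longrightarrow> x \<in> Z 0 a y) \<and> (\<forall>b. y \<in> YE x b \<longrightarrow> y \<in> Z (Suc 0) x b))"

definition todo :: "(nat \<times> nat) set \<Rightarrow> (nat \<times> nat) set" where
 "todo P = {(x, y). x < n \<and> y < n \<and> reach x y \<and> (x, y) \<notin> P}"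

text \<open>The key is the cost of an actual walk, read either as a shortest path to
  \<open>b\<close> and the edge \<open>(b, y)\<close> or as the edge \<open>(x, a)\<close> and a
  shortest path from \<open>a\<close>. So it never falls below the distance.\<close>

lemma tuple_sound:
 assumes Z: "sound Z" and t: "(x, a, b, y) \<in> tuples n Z E1"
 shows "reach x y" "spd x y \<le> KL spd w x y b" "KL spd w x y b = KF spd w x y a" "x \<noteq> y" "x < n" "y < n" "a < n" "b < n"
proof -
 have sub: "Z 0 a b \<subseteq> XE a b" "Z (Suc 0) a b \<subseteq> YE a b" using Z unfolding sound_def by blast+
 have "(x \<in> XE a b \<and> y \<in> YE a b \<and> x \<noteq> y \<and> b < n) \<or> (a = y \<and> b = x \<and> (x, y) \<in> E \<and> x \<noteq> y)"
  using t sub by (auto simp: tuples_def)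
 then have "reach x y \<and> spd x y \<le> KL spd w x y b \<and> KL spd w x y b = KF spd w x y a \<and> x \<noteq> y \<and> x < n \<and> y < n \<and> a < n \<and> b < n"
 proof
  assume a: "x \<in> XE a b \<and> y \<in> YE a b \<and> x \<noteq> y \<and> b < n"
  then have e: "(b, y) \<in> E" "w (x, a) + spd a b = spd x b" "spd a b + w (b, y) = spd a y" by (auto simp: XE_def YE_def)
  have xb: "reach x b" using a XE_reach by blast
  have "spd x y \<le> spd x b + w (b, y)" using spd_triangle[OF xb reach_edge[OF e(1)]] spd_edge[OF e(1)] by linarith
  then show ?thesis using a e xb reach_trans[OF xb reach_edge[OF e(1)]] XE_n YE_n by (auto simp: KL_def KF_def)
 next
  assume a: "a = y \<and> b = x \<and> (x, y) \<in> E \<and> x \<noteq> y"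
  then show ?thesis using reach_edge spd_edge E_n by (auto simp: KL_def KF_def)
 qed
 then show "reach x y" "spd x y \<le> KL spd w x y b" "KL spd w x y b = KF spd w x y a" "x \<noteq> y" "x < n" "y < n" "a < n" "b < n" by auto
qed

text \<open>Dropping the last or the first edge of a shortest path gives a strictly nearer pair.
  Hence \<open>(x, b)\<close> and \<open>(a, y)\<close> are settled, their families are complete,
  and the common middle \<open>(a, b)\<close> yields the tuple.\<close>

lemma tuple_last:
 assumes c: "complete Z P" and xy: "x \<noteq> y" "x < n" "y < n"
  and small: "\<And>x' y'. (x', y') \<in> todo P \<Longrightarrow> spd x y \<le> spd x' y'" and b: "y \<in> YE x b"
 shows "\<exists>a. (x, a, b, y) \<in> tuples n Z E1"
proof (cases "b = x")
 case True
 then show ?thesis using b xy by (auto simp: tuples_def YE_def)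
next
 case False
 then obtain a where a: "x \<in> XE a b" "y \<in> YE a b" using YE_middle[OF b] by blast
 have abn: "a < n" "b < n" using a XE_n YE_n by auto
 have "(x, b) \<in> P"
  using small[of x b] YE_less[OF b] XE_reach[OF a(1)] xy abn by (force simp: todo_def)
 moreover have "spd a y < spd x y"
  using a b pos[of "(x, a)"] by (auto simp: XE_def YE_def)
 then have "(a, y) \<in> P" using small[of a y] YE_reach[OF a(2)] xy abn by (force simp: todo_def)
 ultimately show ?thesis using c a abn xy unfolding complete_def tuples_def by auto
qed

lemma tuple_first:
 assumes c: "complete Z P" and xy: "x \<noteq> y" "x < n" "y < n"
  and small: "\<And>x' y'. (x', y') \<in> todo P \<Longrightarrow> spd x y \<le> spd x' y'" and a: "x \<in> XE a y"
 shows "\<exists>b. (x, a, b, y) \<in> tuples n Z E1"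
proof (cases "a = y")
 case True
 then show ?thesis using a xy by (auto simp: tuples_def XE_def)
next
 case False
 then obtain b where b: "x \<in> XE a b" "y \<in> YE a b" using XE_middle[OF a] by blast
 have abn: "a < n" "b < n" using b XE_n YE_n by auto
 have "(a, y) \<in> P"
  using small[of a y] XE_less[OF a] YE_reach[OF b(2)] xy abn by (force simp: todo_def)
 moreover have "spd x b < spd x y"
  using a b pos[of "(b, y)"] by (auto simp: XE_def YE_def)
 then have "(x, b) \<in> P" using small[of x b] XE_reach[OF b(1)] xy abn by (force simp: todo_def)
 ultimately show ?thesis using c b abn xy unfolding complete_def tuples_def by auto
qed

lemma todo_min:
 assumes "todo P \<noteq> {}"
 obtains x y where "(x, y) \<in> todo P" "\<And>x' y'. (x', y') \<in> todo P \<Longrightarrow> spd x y \<le> spd x' y'"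
proof -
 have "todo P \<subseteq> {..<n} \<times> {..<n}" by (auto simp: todo_def)
 then have "finite (todo P)" by (rule finite_subset) simp
 then have f: "finite ((\<lambda>(x, y). spd x y) ` todo P)" "(\<lambda>(x, y). spd x y) ` todo P \<noteq> {}" using assms by auto
 have "Min ((\<lambda>(x, y). spd x y) ` todo P) \<in> (\<lambda>(x, y). spd x y) ` todo P" by (rule Min_in[OF f])
 then obtain x y where xy: "(x, y) \<in> todo P" "Min ((\<lambda>(x, y). spd x y) ` todo P) = spd x y" by auto
 have "spd x y \<le> spd x' y'" if "(x', y') \<in> todo P" for x' y'
  unfolding xy(2)[symmetric] using that by (intro Min_le[OF f(1)]) force
 then show ?thesis using that xy(1) by blast
qed

text \<open>
 The unsettled pair of smallest key is settled next: a nearest unsettled pair has all shorter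
 distances settled, so its shortest paths have already produced their tuples.
\<close>

lemma min_key_pair:
 assumes Z: "sound Z" and c: "complete Z P" and dg: "\<forall>z<n. (z, z) \<in> P"
  and x: "x < n" "y < n" "(x, y) \<notin> P" "PL (tuples n Z E1) x y \<noteq> {}" and q: "tuples n Z E1 \<subseteq> quads n"
  and mn: "\<forall>x' y'. x' < n \<longrightarrow> y' < n \<longrightarrow> (x', y') \<notin> P \<longrightarrow> PL (tuples n Z E1) x' y' \<noteq> {} \<longrightarrow>
   gkey (tuples n Z E1) spd w x y \<le> gkey (tuples n Z E1) spd w x' y'"
 shows "reach x y" "x \<noteq> y" "gkey (tuples n Z E1) spd w x y = spd x y" "\<And>x' y'. (x', y') \<in> todo P \<Longrightarrow> spd x y \<le> spd x' y'"
  "{b \<in> PL (tuples n Z E1) x y. KL spd w x y b = spd x y} = {b. y \<in> YE x b}"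
  "{a \<in> PF (tuples n Z E1) x y. KF spd w x y a = spd x y} = {a. x \<in> XE a y}"
  "\<And>b. b \<in> PL (tuples n Z E1) x y \<Longrightarrow> spd x y \<le> KL spd w x y b"
  "\<And>a. a \<in> PF (tuples n Z E1) x y \<Longrightarrow> spd x y \<le> KF spd w x y a"
proof -
 let ?T = "tuples n Z E1"
 note ts = tuple_sound[OF Z]
 obtain a0 b0 where "(x, a0, b0, y) \<in> ?T" using x(4) by (auto simp: PL_def)
 from ts(1)[OF this] ts(4)[OF this] show reach: "reach x y" and ne: "x \<noteq> y" by blast+
 have fin: "finite (KL spd w x' y' ` PL ?T x' y')" for x' y' using finite_PL[OF q] by simp
 have ge: "spd x' y' \<le> gkey ?T spd w x' y'" if "PL ?T x' y' \<noteq> {}" for x' y'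
  unfolding gkey_def using that ts(2) fin by (subst Min_ge_iff) (auto simp: PL_def)
 have "(x, y) \<in> todo P" using reach x by (simp add: todo_def)
 then obtain x0 y0 where m: "(x0, y0) \<in> todo P" "\<And>x' y'. (x', y') \<in> todo P \<Longrightarrow> spd x0 y0 \<le> spd x' y'"
  using todo_min[of P] by blast
 have m0: "x0 < n" "y0 < n" "reach x0 y0" "(x0, y0) \<notin> P" using m(1) by (auto simp: todo_def)
 have ne0: "x0 \<noteq> y0" using dg m0 by auto
 obtain b where b: "y0 \<in> YE x0 b" using ex_YE[OF m0(3) ne0] by blast
 obtain a where a: "(x0, a, b, y0) \<in> ?T" using tuple_last[OF c ne0 m0(1,2) m(2) b] by blast
 have bP: "b \<in> PL ?T x0 y0" using a by (auto simp: PL_def)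
 have "gkey ?T spd w x0 y0 \<le> KL spd w x0 y0 b" unfolding gkey_def using bP fin by (intro Min_le) auto
 also have "\<dots> = spd x0 y0" using b by (auto simp: KL_def YE_def)
 finally have le0: "gkey ?T spd w x0 y0 \<le> spd x0 y0" .
 have "gkey ?T spd w x y \<le> gkey ?T spd w x0 y0" using mn m0(1,2,4) bP by blast
 moreover have "spd x0 y0 \<le> spd x y" using m(2) \<open>(x, y) \<in> todo P\<close> by blast
 \<comment> \<open>The chain closes up: the distance of \<open>(x, y)\<close> is at most its key,
   this is at most the key of \<open>(x0, y0)\<close>, then at most the distance of
   \<open>(x0, y0)\<close>, which is at most the distance of \<open>(x, y)\<close>.\<close>
 ultimately have eq: "gkey ?T spd w x y = spd x y" "spd x y = spd x0 y0" using ge[OF x(4)] le0 by linarith+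
 show "gkey ?T spd w x y = spd x y" by (rule eq)
 show small: "\<And>x' y'. (x', y') \<in> todo P \<Longrightarrow> spd x y \<le> spd x' y'" using m(2) eq(2) by simp
 show geL: "\<And>b. b \<in> PL ?T x y \<Longrightarrow> spd x y \<le> KL spd w x y b" using ts(2) by (auto simp: PL_def)
 show geF: "\<And>a. a \<in> PF ?T x y \<Longrightarrow> spd x y \<le> KF spd w x y a" using ts(2,3) by (fastforce simp: PF_def)
 show "{b \<in> PL ?T x y. KL spd w x y b = spd x y} = {b. y \<in> YE x b}"
 proof (intro set_eqI iffI)
  fix b assume "b \<in> {b \<in> PL ?T x y. KL spd w x y b = spd x y}"
  then obtain a where t: "(x, a, b, y) \<in> ?T" "spd x b + w (b, y) = spd x y" by (auto simp: PL_def KL_def)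
  have "(y \<in> YE a b \<and> x \<in> XE a b) \<or> (b = x \<and> (x, y) \<in> E)"
   using t Z unfolding tuples_def sound_def by (auto; blast)
  then show "b \<in> {b. y \<in> YE x b}" using t(2) XE_reach[of x a b] by (auto simp: YE_def)
 next
  fix b assume b: "b \<in> {b. y \<in> YE x b}"
  then obtain a where "(x, a, b, y) \<in> ?T" using tuple_last[OF c ne x(1,2) small] by blast
  then show "b \<in> {b \<in> PL ?T x y. KL spd w x y b = spd x y}" using b by (auto simp: PL_def KL_def YE_def)
 qed
 show "{a \<in> PF ?T x y. KF spd w x y a = spd x y} = {a. x \<in> XE a y}"
 proof (intro set_eqI iffI)
  fix a assume "a \<in> {a \<in> PF ?T x y. KF spd w x y a = spd x y}"
  then obtain b where t: "(x, a, b, y) \<in> ?T" "w (x, a) + spd a y = spd x y" by (auto simp: PF_def KF_def)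
  have "(y \<in> YE a b \<and> x \<in> XE a b) \<or> (a = y \<and> (x, y) \<in> E)"
   using t Z unfolding tuples_def sound_def by (auto; blast)
  then show "a \<in> {a. x \<in> XE a y}" using t(2) YE_reach[of y a b] by (auto simp: XE_def)
 next
  fix a assume a: "a \<in> {a. x \<in> XE a y}"
  then obtain b where "(x, a, b, y) \<in> ?T" using tuple_first[OF c ne x(1,2) small] by blast
  then show "a \<in> {a \<in> PF ?T x y. KF spd w x y a = spd x y}" using a by (auto simp: PF_def KF_def XE_def)
 qed
qed

text \<open>A nearest pair still to be settled would own a tuple by \<open>tuple_last\<close>. So
  when no unsettled pair has one, every reachable pair is settled.\<close>

lemma no_key_no_todo:
 assumes c: "complete Z P" and dg: "\<And>z. z < n \<Longrightarrow> (z, z) \<in> P"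
  and none: "\<And>x' y'. x' < n \<Longrightarrow> y' < n \<Longrightarrow> (x', y') \<notin> P \<Longrightarrow> PL (tuples n Z E1) x' y' = {}"
 shows "todo P = {}"
proof (rule ccontr)
 assume "todo P \<noteq> {}"
 then obtain x0 y0 where m: "(x0, y0) \<in> todo P" "\<And>x' y'. (x', y') \<in> todo P \<Longrightarrow> spd x0 y0 \<le> spd x' y'"
  using todo_min[of P] by blast
 have m0: "x0 < n" "y0 < n" "reach x0 y0" "(x0, y0) \<notin> P" using m(1) by (auto simp: todo_def)
 have ne0: "x0 \<noteq> y0" using dg m0 by auto
 obtain b where b: "y0 \<in> YE x0 b" using ex_YE[OF m0(3) ne0] by blast
 obtain a where "(x0, a, b, y0) \<in> tuples n Z E1" using tuple_last[OF c ne0 m0(1,2) m(2) b] by blast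
 then show False using none[OF m0(1,2,4)] by (auto simp: PL_def)
qed

definition ins :: "fam \<Rightarrow> nat \<Rightarrow> nat \<Rightarrow> (nat \<times> nat) set \<Rightarrow> fam" where
 "ins Z sd e J = (\<lambda>sd' a b. if sd' = sd \<and> (a, b) \<in> J then insert e (Z sd' a b) else Z sd' a b)"

lemma ins_empty [simp]: "ins Z sd e {} = Z" by (simp add: ins_def)

lemma ins_insert: "upd3 (ins Z sd e J) sd a b (insert e (ins Z sd e J sd a b)) = ins Z sd e (insert (a, b) J)"
 by (auto simp: ins_def upd3_def fun_eq_iff)

definition links :: "nat \<Rightarrow> wexp \<Rightarrow> wexp \<Rightarrow> wexp \<Rightarrow> wexp \<Rightarrow> com" where
 "links sd num ea eb ee = For ''fi'' num
   (''qa'' ::= ea ;; ''qb'' ::= eb ;; WSet ''q'' (C sd) ee ;; ''sd'' ::= C sd ;; new_elem)"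

lemma writes_links [simp]:
 "word_writes (links sd num ea eb ee) = {''fi'', ''qa'', ''qb'', ''q'', ''sd''} \<union> word_writes new_elem" "real_writes (links sd num ea eb ee) = real_writes new_elem"
 by (auto simp: links_def)

text \<open>The expressions are kept abstract so that one proof serves both sides. Assumption
  \<open>ev\<close> asks that they be determined by the loop counter and by arrays that the loop
  body does not write.\<close>

lemma links_wp:
 assumes S: "str s Z E1 spd w rsg" and G: "gok s (tuples n Z E1) spd w" and nn: "words s ''n'' 0 = n" and wa: "warr s"
  and sd: "sd < 2" and Z: "sound Z" and rc: "\<And>p. p < n * n \<Longrightarrow> words s ''rc'' p < W" and ffW: "\<And>p. words s ''ff'' p \<le> 1"
  and m: "m \<le> n"
  and ev: "\<And>s' j. words s' ''fi'' 0 = j \<Longrightarrow> j \<le> m \<Longrightarrow> (\<And>x. x \<in> {''n'', ''fx'', ''fy'', ''fp'', ''bl'', ''bn'', ''ml'', ''mn''} \<Longrightarrow> words s' x = words s x) \<Longrightarrow>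
   wfits W s' num \<and> wval s' num = m"
   "\<And>s' j. words s' ''fi'' 0 = j \<Longrightarrow> j < m \<Longrightarrow> (\<And>x. x \<in> {''n'', ''fx'', ''fy'', ''fp'', ''bl'', ''bn'', ''ml'', ''mn''} \<Longrightarrow> words s' x = words s x) \<Longrightarrow>
   wfits W s' ea \<and> wval s' ea = fa j \<and> wfits W s' eb \<and> wval s' eb = fb j \<and> wfits W s' ee \<and> wval s' ee = e"
  and ab: "\<And>j. j < m \<Longrightarrow> fa j < n \<and> fb j < n \<and> (if sd = 0 then e \<in> XE (fa j) (fb j) else e \<in> YE (fa j) (fb j)) \<and>
   reals s ''d'' (fa j * n + fb j) = spd (fa j) (fb j) \<and> reals s ''sg'' (fa j * n + fb j) = rsg (fa j) (fb j)"
 defines "Z' \<equiv> ins Z sd e ((\<lambda>j. (fa j, fb j)) ` {..<m})"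
 shows "wp W (links sd num ea eb ee) (\<lambda>t s'. str s' Z' E1 spd w rsg \<and> gok s' (tuples n Z' E1) spd w \<and> sound Z' \<and> (\<forall>p. words s' ''ff'' p \<le> 1) \<and>
   t + (18 * h + 52) * card (tuples n Z E1) \<le> (18 * h + 52) * card (tuples n Z' E1) + (18 * h + 68) * m + 2) s"
proof -
 define k where "k = 18 * h + 52"
 define N where "N = {''n'', ''fx'', ''fy'', ''fp'', ''bl'', ''bn'', ''ml'', ''mn''}"
 note ev = ev[folded N_def]
 have Nd: "x \<noteq> ''fi''" "x \<noteq> ''qa''" "x \<noteq> ''qb''" "x \<noteq> ''q''" "x \<noteq> ''sd''" "x \<notin> word_writes new_elem" if "x \<in> N" for x
  using that by (auto simp: N_def)
 let ?Z = "\<lambda>j. ins Z sd e ((\<lambda>j. (fa j, fb j)) ` {..<j})"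
 let ?I = "\<lambda>j t s'. str s' (?Z j) E1 spd w rsg \<and> gok s' (tuples n (?Z j) E1) spd w \<and> sound (?Z j) \<and> (\<forall>p. words s' ''ff'' p \<le> 1) \<and>
   t + k * card (tuples n Z E1) \<le> k * card (tuples n (?Z j) E1) + (18 * h + 66) * j \<and> (\<forall>x\<in>N. words s' x = words s x) \<and> words s' ''rc'' = words s ''rc'' \<and>
   reals s' ''d'' = reals s ''d'' \<and> reals s' ''sg'' = reals s ''sg'' \<and> reals s' ''w'' = reals s ''w''"
 show ?thesis
  unfolding links_def k_def[symmetric]
 proof (rule wp_For[where m = m and I = ?I])
  show "m < W" using m W_const(6) by linarith
  show "?I 0 0 (wupd s ''fi'' 0 0)" using S G Z ffW Nd by simp
 next
  fix j t s' assume I: "?I j t s'" and j: "words s' ''fi'' 0 = j" "j \<le> m"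
  have "\<And>x. x \<in> N \<Longrightarrow> words s' x = words s x" using I by (elim conjE) blast
  from ev(1)[OF j this] show "wfits W s' num \<and> wval s' num = m" .
 next
  fix j t s' assume I: "?I j t s'" and j: "words s' ''fi'' 0 = j" "j < m"
  have I': "str s' (?Z j) E1 spd w rsg" "gok s' (tuples n (?Z j) E1) spd w" "sound (?Z j)" "\<And>p. words s' ''ff'' p \<le> 1"
   "t + k * card (tuples n Z E1) \<le> k * card (tuples n (?Z j) E1) + (18 * h + 66) * j"
   and N: "\<And>x. x \<in> N \<Longrightarrow> words s' x = words s x"
   and st: "words s' ''rc'' = words s ''rc''" "reals s' ''d'' = reals s ''d''" "reals s' ''sg'' = reals s ''sg''" "reals s' ''w'' = reals s ''w''"
   using I by blast+
  note ab' = ab[OF j(2)]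
  have n': "words s' ''n'' 0 = n" using N[of "''n''"] nn by (simp add: N_def)
  have ZS: "upd3 (?Z j) sd (fa j) (fb j) (insert e (?Z j sd (fa j) (fb j))) = ?Z (Suc j)"
   by (simp add: ins_insert lessThan_Suc)
  have sW: "sd < W" using sd W_const(4) by linarith
  let ?s1 = "wupd s' ''qa'' 0 (fa j)"
  let ?s2 = "wupd ?s1 ''qb'' 0 (fb j)"
  have e1: "wfits W s' ea" "wval s' ea = fa j" using ev(2)[OF j N] by simp_all
  have e2: "wfits W ?s1 eb" "wval ?s1 eb = fb j" using ev(2)[of ?s1 j] j N Nd by simp_all
  have e3: "wfits W ?s2 ee" "wval ?s2 ee = e" using ev(2)[of ?s2 j] j N Nd by simp_all
  show "wp W (''qa'' ::= ea ;; ''qb'' ::= eb ;; WSet ''q'' (C sd) ee ;; ''sd'' ::= C sd ;; new_elem)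
   (\<lambda>u s''. words s'' ''fi'' 0 = j \<and> ?I (Suc j) (t + u) (wupd s'' ''fi'' 0 (Suc j))) s'"
   apply (simp add: wp_simps e1 e2 e3 sW)
   apply (rule wp_conseq, rule new_elem_wp[where Z = "?Z j" and S = E1 and sd = sd and a = "fa j" and b = "fb j" and e = e])
   subgoal using I'(1) by simp
   subgoal using I'(2) by simp
   subgoal using n' by simp
   subgoal using wa st by (simp add: warr_def)
   subgoal by (rule sd)
   subgoal using ab' by simp
   subgoal using ab' by simp
   apply simp_all[4]
   subgoal using ab' by simp
   subgoal by (rule I'(3))
   subgoal using ab' by (simp add: st)
   subgoal using ab' by (simp add: st)
   subgoal using rc by (simp add: st)
   subgoal using I'(4) by simp
   subgoal premises P for u s''
   proof -
    have frN: "words s'' x = words s x" if "x \<in> N" for x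
     using P(2)[OF Nd(6)[OF that]] Nd[OF that] N[OF that] by simp
    have fr: "words s'' ''fi'' 0 = j" "words s'' ''rc'' = words s ''rc''"
      "reals s'' ''d'' = reals s ''d''" "reals s'' ''sg'' = reals s ''sg''" "reals s'' ''w'' = reals s ''w''"
     by (simp_all add: P(2,3) j st)
    have Q: "str s'' (?Z (Suc j)) E1 spd w rsg" "gok s'' (tuples n (?Z (Suc j)) E1) spd w" "sound (?Z (Suc j))" "\<forall>p. words s'' ''ff'' p \<le> 1"
     "u + k * card (tuples n (?Z j) E1) \<le> k * card (tuples n (?Z (Suc j)) E1) + (18 * h + 62)"
     using P(1) unfolding ZS k_def by blast+
    have time: "t + (4 + u) + k * card (tuples n Z E1) \<le> k * card (tuples n (?Z (Suc j)) E1) + (18 * h + 66) * Suc j"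
     using Q(5) I'(5) by (simp add: algebra_simps)
    show ?thesis using Q(1-4) fr time frN Nd by simp
   qed
   done
 next
  fix t s' assume "?I m t s'"
  then show "str s' Z' E1 spd w rsg \<and> gok s' (tuples n Z' E1) spd w \<and> sound Z' \<and> (\<forall>p. words s' ''ff'' p \<le> 1) \<and>
   t + 2 * m + 2 + k * card (tuples n Z E1) \<le> k * card (tuples n Z' E1) + (18 * h + 68) * m + 2"
   unfolding Z'_def by (simp add: algebra_simps)
 qed simp
qed

end

context ram begin

lemma store_trees:
 assumes S: "store s T D w g"
  and eq: "\<And>x. x \<in> store_words - {''tl'', ''tf''} \<Longrightarrow> words s' x = words s x" "\<And>x. x \<in> {''lsp_weight'', ''lsp_count''} \<Longrightarrow> reals s' x = reals s x"
  and tr: "trees (words s' ''tl'') (reals s' ''kl'') n (PL T) (KL D w)" "trees (words s' ''tf'') (reals s' ''kf'') n (PF T) (KF D w)"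
 shows "store s' T D w g"
 using S tr unfolding store_def by (simp add: eq)

end

section \<open>Settling one pair\<close>

context alg begin

text \<open>
 For the set \<open>P\<close> of settled pairs, \<open>rc\<close> is its flag array, \<open>d\<close> and \<open>sg\<close> are the distances and
 path counts, \<open>bl\<close> lists the predecessors (their number is in \<open>bn\<close>), and \<open>or\<close> is the settling order.
\<close>

definition dist_ok :: "state \<Rightarrow> (nat \<times> nat) set \<Rightarrow> bool" where
 "dist_ok s P \<longleftrightarrow> (\<forall>x<n. \<forall>y<n. if (x, y) \<in> P
   then words s ''rc'' (x * n + y) = 1 \<and> reach x y \<and> reals s ''d'' (x * n + y) = spd x y \<and> reals s ''sg'' (x * n + y) = rsg x y
   else words s ''rc'' (x * n + y) = 0 \<and> reals s ''sg'' (x * n + y) = 0 \<and> words s ''bn'' (x * n + y) = 0)"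

definition lists_ok :: "state \<Rightarrow> (nat \<times> nat) set \<Rightarrow> bool" where
 "lists_ok s P \<longleftrightarrow> (\<forall>x y. (x, y) \<in> P \<longrightarrow> words s ''bn'' (x * n + y) \<le> n \<and>
   distinct (seg n (words s ''bl'') (x * n + y) (words s ''bn'' (x * n + y))) \<and>
   set (seg n (words s ''bl'') (x * n + y) (words s ''bn'' (x * n + y))) = {b. y \<in> YE x b})"

text \<open>Diagonal pairs are settled without passing through the global tree, so the order of
  settling records only pairs with different ends.\<close>

definition codes :: "(nat \<times> nat) set \<Rightarrow> nat set" where
 "codes P = (\<lambda>(x, y). x * n + y) ` {(x, y) \<in> P. x \<noteq> y}"

definition ord_ok :: "state \<Rightarrow> (nat \<times> nat) set \<Rightarrow> bool" where
 "ord_ok s P \<longleftrightarrow> (let os = map (words s ''or'') [0..<words s ''oc'' 0] in distinct os \<and> set os = codes P \<and>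
   sorted_wrt (\<lambda>p q. spd (p div n) (p mod n) \<le> spd (q div n) (q mod n)) os)"

text \<open>By the last condition settled pairs are no farther than those still to come; it keeps
  the order in \<open>or\<close> sorted by distance when a pair is appended.\<close>

definition finv :: "state \<Rightarrow> fam \<Rightarrow> (nat \<times> nat) set \<Rightarrow> bool" where
 "finv s Z P \<longleftrightarrow> str s Z E1 spd w rsg \<and> gok s (tuples n Z E1) spd w \<and> sound Z \<and> complete Z P \<and> words s ''n'' 0 = n \<and> warr s \<and>
   (\<forall>p. words s ''ff'' p \<le> 1) \<and> P \<subseteq> {..<n} \<times> {..<n} \<and> (\<forall>x<n. (x, x) \<in> P) \<and> dist_ok s P \<and> lists_ok s P \<and> ord_ok s P \<and>
   (\<forall>x y x' y'. (x, y) \<in> P \<longrightarrow> (x', y') \<in> todo P \<longrightarrow> spd x y \<le> spd x' y')"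

lemma codesE: "z \<in> codes P \<Longrightarrow> \<exists>x y. (x, y) \<in> P \<and> x \<noteq> y \<and> z = x * n + y"
 by (auto simp: codes_def)

lemma codes_bound: "P \<subseteq> {..<n} \<times> {..<n} \<Longrightarrow> codes P \<subseteq> {..<n * n}"
 by (auto simp: codes_def intro!: digit_less)

definition settle :: com where
 "settle =
   (''fp'' ::= WSub (WGet ''tg'' (C 1)) (C 1) ;;
   ''fx'' ::= WDiv (V ''fp'') (V ''n'') ;; ''fy'' ::= WMod (V ''fp'') (V ''n'') ;;
   ''kap'' ::=r RGet ''kg'' (V ''fp'') ;;
   ''ts'' ::= WMul (V ''n'') (V ''n'') ;; ''tb'' ::= C 0 ;; ''tk'' ::= C 0 ;; ''tj'' ::= V ''fp'' ;;
   tree_delete ''tg'' ''kg'' ;;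
   WSet ''rc'' (V ''fp'') (C 1) ;; RSet ''d'' (V ''fp'') (R ''kap'') ;;
   WSet ''or'' (V ''oc'') (V ''fp'') ;; ''oc'' ::= WAdd (V ''oc'') (C 1) ;;
   collect ''tl'' ''kl'' ''bl'' ''bn'' ;; collect ''tf'' ''kf'' ''ml'' ''mn'' ;;
   For ''fi'' (WGet ''bn'' (V ''fp''))
    (RSet ''sg'' (V ''fp'') (RAdd (RGet ''sg'' (V ''fp'')) (RGet ''sg'' (ix2 (V ''fx'') (WGet ''bl'' (ix2 (V ''fp'') (V ''fi''))))))) ;;
   links (Suc 0) (WGet ''bn'' (V ''fp'')) (V ''fx'') (WGet ''bl'' (ix2 (V ''fp'') (V ''fi''))) (V ''fy'') ;;
   links 0 (WGet ''mn'' (V ''fp'')) (WGet ''ml'' (ix2 (V ''fp'') (V ''fi''))) (V ''fy'') (V ''fx''))"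

definition deg :: "nat \<Rightarrow> nat \<Rightarrow> nat" where
 "deg x y = card {b. y \<in> YE x b} + card {a. x \<in> XE a y}"

lemma settle_wp:
 assumes I: "finv s Z P" and n: "0 < n" and r0: "words s ''tg'' 1 \<noteq> 0"
 shows "wp W settle (\<lambda>t s'. \<exists>Z' x y. (x, y) \<notin> P \<and> x < n \<and> y < n \<and> finv s' Z' (insert (x, y) P) \<and> words s' ''oc'' 0 = Suc (words s ''oc'' 0) \<and>
   t + (18 * h + 52) * card (tuples n Z E1) \<le> (18 * h + 52) * card (tuples n Z' E1) + (30 * h + 100) * deg x y + (6 * h + 60)) s"
proof -
 have F: "str s Z E1 spd w rsg" "gok s (tuples n Z E1) spd w" "sound Z" "complete Z P" "words s ''n'' 0 = n" "warr s"
   "\<And>p. words s ''ff'' p \<le> 1" "P \<subseteq> {..<n} \<times> {..<n}" "\<And>x. x < n \<Longrightarrow> (x, x) \<in> P" "dist_ok s P" "lists_ok s P" "ord_ok s P"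
   "\<And>x y x' y'. (x, y) \<in> P \<Longrightarrow> (x', y') \<in> todo P \<Longrightarrow> spd x y \<le> spd x' y'"
  using I unfolding finv_def by blast+
 define T where "T = tuples n Z E1"
 have nn: "0 < n * n" using n by simp
 have G: "tree (words s ''tg'') (reals s ''kg'') (n * n) 0 0 (gpres s T) (\<lambda>p. gkey T spd w (p div n) (p mod n))"
  using F(2) by (simp add: gok_def T_def)
 define p where "p = words s ''tg'' 1 - 1"
 define x where "x = p div n"
 define y where "y = p mod n"
 note R = tree_root_Some[OF G nn, unfolded add_0, OF r0, folded p_def x_def y_def]
 have p: "p < n * n" "words s ''rc'' p = 0" "PL T x y \<noteq> {}" using R(1) by (auto simp: gpres_def x_def y_def)
 have pe: "p = x * n + y" by (simp add: x_def y_def)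
 have xy: "x < n" "y < n" using p(1) n by (auto simp: x_def y_def div_less_iff_less_mult)
 have xyP: "(x, y) \<notin> P" using F(10) p(2) xy unfolding dist_ok_def pe by force
 have dgP: "\<forall>z<n. (z, z) \<in> P" using F(9) by blast
 have mn0: "gkey T spd w x y \<le> gkey T spd w x' y'" if "x' < n" "y' < n" "(x', y') \<notin> P" "PL T x' y' \<noteq> {}" for x' y'
 proof -
  have "x' * n + y' \<in> gpres s T" using F(10) that digit_less[of x' n y' n] by (auto simp: gpres_def dist_ok_def)
  from R(3)[OF this] show ?thesis using that by simp
 qed
 have mn: "\<forall>x' y'. x' < n \<longrightarrow> y' < n \<longrightarrow> (x', y') \<notin> P \<longrightarrow> PL T x' y' \<noteq> {} \<longrightarrow> gkey T spd w x y \<le> gkey T spd w x' y'"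
  using mn0 by blast
 note q = strD(4)[OF F(1), folded T_def]
 note MK = min_key_pair[OF F(3,4) dgP xy xyP, folded T_def, OF p(3) q mn]
 have small: "(x', y') \<in> P" if "x' < n" "y' < n" "reach x' y'" "spd x' y' < spd x y" for x' y'
  using MK(4)[of x' y'] that by (force simp: todo_def)
 have LP: "b < n \<and> (x, b) \<in> P \<and> b \<noteq> y" if "y \<in> YE x b" for b
 proof -
  have "b < n" using that YE_n by blast
  moreover have "reach x b" using that by (simp add: YE_def)
  ultimately show ?thesis using small[of x b] YE_less[OF that] xy by auto
 qed
 have FP: "a < n \<and> (a, y) \<in> P \<and> a \<noteq> x" if "x \<in> XE a y" for a
 proof -
  have "a < n" using that XE_n by blast
  moreover have "reach a y" using that by (simp add: XE_def)
  ultimately show ?thesis using small[of a y] XE_less[OF that] xy by auto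
 qed
 define os where "os = map (words s ''or'') [0..<words s ''oc'' 0]"
 have os: "distinct os" "set os = codes P" "sorted_wrt (\<lambda>p q. spd (p div n) (p mod n) \<le> spd (q div n) (q mod n)) os" "length os = words s ''oc'' 0"
  using F(12) by (auto simp: ord_ok_def Let_def os_def)
 have "card (set os) \<le> card {..<n * n}" unfolding os(2) using codes_bound[OF F(8)] by (intro card_mono) auto
 then have oc: "words s ''oc'' 0 \<le> n * n" using distinct_card[OF os(1)] os(4) by simp
 have WW: "p < W" "x < W" "y < W" "words s ''oc'' 0 < W" "Suc (words s ''oc'' 0) < W" "words s ''tg'' (Suc 0) < W" "x * n < W" "p * n < W"
 proof -
  have "words s ''tg'' (0 + 1) \<le> n * n" by (rule tree_entry_le[OF G]) (use nn in linarith)+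
  then have "words s ''tg'' (Suc 0) \<le> n * n" by simp
  then show "words s ''tg'' (Suc 0) < W" using W_const(7) by linarith
  show "words s ''oc'' 0 < W" "Suc (words s ''oc'' 0) < W" using oc W_const(7,10) by linarith+
 qed (use p xy in \<open>auto simp: bnd\<close>)
 have rd: "words s ''tg'' (Suc 0) - Suc 0 = p" "reals s ''kg'' p = spd x y" "p div n = x" "p mod n = y"
  using R(2) MK(3) by (simp_all add: p_def x_def y_def)
 have codes': "codes (insert (x, y) P) = insert p (codes P)" "p \<notin> codes P"
 proof -
  show "codes (insert (x, y) P) = insert p (codes P)" using MK(2) by (auto simp: codes_def pe)
  show "p \<notin> codes P"
  proof
   assume "p \<in> codes P"
   then obtain x' y' where a: "(x', y') \<in> P" "x * n + y = x' * n + y'" using codesE[of p P] pe by auto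
   then have "x' < n" "y' < n" using F(8) by auto
   then show False using a xy xyP by auto
  qed
 qed
 have srt: "sorted_wrt (\<lambda>p q. spd (p div n) (p mod n) \<le> spd (q div n) (q mod n)) (os @ [p])"
 proof -
  have "spd (z div n) (z mod n) \<le> spd x y" if zo: "z \<in> set os" for z
  proof -
   obtain x' y' where z: "(x', y') \<in> P" "z = x' * n + y'" using zo os(2) codesE[of z P] by auto
   then have "x' < n" "y' < n" using F(8) by auto
   moreover have "(x, y) \<in> todo P" using xy xyP MK(1) by (simp add: todo_def)
   ultimately show ?thesis using F(13)[OF z(1)] z(2) by simp
  qed
  then show ?thesis using os(3) by (simp add: sorted_wrt_append rd)
 qed
 note S = strD[OF F(1), folded T_def]
 note tr = storeD(3,4)[OF S(1)]
 have trL: "tree (words s ''tl'') (reals s ''kl'') n (p * (2 * n)) (p * n) (PL T x y) (KL spd w x y)"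
  and trF: "tree (words s ''tf'') (reals s ''kf'') n (p * (2 * n)) (p * n) (PF T x y) (KF spd w x y)"
  using tr xy by (auto simp: trees_def pe)
 define mL where "mL = card {b. y \<in> YE x b}"
 define mF where "mF = card {a. x \<in> XE a y}"
 show ?thesis
  unfolding settle_def
  apply (simp add: wp_simps F(5) WW rd)
  apply (rule wp_conseq, rule tree_delete_wp[where b = 0 and k = 0 and sz = "n * n" and h = h and l = p and P = "gpres s T" and key = "\<lambda>p. gkey T spd w (p div n) (p mod n)"])
  apply simp_all[5]
  subgoal by (rule p(1))
  subgoal by (rule two_nn_le)
  subgoal using W_big by simp
  subgoal using W_big by simp
  subgoal using G by simp
  subgoal premises Q1 for t1 s1
  proof -
   have s1: "words s1 ''n'' 0 = n" "words s1 ''fp'' 0 = p" "words s1 ''fx'' 0 = x" "words s1 ''fy'' 0 = y" "reals s1 ''kap'' 0 = spd x y"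
    "words s1 ''oc'' = words s ''oc''" "words s1 ''or'' = words s ''or''" "words s1 ''rc'' = words s ''rc''" "reals s1 ''d'' = reals s ''d''"
    "words s1 ''bl'' = words s ''bl''" "words s1 ''bn'' = words s ''bn''"
    "words s1 ''tl'' = words s ''tl''" "words s1 ''tf'' = words s ''tf''" "reals s1 ''kl'' = reals s ''kl''" "reals s1 ''kf'' = reals s ''kf''"
    by (simp_all add: Q1(2,3) F(5) rd)
   let ?s1 = "wupd (wupd (rupd (wupd s1 ''rc'' p 1) ''d'' p (spd x y)) ''or'' (words s ''oc'' 0) p) ''oc'' 0 (Suc (words s ''oc'' 0))"
   show ?thesis
    apply (simp add: wp_simps s1 WW)
    apply (rule wp_conseq, rule collect_wp[where p = p and \<kappa> = "spd x y" and P = "PL T x y" and key = "KL spd w x y"])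
    apply (simp)
    apply (simp_all add: s1)[2]
    subgoal by (rule p(1))
    apply ((simp add: s1))
    subgoal using trL by (simp add: s1)
    subgoal by (rule MK(7))
    subgoal premises Q2 for t2 s2
    proof -
     note Q2' = Q2(1)[unfolded MK(5), folded mL_def]
     have s2: "words s2 ''n'' 0 = n" "words s2 ''fp'' 0 = p" "words s2 ''fx'' 0 = x" "words s2 ''fy'' 0 = y" "reals s2 ''kap'' 0 = spd x y"
      "words s2 ''tf'' = words s ''tf''" "reals s2 ''kf'' = reals s ''kf''"
      by (simp_all add: Q2(2,3) s1)
     show ?thesis
      apply (rule wp_Seq, rule wp_conseq, rule collect_wp[where p = p and \<kappa> = "spd x y" and P = "PF T x y" and key = "KF spd w x y"])
      apply (simp)
      apply (simp_all add: s2)[2]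
      subgoal by (rule p(1))
      apply ((simp add: s2))
      subgoal using trF by (simp add: s2)
      subgoal by (rule MK(8))
      subgoal premises Q3 for t3 s3
      proof -
       note Q3' = Q3(1)[unfolded MK(6), folded mF_def]
       have s3: "words s3 ''n'' 0 = n" "words s3 ''fp'' 0 = p" "words s3 ''fx'' 0 = x" "words s3 ''fy'' 0 = y"
        "words s3 ''oc'' 0 = Suc (words s ''oc'' 0)" "words s3 ''or'' = (words s ''or'')(words s ''oc'' 0 := p)"
        "words s3 ''rc'' = (words s ''rc'')(p := 1)" "reals s3 ''d'' = (reals s ''d'')(p := spd x y)" "reals s3 ''sg'' = reals s ''sg''"
        "words s3 ''bl'' = words s2 ''bl''" "words s3 ''bn'' = words s2 ''bn''" "words s3 ''tl'' = words s2 ''tl''" "reals s3 ''kl'' = reals s2 ''kl''"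
        "words s3 ''ff'' = words s ''ff''" "words s3 ''fl'' = words s ''fl''" "words s3 ''fc'' = words s ''fc''" "reals s3 ''w'' = reals s ''w''"
        "words s3 ''tg'' = words s1 ''tg''" "reals s3 ''kg'' = reals s ''kg''"
        by (simp_all add: Q3(2,3) Q2(2,3) Q1(2,3) F(5) rd)
       have o: "words s3 z = words s z" if "z \<in> store_words - {''tl'', ''tf''}" for z
        using that by (auto simp: Q3(2) Q2(2) Q1(2))
       have o': "reals s3 z = reals s z" if "z \<in> {''lsp_weight'', ''lsp_count''}" for z
        using that by (auto simp: Q3(3) Q2(3) Q1(3))
       define L where "L = seg n (words s2 ''bl'') p mL"
       define Fs where "Fs = seg n (words s3 ''ml'') p mF"
       have L: "distinct L" "set L = {b. y \<in> YE x b}" "length L = mL" "mL \<le> n" "words s3 ''bn'' p = mL"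
        "\<And>i. i < mL \<Longrightarrow> words s3 ''bl'' (p * n + i) = L ! i" "t2 \<le> (12 * h + 20) * mL + 10"
        using Q2' by (auto simp: L_def s3)
       have Fs: "distinct Fs" "set Fs = {a. x \<in> XE a y}" "length Fs = mF" "mF \<le> n" "words s3 ''mn'' p = mF"
        "\<And>i. i < mF \<Longrightarrow> words s3 ''ml'' (p * n + i) = Fs ! i" "t3 \<le> (12 * h + 20) * mF + 10"
        using Q3' by (auto simp: Fs_def)
       have Lj: "y \<in> YE x (L ! j)" "L ! j < n" "(x, L ! j) \<in> P" "L ! j \<noteq> y" if "j < mL" for j
        using nth_mem[of j L] that L(2,3) LP by auto
       have Fj: "x \<in> XE (Fs ! j) y" "Fs ! j < n" "(Fs ! j, y) \<in> P" "Fs ! j \<noteq> x" if "j < mF" for j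
        using nth_mem[of j Fs] that Fs(2,3) FP by auto
       \<comment> \<open>The two collections may rewrite inner nodes but restore leaves and keys, so
         the store still represents the same tuples.\<close>
       have store3: "store s3 T spd w rsg"
       proof (rule store_trees[OF S(1) o o'])
        show "trees (words s3 ''tl'') (reals s3 ''kl'') n (PL T) (KL spd w)"
         by (rule trees_upd[OF tr(1) xy, folded pe]) (use Q2' in \<open>auto simp: s3 s1\<close>)
        show "trees (words s3 ''tf'') (reals s3 ''kf'') n (PF T) (KF spd w)"
         by (rule trees_upd[OF tr(2) xy, folded pe]) (use Q3' in \<open>auto simp: s2\<close>)
       qed
       have str3: "str s3 Z E1 spd w rsg" using store3 S(2,3) by (simp add: str_def T_def s3)
       \<comment> \<open>Marking the pair as settled takes it out of the leaves that the global tree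
         must contain, in step with the deletion at the start of \<open>settle\<close>.\<close>
       have gp: "gpres s3 T = gpres s T - {p}" by (auto simp: gpres_def s3)
       have gok3: "gok s3 T spd w" unfolding gok_def gp using Q1(1) by (simp add: s3 Q1(3))
       have pn: "p * n + j < W" if "j < n" for j using that p(1) digit_less[of p "n * n" j n] by (auto simp: bnd)
       have mW: "mL < W" "mF < W" using L(4) Fs(4) W_const(6) by linarith+
       have dP: "words s ''rc'' (x' * n + y') = 1" "reals s ''d'' (x' * n + y') = spd x' y'" "reals s ''sg'' (x' * n + y') = rsg x' y'" "reach x' y'"
        if "(x', y') \<in> P" for x' y'
       proof -
        have "x' < n" "y' < n" using F(8) that by auto
        then show "words s ''rc'' (x' * n + y') = 1" "reals s ''d'' (x' * n + y') = spd x' y'" "reals s ''sg'' (x' * n + y') = rsg x' y'" "reach x' y'"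
         using F(10) that by (auto simp: dist_ok_def)
       qed
       have rcs: "words s ''rc'' z < W" if "z < n * n" for z
       proof -
        have zn: "z div n < n" "z mod n < n" using that n by (auto simp: div_less_iff_less_mult)
        have "words s ''rc'' (z div n * n + z mod n) \<le> 1"
         using F(10)[unfolded dist_ok_def, rule_format, OF zn] by (simp split: if_splits)
        then have "words s ''rc'' z \<le> 1" by simp
        then show ?thesis using W_const(3) by linarith
       qed
       \<comment> \<open>Partial sums of the formula \<open>sg_last\<close>. No predecessor equals
         \<open>y\<close>, so the entry being accumulated is never one of the summands.\<close>
       let ?IS = "\<lambda>j t s'. t = j \<and> reals s' ''sg'' = (reals s ''sg'')(p := sum_list (map (rsg x) (take j L))) \<and>
        (\<forall>z. z \<noteq> ''fi'' \<longrightarrow> words s' z = words s3 z) \<and> (\<forall>z. z \<noteq> ''sg'' \<longrightarrow> reals s' z = reals s3 z)"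
       have sg0: "reals s ''sg'' p = 0" using F(10) xy xyP by (auto simp: dist_ok_def pe)
       show ?thesis
        apply (rule wp_Seq, rule wp_For[where m = mL and I = ?IS])
        subgoal by (rule mW)
        apply (simp)
        subgoal using sg0 by (auto simp: s3)
        subgoal premises J for j t s'
        proof -
         have "words s' ''fp'' = words s3 ''fp''" "words s' ''bn'' = words s3 ''bn''" using J(1) by simp_all
         then show ?thesis using WW mW by (simp add: s3(2) L(5))
        qed
        subgoal premises J for j t s'
        proof -
         have w1: "words s' ''fp'' = words s3 ''fp''" "words s' ''fx'' = words s3 ''fx''" "words s' ''bl'' = words s3 ''bl''" "words s' ''n'' = words s3 ''n''"
          and sg: "reals s' ''sg'' = (reals s ''sg'')(p := sum_list (map (rsg x) (take j L)))" and tj: "t = j"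
          using J(1) by simp_all
         have jn: "j < n" using J(3) L(4) by simp
         have Lx: "x * n + L ! j < W" "L ! j < W" "x * n + L ! j \<noteq> p" "reals s ''sg'' (x * n + L ! j) = rsg x (L ! j)"
          using Lj[OF J(3)] xy dP(3) by (auto simp: bnd pe)
         have tk: "take (Suc j) L = take j L @ [L ! j]" using J(3) L(3) by (simp add: take_Suc_conv_app_nth)
         have jW: "j < W" using jn by (rule in_W(1))
         show ?thesis
          using J(1) by (simp add: wp_simps w1 s3(1-3) J(2) WW pn[OF jn] L(6)[OF J(3)] Lx sg tk tj jW fun_eq_iff)
        qed
        subgoal premises J for t4 s4
        proof -
         have sgsum: "sum_list (map (rsg x) L) = rsg x y"
          using sum_list_distinct_conv_sum_set[OF L(1), of "rsg x"] sg_last[OF MK(2)] L(2) by simp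
         have w4: "words s4 z = words s3 z" if "z \<noteq> ''fi''" for z using J(1) that by blast
         have r4: "reals s4 z = reals s3 z" if "z \<noteq> ''sg''" for z using J(1) that by blast
         have sg4: "reals s4 ''sg'' = (reals s ''sg'')(p := rsg x y)" and t4: "t4 = mL" using J(1) L(3) sgsum by simp_all
         have d4: "reals s4 ''d'' = (reals s ''d'')(p := spd x y)" by (simp add: r4 s3)
         have str4: "str s4 Z E1 spd w rsg" using str3 by (subst str_cong[of s4 s3]) (auto intro!: w4 r4)
         have gok4: "gok s4 (tuples n Z E1) spd w" using gok3 by (subst gok_cong[of s4 s3]) (simp_all add: T_def w4 r4)
         have rc4: "words s4 ''rc'' z < W" if "z < n * n" for z using rcs[OF that] by (simp add: w4 s3)
         have warr4: "warr s4" using F(6) by (simp add: warr_def r4 s3)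
         have pne: "x' * n + y' \<noteq> p" if "(x', y') \<in> P" for x' y'
         proof -
          have "x' < n" "y' < n" using F(8) that by auto
          then show ?thesis using that xy xyP by (auto simp: pe)
         qed
         have dd: "reals s4 ''d'' (x' * n + y') = spd x' y' \<and> reals s4 ''sg'' (x' * n + y') = rsg x' y'" if "(x', y') \<in> P" for x' y'
          using dP[OF that] pne[OF that] by (simp add: d4 sg4)
         \<comment> \<open>\<open>y\<close> enters the right families at all \<open>(x, b)\<close>,
           and below \<open>x\<close> enters the left families at all \<open>(a, y)\<close>. These
           are exactly the memberships that completeness at \<open>(x, y)\<close> demands.\<close>
         let ?Z1 = "ins Z (Suc 0) y ((\<lambda>j. (x, L ! j)) ` {..<mL})"
         let ?Z2 = "ins ?Z1 0 x ((\<lambda>j. (Fs ! j, y)) ` {..<mF})"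
         show ?thesis
          apply (rule wp_Seq, rule wp_conseq, rule links_wp[where Z = Z and sd = "Suc 0" and m = mL and fa = "\<lambda>j. x" and fb = "\<lambda>j. L ! j" and e = y])
          subgoal by (rule str4)
          subgoal by (rule gok4)
          apply ((simp add: w4 s3))
          subgoal by (rule warr4)
          apply (simp)
          subgoal by (rule F(3))
          subgoal by (rule rc4)
          subgoal using F(7) by (simp add: w4 s3)
          subgoal by (rule L(4))
          subgoal premises K for s' j
           using K(3)[of "''fp''"] K(3)[of "''bn''"] WW mW by (simp add: w4 s3 L(5)[unfolded s3])
          subgoal premises K for s' j
          proof -
           have "j < n" using K(2) L(4) by simp
           then have "p * n + j < W" "j < W" using pn in_W(1) by blast+
           moreover have "L ! j < W" by (rule in_W(1)[OF Lj(2)[OF K(2)]])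
           ultimately show ?thesis
            using K(3)[of "''fp''"] K(3)[of "''fx''"] K(3)[of "''fy''"] K(3)[of "''bl''"] K(3)[of "''n''"] WW K(1) L(6)[OF K(2)]
            by (simp add: w4 s3(1-4))
          qed
          subgoal for j using Lj[of j] xy dd[of x "L ! j"] by simp
          subgoal premises Q5 for t5 s5
          proof -
           have w5: "words s5 z = words s3 z"
            if "z \<in> {''n'', ''fp'', ''fx'', ''fy'', ''bl'', ''bn'', ''ml'', ''mn'', ''rc'', ''or'', ''oc''}" for z
            using that by (auto simp: Q5(2) w4)
           have r5: "reals s5 ''d'' = reals s4 ''d''" "reals s5 ''sg'' = reals s4 ''sg''" "reals s5 ''w'' = reals s ''w''"
            by (simp_all add: Q5(3) r4 s3)
           show ?thesis
            apply (rule wp_conseq, rule links_wp[where Z = ?Z1 and sd = 0 and m = mF and fa = "\<lambda>j. Fs ! j" and fb = "\<lambda>j. y" and e = x])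
            subgoal using Q5(1) by blast
            subgoal using Q5(1) by blast
            apply ((simp add: w5 s3))
            subgoal using F(6) by (simp add: warr_def r5)
            apply (simp)
            subgoal using Q5(1) by blast
            subgoal using rcs by (simp add: w5 s3)
            subgoal using Q5(1) by blast
            subgoal by (rule Fs(4))
            subgoal premises K for s' j
             using K(3)[of "''fp''"] K(3)[of "''mn''"] WW mW by (simp add: w5 s3 Fs(5))
            subgoal premises K for s' j
            proof -
             have "j < n" using K(2) Fs(4) by simp
             then have "p * n + j < W" "j < W" using pn in_W(1) by blast+
             moreover have "Fs ! j < W" by (rule in_W(1)[OF Fj(2)[OF K(2)]])
             ultimately show ?thesis
              using K(3)[of "''fp''"] K(3)[of "''fx''"] K(3)[of "''fy''"] K(3)[of "''ml''"] K(3)[of "''n''"] WW K(1) Fs(6)[OF K(2)]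
              by (simp add: w5 s3(1-4))
            qed
            subgoal for j using Fj[of j] xy dd[of "Fs ! j" y] by (simp add: r5)
            subgoal premises Q6 for t6 s6
            proof -
             have w6: "words s6 z = words s3 z"
              if "z \<in> {''n'', ''fp'', ''fx'', ''fy'', ''bl'', ''bn'', ''ml'', ''mn'', ''rc'', ''or'', ''oc''}" for z
              using that w5[OF that] by (auto simp: Q6(2))
             have r6: "reals s6 ''d'' = reals s4 ''d''" "reals s6 ''sg'' = reals s4 ''sg''" "reals s6 ''w'' = reals s ''w''"
              by (simp_all add: Q6(3) r5)
             have J1: "(\<lambda>j. (x, L ! j)) ` {..<mL} = {x} \<times> {b. y \<in> YE x b}"
              using L(2,3) by (auto simp: set_conv_nth)
             have J2: "(\<lambda>j. (Fs ! j, y)) ` {..<mF} = {a. x \<in> XE a y} \<times> {y}"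
              using Fs(2,3) by (auto simp: set_conv_nth)
             have Zsub: "Z sd a b \<subseteq> ?Z2 sd a b" for sd a b by (auto simp: ins_def)
             have comp: "complete ?Z2 (insert (x, y) P)"
              unfolding complete_def
             proof (intro allI impI)
              fix x' y' assume "(x', y') \<in> insert (x, y) P"
              then show "(\<forall>a. x' \<in> XE a y' \<longrightarrow> x' \<in> ?Z2 0 a y') \<and> (\<forall>b. y' \<in> YE x' b \<longrightarrow> y' \<in> ?Z2 (Suc 0) x' b)"
              proof
               assume "(x', y') = (x, y)"
               then show ?thesis unfolding J1 J2 by (auto simp: ins_def)
              next
               assume "(x', y') \<in> P"
               then show ?thesis using F(4) Zsub unfolding complete_def by blast
              qed
             qed
             have dist': "dist_ok s6 (insert (x, y) P)"
              unfolding dist_ok_def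
             proof (intro allI impI)
              fix x' y' assume x': "x' < n" "y' < n"
              have eq: "(x' * n + y' = p) = ((x', y') = (x, y))" using x' xy by (simp add: pe)
              have b3: "words s3 ''bn'' z = words s ''bn'' z" if "z \<noteq> p" for z
               using Q2' that by (simp add: s3 s1)
              show "if (x', y') \<in> insert (x, y) P then words s6 ''rc'' (x' * n + y') = 1 \<and> reach x' y' \<and>
                reals s6 ''d'' (x' * n + y') = spd x' y' \<and> reals s6 ''sg'' (x' * n + y') = rsg x' y'
               else words s6 ''rc'' (x' * n + y') = 0 \<and> reals s6 ''sg'' (x' * n + y') = 0 \<and> words s6 ''bn'' (x' * n + y') = 0"
              proof (cases "(x', y') = (x, y)")
               case True
               then show ?thesis using MK(1) by (simp add: w6 r6 s3 d4 sg4 pe)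
              next
               case False
               then have ne: "x' * n + y' \<noteq> p" using eq by simp
               then show ?thesis using F(10) x' False b3[OF ne] by (auto simp: dist_ok_def w6 r6 s3(7) d4 sg4)
              qed
             qed
             have lists': "lists_ok s6 (insert (x, y) P)"
              unfolding lists_ok_def
             proof (intro allI impI)
              fix x' y' assume a: "(x', y') \<in> insert (x, y) P"
              show "words s6 ''bn'' (x' * n + y') \<le> n \<and>
                distinct (seg n (words s6 ''bl'') (x' * n + y') (words s6 ''bn'' (x' * n + y'))) \<and>
                set (seg n (words s6 ''bl'') (x' * n + y') (words s6 ''bn'' (x' * n + y'))) = {b. y' \<in> YE x' b}"
              proof (cases "(x', y') = (x, y)")
               case True
               have "seg n (words s6 ''bl'') p (words s6 ''bn'' p) = L" unfolding L_def by (simp add: w6 L(5)) (simp add: s3)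
               moreover have "words s6 ''bn'' p = mL" by (simp add: w6 L(5))
               ultimately show ?thesis using True L(1,2,4) by (simp add: pe[symmetric])
              next
               case False
               then have xP: "(x', y') \<in> P" using a by blast
               note ne = pne[OF xP]
               have 1: "words s6 ''bn'' (x' * n + y') = words s ''bn'' (x' * n + y')" using Q2' ne by (simp add: w6 s3 s1)
               have le: "words s ''bn'' (x' * n + y') \<le> n" using F(11) xP by (simp add: lists_ok_def)
               have "seg n (words s6 ''bl'') (x' * n + y') (words s ''bn'' (x' * n + y')) = seg n (words s ''bl'') (x' * n + y') (words s ''bn'' (x' * n + y'))"
               proof (rule seg_cong)
                fix i assume "i < words s ''bn'' (x' * n + y')"
                then have "i < n" using le by simp
                then have "(x' * n + y') * n + i < p * n \<or> (x' * n + y') * n + i \<ge> p * n + n"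
                 using digit_range[OF ne, of n "(x' * n + y') * n + i"] by simp
                then show "words s6 ''bl'' ((x' * n + y') * n + i) = words s ''bl'' ((x' * n + y') * n + i)"
                 using Q2' by (auto simp: w6 s3 s1)
               qed
               then show ?thesis using F(11) xP unfolding 1 by (simp add: lists_ok_def)
              qed
             qed
             have ord': "ord_ok s6 (insert (x, y) P)"
             proof -
              have "map (words s6 ''or'') [0..<words s6 ''oc'' 0] = os @ [p]"
               by (simp add: w6 s3 os_def)
              then show ?thesis using os srt codes' by (simp add: ord_ok_def)
             qed
             have order: "spd x1 y1 \<le> spd x2 y2" if "(x1, y1) \<in> insert (x, y) P" "(x2, y2) \<in> todo (insert (x, y) P)" for x1 y1 x2 y2
              using that F(13) MK(4) by (auto simp: todo_def)
             have "finv s6 ?Z2 (insert (x, y) P)"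
              unfolding finv_def using Q6(1) comp dist' lists' ord' order F(6,8,9) xy
              by (auto simp: w6 s3 warr_def r6)
             moreover have "t6 + (18 * h + 52) * card (tuples n ?Z1 E1) \<le> (18 * h + 52) * card (tuples n ?Z2 E1) + (18 * h + 68) * mF + 2"
              using Q6(1) by blast
             moreover have "t5 + (18 * h + 52) * card (tuples n Z E1) \<le> (18 * h + 52) * card (tuples n ?Z1 E1) + (18 * h + 68) * mL + 2"
              using Q5(1) by blast
             \<comment> \<open>The rate \<open>30 * h + 100\<close> per predecessor or successor is
               \<open>12 * h + 20\<close> for collecting it and \<open>18 * h + 68\<close> for
               linking it; the rest pays for summing path counts.\<close>
             moreover have "deg x y = mL + mF" by (simp add: deg_def mL_def mF_def)
             moreover have "t1 \<le> 6 * h + 4" using Q1(1) by blast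
             ultimately have "finv s6 ?Z2 (insert (x, y) P) \<and> words s6 ''oc'' 0 = Suc (words s ''oc'' 0) \<and>
              t1 + t2 + t3 + t4 + t5 + t6 + 2 * mL + 16 + (18 * h + 52) * card (tuples n Z E1) \<le>
               (18 * h + 52) * card (tuples n ?Z2 E1) + (30 * h + 100) * deg x y + (6 * h + 60)"
              using L(7) Fs(7) t4 by (simp add: w6 s3 algebra_simps)
             then show ?thesis
              by (intro exI[of _ ?Z2] exI[of _ x] exI[of _ y]) (use xyP xy in simp)
            qed
            done
          qed
          done
        qed
        done
      qed
      done
    qed
    done
  qed
  done
qed

end

section \<open>Starting and running the settling phase\<close>

context alg begin

definition reset :: com where
 "reset =
   (For ''fi'' (WMul (V ''n'') (V ''n'')) (WSet ''rc'' (V ''fi'') (C 0) ;; RSet ''sg'' (V ''fi'') RZero ;; WSet ''bn'' (V ''fi'') (C 0)) ;;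
   For ''fi'' (V ''n'') (''fp'' ::= ix2 (V ''fi'') (V ''fi'') ;; WSet ''rc'' (V ''fp'') (C 1) ;; RSet ''sg'' (V ''fp'') ROne ;; RSet ''d'' (V ''fp'') RZero) ;;
   ''oc'' ::= C 0 ;;
   For ''fi'' (WMul (V ''n'') (V ''n'')) (WSet ''q'' (C 0) (WDiv (V ''fi'') (V ''n'')) ;; WSet ''q'' (C 1) (WMod (V ''fi'') (V ''n'')) ;; gput))"

lemma writes_reset [simp]:
 "word_writes reset = {''fi'', ''rc'', ''bn'', ''fp'', ''oc'', ''q''} \<union> word_writes gput" "real_writes reset = {''sg'', ''d''} \<union> real_writes gput"
 by (auto simp: reset_def)

definition diag :: "(nat \<times> nat) set" where "diag = (\<lambda>x. (x, x)) ` {..<n}"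

lemma diag_iff [simp]: "(x, y) \<in> diag \<longleftrightarrow> x = y \<and> x < n" by (auto simp: diag_def)

text \<open>The diagonal counts as settled from the start: distance 0, one empty path, no
  predecessors. Completeness is vacuous there, since no shortest path with equal ends has an edge.
  The global tree is then filled from the tuples that survived the update.\<close>

lemma reset_wp:
 assumes S: "str s Z E1 spd w rsg" and Z: "sound Z" and G: "tree (words s ''tg'') (reals s ''kg'') (n * n) 0 0 {} key0"
  and nn: "words s ''n'' 0 = n" and wa: "warr s" and ff: "\<And>p. words s ''ff'' p \<le> 1"
 shows "wp W reset (\<lambda>t s'. finv s' Z diag \<and> t \<le> (6 * h + 30) * (n * n) + 6 * n + 10) s"
proof -
 define T where "T = tuples n Z E1"
 have S': "store s T spd w rsg" "T \<subseteq> quads n" using strD[OF S] by (auto simp: T_def)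
 let ?I1 = "\<lambda>j t s'. t = 3 * j \<and> (\<forall>p<j. words s' ''rc'' p = 0 \<and> reals s' ''sg'' p = 0 \<and> words s' ''bn'' p = 0) \<and>
   (\<forall>z. z \<notin> {''fi'', ''rc'', ''bn''} \<longrightarrow> words s' z = words s z) \<and> (\<forall>z. z \<noteq> ''sg'' \<longrightarrow> reals s' z = reals s z)"
 let ?I2 = "\<lambda>j t s'. t = 4 * j \<and> (\<forall>x<n. \<forall>y<n. if x = y \<and> x < j then words s' ''rc'' (x * n + y) = 1 \<and> reals s' ''sg'' (x * n + y) = 1 \<and> reals s' ''d'' (x * n + y) = 0
    else words s' ''rc'' (x * n + y) = 0 \<and> reals s' ''sg'' (x * n + y) = 0) \<and> (\<forall>p<n * n. words s' ''bn'' p = 0) \<and>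
   (\<forall>z. z \<notin> {''fi'', ''rc'', ''bn'', ''fp''} \<longrightarrow> words s' z = words s z) \<and> (\<forall>z. z \<notin> {''sg'', ''d''} \<longrightarrow> reals s' z = reals s z)"
 show ?thesis
  unfolding reset_def
  apply (rule wp_Seq, rule wp_For[where m = "n * n" and I = ?I1])
  apply simp_all[3]
  subgoal premises J for j t s'
   using J(1) nn by simp
  subgoal premises J for j t s'
  proof -
   have "j < W" using J(3) by (rule in_W(2))
   then show ?thesis using J(1,2) by (auto simp: wp_simps less_Suc_eq)
  qed
  subgoal premises J1 for t1 s1
   apply (rule wp_Seq, rule wp_For[where m = n and I = ?I2])
   apply simp_all[2]
   subgoal using J1(1) digit_less by auto
   subgoal premises J for j t s'
    using J(1) nn by simp
   subgoal premises J for j t s'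
   proof -
    have WW: "j < W" "j * n < W" "j * n + j < W" using J(3) by (auto simp: bnd)
    have n': "words s' ''n'' 0 = n" using J(1) nn by simp
    note tj = J(1)[THEN conjunct1]
    note v = J(1)[THEN conjunct2, THEN conjunct1, rule_format]
    note bn = J(1)[THEN conjunct2, THEN conjunct2, THEN conjunct1]
    note o = J(1)[THEN conjunct2, THEN conjunct2, THEN conjunct2, THEN conjunct1] J(1)[THEN conjunct2, THEN conjunct2, THEN conjunct2, THEN conjunct2]
    define s2 where "s2 = rupd (rupd (wupd (wupd s' ''fp'' 0 (j * n + j)) ''rc'' (j * n + j) 1) ''sg'' (j * n + j) 1) ''d'' (j * n + j) 0"
    have v': "if x = y \<and> x < Suc j then words s2 ''rc'' (x * n + y) = 1 \<and> reals s2 ''sg'' (x * n + y) = 1 \<and> reals s2 ''d'' (x * n + y) = 0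
       else words s2 ''rc'' (x * n + y) = 0 \<and> reals s2 ''sg'' (x * n + y) = 0" if x: "x < n" "y < n" for x y
    proof (cases "x = j \<and> y = j")
     case True
     then show ?thesis by (simp add: s2_def)
    next
     case False
     then have ne: "x * n + y \<noteq> j * n + j" using x J(3) by simp
     have eq: "(x = y \<and> x < Suc j) = (x = y \<and> x < j)" using False by auto
     have u: "words s2 ''rc'' (x * n + y) = words s' ''rc'' (x * n + y)" "reals s2 ''sg'' (x * n + y) = reals s' ''sg'' (x * n + y)"
      "reals s2 ''d'' (x * n + y) = reals s' ''d'' (x * n + y)"
      by (simp_all add: s2_def ne)
     show ?thesis unfolding u eq by (rule v[OF x])
    qed
    have st: "wp W (''fp'' ::= ix2 (V ''fi'') (V ''fi'') ;; WSet ''rc'' (V ''fp'') (C 1) ;; RSet ''sg'' (V ''fp'') ROne ;; RSet ''d'' (V ''fp'') RZero) Q s' \<longleftrightarrow> Q 4 s2" for Q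
     by (simp add: wp_simps J(2) n' WW eval_nat_numeral s2_def)
    have fi: "words s2 ''fi'' 0 = j" by (simp add: s2_def J(2))
    have bn': "\<forall>p<n * n. words s2 ''bn'' p = 0" using bn by (simp add: s2_def)
    have w2: "\<forall>z. z \<notin> {''fi'', ''rc'', ''bn'', ''fp''} \<longrightarrow> words s2 z = words s z" using o(1) by (simp add: s2_def)
    have r2: "\<forall>z. z \<notin> {''sg'', ''d''} \<longrightarrow> reals s2 z = reals s z" using o(2) by (simp add: s2_def)
    have v2: "\<forall>x<n. \<forall>y<n. if x = y \<and> x < Suc j then words s2 ''rc'' (x * n + y) = 1 \<and> reals s2 ''sg'' (x * n + y) = 1 \<and> reals s2 ''d'' (x * n + y) = 0
       else words s2 ''rc'' (x * n + y) = 0 \<and> reals s2 ''sg'' (x * n + y) = 0" using v' by blast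
    have tt: "t + 4 = 4 * Suc j" using tj by simp
    show ?thesis
     unfolding st
     apply (intro conjI fi tt)
     subgoal using v2 by simp
     subgoal using bn' by simp
     subgoal using w2 by simp
     subgoal using r2 by simp
     done
   qed
   subgoal premises J2 for t2 s2
   proof -
    have r2: "if x = y then words s2 ''rc'' (x * n + y) = 1 \<and> reals s2 ''sg'' (x * n + y) = 1 \<and> reals s2 ''d'' (x * n + y) = 0
       else words s2 ''rc'' (x * n + y) = 0 \<and> reals s2 ''sg'' (x * n + y) = 0" if "x < n" "y < n" for x y
     using J2(1)[THEN conjunct2, THEN conjunct1, rule_format, OF that] that by simp
    have bn2: "words s2 ''bn'' p = 0" if "p < n * n" for p
     using J2(1)[THEN conjunct2, THEN conjunct2, THEN conjunct1] that by blast
    have w2: "words s2 z = words s z" if "z \<notin> {''fi'', ''rc'', ''bn'', ''fp''}" for z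
     using J2(1)[THEN conjunct2, THEN conjunct2, THEN conjunct2, THEN conjunct1] that by blast
    have rr2: "reals s2 z = reals s z" if "z \<notin> {''sg'', ''d''}" for z
     using J2(1)[THEN conjunct2, THEN conjunct2, THEN conjunct2, THEN conjunct2] that by blast
    have t12: "t1 = 3 * (n * n)" "t2 = 4 * n" using J1(1)[THEN conjunct1] J2(1)[THEN conjunct1] by simp_all
    define Pr where "Pr = gpres s2 T"
    let ?gk = "\<lambda>p. gkey T spd w (p div n) (p mod n)"
    have Pr: "Pr = {p. p < n * n \<and> words s2 ''rc'' p = 0 \<and> PL T (p div n) (p mod n) \<noteq> {}}" by (simp add: Pr_def gpres_def)
    let ?I3 = "\<lambda>j t s'. t \<le> (6 * h + 18) * j \<and> tree (words s' ''tg'') (reals s' ''kg'') (n * n) 0 0 (Pr \<inter> {..<j}) ?gk \<and>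
      (\<forall>z. z \<notin> {''fi'', ''q''} \<union> word_writes gput \<longrightarrow> words s' z = words (wupd s2 ''oc'' 0 0) z) \<and> (\<forall>z. z \<notin> real_writes gput \<longrightarrow> reals s' z = reals s2 z)"
    show ?thesis
     apply (simp only: wp_simps wval.simps)
     apply (intro conjI)
     apply simp_all[2]
     apply (rule wp_For[where m = "n * n" and I = ?I3])
     apply simp_all[2]
     subgoal
      using tree_cong[OF _ _ _ G, of "words s ''tg''" "reals s ''kg''" ?gk] by (simp add: w2 rr2)
     subgoal premises J for j t s'
     proof -
      have "words s' ''n'' = words s ''n''" using J(1) by (simp add: w2)
      then show ?thesis using nn by simp
     qed
     subgoal premises J for j t s'
     proof -
      define x where "x = j div n"
      define y where "y = j mod n"
      have n: "0 < n" using J(3) by (cases n) auto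
      have xy: "x < n" "y < n" and jx: "x * n + y = j" using J(3) n by (auto simp: x_def y_def div_less_iff_less_mult)
      have w': "words s' z = words s2 z" if "z \<notin> {''fi'', ''q'', ''oc''} \<union> word_writes gput" for z
       using J(1) that by simp
      have r': "reals s' z = reals s2 z" if "z \<notin> real_writes gput" for z using J(1) that by blast
      have tr: "tree (words s' ''tg'') (reals s' ''kg'') (n * n) 0 0 (Pr \<inter> {..<j}) ?gk" and tj: "t \<le> (6 * h + 18) * j" using J(1) by blast+
      have n': "words s' ''n'' 0 = n" using nn by (simp add: w' w2)
      have WW: "j < W" "x < W" "y < W" using J(3) xy by (auto intro: in_W)
      have "words s2 ''rc'' j = 1 \<or> words s2 ''rc'' j = 0" using r2[OF xy] unfolding jx by presburger
      then have rcW: "words s2 ''rc'' j < W" by (elim disjE) simp_all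
      have st': "store s' T spd w rsg" using S'(1) by (subst store_cong[of s' s]) (auto simp: w' w2 r' rr2)
      have ins: "(if words s2 ''rc'' j = 0 \<and> PL T x y \<noteq> {} then insert j (Pr \<inter> {..<j}) else Pr \<inter> {..<j}) = Pr \<inter> {..<Suc j}"
       using J(3) by (auto simp: Pr x_def y_def less_Suc_eq)
      have gk: "(if B then ?gk(j := gkey T spd w x y) else ?gk) = ?gk" for B by (auto simp: x_def y_def)
      show ?thesis
       apply (simp add: wp_simps J(2) n' WW flip: x_def y_def)
       apply (rule wp_conseq, rule gput_wp[where T = T and D = spd and w = w and g = rsg and x = x and y = y and P = "Pr \<inter> {..<j}" and key = ?gk])
       subgoal using st' by simp
       apply ((simp add: n'))
       subgoal by (rule xy)
       subgoal by (rule xy)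
       apply simp_all[2]
       subgoal using rcW by (simp add: jx w')
       subgoal using tr by simp
       subgoal premises Q for u s''
       proof -
        have rcj: "words (wupd (wupd s' ''q'' 0 x) ''q'' (Suc 0) y) ''rc'' (x * n + y) = words s2 ''rc'' j" by (simp add: jx w')
        note Q1 = Q(1)[unfolded rcj, unfolded jx ins gk]
        have time: "t + (2 + u) \<le> (6 * h + 18) * Suc j" using Q1 tj by (simp add: algebra_simps)
        have "words s'' ''fi'' 0 = j" by (simp add: Q(2) J(2))
        moreover have "words s'' z = words (wupd s2 ''oc'' 0 0) z" if "z \<notin> {''fi'', ''q''} \<union> word_writes gput" for z
         using J(1) that Q(2)[of z] by simp
        moreover have "reals s'' z = reals s2 z" if "z \<notin> real_writes gput" for z using r'[OF that] Q(3)[OF that] by simp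
        ultimately show ?thesis using time Q1 by simp
       qed
       done
     qed
     subgoal premises J3 for t3 s3
     proof -
      have w': "words s3 z = words s2 z" if "z \<notin> {''fi'', ''q'', ''oc''} \<union> word_writes gput" for z
       using J3(1) that by simp
      have r': "reals s3 z = reals s2 z" if "z \<notin> real_writes gput" for z using J3(1) that by blast
      have oc: "words s3 ''oc'' 0 = 0" using J3(1) by simp
      have tr: "tree (words s3 ''tg'') (reals s3 ''kg'') (n * n) 0 0 Pr ?gk"
      proof -
       have "Pr \<inter> {..<n * n} = Pr" by (auto simp: Pr)
       then show ?thesis using J3(1) by metis
      qed
      have "gpres s3 T = Pr" by (simp add: gpres_def Pr w')
      then have gok: "gok s3 (tuples n Z E1) spd w" using tr by (simp add: gok_def T_def)
      have str: "str s3 Z E1 spd w rsg" using S by (subst str_cong[of s3 s]) (auto simp: w' w2 r' rr2)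
      have noself: "{b. x \<in> YE x b} = {}" for x using YE_less[of x x] spd_nonneg by (fastforce simp: YE_def)
      have noself2: "{a. x \<in> XE a x} = {}" for x using XE_less[of x _ x] spd_nonneg by (fastforce simp: XE_def)
      have comp: "complete Z diag" using noself noself2 by (auto simp: complete_def)
      have dist: "dist_ok s3 diag" using r2 bn2 digit_less by (fastforce simp: dist_ok_def w' r')
      have lists: "lists_ok s3 diag" using bn2 digit_less noself by (auto simp: lists_ok_def w')
      have ord: "ord_ok s3 diag" by (auto simp: ord_ok_def oc codes_def)
      have "finv s3 Z diag"
       unfolding finv_def using str gok Z comp dist lists ord nn wa ff spd_nonneg
       by (auto simp: w' w2 warr_def r' rr2 todo_def diag_def)
      moreover have "t3 \<le> (6 * h + 18) * (n * n)" using J3(1) by blast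
      ultimately show ?thesis using t12 by (simp add: algebra_simps)
     qed
     done
   qed
   done
  done
qed

text \<open>For \<open>n = 0\<close> the predicate \<open>tree\<close> says nothing about entry 1 of
  the global tree, so the loop is guarded.\<close>

definition fixup :: com where
 "fixup = (reset ;; Cond (WLess (C 0) (V ''n'')) (While (TNot (WEq (WGet ''tg'' (C 1)) (C 0))) settle) Skip)"

definition full :: "fam" where
 "full = (\<lambda>sd a b. if sd = 0 then XE a b else if sd = 1 then YE a b else {})"

definition degs :: nat where "degs = (\<Sum>(x, y)\<in>{..<n} \<times> {..<n}. deg x y)"

text \<open>The empty global tree is the state in which the next \<open>reset\<close> has to start.
  Agreement with \<open>full\<close> is stated for the tuples because soundness and completeness
  speak only of the sides 0 and 1.\<close>

definition settled :: "state \<Rightarrow> bool" where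
 "settled s \<longleftrightarrow> (\<exists>Z P. finv s Z P \<and> todo P = {} \<and> (\<exists>key. tree (words s ''tg'') (reals s ''kg'') (n * n) 0 0 {} key) \<and>
   tuples n Z E1 = tuples n full E1)"

lemma reach_n: "reach a b \<Longrightarrow> a < n \<Longrightarrow> b < n"
proof -
 have "walk E a p b \<Longrightarrow> a < n \<Longrightarrow> b < n" for p
  using E_n by (induction p arbitrary: a) auto
 then show "reach a b \<Longrightarrow> a < n \<Longrightarrow> b < n" by (auto simp: reach_def)
qed

lemma complete_full:
 assumes "complete Z P" "sound Z" "todo P = {}"
 shows "Z 0 a b = XE a b" "a < n \<Longrightarrow> Z (Suc 0) a b = YE a b"
proof -
 have sub: "Z 0 a b \<subseteq> XE a b" "Z (Suc 0) a b \<subseteq> YE a b" using assms(2) unfolding sound_def by blast+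
 have P: "(x, y) \<in> P" if "x < n" "y < n" "reach x y" for x y using assms(3) that by (auto simp: todo_def)
 have "x \<in> Z 0 a b" if x: "x \<in> XE a b" for x
 proof -
  have "x < n" using XE_n x by blast
  moreover have "reach x b" using XE_reach x by blast
  ultimately have "(x, b) \<in> P" using P reach_n by blast
  then show ?thesis using assms(1) x by (auto simp: complete_def)
 qed
 then show "Z 0 a b = XE a b" using sub by blast
 have "y \<in> Z (Suc 0) a b" if y: "y \<in> YE a b" "a < n" for y
 proof -
  have "y < n" using YE_n y by blast
  then have "(a, y) \<in> P" using P YE_reach[OF y(1)] y(2) by blast
  then show ?thesis using assms(1) y by (auto simp: complete_def)
 qed
 then show "a < n \<Longrightarrow> Z (Suc 0) a b = YE a b" using sub by blast
qed

lemma settled_exit: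
 assumes F: "finv s Z P" and r0: "0 < n \<Longrightarrow> words s ''tg'' 1 = 0"
 shows "settled s" "tuples n Z E1 = tuples n full E1"
proof -
 have F': "sound Z" "complete Z P" "\<forall>x<n. (x, x) \<in> P" "dist_ok s P" using F by (simp_all add: finv_def)
 define T where "T = tuples n Z E1"
 have G': "tree (words s ''tg'') (reals s ''kg'') (n * n) 0 0 (gpres s T) (\<lambda>p. gkey T spd w (p div n) (p mod n))"
  using F by (simp add: finv_def gok_def T_def)
 have pres: "gpres s T = {}"
 proof (cases "n = 0")
  case False
  then have "words s ''tg'' (0 + 1) = 0" "0 < n * n" using r0 by simp_all
  then show ?thesis using tree_root_None[OF G'] by blast
 next
  case True
  show ?thesis unfolding gpres_def using True by simp
 qed
 have td: "todo P = {}"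
 proof (rule no_key_no_todo[OF F'(2)])
  show "(z, z) \<in> P" if "z < n" for z using F'(3) that by blast
  show "PL (tuples n Z E1) x y = {}" if "x < n" "y < n" "(x, y) \<notin> P" for x y
  proof (rule ccontr)
   assume "PL (tuples n Z E1) x y \<noteq> {}"
   then have "x * n + y \<in> gpres s T" using that F'(4) digit_less[of x n y n] by (auto simp: gpres_def T_def dist_ok_def)
   then show False using pres by simp
  qed
 qed
 show "tuples n Z E1 = tuples n full E1"
  using complete_full[OF F'(2,1) td] by (auto simp: tuples_def full_def)
 then show "settled s" unfolding settled_def using F td G' pres by auto
qed

lemma fixup_wp:
 assumes S: "str s Z E1 spd w rsg" and Z: "sound Z" and G: "tree (words s ''tg'') (reals s ''kg'') (n * n) 0 0 {} key0"
  and nn: "words s ''n'' 0 = n" and wa: "warr s" and ff: "\<And>p. words s ''ff'' p \<le> 1"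
 shows "wp W fixup (\<lambda>t s'. settled s' \<and>
   t + (18 * h + 52) * card (tuples n Z E1) \<le> (18 * h + 52) * card (tuples n full E1) + (30 * h + 100) * degs + (12 * h + 91) * (n * n) + 6 * n + 13) s"
proof -
 define k where "k = 18 * h + 52"
 \<comment> \<open>The allowance for one settled pair: the bound of \<open>settle_wp\<close> and one
   step for the loop test.\<close>
 define f where "f = (\<lambda>(x, y). (30 * h + 100) * deg x y + (6 * h + 61))"
 let ?I = "\<lambda>t s'. \<exists>Z' P. finv s' Z' P \<and> t + k * card (tuples n Z E1) \<le> k * card (tuples n Z' E1) + sum f (P - diag)"
 have exit: "settled s' \<and> t0 + 1 + t + 1 + k * card (tuples n Z E1) \<le> k * card (tuples n full E1) + (30 * h + 100) * degs + (12 * h + 91) * (n * n) + 6 * n + 13"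
  if t0: "t0 \<le> (6 * h + 30) * (n * n) + 6 * n + 10" and I: "?I t s'" and r0: "0 < n \<Longrightarrow> words s' ''tg'' 1 = 0" for t t0 s'
 proof -
  obtain Z' P where F: "finv s' Z' P" and t: "t + k * card (tuples n Z E1) \<le> k * card (tuples n Z' E1) + sum f (P - diag)" using I by blast
  have "P \<subseteq> {..<n} \<times> {..<n}" using F by (simp add: finv_def)
  then have "sum f (P - diag) \<le> sum f ({..<n} \<times> {..<n})" by (intro sum_mono2) auto
  moreover have "sum f ({..<n} \<times> {..<n}) = (30 * h + 100) * degs + (6 * h + 61) * (n * n)"
   by (simp add: f_def degs_def case_prod_unfold sum.distrib sum_distrib_left)
  moreover have "(6 * h + 61) * (n * n) + (6 * h + 30) * (n * n) = (12 * h + 91) * (n * n)" by (simp add: algebra_simps)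
  ultimately show ?thesis using t t0 settled_exit[OF F r0] by simp
 qed
 show ?thesis
  unfolding fixup_def k_def[symmetric]
  apply (rule wp_Seq, rule wp_conseq, rule reset_wp[OF S Z G nn wa ff])
  subgoal premises Q for t0 s0
  proof -
   have F0: "finv s0 Z diag" and t0: "t0 \<le> (6 * h + 30) * (n * n) + 6 * n + 10" using Q(1) by blast+
   have I0: "?I 0 s0" using F0 by (intro exI[of _ Z] exI[of _ diag]) simp
   have n0: "words s0 ''n'' 0 = n" using F0 by (simp add: finv_def)
   show ?thesis
   proof (rule wp_Cond)
    show "tfits W s0 (WLess (C 0) (V ''n''))" using n0 by simp
   next
    assume "\<not> tval s0 (WLess (C 0) (V ''n''))"
    then have "n = 0" using n0 by simp
    then show "wp W Skip (\<lambda>t s'. settled s' \<and>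
      t0 + Suc t + k * card (tuples n Z E1) \<le> k * card (tuples n full E1) + (30 * h + 100) * degs + (12 * h + 91) * (n * n) + 6 * n + 13) s0"
     using exit[OF t0 I0] by (intro wp_Skip) simp
   next
    assume "tval s0 (WLess (C 0) (V ''n''))"
    then have n: "0 < n" using n0 by simp
    show "wp W (While (TNot (WEq (WGet ''tg'' (C 1)) (C 0))) settle) (\<lambda>t s'. settled s' \<and>
      t0 + Suc t + k * card (tuples n Z E1) \<le> k * card (tuples n full E1) + (30 * h + 100) * degs + (12 * h + 91) * (n * n) + 6 * n + 13) s0"
     \<comment> \<open>\<open>oc\<close> counts the settled pairs off the diagonal, whose codes lie
       below \<open>n * n\<close>, and every round raises it by one.\<close>
     apply (rule wp_While[where I = ?I and \<mu> = "\<lambda>s. Suc (n * n) - words s ''oc'' 0"])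
     subgoal by (rule I0)
     subgoal premises J for t s'
     proof -
      obtain Z' P where F: "finv s' Z' P" using J by blast
      have G': "tree (words s' ''tg'') (reals s' ''kg'') (n * n) 0 0 (gpres s' (tuples n Z' E1)) (\<lambda>p. gkey (tuples n Z' E1) spd w (p div n) (p mod n))"
       using F by (simp add: finv_def gok_def)
      have "0 < n * n" using n by simp
      then have "words s' ''tg'' (0 + 1) \<le> n * n" by (intro tree_entry_le[OF G']) linarith+
      then have "words s' ''tg'' (Suc 0) \<le> n * n" by simp
      then have "words s' ''tg'' (Suc 0) < W" using W_const(7) by linarith
      then show ?thesis by simp
     qed
     subgoal premises J for t s'
     proof -
      obtain Z' P where F: "finv s' Z' P" and t: "t + k * card (tuples n Z E1) \<le> k * card (tuples n Z' E1) + sum f (P - diag)" using J(1) by blast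
      have r0: "words s' ''tg'' 1 \<noteq> 0" using J(2) by simp
      have P: "P \<subseteq> {..<n} \<times> {..<n}" "\<forall>x<n. (x, x) \<in> P" and O: "ord_ok s' P" using F by (simp_all add: finv_def)
      have "card (codes P) \<le> card {..<n * n}" using codes_bound[OF P(1)] by (intro card_mono) auto
      moreover have "card (codes P) = words s' ''oc'' 0"
       using O distinct_card[of "map (words s' ''or'') [0..<words s' ''oc'' 0]"] by (simp add: ord_ok_def Let_def)
      ultimately have oc: "words s' ''oc'' 0 \<le> n * n" by simp
      show ?thesis
       apply (rule wp_conseq, rule settle_wp[OF F n r0])
       subgoal premises R for u s''
       proof -
        obtain Z'' x y where r: "(x, y) \<notin> P" "x < n" "y < n" "finv s'' Z'' (insert (x, y) P)" "words s'' ''oc'' 0 = Suc (words s' ''oc'' 0)"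
         "u + k * card (tuples n Z' E1) \<le> k * card (tuples n Z'' E1) + (30 * h + 100) * deg x y + (6 * h + 60)"
         using R(1) unfolding k_def by blast
        have fP: "finite P" using finite_subset[OF P(1)] by simp
        have "(x, y) \<notin> diag" using r P by auto
        then have "insert (x, y) P - diag = insert (x, y) (P - diag)" by auto
        then have "sum f (insert (x, y) P - diag) = f (x, y) + sum f (P - diag)" using fP r(1) by simp
        then have "t + u + 1 + k * card (tuples n Z E1) \<le> k * card (tuples n Z'' E1) + sum f (insert (x, y) P - diag)"
         using r(6) t by (simp add: f_def)
        then show ?thesis using r(4,5) oc by auto
       qed
       done
     qed
     subgoal premises J for t s'
      using exit[OF t0 J(1)] J(2) by simp
     done
   qed
  qed
  done
qed

end

section \<open>Changing the edges at a vertex\<close>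

text \<open>The places for edges at \<open>v\<close> that a scan has visited after \<open>j\<close>
  rounds; \<open>j = n\<close> gives all of them.\<close>

definition inc :: "nat \<Rightarrow> nat \<Rightarrow> (nat \<times> nat) set" where
 "inc v j = {(x, y). x = v \<and> y < j \<or> y = v \<and> x < j}"

lemma inc_0 [simp]: "inc v 0 = {}" by (simp add: inc_def)

lemma inc_Suc: "inc v (Suc j) = insert (v, j) (insert (j, v) (inc v j))"
 by (auto simp: inc_def)

lemma card_inc: "finite (inc v j)" "card (inc v j) \<le> 2 * j"
proof -
 have "finite (inc v j) \<and> card (inc v j) \<le> 2 * j"
 proof (induction j)
  case (Suc j)
  then have "card (insert (v, j) (insert (j, v) (inc v j))) \<le> Suc (Suc (card (inc v j)))"
   by (metis card_insert_le_m1 card_insert_if finite_insert le_SucI order_refl Suc_leI le_imp_less_Suc lessI)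
  then show ?case using Suc by (simp add: inc_Suc)
 qed simp
 then show "finite (inc v j)" "card (inc v j) \<le> 2 * j" by blast+
qed

definition graph_rep :: "nat \<Rightarrow> state \<Rightarrow> (nat \<times> nat) set \<Rightarrow> (nat \<times> nat \<Rightarrow> real) \<Rightarrow> bool" where
 "graph_rep n s E w \<longleftrightarrow> (\<forall>x<n. \<forall>y<n. (words s ''eg'' (x * n + y) \<noteq> 0 \<longleftrightarrow> (x, y) \<in> E) \<and> words s ''eg'' (x * n + y) \<le> 1 \<and>
   ((x, y) \<in> E \<longrightarrow> reals s ''w'' (x * n + y) = w (x, y)))"

lemma graph_repD:
 assumes "graph_rep n s E w" "x < n" "y < n"
 shows "words s ''eg'' (x * n + y) \<noteq> 0 \<longleftrightarrow> (x, y) \<in> E" "words s ''eg'' (x * n + y) \<le> 1" "(x, y) \<in> E \<Longrightarrow> reals s ''w'' (x * n + y) = w (x, y)"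
 using assms by (auto simp: graph_rep_def)

lemma graph_rep_cong: "words s' ''eg'' = words s ''eg'' \<Longrightarrow> reals s' ''w'' = reals s ''w'' \<Longrightarrow> graph_rep n s' E w = graph_rep n s E w"
 by (simp add: graph_rep_def)

section \<open>Tuples of single edges at a vertex\<close>

context ram begin

definition edge_test :: test where
 "edge_test = TAnd (TNot (WEq (WGet ''eg'' (ix2 (WGet ''q'' (C 0)) (WGet ''q'' (C 1)))) (C 0))) (TNot (WEq (WGet ''q'' (C 0)) (WGet ''q'' (C 1))))"

definition rm1 :: com where
 "rm1 = Cond edge_test (''qa'' ::= WGet ''q'' (C 1) ;; ''qb'' ::= WGet ''q'' (C 0) ;; del) Skip"

definition add1 :: com where
 "add1 = Cond edge_test
   (''qa'' ::= WGet ''q'' (C 1) ;; ''qb'' ::= WGet ''q'' (C 0) ;;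
   ''qw'' ::=r RGet ''w'' (ix2 (WGet ''q'' (C 0)) (WGet ''q'' (C 1))) ;; ''qc'' ::=r ROne ;; add) Skip"

lemma writes_rm1 [simp]:
 "word_writes rm1 = {''qa'', ''qb''} \<union> word_writes del" "real_writes rm1 = real_writes del"
 "word_writes add1 = {''qa'', ''qb''} \<union> word_writes add" "real_writes add1 = {''qw'', ''qc''} \<union> real_writes add"
 by (auto simp: rm1_def add1_def)

lemma tuples_edge:
 assumes "fam_ok n Z"
 shows "tuples n Z (S - {(x, y)}) = tuples n Z S - {(x, y, x, y)}" "tuples n Z (insert (x, y) S) = insert (x, y, x, y) (tuples n Z S)"
  "(x, y, x, y) \<in> tuples n Z S \<longleftrightarrow> (x, y) \<in> S"
 using assms by (auto simp: tuples_def fam_ok_def)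

lemma edge_test:
 assumes "graph_rep n s E w" "words s ''n'' 0 = n" "words s ''q'' 0 = x" "words s ''q'' (Suc 0) = y" "x < n" "y < n"
 shows "tfits W s edge_test" "tval s edge_test \<longleftrightarrow> (x, y) \<in> E \<and> x \<noteq> y"
proof -
 have WW: "x < W" "y < W" "x * n < W" "x * n + y < W" using assms(5,6) by (auto simp: bnd)
 have "words s ''eg'' (x * n + y) < W" using graph_repD(2)[OF assms(1,5,6)] W_const(3) by linarith
 then show "tfits W s edge_test" using WW assms by (simp add: edge_test_def)
 show "tval s edge_test \<longleftrightarrow> (x, y) \<in> E \<and> x \<noteq> y" using graph_repD(1)[OF assms(1,5,6)] assms by (simp add: edge_test_def)
qed

lemma rm1_wp:
 assumes S: "str s Z S D w g" and nn: "words s ''n'' 0 = n" and gr: "graph_rep n s E w'"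
  and q: "words s ''q'' 0 = x" "words s ''q'' (Suc 0) = y" "x < n" "y < n"
  and mem: "(x, y) \<in> E \<and> x \<noteq> y \<longleftrightarrow> (x, y) \<in> S"
 shows "wp W rm1 (\<lambda>t s'. t \<le> 12 * h + 44 \<and> str s' Z (S - {(x, y)}) D w g) s"
proof -
 note et = edge_test[OF gr nn q]
 have WW: "x < W" "y < W" using q by (auto simp: in_W)
 show ?thesis
  unfolding rm1_def
 proof (rule wp_Cond[OF et(1)])
  assume "tval s edge_test"
  then have m: "(x, y) \<in> S" using et(2) mem by simp
  note S' = strD[OF S]
  note te = tuples_edge[OF S'(3)]
  show "wp W (''qa'' ::= WGet ''q'' (C 1) ;; ''qb'' ::= WGet ''q'' (C 0) ;; del)
    (\<lambda>t s'. Suc t \<le> 12 * h + 44 \<and> str s' Z (S - {(x, y)}) D w g) s"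
   apply (simp add: wp_simps q WW)
   apply (rule wp_conseq, rule del_wp[where T = "tuples n Z S" and D = D and w = w and g = g and x = x and a = y and b = x and y = y])
   subgoal using S'(1) by simp
   apply ((simp add: nn))
   subgoal using te(3) m by blast
   apply ((simp add: q))
   apply simp_all[2]
   apply ((simp add: q))
   subgoal premises P for t s'
    using P(1) S'(2,3) unfolding str_def by (simp add: te P(2))
   done
 next
  assume "\<not> tval s edge_test"
  then have "S - {(x, y)} = S" using et(2) mem by blast
  then show "wp W Skip (\<lambda>t s'. Suc t \<le> 12 * h + 44 \<and> str s' Z (S - {(x, y)}) D w g) s"
   using S by (intro wp_Skip) simp
 qed
qed

lemma add1_wp:
 assumes S: "str s Z S D w g" and nn: "words s ''n'' 0 = n" and gr: "graph_rep n s E w"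
  and q: "words s ''q'' 0 = x" "words s ''q'' (Suc 0) = y" "x < n" "y < n"
  and new: "(x, y) \<notin> S \<or> x = y" and D: "\<And>z. D z z = 0"
 shows "wp W add1 (\<lambda>t s'. t \<le> 12 * h + 36 \<and> str s' Z (if (x, y) \<in> E \<and> x \<noteq> y then insert (x, y) S else S) D w g) s"
proof -
 note et = edge_test[OF gr nn q]
 have WW: "x < W" "y < W" "x * n < W" "x * n + y < W" using q by (auto simp: bnd)
 show ?thesis
  unfolding add1_def
 proof (rule wp_Cond[OF et(1)])
  assume "tval s edge_test"
  then have m: "(x, y) \<in> E \<and> x \<noteq> y" using et(2) by simp
  note S' = strD[OF S]
  note te = tuples_edge[OF S'(3)]
  show "wp W (''qa'' ::= WGet ''q'' (C 1) ;; ''qb'' ::= WGet ''q'' (C 0) ;;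
   ''qw'' ::=r RGet ''w'' (ix2 (WGet ''q'' (C 0)) (WGet ''q'' (C 1))) ;; ''qc'' ::=r ROne ;; add)
    (\<lambda>t s'. Suc t \<le> 12 * h + 36 \<and> str s' Z (if (x, y) \<in> E \<and> x \<noteq> y then insert (x, y) S else S) D w g) s"
   unfolding if_P[OF m]
   apply (simp add: wp_simps q WW nn)
   apply (rule wp_conseq, rule add_wp[where T = "tuples n Z S" and D = D and w = w and g = g and x = x and a = y and b = x and y = y])
   subgoal using S'(1) by simp
   apply ((simp add: nn))
   subgoal using te(3) new m by blast
   subgoal by (rule q)
   subgoal by (rule q)
   subgoal by (rule q)
   subgoal by (rule q)
   apply ((simp add: q))
   apply simp_all[2]
   apply ((simp add: q))
   subgoal using graph_repD(3)[OF gr q(3,4)] m by (simp add: D)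
   apply ((simp add: D))
   apply ((simp add: tct_def))
   subgoal premises P for t s'
    using P(1) S'(2,3) unfolding str_def by (simp add: te P(2))
   done
 next
  assume "\<not> tval s edge_test"
  then show "wp W Skip (\<lambda>t s'. Suc t \<le> 12 * h + 36 \<and> str s' Z (if (x, y) \<in> E \<and> x \<noteq> y then insert (x, y) S else S) D w g) s"
   using S et(2) by (intro wp_Skip) auto
 qed
qed

definition scan :: "com \<Rightarrow> com" where
 "scan c = For ''ui'' (V ''n'')
   (WSet ''q'' (C 0) (V ''ui'') ;; WSet ''q'' (C 1) (V ''uv'') ;; c ;; WSet ''q'' (C 0) (V ''uv'') ;; WSet ''q'' (C 1) (V ''ui'') ;; c)"

lemma writes_scan [simp]: "word_writes (scan c) = {''ui'', ''q''} \<union> word_writes c" "real_writes (scan c) = real_writes c"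
 by (auto simp: scan_def)

text \<open>In the round of \<open>v\<close> itself the pair \<open>(v, v)\<close> comes up twice.
  The alternative \<open>x = y\<close> in the assumption on \<open>c\<close> admits the second
  visit; a loop never carries a tuple.\<close>

lemma scan_wp:
 assumes I0: "Inv {} s" and nn: "words s ''n'' 0 = n" and v: "words s ''uv'' 0 = v" "v < n"
  and cw: "word_writes c \<inter> {''ui'', ''uv'', ''n'', ''q''} = {}"
  and upd: "\<And>A s' z i a. z = ''ui'' \<or> z = ''q'' \<Longrightarrow> Inv A s' \<Longrightarrow> Inv A (wupd s' z i a)"
  and c: "\<And>A s' x y. Inv A s' \<Longrightarrow> words s' ''n'' 0 = n \<Longrightarrow> words s' ''q'' 0 = x \<Longrightarrow> words s' ''q'' (Suc 0) = y \<Longrightarrow> x < n \<Longrightarrow> y < n \<Longrightarrow>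
    (x, y) \<notin> A \<or> x = y \<Longrightarrow> (x, y) \<in> inc v n \<Longrightarrow> wp W c (\<lambda>t s''. t \<le> K \<and> Inv (insert (x, y) A) s'') s'"
 shows "wp W (scan c) (\<lambda>t s'. t \<le> (2 * K + 6) * n + 2 \<and> Inv (inc v n) s') s"
proof -
 let ?I = "\<lambda>j t s'. t \<le> (2 * K + 4) * j \<and> Inv (inc v j) s' \<and> words s' ''n'' 0 = n \<and> words s' ''uv'' 0 = v"
 show ?thesis
  unfolding scan_def
  apply (rule wp_For[where m = n and I = ?I])
  apply simp_all[2]
  subgoal using upd[OF _ I0, of "''ui''" 0 0] nn v by simp
  apply (simp)
  subgoal premises J for j t s'
  proof -
   have WW: "j < W" "v < W" using J(3) v(2) by (auto simp: in_W)
   let ?s1 = "wupd (wupd s' ''q'' 0 j) ''q'' (Suc 0) v"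
   have I1: "Inv (inc v j) ?s1" by (intro upd) (use J(1) in simp_all)
   have st: "words s' ''n'' 0 = n" "words s' ''uv'' 0 = v" "t \<le> (2 * K + 4) * j" using J(1) by blast+
   show ?thesis
    apply (simp add: wp_simps st J(2) WW)
    apply (rule wp_conseq, rule c[OF I1, where x = j and y = v])
    apply ((simp add: st))
    apply simp_all[2]
    subgoal by (rule J(3))
    subgoal by (rule v)
    subgoal by (auto simp: inc_def)
    subgoal using J(3) by (auto simp: inc_def)
    subgoal premises P for t1 s1
    proof -
     have s1: "words s1 ''n'' 0 = n" "words s1 ''uv'' 0 = v" "words s1 ''ui'' 0 = j"
      using cw P(2)[of "''n''"] P(2)[of "''uv''"] P(2)[of "''ui''"] st J(2) by auto
     have t1: "t1 \<le> K" and Is: "Inv (insert (j, v) (inc v j)) s1" using P(1) by blast+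
     have I2: "Inv (insert (j, v) (inc v j)) (wupd (wupd s1 ''q'' 0 v) ''q'' (Suc 0) j)"
      by (intro upd) (use Is in simp_all)
     show ?thesis
      apply (simp add: wp_simps s1 WW)
      apply (rule wp_conseq, rule c[OF I2, where x = v and y = j])
      apply ((simp add: s1))
      apply simp_all[2]
      subgoal by (rule v)
      subgoal by (rule J(3))
      subgoal by (auto simp: inc_def)
      subgoal using J(3) by (auto simp: inc_def)
      subgoal premises Q for t2 s2
      proof -
       have "words s2 ''n'' 0 = n" "words s2 ''uv'' 0 = v" "words s2 ''ui'' 0 = j"
        using cw Q(2)[of "''n''"] Q(2)[of "''uv''"] Q(2)[of "''ui''"] s1 by auto
       moreover have "Inv (inc v (Suc j)) (wupd s2 ''ui'' 0 (Suc j))" unfolding inc_Suc by (intro upd) (use Q(1) in simp_all)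
       moreover have "t2 \<le> K" using Q(1) by blast
       ultimately show ?thesis using t1 st(3) by (simp add: algebra_simps)
      qed
      done
    qed
    done
  qed
  apply ((simp add: algebra_simps))
  done
qed

text \<open>The single edges at \<open>v\<close> leave the store while the old graph is still in
  memory and return from the new one, so no stored weight has to be adjusted in place.\<close>

lemma rm_edges_wp:
 assumes S: "str s Z {(x, y) \<in> E. x \<noteq> y} D w g" and nn: "words s ''n'' 0 = n" and v: "words s ''uv'' 0 = v" "v < n" and gr: "graph_rep n s E w'"
 shows "wp W (scan rm1) (\<lambda>t s'. t \<le> (24 * h + 94) * n + 2 \<and> str s' Z ({(x, y) \<in> E. x \<noteq> y} - inc v n) D w g) s"
proof -
 let ?I = "\<lambda>A s'. str s' Z ({(x, y) \<in> E. x \<noteq> y} - A) D w g \<and> graph_rep n s' E w'"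
 show ?thesis
  apply (rule wp_conseq, rule scan_wp[where Inv = ?I and K = "12 * h + 44", OF _ nn v])
  subgoal using S gr by simp
  apply (simp)
  subgoal by (auto simp: graph_rep_def)
  subgoal premises P for A s' x y
   apply (rule wp_conseq, rule rm1_wp[where x = x and y = y and E = E and w' = w' and Z = Z and D = D and w = w and g = g and S = "{(x, y) \<in> E. x \<noteq> y} - A"])
   subgoal using P(1) by blast
   subgoal by (rule P(2))
   subgoal using P(1) by blast
   subgoal by (rule P(3))
   subgoal by (rule P(4))
   subgoal by (rule P(5))
   subgoal by (rule P(6))
   subgoal using P(7) by auto
   subgoal premises Q for t s''
   proof -
    have "graph_rep n s'' E w'" using P(1) by (subst graph_rep_cong[of s'' s']) (simp_all add: Q)
    moreover have "{(x, y) \<in> E. x \<noteq> y} - A - {(x, y)} = {(x, y) \<in> E. x \<noteq> y} - insert (x, y) A" by blast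
    ultimately show ?thesis using Q(1) by simp
   qed
   done
  subgoal premises Q for t s'
   using Q(1) by (simp add: algebra_simps)
  done
qed

lemma add_edges_wp:
 assumes S: "str s Z ({(x, y) \<in> E. x \<noteq> y} - inc v n) D w g" and nn: "words s ''n'' 0 = n" and v: "words s ''uv'' 0 = v" "v < n"
  and gr: "graph_rep n s E w" and D: "\<And>z. D z z = 0" and E: "E \<subseteq> {..<n} \<times> {..<n}"
 shows "wp W (scan add1) (\<lambda>t s'. t \<le> (24 * h + 94) * n + 2 \<and> str s' Z {(x, y) \<in> E. x \<noteq> y} D w g) s"
proof -
 let ?E = "{(x, y) \<in> E. x \<noteq> y}"
 have fin: "?E - inc v n \<union> (?E \<inter> inc v n) = ?E" by blast
 show ?thesis
  apply (rule wp_conseq, rule scan_wp[where Inv = "\<lambda>A s'. str s' Z (?E - inc v n \<union> (?E \<inter> A)) D w g \<and> graph_rep n s' E w" and K = "12 * h + 36", OF _ nn v])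
  subgoal using S gr by simp
  apply (simp)
  subgoal by (auto simp: graph_rep_def)
  subgoal premises P for A s' x y
   apply (rule wp_conseq, rule add1_wp[where x = x and y = y and E = E and Z = Z and D = D and w = w and g = g and S = "?E - inc v n \<union> (?E \<inter> A)"])
   subgoal using P(1) by blast
   subgoal by (rule P(2))
   subgoal using P(1) by blast
   subgoal by (rule P(3))
   subgoal by (rule P(4))
   subgoal by (rule P(5))
   subgoal by (rule P(6))
   subgoal using P(7,8) by blast
   subgoal by (rule D)
   subgoal premises Q for t s''
   proof -
    have "graph_rep n s'' E w" using P(1) by (subst graph_rep_cong[of s'' s']) (simp_all add: Q)
    moreover have "(if (x, y) \<in> E \<and> x \<noteq> y then insert (x, y) (?E - inc v n \<union> (?E \<inter> A)) else ?E - inc v n \<union> (?E \<inter> A)) =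
      ?E - inc v n \<union> (?E \<inter> insert (x, y) A)" by auto
    ultimately show ?thesis using Q(1) by simp
   qed
   done
  subgoal premises Q for t s'
   using Q(1)[unfolded fin] by (simp add: algebra_simps)
  done
qed

end

section \<open>Carrying out the update on the stored graph\<close>

lemma graph_rep_remove:
 assumes "graph_rep n s E w" "a < n" "b < n"
 shows "graph_rep n (wupd s ''eg'' (a * n + b) 0) (E - {(a, b)}) w"
 using assms unfolding graph_rep_def by auto

lemma graph_rep_weight:
 assumes "graph_rep n s E w" "a < n" "b < n"
 shows "graph_rep n (rupd s ''w'' (a * n + b) r) E (w((a, b) := r))"
 using assms unfolding graph_rep_def by auto

lemma graph_rep_insert:
 assumes "graph_rep n s E w" "a < n" "b < n"
 shows "graph_rep n (rupd (wupd s ''eg'' (a * n + b) (Suc 0)) ''w'' (a * n + b) (w (a, b))) (insert (a, b) E) w"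
 using assms unfolding graph_rep_def by auto

text \<open>Only the input arrays are fixed, relative to some state \<open>s0\<close>: other arrays
  have changed by the time \<open>edit\<close> reads its input, and an update need not set every
  input array.\<close>

definition loaded :: "update \<Rightarrow> state \<Rightarrow> bool" where
 "loaded u s \<longleftrightarrow> (\<exists>s0. (\<forall>z\<in>{''upd_kind'', ''upd_vertex'', ''upd_len'', ''upd_src'', ''upd_dst''}. words s z = words (load_update u s0) z) \<and>
   reals s ''upd_wt'' = reals (load_update u s0) ''upd_wt'')"

fun upd_vertex :: "update \<Rightarrow> nat" where
 "upd_vertex (Delete_Vertex v) = v"
| "upd_vertex (Delete_Edges v es) = v"
| "upd_vertex (Increase_Weights v ps) = v"

lemma loaded_vertex: "loaded u s \<Longrightarrow> words s ''upd_vertex'' 0 = upd_vertex u"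
 by (cases u) (auto simp: loaded_def scalar_def)

definition edit :: com where
 "edit =
   Cond (WEq (V ''upd_kind'') (C 0))
   (For ''ui'' (V ''n'') (WSet ''eg'' (ix2 (V ''ui'') (V ''uv'')) (C 0) ;; WSet ''eg'' (ix2 (V ''uv'') (V ''ui'')) (C 0)))
   (Cond (WEq (V ''upd_kind'') (C 1))
    (For ''ui'' (V ''upd_len'') (WSet ''eg'' (ix2 (WGet ''upd_src'' (V ''ui'')) (WGet ''upd_dst'' (V ''ui''))) (C 0)))
    (For ''ui'' (V ''upd_len'') (RSet ''w'' (ix2 (WGet ''upd_src'' (V ''ui'')) (WGet ''upd_dst'' (V ''ui''))) (RGet ''upd_wt'' (V ''ui'')))))"

lemma writes_edit [simp]: "word_writes edit = {''ui'', ''eg''}" "real_writes edit = {''w''}"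
 by (auto simp: edit_def)

context ram begin

lemma incident_length:
 assumes "distinct es" "\<And>e. e \<in> set es \<Longrightarrow> incident v e \<and> fst e < n \<and> snd e < n"
 shows "length es \<le> 2 * n"
proof -
 have "set es \<subseteq> inc v n" using assms(2) by (fastforce simp: inc_def incident_def)
 then have "card (set es) \<le> 2 * n" using card_mono[OF card_inc(1)] card_inc(2)[of v n] by (meson le_trans)
 then show ?thesis using distinct_card[OF assms(1)] by simp
qed

lemma edit_wp:
 assumes gr: "graph_rep n s (parcs G) w" and nn: "words s ''n'' 0 = n" and v: "words s ''uv'' 0 = upd_vertex u" "upd_vertex u < n"
  and E: "parcs G \<subseteq> {..<n} \<times> {..<n}" and val: "valid_update u (G, w)" and ld: "loaded u s"
 shows "wp W edit (\<lambda>t s'. t \<le> 10 * n + 10 \<and> graph_rep n s' (parcs (fst (apply_update u (G, w)))) (snd (apply_update u (G, w)))) s"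
proof (cases u)
 case (Delete_Vertex v)
 have k: "words s ''upd_kind'' 0 = 0" using ld by (auto simp: loaded_def Delete_Vertex scalar_def)
 have v': "words s ''uv'' 0 = v" "v < n" using v Delete_Vertex by simp_all
 have fin: "{e \<in> parcs G. \<not> incident v e} = parcs G - inc v n" using E by (auto simp: inc_def incident_def)
 let ?I = "\<lambda>j t s'. t = 2 * j \<and> graph_rep n s' (parcs G - inc v j) w \<and> words s' ''n'' 0 = n \<and> words s' ''uv'' 0 = v"
 show ?thesis
  unfolding edit_def
  apply (simp add: wp_simps k)
  apply (rule wp_For[where m = n and I = ?I])
  apply simp_all[2]
  subgoal using gr nn v' by (simp add: graph_rep_def)
  apply (simp)
  subgoal premises J for j t s'
  proof -
   have WW: "j < W" "v < W" "j * n < W" "v * n < W" "j * n + v < W" "v * n + j < W" using J(3) v'(2) by (auto simp: bnd)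
   have st: "words s' ''n'' 0 = n" "words s' ''uv'' 0 = v" "t = 2 * j" using J(1) by blast+
   have "graph_rep n (wupd (wupd s' ''eg'' (j * n + v) 0) ''eg'' (v * n + j) 0) (parcs G - inc v j - {(j, v)} - {(v, j)}) w"
    using J(1,3) v'(2) by (intro graph_rep_remove) auto
   moreover have "parcs G - inc v j - {(j, v)} - {(v, j)} = parcs G - inc v (Suc j)" by (auto simp: inc_Suc)
   ultimately have "graph_rep n (wupd (wupd (wupd s' ''eg'' (j * n + v) 0) ''eg'' (v * n + j) 0) ''ui'' 0 (Suc j)) (parcs G - inc v (Suc j)) w"
    by (subst graph_rep_cong[of _ "wupd (wupd s' ''eg'' (j * n + v) 0) ''eg'' (v * n + j) 0"]) simp_all
   then show ?thesis by (simp add: wp_simps st J(2) WW)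
  qed
  apply ((simp add: Delete_Vertex fin))
  done
next
 case (Delete_Edges v es)
 have es: "distinct es" "\<And>e. e \<in> set es \<Longrightarrow> incident v e \<and> fst e < n \<and> snd e < n" using val E unfolding Delete_Edges by auto
 note len = incident_length[OF es]
 have k: "words s ''upd_kind'' 0 = 1" "words s ''upd_len'' 0 = length es"
  "words s ''upd_src'' = array_of (map fst es)" "words s ''upd_dst'' = array_of (map snd es)"
  using ld by (auto simp: loaded_def Delete_Edges scalar_def)
 have lW: "length es < W" using len W_const(8) by linarith
 let ?I = "\<lambda>j t s'. t = j \<and> graph_rep n s' (parcs G - set (take j es)) w \<and> (\<forall>z. z \<notin> {''ui'', ''eg''} \<longrightarrow> words s' z = words s z)"
 show ?thesis
  unfolding edit_def
  apply (simp add: wp_simps k)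
  apply (rule wp_For[where m = "length es" and I = ?I])
  subgoal by (rule lW)
  apply (simp)
  subgoal using gr by (simp add: graph_rep_def)
  subgoal using lW by (simp add: k)
  subgoal premises J for j t s'
  proof -
   obtain a b where ab: "es ! j = (a, b)" by (cases "es ! j")
   have "es ! j \<in> set es" using J(3) by simp
   then have ab': "a < n" "b < n" using es(2)[of "es ! j"] ab by auto
   have WW: "j < W" "a < W" "b < W" "a * n < W" "a * n + b < W" using ab' J(3) lW by (auto simp: bnd)
   have st: "words s' ''n'' 0 = n" "words s' ''upd_src'' j = a" "words s' ''upd_dst'' j = b" "t = j" using J nn ab k by (simp_all add: array_of_def)
   have "graph_rep n (wupd s' ''eg'' (a * n + b) 0) (parcs G - set (take j es) - {(a, b)}) w"
    using J(1) ab' by (intro graph_rep_remove) auto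
   moreover have "parcs G - set (take j es) - {(a, b)} = parcs G - set (take (Suc j) es)" using J(3) ab by (auto simp: take_Suc_conv_app_nth)
   ultimately have "graph_rep n (wupd (wupd s' ''eg'' (a * n + b) 0) ''ui'' 0 (Suc j)) (parcs G - set (take (Suc j) es)) w"
    by (subst graph_rep_cong[of _ "wupd s' ''eg'' (a * n + b) 0"]) simp_all
   then show ?thesis by (simp add: wp_simps st J(2) WW) (use J(1) in simp)
  qed
  subgoal using len by (simp add: Delete_Edges)
  done
next
 case (Increase_Weights v ps)
 have ps: "distinct (map fst ps)" "\<And>e. e \<in> set (map fst ps) \<Longrightarrow> incident v e \<and> fst e < n \<and> snd e < n" using val E unfolding Increase_Weights by auto
 have len: "length ps \<le> 2 * n" using incident_length[OF ps] by simp
 have k: "words s ''upd_kind'' 0 = 2" "words s ''upd_len'' 0 = length ps"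
  "words s ''upd_src'' = array_of (map (fst \<circ> fst) ps)" "words s ''upd_dst'' = array_of (map (snd \<circ> fst) ps)" "reals s ''upd_wt'' = array_of (map snd ps)"
  using ld by (auto simp: loaded_def Increase_Weights scalar_def)
 have lW: "length ps < W" using len W_const(8) by linarith
 define wj where "wj j = (\<lambda>e. case map_of (take j ps) e of None \<Rightarrow> w e | Some c \<Rightarrow> c)" for j
 let ?I = "\<lambda>j t s'. t = j \<and> graph_rep n s' (parcs G) (wj j) \<and> (\<forall>z. z \<notin> {''ui''} \<longrightarrow> words s' z = words s z) \<and> reals s' ''upd_wt'' = reals s ''upd_wt''"
 show ?thesis
  unfolding edit_def
  apply (simp add: wp_simps k)
  apply (rule wp_For[where m = "length ps" and I = ?I])
  subgoal by (rule lW)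
  apply (simp)
  subgoal using gr by (simp add: graph_rep_def wj_def)
  subgoal using lW by (simp add: k)
  subgoal premises J for j t s'
  proof -
   obtain a b r where ab: "ps ! j = ((a, b), r)" by (metis surj_pair)
   then have "(a, b) \<in> set (map fst ps)" using J(3) by (metis (no_types) fst_conv in_set_conv_nth length_map nth_map)
   then have ab': "a < n" "b < n" using ps(2)[of "(a, b)"] by auto
   have WW: "j < W" "a < W" "b < W" "a * n < W" "a * n + b < W" using ab' J(3) lW by (auto simp: bnd)
   have st: "words s' ''n'' 0 = n" "words s' ''upd_src'' j = a" "words s' ''upd_dst'' j = b" "t = j" "reals s' ''upd_wt'' j = r"
    using J nn ab k by (simp_all add: array_of_def)
   have tk: "take (Suc j) ps = take j ps @ [((a, b), r)]" using J(3) ab by (simp add: take_Suc_conv_app_nth)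
   \<comment> \<open>\<open>map_of\<close> prefers the first entry for an edge whereas the program
     lets the last write win; distinctness of the edges makes the two agree.\<close>
   have "distinct (map fst (take (Suc j) ps))" using ps(1) by (simp add: distinct_take flip: take_map)
   then have "map_of (take j ps) (a, b) = None" unfolding tk by (auto simp: map_of_eq_None_iff)
   then have "wj (Suc j) = (wj j)((a, b) := r)" unfolding wj_def tk by (auto simp: fun_eq_iff map_add_def split: option.splits)
   moreover have "graph_rep n (rupd s' ''w'' (a * n + b) r) (parcs G) ((wj j)((a, b) := r))"
    using J(1) ab' by (intro graph_rep_weight) auto
   ultimately have "graph_rep n (wupd (rupd s' ''w'' (a * n + b) r) ''ui'' 0 (Suc j)) (parcs G) (wj (Suc j))"
    by (subst graph_rep_cong[of _ "rupd s' ''w'' (a * n + b) r"]) simp_all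
   then show ?thesis by (simp add: wp_simps st J(2) WW) (use J(1) in simp)
  qed
  subgoal using len by (simp add: Increase_Weights wj_def)
  done
qed

text \<open>Stored reals and tree keys refer to \<open>D\<close>, \<open>w\<close> and
  \<open>g\<close> only through their values at the tuples present. If these values agree, the same
  memory represents the tuples for other parameters.\<close>

lemma store_values:
 assumes S: "store s T D w g"
  and eq: "\<And>x a b y. (x, a, b, y) \<in> T \<Longrightarrow> D' x b + w' (b, y) = D x b + w (b, y) \<and> w' (x, a) + D' a y = w (x, a) + D a y \<and>
    (a = y \<and> b = x \<or> g' a b = g a b)"
 shows "store s T D' w' g'"
proof -
 note S' = storeD[OF S]
 have "blocks n (words s ''lsp_a'') (words s ''lsp_b'') (words s ''lsp_len'') (words s ''pos'')
    (reals s ''lsp_weight'') (reals s ''lsp_count'') T (twt D' w') (tct g')"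
 proof -
  have tw: "twt D' w' x a b y = twt D w x a b y" and tc: "tct g' x a b y = tct g x a b y" if "(x, a, b, y) \<in> T" for x a b y
   using eq[OF that] by (auto simp: twt_def tct_def)
  show ?thesis
   unfolding blocks_def
  proof (intro conjI allI impI)
   show "T \<subseteq> quads n" by (rule S'(5))
   fix x y i assume x: "x < n" "y < n" "i < words s ''lsp_len'' (x * n + y)"
   note B = blocksD(2)[OF S'(1) x]
   show "reals s ''lsp_weight'' ((x * n + y) * (n * n) + i) =
     twt D' w' x (words s ''lsp_a'' ((x * n + y) * (n * n) + i)) (words s ''lsp_b'' ((x * n + y) * (n * n) + i)) y"
    "reals s ''lsp_count'' ((x * n + y) * (n * n) + i) =
     tct g' x (words s ''lsp_a'' ((x * n + y) * (n * n) + i)) (words s ''lsp_b'' ((x * n + y) * (n * n) + i)) y"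
    using B tw tc by auto
   show "(x, words s ''lsp_a'' ((x * n + y) * (n * n) + i), words s ''lsp_b'' ((x * n + y) * (n * n) + i), y) \<in> T"
    "words s ''pos'' (ix4 n x (words s ''lsp_a'' ((x * n + y) * (n * n) + i)) (words s ''lsp_b'' ((x * n + y) * (n * n) + i)) y) = i"
    using B by blast+
  next
   fix x a b y assume "(x, a, b, y) \<in> T"
   from blocksD(3)[OF S'(1) this]
   show "words s ''pos'' (ix4 n x a b y) < words s ''lsp_len'' (x * n + y)"
    "words s ''lsp_a'' ((x * n + y) * (n * n) + words s ''pos'' (ix4 n x a b y)) = a"
    "words s ''lsp_b'' ((x * n + y) * (n * n) + words s ''pos'' (ix4 n x a b y)) = b" by blast+
  qed
 qed
 moreover have "trees (words s ''tl'') (reals s ''kl'') n (PL T) (KL D' w')"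
  unfolding trees_def
 proof (intro allI impI)
  fix x y assume x: "x < n" "y < n"
  show "tree (words s ''tl'') (reals s ''kl'') n ((x * n + y) * (2 * n)) ((x * n + y) * n) (PL T x y) (KL D' w' x y)"
   by (rule tree_cong[OF refl refl, where key = "KL D w x y"]) (use S'(3) x eq in \<open>auto simp: trees_def PL_def KL_def\<close>)
 qed
 moreover have "trees (words s ''tf'') (reals s ''kf'') n (PF T) (KF D' w')"
  unfolding trees_def
 proof (intro allI impI)
  fix x y assume x: "x < n" "y < n"
  show "tree (words s ''tf'') (reals s ''kf'') n ((x * n + y) * (2 * n)) ((x * n + y) * n) (PF T x y) (KF D' w' x y)"
   by (rule tree_cong[OF refl refl, where key = "KF D w x y"]) (use S'(4) x eq in \<open>auto simp: trees_def PF_def KF_def\<close>)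
 qed
 ultimately show ?thesis using S'(2) unfolding store_def by blast
qed

end

section \<open>What survives an update\<close>

locale alg2 = A: alg n h W E w + B: alg n h W E' w' for n h W E w E' w' +
 fixes v :: nat
 assumes sub: "E' \<subseteq> E" and w_le: "\<And>e. e \<in> E' \<Longrightarrow> w e \<le> w' e"
  and same: "\<And>e. e \<in> E \<Longrightarrow> fst e \<noteq> v \<Longrightarrow> snd e \<noteq> v \<Longrightarrow> e \<in> E' \<and> w' e = w e"
begin

lemma cost_le: "set p \<subseteq> E' \<Longrightarrow> cost w p \<le> cost w' p"
 by (induction p) (auto intro: add_mono w_le)

lemma spd_mono: "B.reach a b \<Longrightarrow> A.spd a b \<le> B.spd a b"
proof -
 assume "B.reach a b"
 then obtain p where p: "p \<in> B.SP a b" using B.SP_exists by blast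
 then have "A.spd a b \<le> cost w p" using sub by (intro A.spd_le walk_mono[OF B.SP_walk(1)])
 also have "\<dots> \<le> cost w' p" using walk_set[OF B.SP_walk(1)[OF p]] by (rule cost_le)
 finally show ?thesis using B.SP_walk(2)[OF p] by simp
qed

lemma avoid:
 assumes "walk E a p b" "v \<notin> set (pawalk_verts a p)"
 shows "walk E' a p b" "cost w' p = cost w p"
proof -
 have "walk E' a p b \<and> cost w' p = cost w p" using assms
 proof (induction p arbitrary: a)
  case (Cons e p)
  obtain x y where e: "e = (x, y)" by (cases e)
  have "y \<in> set (pawalk_verts y p)" using Cons.prems(1) e by (cases p) auto
  then have "x \<noteq> v" "y \<noteq> v" using Cons.prems e by auto
  then show ?case using Cons same[of e] e by auto
 qed simp
 then show "walk E' a p b" "cost w' p = cost w p" by blast+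
qed

text \<open>No old shortest path from \<open>a\<close> to \<open>b\<close> meets \<open>v\<close>,
  so each keeps its edges and cost, while no walk becomes cheaper. Conversely a new shortest walk
  costs no more under the old weights and so was shortest before. Hence even the sets of paths
  agree.\<close>

lemma SP_kept:
 assumes "\<not> A.via a v b" "A.reach a b"
 shows "B.reach a b" "B.spd a b = A.spd a b" "B.sg a b = A.sg a b"
proof -
 have *: "walk E' a p b \<and> cost w' p = A.spd a b" if "p \<in> A.SP a b" for p
  using avoid[OF A.SP_walk(1)[OF that]] A.SP_via[OF that, of v] assms(1) A.SP_walk(2)[OF that] by auto
 obtain p where p: "p \<in> A.SP a b" using A.SP_exists assms(2) by blast
 show r: "B.reach a b" using *[OF p] by (auto simp: B.reach_def)
 show d: "B.spd a b = A.spd a b" using *[OF p] B.spd_le spd_mono[OF r] by force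
 have "B.SP a b = A.SP a b"
 proof
  show "A.SP a b \<subseteq> B.SP a b" using * d by (auto simp: B.SP_def)
  show "B.SP a b \<subseteq> A.SP a b"
  proof
   fix q assume q: "q \<in> B.SP a b"
   have wk: "walk E a q b" using walk_mono[OF B.SP_walk(1)[OF q] sub] .
   have "cost w q \<le> A.spd a b" using cost_le[OF walk_set[OF B.SP_walk(1)[OF q]]] B.SP_walk(2)[OF q] d by simp
   then show "q \<in> A.SP a b" using wk A.spd_le[OF wk] by (simp add: A.SP_def)
  qed
 qed
 then show "B.sg a b = A.sg a b" by (simp add: A.sg_def B.sg_def)
qed

text \<open>The edge \<open>(x, a)\<close> is unchanged because neither end is \<open>v\<close>: the
  start \<open>a\<close> lies on every shortest path from \<open>a\<close> to \<open>b\<close>. The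
  extension stays tight, since its cost is the same and distances cannot shrink.\<close>

lemma XE_kept:
 assumes "\<not> A.via a v b" "x \<in> A.XE a b" "x \<noteq> v"
 shows "x \<in> B.XE a b" "B.spd x b = A.spd x b" "w' (x, a) = w (x, a)"
proof -
 have x: "(x, a) \<in> E" "A.reach a b" "w (x, a) + A.spd a b = A.spd x b" using assms(2) by (simp_all add: A.XE_def)
 have "a \<noteq> v" using assms(1) x(2) by (auto simp: A.via_def)
 then have e: "(x, a) \<in> E'" "w' (x, a) = w (x, a)" using same[OF x(1)] assms(3) by auto
 note k = SP_kept[OF assms(1) x(2)]
 have r: "B.reach x b" using e(1) k(1) B.reach_edge B.reach_trans by blast
 have "B.spd x b \<le> B.spd x a + B.spd a b" using B.spd_triangle[OF B.reach_edge[OF e(1)] k(1)] .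
 then show d: "B.spd x b = A.spd x b" using B.spd_edge[OF e(1)] e(2) k(2) x(3) spd_mono[OF r] by simp
 then show "x \<in> B.XE a b" using e k x by (simp add: B.XE_def)
 show "w' (x, a) = w (x, a)" by (rule e)
qed

lemma YE_kept:
 assumes "\<not> A.via a v b" "y \<in> A.YE a b" "y \<noteq> v"
 shows "y \<in> B.YE a b" "B.spd a y = A.spd a y" "w' (b, y) = w (b, y)"
proof -
 have x: "(b, y) \<in> E" "A.reach a b" "A.spd a b + w (b, y) = A.spd a y" using assms(2) by (simp_all add: A.YE_def)
 have "b \<noteq> v" using assms(1) x(2) by (auto simp: A.via_def)
 then have e: "(b, y) \<in> E'" "w' (b, y) = w (b, y)" using same[OF x(1)] assms(3) by auto
 note k = SP_kept[OF assms(1) x(2)]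
 have r: "B.reach a y" using e(1) k(1) B.reach_edge B.reach_trans by blast
 have "B.spd a y \<le> B.spd a b + B.spd b y" using B.spd_triangle[OF k(1) B.reach_edge[OF e(1)]] .
 then show d: "B.spd a y = A.spd a y" using B.spd_edge[OF e(1)] e(2) k(2) x(3) spd_mono[OF r] by simp
 then show "y \<in> B.YE a b" using e k x by (simp add: B.YE_def)
 show "w' (b, y) = w (b, y)" by (rule e)
qed

lemma E1_kept: "A.E1 - inc v n = B.E1 - inc v n"
 using sub same A.E_n by (fastforce simp: inc_def)

text \<open>The pruned tuples have middle pairs and ends untouched by the update, so their weights
  and counts are those of the new graph. The invariant for the new graph therefore holds for the
  very same memory.\<close>

lemma transfer:
 assumes S: "A.str s Z (A.E1 - inc v n) A.spd w A.rsg" and Z: "\<And>sd a b. Z sd a b \<subseteq> Z0 sd a b" "A.sound Z0"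
  and pr: "\<And>sd a b. a < n \<Longrightarrow> b < n \<Longrightarrow> sd < 2 \<Longrightarrow> v \<notin> Z sd a b \<and> (A.via a v b \<longrightarrow> Z sd a b = {})"
 shows "A.str s Z (B.E1 - inc v n) B.spd w' B.rsg" "B.sound Z"
proof -
 have snd: "x \<in> A.XE a b \<and> x \<noteq> v \<and> \<not> A.via a v b" if "x \<in> Z 0 a b" for x a b
 proof -
  have x: "x \<in> A.XE a b" using that Z unfolding A.sound_def by blast
  then have "a < n" using A.XE_n by blast
  moreover have "b < n" using x A.reach_n[of a b] \<open>a < n\<close> by (simp add: A.XE_def)
  ultimately show ?thesis using x pr[of a b 0] that by auto
 qed
 have snd': "y \<in> A.YE a b \<and> y \<noteq> v \<and> \<not> A.via a v b" if "y \<in> Z (Suc 0) a b" for y a b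
 proof -
  have y: "y \<in> A.YE a b" using that Z unfolding A.sound_def by blast
  then have b: "b < n" "A.reach a b" using A.YE_n by (auto simp: A.YE_def)
  \<comment> \<open>Membership in \<open>YE\<close> bounds only \<open>b\<close> and
    \<open>y\<close>. If \<open>a\<close> differs from \<open>b\<close>, a shortest path to
    \<open>b\<close> leaves \<open>a\<close> along an edge, which puts \<open>a\<close> in
    range.\<close>
  have "a < n"
  proof (cases "a = b")
   case False
   then obtain c where "a \<in> A.XE c b"
    using b(2) A.sg_first[of a b] A.sg_pos[of a b] by (metis (no_types, lifting) Collect_empty_eq less_not_refl sum.empty)
   then show ?thesis using A.XE_n by blast
  qed (use b in simp)
  then show ?thesis using y b pr[of a b "Suc 0"] that by auto
 qed
 show "B.sound Z" unfolding B.sound_def using snd snd' XE_kept(1) YE_kept(1) by blast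
 note S' = A.strD[OF S]
 have "A.store s (tuples n Z (A.E1 - inc v n)) B.spd w' B.rsg"
 proof (rule A.store_values[OF S'(1)])
  fix x a b y assume T: "(x, a, b, y) \<in> tuples n Z (A.E1 - inc v n)"
  then consider "x \<in> Z 0 a b" "y \<in> Z (Suc 0) a b" | "a = y" "b = x" "(x, y) \<in> A.E1 - inc v n"
   by (auto simp: tuples_def)
  then show "B.spd x b + w' (b, y) = A.spd x b + w (b, y) \<and> w' (x, a) + B.spd a y = w (x, a) + A.spd a y \<and>
    (a = y \<and> b = x \<or> B.rsg a b = A.rsg a b)"
  proof cases
   case 1
   note x = snd[OF 1(1)] and y = snd'[OF 1(2)]
   have "A.reach a b" using x by (simp add: A.XE_def)
   then show ?thesis using XE_kept[of a b x] YE_kept[of a b y] SP_kept(3)[of a b] x y by simp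
  next
   case 2
   then have "(x, y) \<in> E" "x \<noteq> v" "y \<noteq> v" using A.E_n by (auto simp: inc_def)
   then show ?thesis using 2 same[of "(x, y)"] by simp
  qed
 qed
 then show "A.str s Z (B.E1 - inc v n) B.spd w' B.rsg"
  unfolding E1_kept[symmetric] A.str_def using S'(2,3) by blast
qed

end

section \<open>Shortest path dags and betweenness scores\<close>

lemma sum_pairs: "(\<Sum>j<n * n. f (j div n) (j mod n)) = (\<Sum>(x, y)\<in>{..<n} \<times> {..<n}. f x (y::nat))" for n :: nat
proof (cases "n = 0")
 case False
 then show ?thesis
  by (intro sum.reindex_bij_witness[where i = "\<lambda>(x, y). x * n + y" and j = "\<lambda>p. (p div n, p mod n)"])
   (auto simp: div_less_iff_less_mult digit_less)
qed simp

definition dag_list :: "nat \<Rightarrow> state \<Rightarrow> nat \<Rightarrow> (nat \<times> nat) list" where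
 "dag_list n s r = map (\<lambda>i. (words s ''dag_src'' (r * (n * n) + i), words s ''dag_dst'' (r * (n * n) + i))) [0..<words s ''dag_len'' r]"

definition dag_holds :: "nat \<Rightarrow> state \<Rightarrow> (nat \<times> nat \<times> nat) set \<Rightarrow> bool" where
 "dag_holds n s A \<longleftrightarrow> (\<forall>r<n. distinct (dag_list n s r) \<and> set (dag_list n s r) = {(b, y). (r, b, y) \<in> A})"

lemma dag_holds_cong:
 "(\<And>z. z \<in> {''dag_src'', ''dag_dst'', ''dag_len''} \<Longrightarrow> words s' z = words s z) \<Longrightarrow> dag_holds n s' A = dag_holds n s A"
 by (simp add: dag_holds_def dag_list_def)

text \<open>The edges listed for a root are distinct pairs below \<open>n\<close>. As the new one is
  missing, fewer than \<open>n * n\<close> slots of the block are in use and the write stays inside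
  it.\<close>

lemma dag_push:
 assumes H: "dag_holds n s A" and A: "A \<subseteq> {..<n} \<times> {..<n} \<times> {..<n}" and x: "x < n" "b < n" "y < n" "(x, b, y) \<notin> A"
 defines "k \<equiv> x * (n * n) + words s ''dag_len'' x"
 shows "words s ''dag_len'' x < n * n"
  "dag_holds n (wupd (wupd (wupd s ''dag_src'' k b) ''dag_dst'' k y) ''dag_len'' x (Suc (words s ''dag_len'' x))) (insert (x, b, y) A)"
proof -
 define l where "l = words s ''dag_len''"
 define s' where "s' = wupd (wupd (wupd s ''dag_src'' k b) ''dag_dst'' k y) ''dag_len'' x (Suc (l x))"
 have len: "length (dag_list n s r) = l r" for r by (simp add: dag_list_def l_def)
 have card: "l r = card {(b, y). (r, b, y) \<in> A}" if "r < n" for r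
  using H that distinct_card[of "dag_list n s r"] len[of r] by (simp add: dag_holds_def)
 have sub: "{(b, y). (r, b, y) \<in> A} \<subseteq> {..<n} \<times> {..<n}" for r using A by auto
 have le: "l r \<le> n * n" if "r < n" for r
  using card_mono[OF _ sub[of r]] card[OF that] by simp
 have "{(b, y). (x, b, y) \<in> A} \<subset> {..<n} \<times> {..<n}" using sub[of x] x by auto
 then have lt: "l x < n * n" using psubset_card_mono[of "{..<n} \<times> {..<n}"] card[OF x(1)] by simp
 then show "words s ''dag_len'' x < n * n" by (simp add: l_def)
 have k: "k = x * (n * n) + l x" by (simp add: k_def l_def)
 have same: "dag_list n s' x = dag_list n s x @ [(b, y)]"
  by (simp add: dag_list_def s'_def l_def[symmetric] k)
 have other: "dag_list n s' r = dag_list n s r" if r: "r < n" "r \<noteq> x" for r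
 proof -
  have ne: "r * (n * n) + i \<noteq> k" if "i < l r" for i
   using that le[OF r(1)] lt r(2) by (simp add: k)
  then show ?thesis using r(2) by (simp add: dag_list_def s'_def l_def[symmetric])
 qed
 have "dag_holds n s' (insert (x, b, y) A)"
  unfolding dag_holds_def
 proof (intro allI impI)
  fix r assume r: "r < n"
  have h: "distinct (dag_list n s r)" "set (dag_list n s r) = {(b, y). (r, b, y) \<in> A}" using H r by (auto simp: dag_holds_def)
  show "distinct (dag_list n s' r) \<and> set (dag_list n s' r) = {(b', y'). (r, b', y') \<in> insert (x, b, y) A}"
  proof (cases "r = x")
   case True
   then show ?thesis using h x(4) by (auto simp: same)
  next
   case False
   then show ?thesis using h by (auto simp: other[OF r])
  qed
 qed
 then show "dag_holds n (wupd (wupd (wupd s ''dag_src'' k b) ''dag_dst'' k y) ''dag_len'' x (Suc (words s ''dag_len'' x))) (insert (x, b, y) A)"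
  by (simp add: s'_def l_def)
qed

definition dags :: com where
 "dags =
   (For ''fi'' (V ''n'') (WSet ''dag_len'' (V ''fi'') (C 0)) ;;
   For ''fi'' (WMul (V ''n'') (V ''n''))
    (''fx'' ::= WDiv (V ''fi'') (V ''n'') ;; ''fy'' ::= WMod (V ''fi'') (V ''n'') ;;
    For ''fj'' (WGet ''bn'' (V ''fi''))
     (''fk'' ::= WAdd (WMul (V ''fx'') (WMul (V ''n'') (V ''n''))) (WGet ''dag_len'' (V ''fx'')) ;;
     WSet ''dag_src'' (V ''fk'') (WGet ''bl'' (ix2 (V ''fi'') (V ''fj''))) ;;
     WSet ''dag_dst'' (V ''fk'') (V ''fy'') ;;
     WSet ''dag_len'' (V ''fx'') (WAdd (WGet ''dag_len'' (V ''fx'')) (C 1)))))"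

lemma writes_dags [simp]:
 "word_writes dags = {''fi'', ''fx'', ''fy'', ''fj'', ''fk'', ''dag_src'', ''dag_dst'', ''dag_len''}" "real_writes dags = {}"
 by (auto simp: dags_def)

definition scores :: com where
 "scores =
   (For ''fi'' (V ''n'') (RSet ''bc'' (V ''fi'') RZero) ;;
   For ''fi'' (WMul (V ''n'') (V ''n'')) (RSet ''de'' (V ''fi'') RZero) ;;
   For ''fi'' (V ''oc'')
    (''fp'' ::= WGet ''or'' (WSub (V ''oc'') (WAdd (V ''fi'') (C 1))) ;;
    ''fx'' ::= WDiv (V ''fp'') (V ''n'') ;; ''fy'' ::= WMod (V ''fp'') (V ''n'') ;;
    RSet ''bc'' (V ''fy'') (RAdd (RGet ''bc'' (V ''fy'')) (RGet ''de'' (V ''fp''))) ;;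
    For ''fj'' (WGet ''bn'' (V ''fp''))
     (''fk'' ::= ix2 (V ''fx'') (WGet ''bl'' (ix2 (V ''fp'') (V ''fj''))) ;;
     RSet ''de'' (V ''fk'') (RAdd (RGet ''de'' (V ''fk''))
      (RMul (RDiv (RGet ''sg'' (V ''fk'')) (RGet ''sg'' (V ''fp''))) (RAdd ROne (RGet ''de'' (V ''fp''))))))))"

lemma writes_scores [simp]:
 "word_writes scores = {''fi'', ''fp'', ''fx'', ''fy'', ''fj'', ''fk''}" "real_writes scores = {''bc'', ''de''}"
 by (auto simp: scores_def)

context alg begin

definition reached :: "(nat \<times> nat) set" where "reached = {(x, y). x < n \<and> y < n \<and> reach x y}"

definition ready :: "state \<Rightarrow> bool" where
 "ready s \<longleftrightarrow> words s ''n'' 0 = n \<and>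
   (\<forall>x<n. \<forall>y<n. words s ''bn'' (x * n + y) \<le> n \<and> distinct (seg n (words s ''bl'') (x * n + y) (words s ''bn'' (x * n + y))) \<and>
    set (seg n (words s ''bl'') (x * n + y) (words s ''bn'' (x * n + y))) = {b. y \<in> YE x b} \<and> reals s ''sg'' (x * n + y) = rsg x y) \<and>
   ord_ok s reached"

lemma ready_cong:
 "(\<And>z. z \<in> {''n'', ''bn'', ''bl'', ''or'', ''oc''} \<Longrightarrow> words s' z = words s z) \<Longrightarrow> reals s' ''sg'' = reals s ''sg'' \<Longrightarrow> ready s' = ready s"
 by (simp add: ready_def ord_ok_def)

lemma finv_reached:
 assumes F: "finv s Z P" and t: "todo P = {}"
 shows "P = reached" "ready s"
proof -
 have F': "words s ''n'' 0 = n" "P \<subseteq> {..<n} \<times> {..<n}" "dist_ok s P" "lists_ok s P" "ord_ok s P" using F by (simp_all add: finv_def)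
 show P: "P = reached"
 proof
  show "P \<subseteq> reached" using F'(2,3) by (force simp: dist_ok_def reached_def)
  show "reached \<subseteq> P" using t by (auto simp: todo_def reached_def)
 qed
 have "words s ''bn'' (x * n + y) \<le> n \<and> distinct (seg n (words s ''bl'') (x * n + y) (words s ''bn'' (x * n + y))) \<and>
    set (seg n (words s ''bl'') (x * n + y) (words s ''bn'' (x * n + y))) = {b. y \<in> YE x b} \<and> reals s ''sg'' (x * n + y) = rsg x y"
  if x: "x < n" "y < n" for x y
 proof (cases "(x, y) \<in> P")
  case True
  then show ?thesis using F'(3,4) x by (simp add: dist_ok_def lists_ok_def)
 next
  case False
  then have nr: "\<not> reach x y" using P x by (simp add: reached_def)
  then have "{b. y \<in> YE x b} = {}" using YE_reach by blast
  then show ?thesis using F'(3) x False sg_unreach[OF nr] by (simp add: dist_ok_def)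
 qed
 then show "ready s" using F'(1,5) P by (simp add: ready_def)
qed

lemma readyD:
 assumes "ready s" "x < n" "y < n"
 shows "words s ''bn'' (x * n + y) \<le> n" "distinct (seg n (words s ''bl'') (x * n + y) (words s ''bn'' (x * n + y)))"
  "set (seg n (words s ''bl'') (x * n + y) (words s ''bn'' (x * n + y))) = {b. y \<in> YE x b}" "reals s ''sg'' (x * n + y) = rsg x y"
  "words s ''bn'' (x * n + y) = card {b. y \<in> YE x b}"
proof -
 show 1: "words s ''bn'' (x * n + y) \<le> n" "distinct (seg n (words s ''bl'') (x * n + y) (words s ''bn'' (x * n + y)))"
  "set (seg n (words s ''bl'') (x * n + y) (words s ''bn'' (x * n + y))) = {b. y \<in> YE x b}" "reals s ''sg'' (x * n + y) = rsg x y"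
  using assms by (simp_all add: ready_def)
 show "words s ''bn'' (x * n + y) = card {b. y \<in> YE x b}"
  using distinct_card[OF 1(2)] 1(3) by simp
qed

lemma ready_degs: "ready s \<Longrightarrow> (\<Sum>p<n * n. words s ''bn'' p) \<le> degs"
proof -
 assume r: "ready s"
 have "(\<Sum>p<n * n. words s ''bn'' p) = (\<Sum>p<n * n. words s ''bn'' (p div n * n + p mod n))" by simp
 also have "\<dots> = (\<Sum>(x, y)\<in>{..<n} \<times> {..<n}. words s ''bn'' (x * n + y))"
  by (rule sum_pairs[where f = "\<lambda>x y. words s ''bn'' (x * n + y)"])
 also have "\<dots> \<le> degs"
  unfolding degs_def deg_def by (intro sum_mono) (auto simp: readyD(5)[OF r])
 finally show ?thesis .
qed

definition dag_part :: "nat \<Rightarrow> (nat \<times> nat \<times> nat) set" where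
 "dag_part j = {(r, b, y). r < n \<and> y \<in> YE r b \<and> r * n + y < j}"

lemma dags_wp:
 assumes r: "ready s"
 shows "wp W dags (\<lambda>t s'. t \<le> 6 * degs + 6 * (n * n) + 3 * n + 4 \<and> dag_holds n s' {(r, b, y). y \<in> YE r b}) s"
proof -
 have nn: "words s ''n'' 0 = n" using r by (simp add: ready_def)
 let ?I1 = "\<lambda>j t s'. t = j \<and> (\<forall>r<j. words s' ''dag_len'' r = 0) \<and> (\<forall>z. z \<notin> {''fi'', ''dag_len''} \<longrightarrow> words s' z = words s z)"
 let ?I2 = "\<lambda>j t s'. t \<le> 4 * j + 6 * (\<Sum>p<j. words s ''bn'' p) \<and> dag_holds n s' (dag_part j) \<and>
   (\<forall>z. z \<notin> {''fi'', ''fx'', ''fy'', ''fj'', ''fk'', ''dag_src'', ''dag_dst'', ''dag_len''} \<longrightarrow> words s' z = words s z)"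
 have part_n: "dag_part j \<subseteq> {..<n} \<times> {..<n} \<times> {..<n}" for j using YE_n by (auto simp: dag_part_def)
 have all: "dag_part (n * n) \<subseteq> {(r, b, y). y \<in> YE r b}" "\<And>r b y. r < n \<Longrightarrow> y \<in> YE r b \<Longrightarrow> (r, b, y) \<in> dag_part (n * n)"
  using YE_n digit_less by (auto simp: dag_part_def)
 show ?thesis
  unfolding dags_def
  apply (rule wp_Seq, rule wp_For[where m = n and I = ?I1])
  apply simp_all[3]
  subgoal premises J for j t s' using J(1) nn by simp
  subgoal premises J for j t s'
  proof -
   have "j < W" using J(3) by (rule in_W(1))
   then show ?thesis using J(1,2) by (auto simp: wp_simps less_Suc_eq)
  qed
  subgoal premises J1 for t1 s1
   apply (rule wp_For[where m = "n * n" and I = ?I2])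
   apply simp_all[2]
   subgoal using J1(1) by (auto simp: dag_holds_def dag_list_def dag_part_def)
   subgoal premises J for j t s' using J(1) nn by simp
   subgoal premises J for j t s'
   proof -
    define x where "x = j div n"
    define y where "y = j mod n"
    note pb = pairs_below_Suc[OF J(3), folded x_def y_def]
    have xy: "x < n" "y < n" and jx: "x * n + y = j" using pb by auto
    have w': "words s' z = words s z" if "z \<notin> {''fi'', ''fx'', ''fy'', ''fj'', ''fk'', ''dag_src'', ''dag_dst'', ''dag_len''}" for z
     by (rule J(1)[THEN conjunct2, THEN conjunct2, rule_format, OF that])
    note tj = J(1)[THEN conjunct1] and H = J(1)[THEN conjunct2, THEN conjunct1]
    define L where "L = seg n (words s ''bl'') j (words s ''bn'' j)"
    note rD = readyD[OF r xy, unfolded jx, folded L_def]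
    have lenL: "length L = words s ''bn'' j" by (simp add: L_def)
    have WW: "j < W" "x < W" "y < W" "j * n < W" "x * (n * n) < W" "words s ''bn'' j < W"
    proof -
     have "x < n * n" using xy(1) by (cases n) auto
     then show "x * (n * n) < W" by (rule mult_W(4))
     show "words s ''bn'' j < W" using rD(1) W_const(6) by linarith
    qed (use J(3) xy in \<open>auto simp: bnd\<close>)
    let ?A = "\<lambda>i. dag_part j \<union> (\<lambda>b. (x, b, y)) ` set (take i L)"
    let ?J = "\<lambda>i u s''. u = 4 * i \<and> dag_holds n s'' (?A i) \<and> words s'' ''fi'' 0 = j \<and> words s'' ''fx'' 0 = x \<and> words s'' ''fy'' 0 = y \<and>
     (\<forall>z. z \<notin> {''fi'', ''fx'', ''fy'', ''fj'', ''fk'', ''dag_src'', ''dag_dst'', ''dag_len''} \<longrightarrow> words s'' z = words s z)"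
    have Lb: "L ! i < n" "y \<in> YE x (L ! i)" if "i < length L" for i
     using nth_mem[OF that] rD(3) YE_n by auto
    have last: "?A (length L) = dag_part (Suc j)"
    proof -
     have "(x', b, y') \<in> dag_part (Suc j) \<longleftrightarrow> (x', b, y') \<in> dag_part j \<or> x' = x \<and> y' = y \<and> y \<in> YE x b" for x' b y'
      using xy YE_n[of y' x' b] by (auto simp: dag_part_def less_Suc_eq simp flip: jx)
     then show ?thesis using rD(3) by auto
    qed
    show ?thesis
     apply (simp add: wp_simps J(2) w' nn WW flip: x_def y_def)
     apply (rule wp_For[where m = "words s ''bn'' j" and I = ?J])
     subgoal by (rule WW)
     apply (simp)
     subgoal using H by (simp add: J(2) w' dag_holds_def dag_list_def)
     subgoal premises K for i u s'' using K(1) WW by simp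
     subgoal premises K for i u s''
     proof -
      have i: "i < length L" "i < n" using K(3) rD(1) lenL by auto
      note b = Lb[OF i(1)]
      \<comment> \<open>Edges entered for earlier pairs have another root or another head, and the
        predecessor list has no duplicates.\<close>
      have new: "(x, L ! i, y) \<notin> ?A i"
      proof -
       have "L ! i \<notin> set (take i L)" using rD(2) i(1) by (auto simp: in_set_conv_nth nth_eq_iff_index_eq)
       then show ?thesis using jx by (auto simp: dag_part_def)
      qed
      have An: "?A i \<subseteq> {..<n} \<times> {..<n} \<times> {..<n}" using part_n[of j] xy Lb(1) by (auto simp: in_set_conv_nth)
      note HA = K(1)[THEN conjunct2, THEN conjunct1]
      note push = dag_push[OF HA An xy(1) b(1) xy(2) new]
      have st: "words s'' ''n'' 0 = n" "words s'' ''fi'' 0 = j" "words s'' ''fx'' 0 = x" "words s'' ''fy'' 0 = y"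
       "words s'' ''bl'' (j * n + i) = L ! i" "u = 4 * i"
       using K(1) nn i lenL by (simp_all add: L_def)
      have x2: "x < n * n" using xy(1) by (cases n) auto
      have W2: "i < W" "j * n + i < W" "L ! i < W" "x * (n * n) + words s'' ''dag_len'' x < W" "words s'' ''dag_len'' x < W" "Suc (words s'' ''dag_len'' x) < W"
       using i J(3) b push(1) in_W(7)[OF x2 push(1)] in_W(6)[OF push(1)] in_W(2)[OF push(1)] by (auto simp: bnd)
      define s3 where "s3 = wupd (wupd (wupd s'' ''dag_src'' (x * (n * n) + words s'' ''dag_len'' x) (L ! i)) ''dag_dst'' (x * (n * n) + words s'' ''dag_len'' x) y) ''dag_len'' x (Suc (words s'' ''dag_len'' x))"
      have "insert (x, L ! i, y) (?A i) = ?A (Suc i)" using i(1) by (simp add: take_Suc_conv_app_nth)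
      then have H3: "dag_holds n s3 (?A (Suc i))" using push(2) by (simp add: s3_def)
      define s4 where "s4 = wupd (wupd (wupd (wupd s'' ''fk'' 0 (x * (n * n) + words s'' ''dag_len'' x)) ''dag_src'' (x * (n * n) + words s'' ''dag_len'' x) (L ! i)) ''dag_dst'' (x * (n * n) + words s'' ''dag_len'' x) y) ''dag_len'' x (Suc (words s'' ''dag_len'' x))"
      have H4: "dag_holds n (wupd s4 ''fj'' 0 (Suc i)) (?A (Suc i))"
       using H3 by (subst dag_holds_cong[of _ s3]) (auto simp: s3_def s4_def)
      have fr: "words s4 ''fj'' 0 = i" "words s4 ''fi'' 0 = j" "words s4 ''fx'' 0 = x" "words s4 ''fy'' 0 = y"
       using K(2) st by (simp_all add: s4_def)
      have fr2: "words s4 z = words s z" if "z \<notin> {''fi'', ''fx'', ''fy'', ''fj'', ''fk'', ''dag_src'', ''dag_dst'', ''dag_len''}" for z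
       using K(1) that by (simp add: s4_def)
      have st4: "wp W (''fk'' ::= WAdd (WMul (V ''fx'') (WMul (V ''n'') (V ''n''))) (WGet ''dag_len'' (V ''fx'')) ;;
       WSet ''dag_src'' (V ''fk'') (WGet ''bl'' (ix2 (V ''fi'') (V ''fj''))) ;;
       WSet ''dag_dst'' (V ''fk'') (V ''fy'') ;;
       WSet ''dag_len'' (V ''fx'') (WAdd (WGet ''dag_len'' (V ''fx'')) (C (Suc 0)))) Q s'' \<longleftrightarrow> Q 4 s4" for Q
       by (simp add: wp_simps st K(2) WW W2 s4_def eval_nat_numeral)
      show ?thesis unfolding st4 using H4 fr fr2 st(6) by simp
     qed
     subgoal premises K for u s''
     proof -
      have "dag_holds n s'' (dag_part (Suc j))" using K(1) last unfolding lenL by simp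
      then have "dag_holds n (wupd s'' ''fi'' 0 (Suc j)) (dag_part (Suc j))" by (simp add: dag_holds_def dag_list_def)
      then show ?thesis using K(1) tj by simp
     qed
     done
   qed
   subgoal premises J for t s'
   proof -
    have "dag_holds n s' {(r, b, y). y \<in> YE r b} = dag_holds n s' (dag_part (n * n))"
     unfolding dag_holds_def using all by (intro all_cong) auto
    moreover note J(1)[THEN conjunct1] J1(1)[THEN conjunct1] J(1)[THEN conjunct2, THEN conjunct1]
    ultimately show ?thesis using ready_degs[OF r] by simp
   qed
   done
  done
qed

end

section \<open>Brandes' accumulation of the scores\<close>

context alg begin

definition delta :: "nat \<Rightarrow> nat \<Rightarrow> nat \<Rightarrow> real" where
 "delta x b y = rsg x b / rsg x y * (1 + dep {..<n} x y)"

text \<open>The content of \<open>de\<close> once the pairs with codes in \<open>A\<close> have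
  passed their dependency on to their predecessors; \<open>partial_score\<close> is the content of
  \<open>bc\<close> at that time.\<close>

definition partial_dep :: "nat set \<Rightarrow> nat \<Rightarrow> nat \<Rightarrow> real" where
 "partial_dep A x b = (\<Sum>y | y \<in> YE x b \<and> x * n + y \<in> A. delta x b y)"

definition partial_score :: "nat set \<Rightarrow> nat \<Rightarrow> real" where
 "partial_score A u = (\<Sum>p\<in>A. if p mod n = u then dep {..<n} (p div n) u else 0)"

lemma finite_YE': "finite (YE x b)"
proof -
 have "YE x b \<subseteq> {..<n}" using YE_n by blast
 then show ?thesis by (rule finite_subset) simp
qed

lemma partial_dep_insert:
 assumes "x < n" "y < n" "x * n + y \<notin> A" "x' < n"
 shows "partial_dep (insert (x * n + y) A) x' b = partial_dep A x' b + (if x' = x \<and> y \<in> YE x b then delta x b y else 0)"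
proof (cases "x' = x \<and> y \<in> YE x b")
 case True
 have "{z. z \<in> YE x' b \<and> x' * n + z \<in> insert (x * n + y) A} = insert y {z. z \<in> YE x' b \<and> x' * n + z \<in> A}"
  using True by auto
 moreover have "y \<notin> {z. z \<in> YE x' b \<and> x' * n + z \<in> A}" using True assms(3) by simp
 moreover have "finite {z. z \<in> YE x' b \<and> x' * n + z \<in> A}" using finite_YE' by simp
 ultimately show ?thesis using True by (simp add: partial_dep_def)
next
 case False
 have "z \<in> YE x' b \<and> x' * n + z \<in> insert (x * n + y) A \<longleftrightarrow> z \<in> YE x' b \<and> x' * n + z \<in> A" for z
 proof (cases "z \<in> YE x' b")
  case True
  then have "z < n" using YE_n by blast
  then have "x' * n + z = x * n + y \<longleftrightarrow> x' = x \<and> z = y" using assms by simp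
  then show ?thesis using False True by auto
 qed simp
 then show ?thesis unfolding partial_dep_def if_not_P[OF False] by simp
qed

text \<open>When all successors of \<open>y\<close> have been treated, the partial sum is the whole
  right-hand side of \<open>dep_rec\<close>.\<close>

lemma dep_partial:
 assumes "\<And>y'. y' \<in> YE x y \<Longrightarrow> x * n + y' \<in> A"
 shows "partial_dep A x y = dep {..<n} x y"
proof -
 have "fst ` E \<union> snd ` E \<subseteq> {..<n}" using E_n by auto
 moreover have "{z. z \<in> YE x y \<and> x * n + z \<in> A} = YE x y" using assms by auto
 ultimately show ?thesis using dep_rec[of "{..<n}" x y] by (simp add: partial_dep_def delta_def)
qed

lemma dep_unreached: "\<not> reach x u \<Longrightarrow> dep U x u = 0"
 by (simp add: dep_def via_def)

lemma codes_reached: "x < n \<Longrightarrow> y < n \<Longrightarrow> x * n + y \<in> codes reached \<longleftrightarrow> reach x y \<and> x \<noteq> y"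
 by (auto simp: codes_def reached_def image_iff)

lemma partial_score_all:
 assumes u: "u < n"
 shows "partial_score (codes reached) u = (\<Sum>x\<in>{..<n} - {u}. dep {..<n} x u)"
proof -
 have sub: "codes reached \<subseteq> {..<n * n}" by (intro codes_bound) (auto simp: reached_def)
 let ?f = "\<lambda>x y. if x * n + y \<in> codes reached then if y = u then dep {..<n} x u else 0 else 0"
 have "partial_score (codes reached) u = (\<Sum>p<n * n. if p \<in> codes reached then if p mod n = u then dep {..<n} (p div n) u else 0 else 0)"
  unfolding partial_score_def using sub by (simp add: sum.If_cases Int_absorb1)
 also have "\<dots> = (\<Sum>p<n * n. ?f (p div n) (p mod n))" by simp
 also have "\<dots> = (\<Sum>(x, y)\<in>{..<n} \<times> {..<n}. ?f x y)" by (rule sum_pairs)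
 also have "\<dots> = (\<Sum>x<n. \<Sum>y<n. ?f x y)" by (rule sum.cartesian_product[symmetric])
 also have "\<dots> = (\<Sum>x<n. if x = u then 0 else dep {..<n} x u)"
 proof (rule sum.cong[OF refl])
  fix x assume "x \<in> {..<n}"
  then have x: "x < n" by simp
  have "(\<Sum>y<n. ?f x y) = (\<Sum>y<n. if y = u then if x = u then 0 else dep {..<n} x u else 0)"
   by (rule sum.cong[OF refl]) (use x codes_reached dep_unreached in auto)
  then show "(\<Sum>y<n. ?f x y) = (if x = u then 0 else dep {..<n} x u)" using u by simp
 qed
 also have "\<dots> = (\<Sum>x\<in>{..<n} - {u}. dep {..<n} x u)"
  by (intro sum.mono_neutral_cong_right) auto
 finally show ?thesis .
qed

text \<open>Pairs are treated by decreasing distance. Each \<open>z\<close> in \<open>YE x y\<close>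
  is farther from \<open>x\<close> than \<open>y\<close> is, so \<open>(x, z)\<close> precedes
  \<open>(x, y)\<close>, and the entry of \<open>de\<close> at \<open>(x, y)\<close> is final when
  it is added to the score of \<open>y\<close> and passed on.\<close>

lemma scores_wp:
 assumes r: "ready s"
 shows "wp W scores (\<lambda>t s'. t \<le> 4 * degs + 12 * (n * n) + 3 * n + 6 \<and> (\<forall>u<n. reals s' ''bc'' u = (\<Sum>x\<in>{..<n} - {u}. dep {..<n} x u))) s"
proof -
 have nn: "words s ''n'' 0 = n" and ord: "ord_ok s reached" using r by (simp_all add: ready_def)
 define m where "m = words s ''oc'' 0"
 define os where "os = map (words s ''or'') [0..<m]"
 define rs where "rs = rev os"
 let ?f = "\<lambda>p. spd (p div n) (p mod n)"
 have os: "distinct os" "set os = codes reached" "sorted_wrt (\<lambda>p q. ?f p \<le> ?f q) os"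
  using ord by (simp_all add: ord_ok_def os_def m_def Let_def)
 have lenr: "length rs = m" by (simp add: rs_def os_def)
 have rs: "distinct rs" "set rs = codes reached" "sorted_wrt (\<lambda>p q. ?f q \<le> ?f p) rs" using os by (simp_all add: rs_def sorted_wrt_rev)
 have nth: "rs ! j = words s ''or'' (m - Suc j)" if "j < m" for j
  using that by (simp add: rs_def os_def rev_nth)
 have sub: "codes reached \<subseteq> {..<n * n}" by (intro codes_bound) (auto simp: reached_def)
 have "card (set rs) \<le> card {..<n * n}" using sub unfolding rs(2) by (intro card_mono) simp_all
 then have mn: "m \<le> n * n" using distinct_card[OF rs(1)] lenr by simp
 have mW: "m < W" using mn W_const(7) by linarith
 let ?A = "\<lambda>j. set (take j rs)"
 let ?I1 = "\<lambda>j t s'. t = j \<and> (\<forall>u<j. reals s' ''bc'' u = 0) \<and> (\<forall>z. z \<noteq> ''fi'' \<longrightarrow> words s' z = words s z) \<and> reals s' ''sg'' = reals s ''sg''"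
 let ?I2 = "\<lambda>j t s'. t = j \<and> (\<forall>p<j. reals s' ''de'' p = 0) \<and> (\<forall>u<n. reals s' ''bc'' u = 0) \<and>
   (\<forall>z. z \<noteq> ''fi'' \<longrightarrow> words s' z = words s z) \<and> reals s' ''sg'' = reals s ''sg''"
 let ?I3 = "\<lambda>j t s'. t \<le> 6 * j + 4 * (\<Sum>p\<in>?A j. words s ''bn'' p) \<and>
   (\<forall>x<n. \<forall>b<n. reals s' ''de'' (x * n + b) = partial_dep (?A j) x b) \<and> (\<forall>u<n. reals s' ''bc'' u = partial_score (?A j) u) \<and>
   (\<forall>z. z \<notin> {''fi'', ''fp'', ''fx'', ''fy'', ''fj'', ''fk''} \<longrightarrow> words s' z = words s z) \<and> reals s' ''sg'' = reals s ''sg''"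
 show ?thesis
  unfolding scores_def
  apply (rule wp_Seq, rule wp_For[where m = n and I = ?I1])
  apply simp_all[3]
  subgoal premises J for j t s' using J(1) nn by simp
  subgoal premises J for j t s'
  proof -
   have "j < W" using J(3) by (rule in_W(1))
   then show ?thesis using J(1,2) by (auto simp: wp_simps less_Suc_eq)
  qed
  subgoal premises J1 for t1 s1
   apply (rule wp_Seq, rule wp_For[where m = "n * n" and I = ?I2])
   apply simp_all[2]
   subgoal using J1(1) by auto
   subgoal premises J for j t s' using J(1) nn by simp
   subgoal premises J for j t s'
   proof -
    have "j < W" using J(3) by (rule in_W(2))
    then show ?thesis using J(1,2) by (auto simp: wp_simps less_Suc_eq)
   qed
   subgoal premises J2 for t2 s2
    apply (rule wp_For[where m = m and I = ?I3])
    subgoal by (rule mW)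
    apply (simp)
    subgoal using J2(1) digit_less by (auto simp: partial_dep_def partial_score_def)
    subgoal premises J for j t s' using J(1) mW by (simp add: m_def)
    subgoal premises J for j t s'
    proof -
     define p where "p = rs ! j"
     define x where "x = p div n"
     define y where "y = p mod n"
     have tk: "take (Suc j) rs = take j rs @ [p]" using J(3) lenr by (simp add: p_def take_Suc_conv_app_nth)
     have pA: "p \<notin> ?A j" using rs(1) J(3) lenr by (auto simp: p_def in_set_conv_nth nth_eq_iff_index_eq)
     have "p \<in> set rs" using J(3) lenr by (simp add: p_def)
     then obtain x' y' where xy': "(x', y') \<in> reached" "x' \<noteq> y'" "p = x' * n + y'" using rs(2) codesE by blast
     have lt: "x' < n" "y' < n" using xy' by (auto simp: reached_def)
     have eq: "x = x'" "y = y'" using xy' lt by (auto simp: x_def y_def)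
     have xy: "x < n" "y < n" "reach x y" "x \<noteq> y" and px: "p = x * n + y" using xy' by (auto simp: eq reached_def)
     have p_n: "p < n * n" unfolding px by (rule digit_less[OF xy(1,2)])
     have ins: "?A (Suc j) = insert (x * n + y) (?A j)" using tk px by auto
     have pA': "x * n + y \<notin> ?A j" using pA px by simp
     have cov: "x * n + z \<in> ?A j" if z: "z \<in> YE x y" for z
     proof -
      have zn: "z < n" using z YE_n by blast
      have less: "spd x y < spd x z" using YE_less[OF z] .
      then have "x \<noteq> z" using spd_nonneg[OF xy(3)] by auto
      then have "x * n + z \<in> set rs" using codes_reached[OF xy(1) zn] YE_reach[OF z] rs(2) by simp
      then obtain i where i: "i < m" "rs ! i = x * n + z" using lenr by (metis in_set_conv_nth)
      have "\<not> j \<le> i"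
      proof
       assume ji: "j \<le> i"
       have "?f (rs ! i) \<le> ?f (rs ! j)"
       proof (cases "i = j")
        case False
        then show ?thesis using sorted_wrt_nth_less[OF rs(3), of j i] ji i(1) lenr by simp
       qed simp
       then show False using less i(2) zn xy by (simp add: p_def[symmetric] px)
      qed
      then have "i < j" by simp
      then have "rs ! i \<in> ?A j" using i(1) lenr by (auto simp: in_set_conv_nth intro!: exI[of _ i])
      then show ?thesis using i(2) by simp
     qed
     have dep: "partial_dep (?A j) x y = dep {..<n} x y" by (rule dep_partial[OF cov])
     have w': "words s' z = words s z" if "z \<notin> {''fi'', ''fp'', ''fx'', ''fy'', ''fj'', ''fk''}" for z
      by (rule J(1)[THEN conjunct2, THEN conjunct2, THEN conjunct2, THEN conjunct1, rule_format, OF that])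
     note tj = J(1)[THEN conjunct1]
      and de' = J(1)[THEN conjunct2, THEN conjunct1, rule_format]
      and bc' = J(1)[THEN conjunct2, THEN conjunct2, THEN conjunct1, rule_format]
      and sg' = J(1)[THEN conjunct2, THEN conjunct2, THEN conjunct2, THEN conjunct2]
     define L where "L = seg n (words s ''bl'') p (words s ''bn'' p)"
     note rD = readyD[OF r xy(1,2), folded px, folded L_def]
     have lenL: "length L = words s ''bn'' p" by (simp add: L_def)
     have Lb: "L ! i < n" "y \<in> YE x (L ! i)" "L ! i \<noteq> y" if "i < length L" for i
      using nth_mem[OF that] rD(3) YE_n YE_less[of y x y] by auto
     have LS: "b \<in> set L \<longleftrightarrow> y \<in> YE x b" for b using rD(3) by auto
     have jm: "m - Suc j < W" "Suc j < W" "j < W" "words s ''or'' (m - Suc j) = p" using J(3) mW nth[OF J(3)] by (auto simp: p_def)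
     have WW: "p < W" "x < W" "y < W" "p * n < W" "x * n < W" "words s ''bn'' p < W"
     proof -
      show "words s ''bn'' p < W" using rD(1) W_const(6) by linarith
     qed (use p_n xy in \<open>auto simp: bnd\<close>)
     let ?J = "\<lambda>i u s''. u = 2 * i \<and>
      (\<forall>x'<n. \<forall>b<n. reals s'' ''de'' (x' * n + b) = partial_dep (?A j) x' b + (if x' = x \<and> b \<in> set (take i L) then delta x b y else 0)) \<and>
      (\<forall>u<n. reals s'' ''bc'' u = partial_score (?A (Suc j)) u) \<and> words s'' ''fi'' 0 = j \<and> words s'' ''fp'' 0 = p \<and> words s'' ''fx'' 0 = x \<and>
      (\<forall>z. z \<notin> {''fi'', ''fp'', ''fx'', ''fy'', ''fj'', ''fk''} \<longrightarrow> words s'' z = words s z) \<and> reals s'' ''sg'' = reals s ''sg''"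
     have sc: "partial_score (?A (Suc j)) u = partial_score (?A j) u + (if u = y then dep {..<n} x y else 0)" for u
      unfolding ins partial_score_def using pA' xy by (simp add: px[symmetric] x_def y_def)
     have dp: "reals s' ''de'' p = dep {..<n} x y" using de'[OF xy(1,2)] dep by (simp add: px)
     show ?thesis
      apply (simp add: wp_simps J(2) w' WW jm flip: m_def)
      apply (simp add: wp_simps nn WW mW dp flip: x_def y_def)
      apply (rule wp_For[where m = "words s ''bn'' p" and I = ?J])
      subgoal by (rule WW)
      apply (simp)
      subgoal using xy(2) by (simp add: J(2) w' sg' de' bc' sc)
      subgoal premises K for i u s'' using K(1) WW by simp
      subgoal premises K for i u s''
      proof -
       have i: "i < length L" "i < n" using K(3) rD(1) lenL by auto
       note b = Lb[OF i(1)]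
       have st: "words s'' ''n'' 0 = n" "words s'' ''fp'' 0 = p" "words s'' ''fx'' 0 = x" "words s'' ''fi'' 0 = j"
        "words s'' ''bl'' (p * n + i) = L ! i" "u = 2 * i" "reals s'' ''sg'' = reals s ''sg''"
        using K(1) nn i lenL by (simp_all add: L_def)
       note de2 = K(1)[THEN conjunct2, THEN conjunct1, rule_format]
       have notin: "L ! i \<notin> set (take i L)" using rD(2) i(1) by (auto simp: in_set_conv_nth nth_eq_iff_index_eq)
       \<comment> \<open>\<open>y\<close> is not its own predecessor, so the inner loop never
         overwrites the entry of \<open>de\<close> at \<open>p\<close> that it keeps
         reading.\<close>
       have yn: "y \<notin> set (take i L)" using Lb(3) i(1) by (auto simp: in_set_conv_nth)
       have dpp: "reals s'' ''de'' p = dep {..<n} x y" using de2[OF xy(1,2)] yn dep by (simp add: px)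
       have sgs: "reals s ''sg'' (x * n + L ! i) = rsg x (L ! i)" "reals s ''sg'' p = rsg x y"
        using readyD(4)[OF r xy(1) b(1)] rD(4) by simp_all
       have W2: "i < W" "p * n + i < W" "L ! i < W" "x * n + L ! i < W" using i p_n b xy by (auto simp: bnd)
       define k where "k = x * n + L ! i"
       define s4 where "s4 = rupd (wupd s'' ''fk'' 0 k) ''de'' k (reals s'' ''de'' k + delta x (L ! i) y)"
       have st4: "wp W (''fk'' ::= ix2 (V ''fx'') (WGet ''bl'' (ix2 (V ''fp'') (V ''fj''))) ;;
         RSet ''de'' (V ''fk'') (RAdd (RGet ''de'' (V ''fk''))
         (RMul (RDiv (RGet ''sg'' (V ''fk'')) (RGet ''sg'' (V ''fp''))) (RAdd ROne (RGet ''de'' (V ''fp'')))))) Q s'' \<longleftrightarrow> Q 2 s4" for Q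
        by (simp add: wp_simps st K(2) WW W2 s4_def eval_nat_numeral delta_def dpp sgs k_def)
       have de4: "reals s4 ''de'' (x' * n + b) = partial_dep (?A j) x' b + (if x' = x \<and> b \<in> set (take (Suc i) L) then delta x b y else 0)"
        if x': "x' < n" "b < n" for x' b
       proof (cases "x' = x \<and> b = L ! i")
        case True
        then show ?thesis using de2[OF x'] notin i(1) by (simp add: s4_def k_def take_Suc_conv_app_nth)
       next
        case False
        then have "x' * n + b \<noteq> k" using x' b(1) by (auto simp: k_def)
        then show ?thesis using de2[OF x'] False i(1) by (auto simp: s4_def take_Suc_conv_app_nth)
       qed
       have fr: "words s4 ''fj'' 0 = i" "words s4 ''fi'' 0 = j" "words s4 ''fp'' 0 = p" "words s4 ''fx'' 0 = x" "reals s4 ''sg'' = reals s ''sg''"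
        using K(2) st by (simp_all add: s4_def)
       have fr2: "\<forall>z. z \<notin> {''fi'', ''fp'', ''fx'', ''fy'', ''fj'', ''fk''} \<longrightarrow> words s4 z = words s z" "\<forall>u<n. reals s4 ''bc'' u = partial_score (?A (Suc j)) u"
        using K(1) by (simp_all add: s4_def)
       show ?thesis
        unfolding st4
        apply (intro conjI)
        subgoal by (rule fr)
        subgoal using st(6) by simp
        subgoal using de4 by (simp del: take_Suc)
        subgoal using fr2(2) by (simp del: take_Suc)
        subgoal using fr by simp
        subgoal using fr by simp
        subgoal using fr by simp
        subgoal using fr2(1) by simp
        subgoal using fr by simp
        done
      qed
      subgoal premises K for u s''
      proof -
       have de2: "reals s'' ''de'' (x' * n + b) = partial_dep (?A (Suc j)) x' b" if "x' < n" "b < n" for x' b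
        using K(1) that unfolding ins partial_dep_insert[OF xy(1,2) pA' that(1)] by (simp add: LS flip: lenL)
       have tt: "t + (u + 2 * words s ''bn'' p + 2 + 4) \<le> 6 * Suc j + 4 * (\<Sum>p\<in>?A (Suc j). words s ''bn'' p)"
        using tj K(1) pA' unfolding ins by (simp add: px)
       note K' = K(1)[THEN conjunct2, THEN conjunct2]
       note o = K'[THEN conjunct2, THEN conjunct1] K'[THEN conjunct1]
        K'[THEN conjunct2, THEN conjunct2, THEN conjunct2, THEN conjunct2, THEN conjunct1]
        K'[THEN conjunct2, THEN conjunct2, THEN conjunct2, THEN conjunct2, THEN conjunct2]
       show ?thesis
        apply (intro conjI)
        subgoal by (rule o)
        subgoal using tt by simp
        subgoal using de2 by simp
        subgoal using o(2) by simp
        subgoal using o(3) by simp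
        subgoal using o(4) by simp
        done
      qed
      done
    qed
    subgoal premises J3 for t3 s3
    proof -
     have "take m rs = rs" using lenr by simp
     then have "\<forall>u<n. reals s3 ''bc'' u = partial_score (codes reached) u" and t3: "t3 \<le> 6 * m + 4 * (\<Sum>p\<in>codes reached. words s ''bn'' p)"
      using J3(1) rs(2) by simp_all
     moreover have "(\<Sum>p\<in>codes reached. words s ''bn'' p) \<le> degs"
      using sum_mono2[OF _ sub, of "words s ''bn''"] ready_degs[OF r] by simp
     moreover have "t1 = n" "t2 = n * n" using J1(1)[THEN conjunct1] J2(1)[THEN conjunct1] by blast+
     ultimately show ?thesis using mn by (simp add: partial_score_all)
    qed
    done
   done
  done
qed

end

section \<open>Shortest and locally shortest paths\<close>

lemma last_pawalk_verts: "walk E x p y \<Longrightarrow> last (pawalk_verts x p) = y"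
proof (induction p arbitrary: x)
 case Nil
 then show ?case by simp
next
 case (Cons e p)
 then have "last (pawalk_verts (snd e) p) = y" by auto
 moreover have "pawalk_verts (snd e) p \<noteq> []" by (cases p) auto
 ultimately show ?case by simp
qed

locale fgraph =
 fixes G :: "nat pair_pre_digraph" and w :: "(nat \<times> nat) weight_fun"
 assumes pf: "pair_fin_digraph G" and pos_w: "\<And>e. e \<in> parcs G \<Longrightarrow> 0 < w e"
begin

sublocale wgraph "parcs G" w
proof
 interpret pair_fin_digraph G by (rule pf)
 show "finite (parcs G)" by (rule pair_finite_arcs)
qed (rule pos_w)

lemma arc_verts: "e \<in> parcs G \<Longrightarrow> fst e \<in> pverts G \<and> snd e \<in> pverts G"
proof -
 interpret pair_fin_digraph G by (rule pf)
 show "e \<in> parcs G \<Longrightarrow> fst e \<in> pverts G \<and> snd e \<in> pverts G" using arc_fst_in_verts arc_snd_in_verts by blast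
qed

lemma finite_verts: "finite (pverts G)"
proof -
 interpret pair_fin_digraph G by (rule pf)
 show ?thesis by (rule pair_finite_verts)
qed

lemma walk_verts: "walk (parcs G) x p y \<Longrightarrow> x \<in> pverts G \<Longrightarrow> y \<in> pverts G"
 by (induction p arbitrary: x) (auto dest: arc_verts)

lemma reach_verts: "reach x y \<Longrightarrow> x \<in> pverts G \<Longrightarrow> y \<in> pverts G"
 using walk_verts by (auto simp: reach_def)

lemma awalk_iff: "pre_digraph.awalk (with_proj G) x p y \<longleftrightarrow> x \<in> pverts G \<and> walk (parcs G) x p y"
proof -
 interpret pair_fin_digraph G by (rule pf)
 show ?thesis by (rule pair_wf_walk) unfold_locales
qed

lemma apath_iff: "pre_digraph.apath (with_proj G) x p y \<longleftrightarrow> x \<in> pverts G \<and> walk (parcs G) x p y \<and> distinct (pawalk_verts x p)"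
 by (simp add: pre_digraph.apath_def awalk_iff awalk_verts_with_proj_eq)

lemma acost: "wf_digraph.awalk_cost w p = cost w p"
proof -
 interpret pair_fin_digraph G by (rule pf)
 show ?thesis by (simp add: awalk_cost_def cost_def)
qed

lemma mu_spd:
 assumes "x \<in> pverts G" "reach x y"
 shows "wf_digraph.\<mu> (with_proj G) w x y = ereal (spd x y)"
proof -
 interpret pair_fin_digraph G by (rule pf)
 obtain q where "walk (parcs G) x q y" using assms by (auto simp: reach_def)
 then have "x \<rightarrow>\<^sup>*\<^bsub>with_proj G\<^esub> y" using awalk_iff assms reachable_awalk by blast
 moreover have "\<And>e. e \<in> parcs G \<Longrightarrow> 0 \<le> w e" using pos_w by (auto simp: less_imp_le)
 ultimately obtain p where p: "apath x p y" "\<mu> w x y = awalk_cost w p"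
  using min_cost_awalk[of x y w] by auto
 have wk: "walk (parcs G) x p y" using p(1) by (simp add: apath_iff)
 obtain q where q: "q \<in> SP x y" using SP_exists assms by blast
 have "\<mu> w x y \<le> cost w q" using min_cost_le_walk_cost[of x q y w] q assms by (simp add: awalk_iff acost SP_def)
 then have "cost w p \<le> spd x y" using p(2) q by (simp add: acost SP_def)
 then show ?thesis using spd_le[OF wk] p(2) by (simp add: acost)
qed

lemma shortest_iff: "shortest_path G w x p y \<longleftrightarrow> x \<in> pverts G \<and> p \<in> SP x y"
proof
 assume a: "shortest_path G w x p y"
 then have b: "x \<in> pverts G" "walk (parcs G) x p y" by (auto simp: shortest_path_def apath_iff)
 then have "reach x y" by (auto simp: reach_def)
 then show "x \<in> pverts G \<and> p \<in> SP x y" using a b mu_spd by (auto simp: shortest_path_def acost SP_def)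
next
 assume a: "x \<in> pverts G \<and> p \<in> SP x y"
 then show "shortest_path G w x p y"
  using mu_spd[of x y] SP_reach[of p x y] SP_distinct[of p x y] by (auto simp: shortest_path_def apath_iff acost SP_def)
qed

lemma SP_infix:
 assumes "p1 @ q @ p2 \<in> SP x y"
 shows "q \<in> SP (last (pawalk_verts x p1)) (last (pawalk_verts x (p1 @ q)))"
proof -
 obtain u v where uv: "walk (parcs G) x p1 u" "walk (parcs G) u q v" using SP_walk(1)[OF assms] by (auto simp: walk_append)
 have 1: "q @ p2 \<in> SP u y" using SP_split(2)[OF assms uv(1)] .
 have "q \<in> SP u v" using SP_split(1)[OF 1 uv(2)] .
 moreover have "last (pawalk_verts x p1) = u" using last_pawalk_verts uv(1) .
 moreover have "walk (parcs G) x (p1 @ q) v" using uv by (auto simp: walk_append)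
 then have "last (pawalk_verts x (p1 @ q)) = v" by (rule last_pawalk_verts)
 ultimately show ?thesis by simp
qed

lemma SP_edge_last: assumes "p \<in> SP x y" "e \<in> set p" shows "snd e \<in> YE x (fst e)"
proof -
 obtain p1 p2 where p: "p = p1 @ e # p2" using assms(2) by (auto dest: split_list)
 have "p = (p1 @ [e]) @ p2" using p by simp
 moreover have "walk (parcs G) x (p1 @ [e]) (snd e)" using SP_walk(1)[OF assms(1)] by (auto simp: p walk_append)
 ultimately have "p1 @ [e] \<in> SP x (snd e)" using SP_split(1) assms(1) by metis
 from SP_snoc[OF this] show ?thesis by blast
qed

lemma sp_dag_eq: "s \<in> pverts G \<Longrightarrow> sp_dag G w s = {(b, y). y \<in> YE s b}"
proof (intro set_eqI)
 fix e :: "nat \<times> nat" assume s: "s \<in> pverts G"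
 obtain b y where e: "e = (b, y)" by (cases e)
 have "(b, y) \<in> sp_dag G w s" if yb: "y \<in> YE s b"
 proof -
  obtain q where "q \<in> SP s b" using yb SP_exists by (auto simp: YE_def)
  from YE_SP[OF yb this] show ?thesis using s by (force simp: sp_dag_def shortest_iff)
 qed
 moreover have "y \<in> YE s b" if dag: "(b, y) \<in> sp_dag G w s"
 proof -
  obtain p t where "p \<in> SP s t" "(b, y) \<in> set p" using dag by (auto simp: sp_dag_def shortest_iff)
  from SP_edge_last[OF this] show ?thesis by simp
 qed
 ultimately show "e \<in> sp_dag G w s \<longleftrightarrow> e \<in> {(b, y). y \<in> YE s b}" unfolding e by blast
qed

lemma throughI:
 "p \<in> SP x y \<Longrightarrow> x \<in> pverts G \<Longrightarrow> v \<in> set (pawalk_verts x p) \<Longrightarrow> e \<in> set p \<Longrightarrow> e \<in> sp_edges_through G w v"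
 unfolding sp_edges_through_def shortest_iff awalk_verts_with_proj_eq by blast

lemma through_sub: "sp_edges_through G w v \<subseteq> parcs G"
proof
 fix e assume "e \<in> sp_edges_through G w v"
 then obtain x p y where "p \<in> SP x y" "e \<in> set p" unfolding sp_edges_through_def shortest_iff by blast
 then show "e \<in> parcs G" using walk_set[OF SP_walk(1)] by blast
qed

lemma sp_edges_sub: "sp_edges G w \<subseteq> parcs G"
proof
 fix e assume "e \<in> sp_edges G w"
 then obtain x p y where "p \<in> SP x y" "e \<in> set p" unfolding sp_edges_def shortest_iff by blast
 then show "e \<in> parcs G" using walk_set[OF SP_walk(1)] by blast
qed

lemma finite_through: "finite (sp_edges_through G w v)"
 using through_sub fin by (rule finite_subset)

lemma through_le: "v \<in> pverts G \<Longrightarrow> card (sp_edges_through G w v) \<le> nu_star G w"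
 unfolding nu_star_def using finite_verts by (intro Max_ge) auto

lemma XE_via_through: assumes "via a v b" "x \<in> XE a b" shows "(x, a) \<in> sp_edges_through G w v"
proof -
 obtain p q where pq: "p \<in> SP a v" "q \<in> SP v b" using SP_exists assms(1) unfolding via_def by blast
 have pq': "p @ q \<in> SP a b" using SP_join pq assms(1) by (auto simp: via_def)
 have x: "(x, a) # (p @ q) \<in> SP x b" by (rule XE_SP[OF assms(2) pq'])
 have "walk (parcs G) x ((x, a) # p) v" using SP_walk(1)[OF pq(1)] assms(2) by (auto simp: XE_def)
 then have "v \<in> set (pawalk_verts x ((x, a) # (p @ q)))"
  using walk_verts_iff[OF SP_walk(1)[OF x], of v] SP_walk(1)[OF pq(2)] by (metis append_Cons)
 moreover have "x \<in> pverts G" using assms(2) arc_verts by (force simp: XE_def)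
 ultimately show ?thesis using throughI[OF x] by simp
qed

lemma YE_via_through: assumes "via a v b" "y \<in> YE a b" "a \<in> pverts G" shows "(b, y) \<in> sp_edges_through G w v"
proof -
 obtain p q where pq: "p \<in> SP a v" "q \<in> SP v b" using SP_exists assms(1) unfolding via_def by blast
 have pq': "p @ q \<in> SP a b" using SP_join pq assms(1) by (auto simp: via_def)
 have x: "(p @ q) @ [(b, y)] \<in> SP a y" by (rule YE_SP[OF assms(2) pq'])
 have "walk (parcs G) v (q @ [(b, y)]) y" using SP_walk(1)[OF pq(2)] assms(2) by (auto simp: YE_def walk_append)
 then have "v \<in> set (pawalk_verts a ((p @ q) @ [(b, y)]))"
  using walk_verts_iff[OF SP_walk(1)[OF x], of v] SP_walk(1)[OF pq(1)] by (metis append_assoc)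
 then show ?thesis using throughI[OF x assms(3)] by simp
qed

lemma via_ends: "reach a b \<Longrightarrow> via a a b" "reach a b \<Longrightarrow> via a b b"
 by (auto simp: via_def)

definition LST :: "(nat \<times> nat \<times> nat \<times> nat) set" where
 "LST = {(x, a, b, y). x \<in> XE a b \<and> y \<in> YE a b \<and> x \<noteq> y} \<union> {(x, a, b, y). a = y \<and> b = x \<and> (x, y) \<in> parcs G \<and> x \<noteq> y}"

text \<open>The proper subpaths of one edge are empty and thus shortest, so every edge that is not a
  loop qualifies, even if it is longer than the distance of its ends.\<close>

lemma lsp_single: "locally_shortest_path G w x [e] y \<longleftrightarrow> e = (x, y) \<and> (x, y) \<in> parcs G \<and> x \<noteq> y"
proof
 assume "locally_shortest_path G w x [e] y"
 then show "e = (x, y) \<and> (x, y) \<in> parcs G \<and> x \<noteq> y"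
  by (auto simp: locally_shortest_path_def apath_iff)
next
 assume e: "e = (x, y) \<and> (x, y) \<in> parcs G \<and> x \<noteq> y"
 then have v: "x \<in> pverts G" "y \<in> pverts G" using arc_verts by fastforce+
 have "shortest_path G w (last (pawalk_verts x p1)) q (last (pawalk_verts x (p1 @ q)))"
  if "[e] = p1 @ q @ p2" "q \<noteq> [e]" for p1 q p2
 proof -
  have "q = [] \<and> (p1 = [] \<or> p1 = [e])" using that by (cases p1) (auto simp: Cons_eq_append_conv)
  then show ?thesis using e v by (auto simp: shortest_iff)
 qed
 then show "locally_shortest_path G w x [e] y"
  using e v by (auto simp: locally_shortest_path_def apath_iff awalk_verts_with_proj_eq)
qed

text \<open>The maximal proper subpaths drop the last or the first edge, and all others are infixes
  of these two. So local shortestness amounts to both extensions of the middle \<open>m\<close>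
  being shortest, and distinctness of the vertices reduces to \<open>x \<noteq> y\<close>.\<close>

lemma lsp_long:
 "locally_shortest_path G w x (e # m @ [f]) y \<longleftrightarrow>
   fst e = x \<and> snd f = y \<and> m \<in> SP (snd e) (fst f) \<and> x \<in> XE (snd e) (fst f) \<and> y \<in> YE (snd e) (fst f) \<and> x \<noteq> y"
proof
 assume a: "locally_shortest_path G w x (e # m @ [f]) y"
 then have ap: "x \<in> pverts G" "walk (parcs G) x (e # m @ [f]) y" "distinct (pawalk_verts x (e # m @ [f]))"
  and sub: "\<And>p1 q p2. e # m @ [f] = p1 @ q @ p2 \<Longrightarrow> q \<noteq> e # m @ [f] \<Longrightarrow>
   q \<in> SP (last (pawalk_verts x p1)) (last (pawalk_verts x (p1 @ q)))"
  by (auto simp: locally_shortest_path_def apath_iff awalk_verts_with_proj_eq shortest_iff)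
 have wk: "fst e = x" "snd f = y" "walk (parcs G) (snd e) m (fst f)" "walk (parcs G) x (e # m) (fst f)" "walk (parcs G) (snd e) (m @ [f]) y"
  using ap(2) by (auto simp: walk_append)
 have 1: "e # m \<in> SP x (fst f)" using sub[of "[]" "e # m" "[f]"] last_pawalk_verts[OF wk(4)] by simp
 have e1: "walk (parcs G) x [e] (snd e)" using ap(2) by (cases e) auto
 have 2: "m @ [f] \<in> SP (snd e) y"
  using sub[of "[e]" "m @ [f]" "[]"] last_pawalk_verts[OF ap(2)] last_pawalk_verts[OF e1] by simp
 have "y \<in> set (pawalk_verts (snd e) (m @ [f]))"
  using last_pawalk_verts[OF wk(5)] by (metis last_in_set pawalk_verts.simps list.distinct(1) list.exhaust)
 then have "x \<noteq> y" using ap(3) wk(1) by auto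
 then show "fst e = x \<and> snd f = y \<and> m \<in> SP (snd e) (fst f) \<and> x \<in> XE (snd e) (fst f) \<and> y \<in> YE (snd e) (fst f) \<and> x \<noteq> y"
  using SP_Cons[OF 1] SP_snoc[OF 2] wk by auto
next
 assume a: "fst e = x \<and> snd f = y \<and> m \<in> SP (snd e) (fst f) \<and> x \<in> XE (snd e) (fst f) \<and> y \<in> YE (snd e) (fst f) \<and> x \<noteq> y"
 then have 1: "e # m \<in> SP x (fst f)" and 2: "m @ [f] \<in> SP (snd e) y"
  using XE_SP[of x "snd e" "fst f" m] YE_SP[of y "snd e" "fst f" m] by (cases e; cases f; auto)+
 have "(x, snd e) \<in> parcs G" using a by (simp add: XE_def)
 from arc_verts[OF this] have xv: "x \<in> pverts G" "snd e \<in> pverts G" by simp_all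
 have e1: "walk (parcs G) x [e] (snd e)" using SP_walk(1)[OF 1] by (cases e) auto
 have wk: "walk (parcs G) x (e # m @ [f]) y" using e1 SP_walk(1)[OF 2] by auto
 have wm: "walk (parcs G) (snd e) m (fst f)" using SP_walk(1) a by blast
 \<comment> \<open>A second visit to \<open>x\<close> cannot be at the end \<open>y\<close>, so it
   would lie on \<open>m\<close> and contradict the distinctness of the shortest path
   \<open>e # m\<close>.\<close>
 have "x \<notin> set (pawalk_verts (snd e) (m @ [f]))"
 proof
  assume "x \<in> set (pawalk_verts (snd e) (m @ [f]))"
  then obtain q r where qr: "m @ [f] = q @ r" "walk (parcs G) (snd e) q x" "walk (parcs G) x r y"
   using walk_verts_iff[OF SP_walk(1)[OF 2], of x] by blast
  have "r \<noteq> []" using qr(3) a by auto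
  then obtain r' where r': "r = r' @ [f]" "m = q @ r'" using qr(1) by (cases r rule: rev_cases) auto
  then have "walk (parcs G) x r' (fst f)" using qr(3) by (auto simp: walk_append)
  then have "x \<in> set (pawalk_verts (snd e) m)" using walk_verts_iff[OF wm, of x] qr(2) r'(2) by blast
  then show False using SP_distinct[OF 1] a by simp
 qed
 then have dst: "distinct (pawalk_verts x (e # m @ [f]))" using SP_distinct[OF 2] a by simp
 have "shortest_path G w (last (pawalk_verts x p1)) q (last (pawalk_verts x (p1 @ q)))"
  if p: "e # m @ [f] = p1 @ q @ p2" and qn: "q \<noteq> e # m @ [f]" for p1 q p2
 proof -
  have lv: "last (pawalk_verts x p1) \<in> pverts G"
  proof -
   obtain u where u: "walk (parcs G) x p1 u" using wk unfolding p by (auto simp: walk_append)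
   then show ?thesis using last_pawalk_verts[OF u] walk_verts[OF u xv(1)] by simp
  qed
  have "q \<in> SP (last (pawalk_verts x p1)) (last (pawalk_verts x (p1 @ q)))"
  proof (cases p1)
   case Nil
   then have "p2 \<noteq> []" using p qn by auto
   then obtain p3 g where "p2 = p3 @ [g]" by (cases p2 rule: rev_cases) auto
   then have "e # m = [] @ q @ p3" using p Nil by (metis append_Cons append_Nil append_assoc butlast_snoc)
   then show ?thesis using SP_infix[of "[]" q p3 x "fst f"] 1 Nil by simp
  next
   case (Cons e' p1')
   then have "m @ [f] = p1' @ q @ p2" "e' = e" using p by auto
   then have "q \<in> SP (last (pawalk_verts (snd e) p1')) (last (pawalk_verts (snd e) (p1' @ q)))"
    using SP_infix[of p1' q p2 "snd e" y] 2 by simp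
   moreover have "pawalk_verts (snd e) p \<noteq> []" for p by (cases p) auto
   ultimately show ?thesis using Cons \<open>e' = e\<close> by simp
  qed
  then show ?thesis using lv by (simp add: shortest_iff)
 qed
 then show "locally_shortest_path G w x (e # m @ [f]) y"
  using xv wk dst by (auto simp: locally_shortest_path_def apath_iff awalk_verts_with_proj_eq)
qed

lemma list_ends_cases: obtains "p = []" | e where "p = [e]" | e m f where "p = e # m @ [f]"
 by (cases p; cases "tl p" rule: rev_cases) auto

lemma lsp_group_eq:
 "lsp_group G w x a b y =
   (if x \<in> XE a b \<and> y \<in> YE a b \<and> x \<noteq> y then (\<lambda>m. (x, a) # m @ [(b, y)]) ` SP a b else {}) \<union>
   (if a = y \<and> b = x \<and> (x, y) \<in> parcs G \<and> x \<noteq> y then {[(x, y)]} else {})"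
proof (intro set_eqI)
 fix p
 show "p \<in> lsp_group G w x a b y \<longleftrightarrow> p \<in>
   (if x \<in> XE a b \<and> y \<in> YE a b \<and> x \<noteq> y then (\<lambda>m. (x, a) # m @ [(b, y)]) ` SP a b else {}) \<union>
   (if a = y \<and> b = x \<and> (x, y) \<in> parcs G \<and> x \<noteq> y then {[(x, y)]} else {})"
  by (cases p rule: list_ends_cases) (auto simp: lsp_group_def lsp_single lsp_long image_iff)
qed

lemma XE_YE_not_single: "x \<in> XE a b \<Longrightarrow> \<not> (a = y \<and> b = x)"
 using XE_less[of x a b] spd_nonneg[of a b] by (auto simp: XE_def)

text \<open>The paths of a group differ only in the shortest path from \<open>a\<close> to
  \<open>b\<close>, so they have equal cost and are as many as these; the group of a single edge is
  a singleton.\<close>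

lemma lsp_tuples_eq:
 "lsp_tuples G w x y = (\<lambda>(a, b). (a, b, spd x b + w (b, y), if a = y \<and> b = x then 1 else real (sg a b))) ` {(a, b). (x, a, b, y) \<in> LST}"
proof (intro set_eqI, clarify)
 fix a b and c k :: real
 have rhs: "(a, b, c, k) \<in> (\<lambda>(a, b). (a, b, spd x b + w (b, y), if a = y \<and> b = x then 1 else real (sg a b))) ` {(a, b). (x, a, b, y) \<in> LST}
  \<longleftrightarrow> (x, a, b, y) \<in> LST \<and> c = spd x b + w (b, y) \<and> k = (if a = y \<and> b = x then 1 else real (sg a b))"
  by (auto simp: image_iff)
 show "(a, b, c, k) \<in> lsp_tuples G w x y \<longleftrightarrow>
  (a, b, c, k) \<in> (\<lambda>(a, b). (a, b, spd x b + w (b, y), if a = y \<and> b = x then 1 else real (sg a b))) ` {(a, b). (x, a, b, y) \<in> LST}"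
 proof (cases "x \<in> XE a b \<and> y \<in> YE a b \<and> x \<noteq> y")
  case True
  then have ns: "\<not> (a = y \<and> b = x)" using XE_YE_not_single by blast
  have grp: "lsp_group G w x a b y = (\<lambda>m. (x, a) # m @ [(b, y)]) ` SP a b" using True ns by (auto simp: lsp_group_eq)
  have "reach a b" using True by (simp add: XE_def)
  then have ne: "SP a b \<noteq> {}" using SP_exists by blast
  have cs: "cost w ((x, a) # m @ [(b, y)]) = spd x b + w (b, y)" if "m \<in> SP a b" for m
   using that True by (simp add: SP_def XE_def)
  have cd: "card (lsp_group G w x a b y) = sg a b" unfolding grp sg_def by (rule card_image) (simp add: inj_on_def)
  have "(\<forall>p\<in>lsp_group G w x a b y. wf_digraph.awalk_cost w p = c) \<longleftrightarrow> c = spd x b + w (b, y)"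
   unfolding grp using ne cs by (auto simp: acost)
  moreover have "lsp_group G w x a b y \<noteq> {}" using ne grp by simp
  moreover have "(x, a, b, y) \<in> LST" using True by (simp add: LST_def)
  ultimately show ?thesis unfolding rhs if_not_P[OF ns] using cd by (simp add: lsp_tuples_def)
 next
  case False
  then have grp: "lsp_group G w x a b y = (if a = y \<and> b = x \<and> (x, y) \<in> parcs G \<and> x \<noteq> y then {[(x, y)]} else {})"
   unfolding lsp_group_eq using False by auto
  show ?thesis unfolding rhs using False by (auto simp: lsp_tuples_def LST_def grp acost)
 qed
qed

lemma betweenness_eq: "betweenness G w v = (\<Sum>s\<in>pverts G - {v}. dep (pverts G) s v)"
proof -
 have sig: "sigma G w s t = sg s t" if "s \<in> pverts G" for s t
  using that by (simp add: sigma_def shortest_iff sg_def)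
 have sigv: "sigma_via G w s t v = (if via s v t then sg s v * sg v t else 0)" if "s \<in> pverts G" for s t
  using that card_SP_via[of s t v] by (simp add: sigma_via_def shortest_iff awalk_verts_with_proj_eq)
 show ?thesis unfolding betweenness_def dep_def
  by (intro sum.cong) (auto simp: sig sigv)
qed

end

section \<open>Counting tuples\<close>

lemma sum_card_le:
 assumes "finite I" "\<And>i. i \<in> I \<Longrightarrow> finite (F i)" "finite S" "inj_on f (Sigma I F)" "f ` Sigma I F \<subseteq> S"
 shows "(\<Sum>i\<in>I. card (F i)) \<le> card S"
proof -
 have "(\<Sum>i\<in>I. card (F i)) = card (Sigma I F)" using assms(1,2) by (simp add: card_SigmaI)
 also have "\<dots> \<le> card S" using assms(4,5,3) by (rule card_inj_on_le)
 finally show ?thesis .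
qed

text \<open>Only an inclusion is assumed, because vertices get deleted while the machine keeps the
  original \<open>n\<close>. A deleted vertex lives on as an index without edges.\<close>

locale run = fgraph G w + ram n h W for G w n h W +
 assumes verts: "pverts G \<subseteq> {..<n}"
begin

sublocale alg n h W "parcs G" w
proof
 show "parcs G \<subseteq> {..<n} \<times> {..<n}" using arc_verts verts by fastforce
qed

lemma reach_ghost: "x \<notin> pverts G \<Longrightarrow> reach x y \<Longrightarrow> x = y"
proof -
 assume x: "x \<notin> pverts G" "reach x y"
 then obtain p where p: "walk (parcs G) x p y" by (auto simp: reach_def)
 then show "x = y" using x(1) arc_verts by (cases p) auto
qed

lemma YE_verts: "y \<in> YE x b \<Longrightarrow> x \<in> pverts G"
 using reach_ghost[of x b] arc_verts by (fastforce simp: YE_def)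

lemma XE_verts: "x \<in> XE a b \<Longrightarrow> a \<in> pverts G \<and> b \<in> pverts G"
 using arc_verts reach_verts by (fastforce simp: XE_def)

text \<open>Each edge of the dag rooted at \<open>x\<close> ends a shortest path that starts in
  \<open>x\<close>, hence lies on a shortest path through \<open>x\<close>.\<close>

lemma out_edges: "finite {(b, y). y \<in> YE x b}" "card {(b, y). y \<in> YE x b} \<le> nu_star G w"
proof -
 have "finite {(b, y). y \<in> YE x b} \<and> card {(b, y). y \<in> YE x b} \<le> nu_star G w"
 proof (cases "x \<in> pverts G")
  case True
  have "{(b, y). y \<in> YE x b} \<subseteq> sp_edges_through G w x"
   using YE_via_through[OF via_ends(1)] True by (auto simp: YE_def)
  then show ?thesis using card_mono[OF finite_through] through_le[OF True] finite_subset[OF _ finite_through] by (meson le_trans)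
 next
  case False
  then have "{(b, y). y \<in> YE x b} = {}" using YE_verts by blast
  then show ?thesis by simp
 qed
 then show "finite {(b, y). y \<in> YE x b}" "card {(b, y). y \<in> YE x b} \<le> nu_star G w" by blast+
qed

lemma in_edges: "finite {(x, a). x \<in> XE a b}" "card {(x, a). x \<in> XE a b} \<le> nu_star G w"
proof -
 have "finite {(x, a). x \<in> XE a b} \<and> card {(x, a). x \<in> XE a b} \<le> nu_star G w"
 proof (cases "b \<in> pverts G")
  case True
  have "{(x, a). x \<in> XE a b} \<subseteq> sp_edges_through G w b"
   using XE_via_through[OF via_ends(2)] by (auto simp: XE_def)
  then show ?thesis using card_mono[OF finite_through] through_le[OF True] finite_subset[OF _ finite_through] by (meson le_trans)
 next
  case False
  then have "{(x, a). x \<in> XE a b} = {}" using XE_verts by blast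
  then show ?thesis by simp
 qed
 then show "finite {(x, a). x \<in> XE a b}" "card {(x, a). x \<in> XE a b} \<le> nu_star G w" by blast+
qed

lemma finite_XE': "finite (XE a b)"
proof -
 have "XE a b \<subseteq> {..<n}" using XE_n by blast
 then show ?thesis by (rule finite_subset) simp
qed

text \<open>For fixed \<open>x\<close> the predecessors of all \<open>y\<close> are the edges of the
  dag of \<open>x\<close>, and dually for fixed \<open>y\<close>; this gives \<open>2 * n\<close>
  edge sets of size at most \<open>nu_star G w\<close>.\<close>

lemma degs_le: "degs \<le> 2 * n * nu_star G w"
proof -
 have 1: "(\<Sum>y<n. card {b. y \<in> YE x b}) \<le> nu_star G w" for x
  by (rule order_trans[OF sum_card_le[where f = "\<lambda>(y, b). (b, y)" and S = "{(b, y). y \<in> YE x b}"] out_edges(2)])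
   (auto simp: finite_YE out_edges inj_on_def)
 have 2: "(\<Sum>x<n. card {a. x \<in> XE a y}) \<le> nu_star G w" for y
  by (rule order_trans[OF sum_card_le[where f = "\<lambda>z. z" and S = "{(x, a). x \<in> XE a y}"] in_edges(2)])
   (auto simp: finite_XE in_edges inj_on_def)
 have "degs = (\<Sum>x<n. \<Sum>y<n. card {b. y \<in> YE x b}) + (\<Sum>y<n. \<Sum>x<n. card {a. x \<in> XE a y})"
  unfolding degs_def deg_def sum.cartesian_product[symmetric] sum.distrib
  by (subst (2) sum.swap) (rule refl)
 also have "\<dots> \<le> (\<Sum>x<n. nu_star G w) + (\<Sum>y<n. nu_star G w)" by (intro add_mono sum_mono 1 2)
 finally show ?thesis by simp
qed

lemma fam_size_le:
 assumes Z: "sound Z"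
 shows "(\<Sum>j<n * n. fam_size Z j) \<le> 2 * n * nu_star G w"
proof -
 have 1: "(\<Sum>b<n. card (YE a b)) \<le> nu_star G w" for a
  by (rule order_trans[OF sum_card_le[where f = "\<lambda>z. z" and S = "{(b, y). y \<in> YE a b}"] out_edges(2)])
   (auto simp: finite_YE' out_edges inj_on_def)
 have 2: "(\<Sum>a<n. card (XE a b)) \<le> nu_star G w" for b
  by (rule order_trans[OF sum_card_le[where f = "\<lambda>(a, x). (x, a)" and S = "{(x, a). x \<in> XE a b}"] in_edges(2)])
   (auto simp: finite_XE' in_edges inj_on_def)
 have "(\<Sum>j<n * n. fam_size Z j) = (\<Sum>(a, b)\<in>{..<n} \<times> {..<n}. card (Z 0 a b) + card (Z (Suc 0) a b))"
  unfolding fam_size_def by (rule sum_pairs)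
 also have "\<dots> \<le> (\<Sum>(a, b)\<in>{..<n} \<times> {..<n}. card (XE a b) + card (YE a b))"
 proof (intro sum_mono, clarify)
  fix a b
  show "card (Z 0 a b) + card (Z (Suc 0) a b) \<le> card (XE a b) + card (YE a b)"
   using Z unfolding sound_def by (intro add_mono card_mono finite_XE' finite_YE') blast+
 qed
 also have "\<dots> = (\<Sum>b<n. \<Sum>a<n. card (XE a b)) + (\<Sum>a<n. \<Sum>b<n. card (YE a b))"
  unfolding sum.cartesian_product[symmetric] sum.distrib
  by (subst (1) sum.swap) (rule refl)
 also have "\<dots> \<le> (\<Sum>b<n. nu_star G w) + (\<Sum>a<n. nu_star G w)" by (intro add_mono sum_mono 1 2)
 finally show ?thesis by simp
qed

lemma full_LST: "tuples n full E1 = LST"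
 using XE_n YE_n by (fastforce simp: tuples_def full_def LST_def)

lemma start_tuples: "finite {(a, b, y). a < n \<and> y \<in> YE a b}" "card {(a, b, y). a < n \<and> y \<in> YE a b} \<le> n * nu_star G w"
proof -
 have eq: "{(a, b, y). a < n \<and> y \<in> YE a b} = Sigma {..<n} (\<lambda>a. {(b, y). y \<in> YE a b})" by auto
 show "finite {(a, b, y). a < n \<and> y \<in> YE a b}" unfolding eq using out_edges by (intro finite_SigmaI) auto
 have "card (Sigma {..<n} (\<lambda>a. {(b, y). y \<in> YE a b})) = (\<Sum>a<n. card {(b, y). y \<in> YE a b})" using out_edges by (intro card_SigmaI) auto
 also have "\<dots> \<le> (\<Sum>a<n. nu_star G w)" by (intro sum_mono out_edges)
 finally show "card {(a, b, y). a < n \<and> y \<in> YE a b} \<le> n * nu_star G w" unfolding eq by simp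
qed

lemma end_tuples: "finite {(b, x, a). b < n \<and> x \<in> XE a b}" "card {(b, x, a). b < n \<and> x \<in> XE a b} \<le> n * nu_star G w"
proof -
 have eq: "{(b, x, a). b < n \<and> x \<in> XE a b} = Sigma {..<n} (\<lambda>b. {(x, a). x \<in> XE a b})" by auto
 show "finite {(b, x, a). b < n \<and> x \<in> XE a b}" unfolding eq using in_edges by (intro finite_SigmaI) auto
 have "card (Sigma {..<n} (\<lambda>b. {(x, a). x \<in> XE a b})) = (\<Sum>b<n. card {(x, a). x \<in> XE a b})" using in_edges by (intro card_SigmaI) auto
 also have "\<dots> \<le> (\<Sum>b<n. nu_star G w)" by (intro sum_mono in_edges)
 finally show "card {(b, x, a). b < n \<and> x \<in> XE a b} \<le> n * nu_star G w" unfolding eq by simp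
qed

lemma pruned_tuples:
 assumes Z: "sound Z" and v: "v \<in> pverts G" and vf: "\<And>a b. a < n \<Longrightarrow> b < n \<Longrightarrow> vf a b \<longleftrightarrow> via a v b"
  and fin: "finite (tuples n (prune v vf ({..<n} \<times> {..<n}) Z) S)"
 shows "card (tuples n Z S) \<le> card (tuples n (prune v vf ({..<n} \<times> {..<n}) Z) S) + nu_star G w * nu_star G w + 2 * (n * nu_star G w)"
proof -
 let ?Z = "prune v vf ({..<n} \<times> {..<n}) Z"
 let ?N = "nu_star G w"
 define D1 where "D1 = {(x, a, b, y). x \<in> XE a b \<and> y \<in> YE a b \<and> via a v b}"
 define D2 where "D2 = (\<lambda>(a, b, y). (v, a, b, y)) ` {(a, b, y). a < n \<and> y \<in> YE a b}"
 define D3 where "D3 = (\<lambda>(b, x, a). (x, a, b, v)) ` {(b, x, a). b < n \<and> x \<in> XE a b}"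
 have D2: "finite D2" "card D2 \<le> n * ?N"
  unfolding D2_def using start_tuples card_image_le[OF start_tuples(1), of "\<lambda>(a, b, y). (v, a, b, y)"] by auto
 have D3: "finite D3" "card D3 \<le> n * ?N"
  unfolding D3_def using end_tuples card_image_le[OF end_tuples(1), of "\<lambda>(b, x, a). (x, a, b, v)"] by auto
 have D1: "finite D1" "card D1 \<le> ?N * ?N"
 proof -
  let ?T = "sp_edges_through G w v"
  have sub: "D1 \<subseteq> (\<lambda>((x, a), (b, y)). (x, a, b, y)) ` (?T \<times> ?T)"
  proof clarify
   fix x a b y assume "(x, a, b, y) \<in> D1"
   then have d: "x \<in> XE a b" "y \<in> YE a b" "via a v b" by (simp_all add: D1_def)
   have "(x, a) \<in> ?T" "(b, y) \<in> ?T" using XE_via_through[OF d(3,1)] YE_via_through[OF d(3,2)] XE_verts[OF d(1)] by auto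
   then show "(x, a, b, y) \<in> (\<lambda>((x, a), (b, y)). (x, a, b, y)) ` (?T \<times> ?T)" by force
  qed
  have f: "finite (?T \<times> ?T)" using finite_through by simp
  show "finite D1" using sub f by (rule finite_subset[OF _ finite_imageI])
  have "card D1 \<le> card (?T \<times> ?T)" by (rule order_trans[OF card_mono[OF finite_imageI[OF f] sub] card_image_le[OF f]])
  also have "\<dots> \<le> ?N * ?N" unfolding card_cartesian_product using through_le[OF v] by (intro mult_le_mono)
  finally show "card D1 \<le> ?N * ?N" .
 qed
 have "tuples n Z S \<subseteq> tuples n ?Z S \<union> D1 \<union> D2 \<union> D3"
 proof clarify
  fix x a b y assume t: "(x, a, b, y) \<in> tuples n Z S" "(x, a, b, y) \<notin> D3" "(x, a, b, y) \<notin> D2" "(x, a, b, y) \<notin> D1"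
  show "(x, a, b, y) \<in> tuples n ?Z S"
  proof (cases "a = y \<and> b = x \<and> (x, y) \<in> S")
   case False
   then have m: "a < n" "b < n" "x \<in> Z 0 a b" "y \<in> Z (Suc 0) a b" "x \<noteq> y" using t(1) by (auto simp: tuples_def)
   then have xe: "x \<in> XE a b" "y \<in> YE a b" using Z unfolding sound_def by blast+
   have "x \<noteq> v" "y \<noteq> v" "\<not> via a v b" using t m xe by (auto simp: D1_def D2_def D3_def image_iff)
   then show ?thesis using m vf by (simp add: tuples_def prune_def)
  qed (simp add: tuples_def)
 qed
 then have "card (tuples n Z S) \<le> card (tuples n ?Z S \<union> D1 \<union> D2 \<union> D3)" using fin D1 D2 D3 by (intro card_mono) auto
 also have "\<dots> \<le> card (tuples n ?Z S) + card D1 + card D2 + card D3" by (intro order_trans[OF card_Un_le] add_mono order_refl)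
 finally show ?thesis using D1 D2 D3 by simp
qed

text \<open>The first edge of a tuple with more than one edge lies on a shortest path, giving
  \<open>m_star\<close> choices, and its last edge is in the dag rooted at \<open>a\<close>, giving
  at most \<open>nu_star\<close> more. Single edges are counted separately by
  \<open>n * n\<close>.\<close>

lemma LST_le: "card LST \<le> m_star G w * nu_star G w + n * n"
proof -
 have fm: "finite (sp_edges G w)" using sp_edges_sub fin by (rule finite_subset)
 define B where "B = Sigma (sp_edges G w) (\<lambda>(x, a). {(b, y). y \<in> YE a b})"
 have fB: "finite B" unfolding B_def using fm out_edges by (intro finite_SigmaI) auto
 have "card B = (\<Sum>(x, a)\<in>sp_edges G w. card {(b, y). y \<in> YE a b})"
  unfolding B_def using fm out_edges by (subst card_SigmaI) (auto intro: sum.cong)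
 also have "\<dots> \<le> (\<Sum>e\<in>sp_edges G w. nu_star G w)" by (intro sum_mono) (auto intro: out_edges)
 finally have cB: "card B \<le> m_star G w * nu_star G w" by (simp add: m_star_def)
 have sub: "LST \<subseteq> (\<lambda>((x, a), (b, y)). (x, a, b, y)) ` B \<union> (\<lambda>(x, y). (x, y, x, y)) ` ({..<n} \<times> {..<n})"
 proof clarify
  fix x a b y assume t: "(x, a, b, y) \<in> LST" "(x, a, b, y) \<notin> (\<lambda>(x, y). (x, y, x, y)) ` ({..<n} \<times> {..<n})"
  then have d: "x \<in> XE a b" "y \<in> YE a b" using E_n by (auto simp: LST_def)
  have "(x, a) \<in> sp_edges_through G w b" using XE_via_through[OF via_ends(2) d(1)] d(1) by (simp add: XE_def)
  then have "(x, a) \<in> sp_edges G w" unfolding sp_edges_through_def sp_edges_def by blast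
  then show "(x, a, b, y) \<in> (\<lambda>((x, a), (b, y)). (x, a, b, y)) ` B" using d(2) by (force simp: B_def)
 qed
 have "card LST \<le> card ((\<lambda>((x, a), (b, y)). (x, a, b, y)) ` B \<union> (\<lambda>(x, y). (x, y, x, y)) ` ({..<n} \<times> {..<n}))"
  using fB by (intro card_mono sub) auto
 also have "\<dots> \<le> card B + card ({..<n} \<times> {..<n})"
  using fB by (intro order_trans[OF card_Un_le] add_mono card_image_le) auto
 finally show ?thesis using cB by simp
qed

section \<open>Correctness of the output\<close>

lemma tuples_out:
 assumes S: "store s LST spd w rsg" and x: "x < n" "y < n"
 shows "distinct (read_tuples n s x y)" "set (read_tuples n s x y) = lsp_tuples G w x y"
proof -
 note B = storeD(1)[OF S]
 define a where "a i = words s ''lsp_a'' ((x * n + y) * (n * n) + i)" for i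
 define b where "b i = words s ''lsp_b'' ((x * n + y) * (n * n) + i)" for i
 define l where "l = words s ''lsp_len'' (x * n + y)"
 let ?v = "\<lambda>(a, b). (a, b, spd x b + w (b, y), if a = y \<and> b = x then 1 else rsg a b)"
 have b1: "(x, a i, b i, y) \<in> LST \<and> words s ''pos'' (ix4 n x (a i) (b i) y) = i \<and>
   reals s ''lsp_weight'' ((x * n + y) * (n * n) + i) = twt spd w x (a i) (b i) y \<and>
   reals s ''lsp_count'' ((x * n + y) * (n * n) + i) = tct rsg x (a i) (b i) y" if "i < l" for i
  using blocksD(2)[OF B x, of i] that by (simp add: a_def b_def l_def)
 have list: "read_tuples n s x y = map (\<lambda>i. ?v (a i, b i)) [0..<l]"
  unfolding read_tuples_def Let_def power2_eq_square l_def[symmetric]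
  by (rule map_cong[OF refl]) (use b1 in \<open>auto simp: twt_def tct_def a_def b_def\<close>)
 have "inj_on (\<lambda>i. ?v (a i, b i)) (set [0..<l])"
 proof (rule inj_onI)
  fix i j assume ij: "i \<in> set [0..<l]" "j \<in> set [0..<l]" "?v (a i, b i) = ?v (a j, b j)"
  then have "a i = a j" "b i = b j" "i < l" "j < l" by auto
  then show "i = j" using b1[of i] b1[of j] by metis
 qed
 then show "distinct (read_tuples n s x y)" unfolding list distinct_map by simp
 have img: "(\<lambda>i. (a i, b i)) ` {..<l} = {(a, b). (x, a, b, y) \<in> LST}"
 proof
  show "(\<lambda>i. (a i, b i)) ` {..<l} \<subseteq> {(a, b). (x, a, b, y) \<in> LST}" using b1 by auto
  show "{(a, b). (x, a, b, y) \<in> LST} \<subseteq> (\<lambda>i. (a i, b i)) ` {..<l}"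
  proof clarify
   fix c d assume "(x, c, d, y) \<in> LST"
   from blocksD(3)[OF B this] show "(c, d) \<in> (\<lambda>i. (a i, b i)) ` {..<l}"
    by (intro image_eqI[where x = "words s ''pos'' (ix4 n x c d y)"]) (auto simp: a_def b_def l_def)
  qed
 qed
 have "set (read_tuples n s x y) = ?v ` ((\<lambda>i. (a i, b i)) ` {..<l})" unfolding list by (simp add: image_image atLeast0LessThan)
 then show "set (read_tuples n s x y) = lsp_tuples G w x y" unfolding img lsp_tuples_eq .
qed

text \<open>Indices outside the vertex set add nothing: no vertex reaches them, and they reach only
  themselves.\<close>

lemma scores_out:
 assumes v: "v \<in> pverts G"
 shows "(\<Sum>x\<in>{..<n} - {v}. dep {..<n} x v) = betweenness G w v"
proof -
 have 1: "dep {..<n} x v = dep (pverts G) x v" for x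
  unfolding dep_def
 proof (rule sum.mono_neutral_right)
  show "finite ({..<n} - {v})" "pverts G - {v} \<subseteq> {..<n} - {v}" using verts by auto
  have "\<not> via x v t" if "t \<notin> pverts G" for t
  proof
   assume "via x v t"
   then have "reach v t" by (simp add: via_def)
   then show False using reach_verts[of v t] v that by simp
  qed
  then show "\<forall>t\<in>{..<n} - {v} - (pverts G - {v}). (if via x v t then real (sg x v * sg v t) / real (sg x t) else 0) = 0" by auto
 qed
 have "(\<Sum>x\<in>{..<n} - {v}. dep (pverts G) x v) = (\<Sum>x\<in>pverts G - {v}. dep (pverts G) x v)"
 proof (rule sum.mono_neutral_right)
  show "\<forall>x\<in>{..<n} - {v} - (pverts G - {v}). dep (pverts G) x v = 0"
  proof
   fix x assume "x \<in> {..<n} - {v} - (pverts G - {v})"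
   then have "\<not> reach x v" using reach_ghost[of x v] by auto
   then show "dep (pverts G) x v = 0" by (rule dep_unreached)
  qed
 qed (use verts in auto)
 then show ?thesis unfolding betweenness_eq 1 .
qed

definition maintained :: "state \<Rightarrow> bool" where
 "maintained s \<longleftrightarrow> settled s \<and> graph_rep n s (parcs G) w"

lemma finv_cong:
 assumes "\<And>z. z \<in> str_words \<union> {''tg'', ''rc'', ''bn'', ''bl'', ''or'', ''oc'', ''n''} \<Longrightarrow> words s' z = words s z"
  "\<And>z. z \<in> store_reals \<union> {''kg'', ''d'', ''sg'', ''w''} \<Longrightarrow> reals s' z = reals s z"
 shows "finv s' Z P = finv s Z P"
proof -
 have "str s' Z E1 spd w rsg = str s Z E1 spd w rsg" using assms by (intro str_cong) auto
 moreover have "gok s' (tuples n Z E1) spd w = gok s (tuples n Z E1) spd w" using assms by (intro gok_cong) simp_all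
 ultimately show ?thesis unfolding finv_def dist_ok_def lists_ok_def ord_ok_def warr_def using assms by simp
qed

lemma settled_cong:
 assumes "\<And>z. z \<in> str_words \<union> {''tg'', ''rc'', ''bn'', ''bl'', ''or'', ''oc'', ''n''} \<Longrightarrow> words s' z = words s z"
  "\<And>z. z \<in> store_reals \<union> {''kg'', ''d'', ''sg'', ''w''} \<Longrightarrow> reals s' z = reals s z"
 shows "settled s' = settled s"
 unfolding settled_def using finv_cong[of s' s, OF assms] assms by simp

lemma output_ok:
 assumes "settled s" "dag_holds n s {(r, b, y). y \<in> YE r b}" "\<forall>u<n. reals s ''bc'' u = (\<Sum>x\<in>{..<n} - {u}. dep {..<n} x u)"
 shows "output_correct n (G, w) s"
proof -
 obtain Z P where F: "finv s Z P" and T: "tuples n Z E1 = tuples n full E1" using assms(1) unfolding settled_def by (elim exE conjE)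
 have "str s Z E1 spd w rsg" using F by (simp add: finv_def)
 note S = strD(1)[OF this, unfolded T full_LST]
 have dag: "read_dag n s r = dag_list n s r" for r by (simp add: read_dag_def dag_list_def power2_eq_square)
 have sub: "z < n" if "z \<in> pverts G" for z using verts that by blast
 have "distinct (dag_list n s r) \<and> set (dag_list n s r) = sp_dag G w r" if "r \<in> pverts G" for r
  using assms(2) sub[OF that] unfolding sp_dag_eq[OF that] by (simp add: dag_holds_def)
 moreover have "reals s ''bc'' v = betweenness G w v" if "v \<in> pverts G" for v
  using assms(3) sub[OF that] scores_out[OF that] by simp
 ultimately show ?thesis using tuples_out[OF S] sub by (simp add: dag)
qed

lemma fixup_writes: "''eg'' \<notin> word_writes fixup" "''w'' \<notin> real_writes fixup"
 by (simp_all add: fixup_def settle_def)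

end

section \<open>Initialisation and update\<close>

text \<open>A syntactic criterion: the array is only assigned the constants 0 and 1. It carries the
  bound on \<open>ff\<close> through \<open>cleanup\<close> without threading it through the loop
  invariants.\<close>

fun flag_writes :: "string \<Rightarrow> com \<Rightarrow> bool" where
 "flag_writes x (WSet y i a) \<longleftrightarrow> (y = x \<longrightarrow> a = WConst 0 \<or> a = WConst 1)"
| "flag_writes x (Seq c d) \<longleftrightarrow> flag_writes x c \<and> flag_writes x d"
| "flag_writes x (Cond b c d) \<longleftrightarrow> flag_writes x c \<and> flag_writes x d"
| "flag_writes x (While b c) \<longleftrightarrow> flag_writes x c"
| "flag_writes x _ \<longleftrightarrow> True"

lemma exec_flags: "exec W c s t s' \<Longrightarrow> flag_writes x c \<Longrightarrow> \<forall>p. words s x p \<le> 1 \<Longrightarrow> \<forall>p. words s' x p \<le> 1"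
 by (induction rule: exec.induct) auto

lemma wp_flags:
 assumes "wp W c Q s" "flag_writes x c" "\<forall>p. words s x p \<le> 1"
 shows "wp W c (\<lambda>t s'. Q t s' \<and> (\<forall>p. words s' x p \<le> 1)) s"
 using assms exec_flags unfolding wp_def by meson

lemma no_writes_flag: "x \<notin> word_writes c \<Longrightarrow> flag_writes x c"
 by (induction c) auto

lemma loaded_cong:
 "(\<And>z. z \<in> {''upd_kind'', ''upd_vertex'', ''upd_len'', ''upd_src'', ''upd_dst''} \<Longrightarrow> words s' z = words s z) \<Longrightarrow>
   reals s' ''upd_wt'' = reals s ''upd_wt'' \<Longrightarrow> loaded u s' = loaded u s"
 by (simp add: loaded_def)

context ram begin

lemma flags_cleanup: "flag_writes ''ff'' cleanup"
proof -
 have "flag_writes ''ff'' del" by (rule no_writes_flag) simp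
 then show ?thesis
  by (simp add: cleanup_def purge_def For_def del_row_def del_elem_def load_rows_def via_test_def)
qed

lemma str_zero:
 assumes "\<And>z. z \<in> str_words \<Longrightarrow> words s z = (\<lambda>_. 0)"
 shows "str s (\<lambda>_ _ _. {}) {} D w g"
proof -
 have "tuples n (\<lambda>_ _ _. {}) {} = {}" by (simp add: tuples_def)
 moreover have "store s {} D w g"
  unfolding store_def trees_def blocks_def cell_counts_def PL_def PF_def
  using assms by (auto intro: tree_empty)
 ultimately show ?thesis unfolding str_def fam_def fam_ok_def using assms by simp
qed

end

context run begin

definition refresh :: com where "refresh = (fixup ;; dags ;; scores)"

definition ini :: com where
 "ini =
   (For ''ui'' (V ''m'')
    (WSet ''eg'' (ix2 (WGet ''src'' (V ''ui'')) (WGet ''dst'' (V ''ui''))) (C 1) ;;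
    RSet ''w'' (ix2 (WGet ''src'' (V ''ui'')) (WGet ''dst'' (V ''ui''))) (RGet ''wt'' (V ''ui''))) ;;
   For ''ui'' (WMul (V ''n'') (V ''n''))
    (WSet ''q'' (C 0) (WDiv (V ''ui'') (V ''n'')) ;; WSet ''q'' (C 1) (WMod (V ''ui'') (V ''n'')) ;; add1) ;;
   refresh)"

definition upd :: com where
 "upd = (''uv'' ::= V ''upd_vertex'' ;; cleanup ;; scan rm1 ;; edit ;; scan add1 ;; refresh)"

lemma refresh_wp:
 assumes S: "str s Z E1 spd w rsg" and Z: "sound Z" and G: "tree (words s ''tg'') (reals s ''kg'') (n * n) 0 0 {} key0"
  and nn: "words s ''n'' 0 = n" and gr: "graph_rep n s (parcs G) w" and ff: "\<And>p. words s ''ff'' p \<le> 1"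
 shows "wp W refresh (\<lambda>t s'. maintained s' \<and> output_correct n (G, w) s' \<and>
   t + (18 * h + 52) * card (tuples n Z E1) \<le> (18 * h + 52) * card LST + (30 * h + 110) * degs + (12 * h + 109) * (n * n) + 12 * n + 23) s"
proof -
 have wa: "warr s" unfolding warr_def using E_n graph_repD(3)[OF gr] by auto
 show ?thesis
  unfolding refresh_def
  apply (rule wp_Seq, rule wp_conseq, rule fixup_wp[OF S Z G nn wa ff])
  subgoal premises P for t s1
  proof -
   have st1: "settled s1" using P(1) by blast
   obtain Z1 P1 where F: "finv s1 Z1 P1" and td: "todo P1 = {}" using st1 unfolding settled_def by (elim exE conjE)
   note rd = finv_reached(2)[OF F td]
   have gr1: "graph_rep n s1 (parcs G) w" using gr fixup_writes by (subst graph_rep_cong[of s1 s]) (auto intro: P(2,3))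
   show ?thesis
    apply (rule wp_Seq, rule wp_conseq, rule dags_wp[OF rd])
    subgoal premises Q for t2 s2
    proof -
     have rd2: "ready s2" using rd by (subst ready_cong[of s2 s1]) (auto simp: Q)
     show ?thesis
      apply (rule wp_conseq, rule scores_wp[OF rd2])
      subgoal premises R for t3 s3
      proof -
       have "settled s3" using st1 by (subst settled_cong[of s3 s1]) (auto simp: Q R)
       moreover have "graph_rep n s3 (parcs G) w" using gr1 by (subst graph_rep_cong[of s3 s1]) (simp_all add: Q R)
       moreover have "dag_holds n s3 {(r, b, y). y \<in> YE r b}" using Q(1) by (subst dag_holds_cong[of s3 s2]) (auto simp: R)
       moreover have "\<forall>u<n. reals s3 ''bc'' u = (\<Sum>x\<in>{..<n} - {u}. dep {..<n} x u)" using R(1) by blast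
       ultimately have "maintained s3 \<and> output_correct n (G, w) s3" using output_ok by (simp add: maintained_def)
       moreover have "t + (18 * h + 52) * card (tuples n Z E1) \<le> (18 * h + 52) * card LST + (30 * h + 100) * degs + (12 * h + 91) * (n * n) + 6 * n + 13"
        using P(1) unfolding full_LST by blast
       moreover have "t2 \<le> 6 * degs + 6 * (n * n) + 3 * n + 4" "t3 \<le> 4 * degs + 12 * (n * n) + 3 * n + 6" using Q(1) R(1) by blast+
       ultimately show ?thesis by (simp add: algebra_simps)
      qed
      done
    qed
    done
  qed
  done
qed

lemma ini_wp:
 assumes es: "distinct es" "set es = parcs G"
 shows "wp W ini (\<lambda>t s'. maintained s' \<and> output_correct n (G, w) s') (initial_state n es w)"
proof -
 define s where "s = initial_state n es w"
 have s: "words s ''n'' 0 = n" "words s ''m'' 0 = length es" "words s ''src'' = array_of (map fst es)" "words s ''dst'' = array_of (map snd es)"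
  "reals s ''wt'' = array_of (map w es)" by (simp_all add: s_def initial_state_def scalar_def)
 have zero: "words s z = (\<lambda>_. 0)" if "z \<notin> {''n'', ''m'', ''src'', ''dst''}" for z using that by (simp add: s_def initial_state_def)
 have "card (set es) \<le> card ({..<n} \<times> {..<n})" using es(2) E_n by (intro card_mono) auto
 then have len: "length es \<le> n * n" using distinct_card[OF es(1)] by simp
 then have lW: "length es < W" using W_const(7) by linarith
 \<comment> \<open>The time argument is left unconstrained, as the initialisation is not
   charged.\<close>
 let ?I1 = "\<lambda>j (t::nat) s'. graph_rep n s' (set (take j es)) w \<and> (\<forall>z. z \<notin> {''ui'', ''eg''} \<longrightarrow> words s' z = words s z) \<and> reals s' ''wt'' = reals s ''wt''"
 show ?thesis
  unfolding ini_def s_def[symmetric]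
  apply (rule wp_Seq, rule wp_For[where m = "length es" and I = ?I1])
  subgoal by (rule lW)
  apply (simp)
  apply ((simp add: graph_rep_def zero))
  subgoal premises J for j t s' using J(1) lW s by simp
  subgoal premises J for j t s'
  proof -
   obtain a b where ab: "es ! j = (a, b)" by (cases "es ! j")
   have "es ! j \<in> set es" using J(3) by simp
   then have ab': "a < n" "b < n" using es(2) E_n ab by auto
   have WW: "j < W" "a < W" "b < W" "a * n < W" "a * n + b < W" using ab' J(3) lW by (auto simp: bnd)
   have st: "words s' ''n'' 0 = n" "words s' ''src'' j = a" "words s' ''dst'' j = b" "reals s' ''wt'' j = w (a, b)" using J ab s by (simp_all add: array_of_def)
   define s2 where "s2 = rupd (wupd s' ''eg'' (a * n + b) (Suc 0)) ''w'' (a * n + b) (w (a, b))"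
   have "graph_rep n s2 (insert (a, b) (set (take j es))) w" unfolding s2_def using J(1) ab' by (intro graph_rep_insert) simp_all
   moreover have "insert (a, b) (set (take j es)) = set (take (Suc j) es)" using J(3) ab by (simp add: take_Suc_conv_app_nth)
   ultimately have g: "graph_rep n (wupd s2 ''ui'' 0 (Suc j)) (set (take (Suc j) es)) w"
    by (subst graph_rep_cong[of _ s2]) simp_all
   have o: "words s2 ''ui'' 0 = j" "\<forall>z. z \<notin> {''ui'', ''eg''} \<longrightarrow> words s2 z = words s z" "reals s2 ''wt'' = reals s ''wt''"
    using J(1,2) by (simp_all add: s2_def)
   have st2: "wp W (WSet ''eg'' (ix2 (WGet ''src'' (V ''ui'')) (WGet ''dst'' (V ''ui''))) (C 1) ;;
    RSet ''w'' (ix2 (WGet ''src'' (V ''ui'')) (WGet ''dst'' (V ''ui''))) (RGet ''wt'' (V ''ui''))) Q s' \<longleftrightarrow> Q 2 s2" for Q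
    by (simp add: wp_simps st J(2) WW s2_def eval_nat_numeral)
   show ?thesis
    unfolding st2
    apply (intro conjI)
    subgoal by (rule o)
    subgoal by (rule g)
    subgoal using o(2) by simp
    subgoal using o(3) by simp
    done
  qed
  subgoal premises J1 for t1 s1
  proof -
   have gr1: "graph_rep n s1 (parcs G) w" using J1(1) es(2) by simp
   have w1: "words s1 z = words s z" if "z \<notin> {''ui'', ''eg''}" for z by (rule J1(1)[THEN conjunct2, THEN conjunct1, rule_format, OF that])
   have str1: "str s1 (\<lambda>_ _ _. {}) {} spd w rsg" by (rule str_zero) (auto simp: w1 zero)
   have gr0: "graph_rep n (wupd s1 ''ui'' 0 0) (parcs G) w" using gr1 by (subst graph_rep_cong[of _ s1]) simp_all
   have n1: "words s1 ''n'' 0 = n" "words s1 ''tg'' = (\<lambda>_. 0)" "words s1 ''ff'' = (\<lambda>_. 0)" by (simp_all add: w1 s(1) zero)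
   let ?I2 = "\<lambda>j (t::nat) s'. str s' (\<lambda>_ _ _. {}) (E1 \<inter> pairs_below j) spd w rsg \<and> graph_rep n s' (parcs G) w \<and>
     words s' ''n'' 0 = n \<and> words s' ''tg'' = (\<lambda>_. 0) \<and> words s' ''ff'' = (\<lambda>_. 0)"
   show ?thesis
    apply (rule wp_Seq, rule wp_For[where m = "n * n" and I = ?I2])
    apply simp_all[2]
    subgoal
     using str1 gr0 n1 by simp
    subgoal premises J for j t s' using J(1) by simp
    subgoal premises J for j t s'
    proof -
     define x where "x = j div n"
     define y where "y = j mod n"
     note pb = pairs_below_Suc[OF J(3), folded x_def y_def]
     have WW: "j < W" "x < W" "y < W" using J(3) pb(3,4) by (auto intro: in_W)
     have st: "words s' ''n'' 0 = n" and S': "str s' (\<lambda>_ _ _. {}) (E1 \<inter> pairs_below j) spd w rsg" and g': "graph_rep n s' (parcs G) w"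
      and z': "words s' ''tg'' = (\<lambda>_. 0)" "words s' ''ff'' = (\<lambda>_. 0)" using J(1) by blast+
     have S2: "(if (x, y) \<in> parcs G \<and> x \<noteq> y then insert (x, y) (E1 \<inter> pairs_below j) else E1 \<inter> pairs_below j) = E1 \<inter> pairs_below (Suc j)"
      unfolding pb(1) by auto
     show ?thesis
      apply (simp add: wp_simps J(2) st WW flip: x_def y_def)
      apply (rule wp_conseq, rule add1_wp[where x = x and y = y and E = "parcs G" and w = w and Z = "\<lambda>_ _ _. {}" and D = spd and g = rsg and S = "E1 \<inter> pairs_below j"])
      subgoal using S' by simp
      apply ((simp add: st))
      subgoal using g' by (subst graph_rep_cong[of _ s']) simp_all
      apply simp_all[2]
      subgoal by (rule pb)
      subgoal by (rule pb)
      subgoal using pb(2) by blast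
      apply (simp)
      subgoal premises Q for u s2
      proof -
       have "graph_rep n s2 (parcs G) w" using g' by (subst graph_rep_cong[of s2 s']) (simp_all add: Q)
       then have "graph_rep n (wupd s2 ''ui'' 0 (Suc j)) (parcs G) w" by (subst graph_rep_cong[of _ s2]) simp_all
       then show ?thesis using Q(1)[unfolded S2] z' st J(2) by (simp add: Q(2))
      qed
      done
    qed
    subgoal premises J2 for t2 s2
    proof -
     have "E1 \<inter> pairs_below (n * n) = E1" unfolding pairs_below_all using E_n by auto
     then have S2: "str s2 (\<lambda>_ _ _. {}) E1 spd w rsg" using J2(1) by metis
     have st: "words s2 ''n'' 0 = n" "graph_rep n s2 (parcs G) w" "words s2 ''tg'' = (\<lambda>_. 0)" "words s2 ''ff'' = (\<lambda>_. 0)" using J2(1) by blast+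
     have tr: "tree (words s2 ''tg'') (reals s2 ''kg'') (n * n) 0 0 {} (\<lambda>_. 0)" using st(3) by (intro tree_empty) simp
     show ?thesis
      apply (rule wp_conseq, rule refresh_wp[OF S2 _ tr st(1,2)])
      apply ((simp add: sound_def))
      apply ((simp add: st(4)))
      subgoal by blast
      done
    qed
    done
  qed
  done
qed

lemma maintained_load:
 assumes "maintained s"
 shows "maintained (load_update u s)" "loaded u (load_update u s)"
proof -
 have w: "words (load_update u s) z = words s z" if "z \<notin> {''upd_kind'', ''upd_vertex'', ''upd_len'', ''upd_src'', ''upd_dst''}" for z
  using that by (cases u) auto
 have r: "reals (load_update u s) z = reals s z" if "z \<noteq> ''upd_wt''" for z using that by (cases u) auto
 have "settled (load_update u s) = settled s" by (rule settled_cong; rule w r; auto)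
 moreover have "graph_rep n (load_update u s) (parcs G) w = graph_rep n s (parcs G) w" by (rule graph_rep_cong; rule w r; simp)
 ultimately show "maintained (load_update u s)" using assms by (simp add: maintained_def)
 show "loaded u (load_update u s)" unfolding loaded_def by blast
qed

end

text \<open>\<open>CA\<close> counts the tuples before the update, \<open>Cp\<close> those after
  pruning, \<open>CpB\<close> those once the edges at \<open>v\<close> have been exchanged, and
  \<open>CB\<close> those at the end. Deletions cost \<open>12 * h + 60\<close> for each of the
  \<open>CA - Cp\<close> pruned tuples. The same difference and the at most \<open>2 * n\<close>
  single edges at \<open>v\<close> also enter at the potential rate \<open>18 * h + 52\<close>,
  while insertions are covered by \<open>CB\<close>.\<close>

lemma update_time:
 fixes h n N :: nat
 assumes "tc + (12 * h + 60) * Cp \<le> (12 * h + 60) * (CA + F) + 42 * (n * n) + 2"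
  and CA: "CA \<le> Cp + N * N + 2 * (n * N)" and F: "F \<le> 2 * n * N"
  and "t2 \<le> (24 * h + 94) * n + 2" "t3 \<le> 10 * n + 10" "t4 \<le> (24 * h + 94) * n + 2"
  and Cp: "Cp \<le> CpB + 2 * n"
  and "t5 + (18 * h + 52) * CpB \<le> (18 * h + 52) * CB + (30 * h + 110) * dg + (12 * h + 109) * (n * n) + 12 * n + 23" and dg: "dg \<le> 2 * n * N"
 shows "1 + tc + t2 + t3 + t4 + t5 + (18 * h + 52) * CA \<le> (18 * h + 52) * CB + (200 * h + 1000) * (N * N + n * N + n * n + n + 1)"
proof -
 have "(12 * h + 60) * (CA + F) \<le> (12 * h + 60) * (Cp + N * N + 2 * (n * N) + 2 * n * N)" using CA F by (intro mult_le_mono2) (simp add: algebra_simps)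
 moreover have "(18 * h + 52) * CA \<le> (18 * h + 52) * (CpB + 2 * n + N * N + 2 * (n * N))" using CA Cp by (intro mult_le_mono2) (simp add: algebra_simps)
 moreover have "(30 * h + 110) * dg \<le> (30 * h + 110) * (2 * n * N)" using dg by (intro mult_le_mono2)
 ultimately show ?thesis using assms(1,4,5,6,8) by (simp add: algebra_simps)
qed

locale run2 = A: run G w n h W + B: run G' w' n h W for G w n h W G' w' +
 fixes u :: update
 assumes val: "valid_update u (G, w)" and app: "apply_update u (G, w) = (G', w')"
begin

sublocale alg2 n h W "parcs G" w "parcs G'" w' "upd_vertex u"
proof
 show "parcs G' \<subseteq> parcs G" using app by (cases u) auto
 show "w e \<le> w' e" if "e \<in> parcs G'" for e
  using app val by (cases u) (auto split: option.splits dest!: map_of_SomeD, fastforce)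
 show "e \<in> parcs G' \<and> w' e = w e" if e: "e \<in> parcs G" "fst e \<noteq> upd_vertex u" "snd e \<noteq> upd_vertex u" for e
  using app val e by (cases u) (auto simp: incident_def split: option.splits dest!: map_of_SomeD)
qed

lemma vertex: "upd_vertex u \<in> pverts G" "upd_vertex u < n"
proof -
 show 1: "upd_vertex u \<in> pverts G" using val by (cases u) auto
 then show "upd_vertex u < n" using A.verts by blast
qed

lemma upd_wp:
 assumes M: "A.maintained s" and ld: "loaded u s" and N: "nu_star G w \<le> N" "nu_star G' w' \<le> N"
 shows "wp W A.upd (\<lambda>t s'. B.maintained s' \<and> output_correct n (G', w') s' \<and>
   t + (18 * h + 52) * card A.LST \<le> (18 * h + 52) * card B.LST + (200 * h + 1000) * (N * N + n * N + n * n + n + 1)) s"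
proof -
 define v where "v = upd_vertex u"
 have v: "v < n" "v \<in> pverts G" using vertex by (simp_all add: v_def)
 have st: "A.settled s" and gr: "graph_rep n s (parcs G) w" using M by (simp_all add: A.maintained_def)
 obtain Z P key where F: "A.finv s Z P" and td: "A.todo P = {}" and tr: "tree (words s ''tg'') (reals s ''kg'') (n * n) 0 0 {} key"
  and T: "tuples n Z A.E1 = tuples n A.full A.E1" using st unfolding A.settled_def by (elim exE conjE)
 have F': "A.str s Z A.E1 A.spd w A.rsg" "A.sound Z" "words s ''n'' 0 = n" "\<forall>p. words s ''ff'' p \<le> 1" "A.dist_ok s P"
  using F by (simp_all add: A.finv_def)
 have PR: "P = A.reached" by (rule A.finv_reached(1)[OF F td])
 define s1 where "s1 = wupd s ''uv'' 0 v"
 have rc: "words s ''rc'' (x * n + y) = (if A.reach x y then 1 else 0)" "A.reach x y \<Longrightarrow> reals s ''d'' (x * n + y) = A.spd x y" if "x < n" "y < n" for x y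
  using F'(5) that unfolding A.dist_ok_def PR A.reached_def by auto
 \<comment> \<open>In a settled memory the flags mark exactly the reachable pairs. If both parts are
   reachable, so is \<open>(a, b)\<close>, and all three distances compared are valid; the test is
   then \<open>via\<close> in the old graph.\<close>
 have vf: "A.vias s1 v a b \<longleftrightarrow> A.via a v b" if "a < n" "b < n" for a b
  using rc[OF that(1) v(1)] rc[OF v(1) that(2)] rc[OF that] A.reach_trans[of a v b] by (auto simp: A.vias_def A.via_def s1_def)
 define Zp where "Zp = A.prune v (A.vias s1 v) ({..<n} \<times> {..<n}) Z"
 have rcW: "words s1 ''rc'' p < W" if p: "p < n * n" for p
  using A.pairs_below_Suc(3-5)[OF p] rc(1)[of "p div n" "p mod n"] by (auto simp: s1_def)
 have uv: "words s ''upd_vertex'' 0 = v" using loaded_vertex[OF ld] by (simp add: v_def)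
 have vW: "v < W" using v(1) by (rule A.in_W(1))
 have Zsub: "Zp sd a b \<subseteq> Z sd a b" for sd a b by (auto simp: Zp_def A.prune_def)
 have Zp: "v \<notin> Zp sd a b \<and> (A.via a v b \<longrightarrow> Zp sd a b = {})" if "a < n" "b < n" "sd < 2" for sd a b
  using that vf[OF that(1,2)] by (simp add: Zp_def A.prune_def)
 have E': "parcs (fst (apply_update u (G, w))) = parcs G'" "snd (apply_update u (G, w)) = w'" using app by simp_all
 have s1: "A.str s1 Z A.E1 A.spd w A.rsg" "words s1 ''n'' 0 = n" "words s1 ''uv'' 0 = v" "\<forall>p. words s1 ''ff'' p \<le> 1"
  using F' by (simp_all add: s1_def)
 show ?thesis
  unfolding A.upd_def
  apply (simp only: wp_simps wval.simps uv)
  apply (intro conjI)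
  apply (simp)
  subgoal using vW uv by simp
  apply (fold s1_def)
  apply (rule wp_conseq, rule wp_flags[OF A.cleanup_wp[OF s1(1-3) v(1) rcW] A.flags_cleanup s1(4), folded Zp_def])
  subgoal by assumption
  subgoal premises P2 for t2 s2
  proof -
   have s2: "A.str s2 Zp A.E1 A.spd w A.rsg" "\<forall>p. words s2 ''ff'' p \<le> 1" using P2(1) by blast+
   have w2: "words s2 z = words s z" if "z \<in> {''n'', ''eg'', ''tg'', ''upd_kind'', ''upd_vertex'', ''upd_len'', ''upd_src'', ''upd_dst''}" for z
    using that by (auto simp: P2(2) s1_def)
   have uv2: "words s2 ''uv'' 0 = v" by (simp add: P2(2) s1_def)
   have r2: "reals s2 z = reals s z" if "z \<in> {''w'', ''kg'', ''upd_wt''}" for z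
    using that by (auto simp: P2(3) s1_def)
   have n2: "words s2 ''n'' 0 = n" by (simp add: w2 F'(3))
   have gr2: "graph_rep n s2 (parcs G) w" using gr by (subst graph_rep_cong[of s2 s]) (simp_all add: w2 r2)
   show ?thesis
    apply (rule wp_conseq, rule A.rm_edges_wp[OF s2(1) n2 uv2 v(1) gr2])
    subgoal premises P3 for t3 s3
    proof -
     have s3: "A.str s3 Zp (A.E1 - inc v n) A.spd w A.rsg" using P3(1) by blast
     have w3: "words s3 z = words s z" if "z \<in> {''n'', ''eg'', ''tg'', ''upd_kind'', ''upd_vertex'', ''upd_len'', ''upd_src'', ''upd_dst''}" for z
      using that w2[OF that] by (auto simp: P3(2))
     have r3: "reals s3 z = reals s z" if "z \<in> {''w'', ''kg'', ''upd_wt''}" for z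
      using that r2[OF that] by (auto simp: P3(3))
     have uv3: "words s3 ''uv'' 0 = upd_vertex u" by (simp add: P3(2) uv2 flip: v_def)
     have n3: "words s3 ''n'' 0 = n" by (simp add: w3 F'(3))
     have gr3: "graph_rep n s3 (parcs G) w" using gr by (subst graph_rep_cong[of s3 s]) (simp_all add: w3 r3)
     have "loaded u s3 = loaded u s"
     proof (rule loaded_cong)
      show "reals s3 ''upd_wt'' = reals s ''upd_wt''" by (rule r3) simp
      show "words s3 z = words s z" if "z \<in> {''upd_kind'', ''upd_vertex'', ''upd_len'', ''upd_src'', ''upd_dst''}" for z
       using that by (intro w3) auto
     qed
     then have ld3: "loaded u s3" using ld by simp
     have ff3: "words s3 ''ff'' = words s2 ''ff''" by (simp add: P3(2))
     \<comment> \<open>Here the memory is reinterpreted: the store now represents tuples of the new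
       graph, although the edge arrays still hold the old one.\<close>
     note trf = transfer[of s3 Zp Z, folded v_def, OF s3 Zsub F'(2) Zp]
     show ?thesis
      apply (rule wp_conseq, rule A.edit_wp[OF gr3 n3 uv3 vertex(2) A.E_n val ld3])
      subgoal premises P4 for t4 s4
      proof -
       have s4: "A.str s4 Zp (B.E1 - inc v n) B.spd w' B.rsg" using trf(1) by (subst A.str_cong[of s4 s3]) (auto simp: P4(2,3))
       have gr4: "graph_rep n s4 (parcs G') w'" using P4(1) unfolding E' by blast
       have n4: "words s4 ''n'' 0 = n" "words s4 ''uv'' 0 = v" using n3 uv3 by (simp_all add: P4(2) v_def)
       show ?thesis
        apply (rule wp_conseq, rule A.add_edges_wp[OF s4 n4 v(1) gr4 B.spd_refl B.E_n])
        subgoal premises P5 for t5 s5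
        proof -
         have s5: "A.str s5 Zp B.E1 B.spd w' B.rsg" using P5(1) by blast
         have n5: "words s5 ''n'' 0 = n" by (simp add: P5(2) n4)
         have gr5: "graph_rep n s5 (parcs G') w'" using gr4 by (subst graph_rep_cong[of s5 s4]) (simp_all add: P5)
         have "words s5 ''tg'' = words s ''tg''" "reals s5 ''kg'' = reals s ''kg''" by (simp_all add: P5 P4(2,3) w3 r3)
         then have tr5: "tree (words s5 ''tg'') (reals s5 ''kg'') (n * n) 0 0 {} key" using tr by simp
         have ff5: "words s5 ''ff'' p \<le> 1" for p using s2(2) by (simp add: P5(2) P4(2) ff3)
         have fin: "finite (tuples n Zp A.E1)" "finite (tuples n Zp B.E1)" using A.strD(5)[OF s2(1)] A.strD(5)[OF s5] by simp_all
         \<comment> \<open>With the families fixed, exchanging the edges can lose only single-edge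
           tuples at \<open>v\<close>.\<close>
         have "tuples n Zp A.E1 \<subseteq> tuples n Zp B.E1 \<union> (\<lambda>(x, y). (x, y, x, y)) ` inc v n"
          using E1_kept[folded v_def] by (auto simp: tuples_def)
         then have "card (tuples n Zp A.E1) \<le> card (tuples n Zp B.E1 \<union> (\<lambda>(x, y). (x, y, x, y)) ` inc v n)"
          using fin card_inc(1) by (intro card_mono) auto
         also have "\<dots> \<le> card (tuples n Zp B.E1) + card (inc v n)"
          by (intro order_trans[OF card_Un_le] add_mono card_image_le card_inc order_refl)
         finally have c1: "card (tuples n Zp A.E1) \<le> card (tuples n Zp B.E1) + 2 * n" using card_inc(2)[of v n] by simp
         have NN: "nu_star G w * nu_star G w \<le> N * N" "n * nu_star G w \<le> n * N" "n * nu_star G' w' \<le> n * N"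
          using N by (auto intro: mult_le_mono)
         have "card (tuples n Z A.E1) \<le> card (tuples n Zp A.E1) + nu_star G w * nu_star G w + 2 * (n * nu_star G w)"
          unfolding Zp_def by (rule A.pruned_tuples[OF F'(2) v(2) vf]) (use fin in \<open>simp_all add: Zp_def\<close>)
         then have c2: "card A.LST \<le> card (tuples n Zp A.E1) + N * N + 2 * (n * N)" using NN unfolding T A.full_LST by linarith
         have c3: "(\<Sum>j<n * n. A.fam_size Z j) \<le> 2 * n * N" using A.fam_size_le[OF F'(2)] by (rule order_trans) (intro mult_le_mono order_refl N)
         have c4: "B.degs \<le> 2 * n * N" using B.degs_le by (rule order_trans) (intro mult_le_mono order_refl N)
         have c5: "t2 + (12 * h + 60) * card (tuples n Zp A.E1) \<le> (12 * h + 60) * (card A.LST + (\<Sum>j<n * n. A.fam_size Z j)) + 42 * (n * n) + 2"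
          using P2(1) unfolding T A.full_LST by blast
         have c6: "t3 \<le> (24 * h + 94) * n + 2" "t4 \<le> 10 * n + 10" "t5 \<le> (24 * h + 94) * n + 2" using P3(1) P4(1) P5(1) by blast+
         show ?thesis
          apply (rule wp_conseq, rule B.refresh_wp[OF s5 trf(2) tr5 n5 gr5 ff5])
          subgoal by assumption
          subgoal by assumption
          subgoal by assumption
          subgoal premises P6 for t6 s6
           using P6(1) update_time[OF c5 c2 c3 c6 c1 _ c4, of t6 "card B.LST"] by (simp add: add.assoc)
          done
        qed
        done
      qed
      done
    qed
    done
  qed
  done
qed

end

section \<open>Amortisation\<close>

lemma apply_update_fgraph:
 assumes G: "fgraph G w" and u: "valid_update u (G, w)" and a: "apply_update u (G, w) = (G', w')"
 shows "fgraph G' w'" "pverts G' \<subseteq> pverts G"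
proof -
 interpret fgraph G w by (rule G)
 have sub: "parcs G' \<subseteq> parcs G" using a by (cases u) auto
 have ends: "fst e \<in> pverts G' \<and> snd e \<in> pverts G'" if "e \<in> parcs G'" for e
 proof -
  have "fst e \<in> pverts G \<and> snd e \<in> pverts G" using that sub by (intro arc_verts) blast
  then show ?thesis using a that by (cases u) (auto simp: incident_def)
 qed
 show "pverts G' \<subseteq> pverts G" using a by (cases u) auto
 then have "pair_fin_digraph G'"
  using finite_subset[OF _ finite_verts] finite_subset[OF sub fin] ends by unfold_locales auto
 moreover have "0 < w' e" if "e \<in> parcs G'" for e
 proof -
  have "e \<in> parcs G" using that sub by blast
  then have "0 < w e" by (rule pos_w)
  then show ?thesis using a u by (cases u) (auto split: option.splits dest!: map_of_SomeD, fastforce)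
 qed
 ultimately show "fgraph G' w'" by (simp add: fgraph_def)
qed

lemma graph_after_Suc: "i < length us \<Longrightarrow> graph_after Gw us (Suc i) = apply_update (us ! i) (graph_after Gw us i)"
 by (simp add: graph_after_def take_Suc_conv_app_nth)

lemma graph_after_fgraph:
 assumes "fgraph G w" "valid_updates (G, w) us" "i \<le> length us"
 shows "fgraph (fst (graph_after (G, w) us i)) (snd (graph_after (G, w) us i)) \<and> pverts (fst (graph_after (G, w) us i)) \<subseteq> pverts G"
 using assms(3)
proof (induction i)
 case 0
 then show ?case using assms(1) by (simp add: graph_after_def)
next
 case (Suc i)
 obtain H v where H: "graph_after (G, w) us i = (H, v)" by (cases "graph_after (G, w) us i")
 obtain H' v' where H': "apply_update (us ! i) (H, v) = (H', v')" by (cases "apply_update (us ! i) (H, v)")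
 have "fgraph H v" "pverts H \<subseteq> pverts G" using Suc H by simp_all
 moreover have "valid_update (us ! i) (H, v)" using assms(2) Suc.prems H unfolding valid_updates_def by (metis Suc_le_eq)
 ultimately have "fgraph H' v'" "pverts H' \<subseteq> pverts G" using apply_update_fgraph[OF _ _ H'] by blast+
 then show ?case using Suc.prems H H' graph_after_Suc[of i us "(G, w)"] by simp
qed

text \<open>The initial value \<open>\<Phi> 0\<close> stands on the credit side, so tuples created
  by the initialisation are not charged to updates; only the final potential remains.\<close>

lemma telescope:
 fixes \<Phi> T :: "nat \<Rightarrow> nat"
 assumes "\<And>i. i < l \<Longrightarrow> T i + c * \<Phi> i \<le> c * \<Phi> (Suc i) + K"
 shows "(\<Sum>i<l. T i) \<le> c * \<Phi> l + l * K"
proof -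
 have "(\<Sum>i<j. T i) + c * \<Phi> 0 \<le> c * \<Phi> j + j * K" if "j \<le> l" for j
  using that
 proof (induction j)
  case (Suc j)
  then show ?case using assms[of j] by simp
 qed simp
 from this[of l] show ?thesis by simp
qed

lemma maintains_bound:
 assumes V: "valid_instance n es (G, w) us" and h: "4 * (n + 1) * (n + 1) \<le> 2 ^ h"
 defines "N \<equiv> max_nu_star (G, w) us"
 shows "\<exists>T. maintains run.ini run.upd ((n + 2) ^ 8) n es (G, w) us T \<and>
  (\<Sum>i<length us. T i) \<le> (18 * h + 52) * (max_m_star (G, w) us * N + n * n) + length us * ((200 * h + 1000) * (N * N + n * N + n * n + n + 1))"
proof -
 define W where "W = (n + 2) ^ 8"
 define l where "l = length us"
 define H where "H i = fst (graph_after (G, w) us i)" for i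
 define v where "v i = snd (graph_after (G, w) us i)" for i
 have Hv: "graph_after (G, w) us i = (H i, v i)" for i by (simp add: H_def v_def)
 have V': "pair_fin_digraph G" "pverts G = {..<n}" "distinct es" "set es = parcs G" "\<And>e. e \<in> parcs G \<Longrightarrow> 0 < w e" "valid_updates (G, w) us"
  using V by (auto simp: valid_instance_def)
 have fg: "fgraph G w" using V'(1,5) by (simp add: fgraph_def)
 have ram: "ram n h W" using h by unfold_locales (simp_all add: W_def)
 have run: "run (H i) (v i) n h W" if "i \<le> l" for i
  using graph_after_fgraph[OF fg V'(6), of i] that ram V'(2) by (simp add: run_def run_axioms_def H_def v_def l_def)
 have H0: "H 0 = G" "v 0 = w" by (simp_all add: H_def v_def graph_after_def)
 have up: "run2 (H i) (v i) n h W (H (Suc i)) (v (Suc i)) (us ! i)" if "i < l" for i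
 proof -
  have "valid_update (us ! i) (H i, v i)" using V'(6) that unfolding valid_updates_def l_def Hv by blast
  moreover have "apply_update (us ! i) (H i, v i) = (H (Suc i), v (Suc i))"
   using graph_after_Suc[of i us "(G, w)"] that unfolding l_def Hv by simp
  ultimately show ?thesis using run[of i] run[of "Suc i"] that by (simp add: run2_def run2_axioms_def)
 qed
 have nu: "nu_star (H i) (v i) \<le> N" if "i \<le> l" for i
  unfolding N_def max_nu_star_def Hv using that by (intro Max_ge) (auto simp: l_def intro!: image_eqI[of _ _ i])
 have ms: "m_star (H i) (v i) \<le> max_m_star (G, w) us" if "i \<le> l" for i
  unfolding max_m_star_def Hv using that by (intro Max_ge) (auto simp: l_def intro!: image_eqI[of _ _ i])
 define \<Phi> where "\<Phi> i = card (fgraph.LST (H i) (v i))" for i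
 define K where "K = (200 * h + 1000) * (N * N + n * N + n * n + n + 1)"
 define good where "good i s \<longleftrightarrow> run.maintained (H i) (v i) n s \<and> output_correct n (H i, v i) s" for i s
 \<comment> \<open>Both predicates become vacuous beyond the last update, so that an infinite
   sequence of memories can be chosen. The clause for index 0 remembers the run of the
   initialisation.\<close>
 define P where "P i s \<longleftrightarrow> (i \<le> l \<longrightarrow> good i s) \<and> (i = 0 \<longrightarrow> (\<exists>t0. exec W run.ini (initial_state n es w) t0 s))" for i s
 define Q where "Q i s s' \<longleftrightarrow> (i < l \<longrightarrow> (\<exists>t. exec W run.upd (load_update (us ! i) s) t s' \<and> t + (18 * h + 52) * \<Phi> i \<le> (18 * h + 52) * \<Phi> (Suc i) + K))" for i s s'
 have "\<exists>f. \<forall>i. P i (f i) \<and> Q i (f i) (f (Suc i))"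
 proof (rule dependent_nat_choice)
  interpret run G w n h W using run[of 0] H0 by simp
  have "wp W ini (\<lambda>t s'. maintained s' \<and> output_correct n (G, w) s') (initial_state n es w)"
   by (rule ini_wp[OF V'(3,4)])
  then show "\<exists>s. P 0 s" unfolding wp_def P_def good_def H0 by blast
 next
  fix s i assume p: "P i s"
  show "\<exists>s'. P (Suc i) s' \<and> Q i s s'"
  proof (cases "i < l")
   case True
   interpret run2 "H i" "v i" n h W "H (Suc i)" "v (Suc i)" "us ! i" by (rule up[OF True])
   have m: "A.maintained s" using p True by (simp add: P_def good_def)
   have "wp W A.upd (\<lambda>t s'. B.maintained s' \<and> output_correct n (H (Suc i), v (Suc i)) s' \<and>
     t + (18 * h + 52) * \<Phi> i \<le> (18 * h + 52) * \<Phi> (Suc i) + K) (load_update (us ! i) s)"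
    unfolding \<Phi>_def K_def using True by (intro upd_wp A.maintained_load m nu) simp_all
   then show ?thesis unfolding wp_def P_def Q_def good_def by blast
  next
   case False
   then show ?thesis by (simp add: P_def Q_def)
  qed
 qed
 then obtain S where S: "\<And>i. P i (S i)" "\<And>i. Q i (S i) (S (Suc i))" by blast
 have "\<forall>i. \<exists>t. i < l \<longrightarrow> exec W run.upd (load_update (us ! i) (S i)) t (S (Suc i)) \<and> t + (18 * h + 52) * \<Phi> i \<le> (18 * h + 52) * \<Phi> (Suc i) + K"
  using S(2) unfolding Q_def by blast
 then obtain T where T: "\<And>i. i < l \<Longrightarrow> exec W run.upd (load_update (us ! i) (S i)) (T i) (S (Suc i))"
  "\<And>i. i < l \<Longrightarrow> T i + (18 * h + 52) * \<Phi> i \<le> (18 * h + 52) * \<Phi> (Suc i) + K" by metis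
 obtain t0 where "exec W run.ini (initial_state n es w) t0 (S 0)" using S(1)[of 0] unfolding P_def by blast
 moreover have "output_correct n (graph_after (G, w) us i) (S i)" if "i \<le> l" for i
  using S(1)[of i] that unfolding P_def good_def Hv by blast
 ultimately have mt: "maintains run.ini run.upd W n es (G, w) us T"
  unfolding maintains_def using T(1) by (auto simp: l_def)
 have \<Phi>: "\<Phi> l \<le> max_m_star (G, w) us * N + n * n"
 proof -
  have "\<Phi> l \<le> m_star (H l) (v l) * nu_star (H l) (v l) + n * n" unfolding \<Phi>_def by (rule run.LST_le[OF run]) simp
  also have "\<dots> \<le> max_m_star (G, w) us * N + n * n" by (intro add_mono mult_le_mono ms nu order_refl)
  finally show ?thesis .
 qed
 have "(\<Sum>i<l. T i) \<le> (18 * h + 52) * \<Phi> l + l * K" using T(2) by (rule telescope[where T = T and c = "18 * h + 52" and \<Phi> = \<Phi> and K = K])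
 moreover have "(18 * h + 52) * \<Phi> l \<le> (18 * h + 52) * (max_m_star (G, w) us * N + n * n)" using \<Phi> by (rule mult_le_mono2)
 ultimately have "(\<Sum>i<l. T i) \<le> (18 * h + 52) * (max_m_star (G, w) us * N + n * n) + l * K" by linarith
 then show ?thesis using mt unfolding l_def K_def W_def by blast
qed

text \<open>From \<open>2 * (n + 1) \<le> 4 * n \<le> n ^ 3\<close> one gets
  \<open>4 * (n + 1) * (n + 1) \<le> n ^ 6\<close>, so \<open>h\<close> is six logarithms rounded
  up. The rounding and the added 1 fit into two more logarithms because the logarithm is at least
  1.\<close>

lemma tree_height:
 assumes n: "2 \<le> n"
 shows "\<exists>h. 4 * (n + 1) * (n + 1) \<le> (2::nat) ^ h \<and> real (h + 1) \<le> 8 * log 2 (real n)"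
proof -
 define L where "L = log 2 (real n)"
 define h where "h = nat \<lceil>6 * L\<rceil>"
 have L1: "1 \<le> L" unfolding L_def using n by (simp add: le_log_iff)
 have h1: "6 * L \<le> real h" "real h \<le> 6 * L + 1"
 proof -
  have "real h = of_int \<lceil>6 * L\<rceil>" using L1 by (simp add: h_def)
  then show "6 * L \<le> real h" "real h \<le> 6 * L + 1" by linarith+
 qed
 have "2 * (n + 1) \<le> n ^ 3"
 proof -
  have "2 * (n + 1) \<le> 2 * 2 * n" using n by simp
  also have "\<dots> \<le> n * n * n" using n by (intro mult_le_mono) auto
  finally show ?thesis by (simp only: power3_eq_cube)
 qed
 then have "(2 * (n + 1)) ^ 2 \<le> (n ^ 3) ^ 2" by (rule power_mono) simp
 moreover have "(2 * (n + 1)) ^ 2 = 4 * (n + 1) * (n + 1)" by (simp add: power2_eq_square algebra_simps)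
 moreover have "(n ^ 3) ^ 2 = n ^ 6" by (simp flip: power_mult)
 ultimately have "4 * (n + 1) * (n + 1) \<le> n ^ 6" by simp
 then have "real (4 * (n + 1) * (n + 1)) \<le> real n ^ 6" by (metis of_nat_le_iff of_nat_power)
 also have "\<dots> = 2 powr (6 * L)"
 proof -
  have "2 powr (6 * L) = (2 powr L) powr 6" by (simp add: powr_powr mult.commute)
  also have "2 powr L = real n" unfolding L_def using n by simp
  finally show ?thesis using n by (simp add: powr_numeral)
 qed
 also have "\<dots> \<le> 2 powr real h" using h1 by (intro powr_mono) simp_all
 also have "\<dots> = real (2 ^ h)" by (simp add: powr_realpow)
 finally have "4 * (n + 1) * (n + 1) \<le> (2::nat) ^ h" by (simp only: of_nat_le_iff)
 moreover have "real (h + 1) \<le> 8 * L" using h1 L1 by simp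
 ultimately show ?thesis unfolding L_def by blast
qed

text \<open>The lower bound on \<open>l\<close> turns \<open>m * \<nu>\<close> into at most
  \<open>l * \<nu>\<^sup>2 / c2\<close>, and \<open>n \<le> \<nu> / c1\<close> turns each remaining
  term into a multiple of \<open>\<nu>\<^sup>2\<close>, using \<open>n + 1 \<le> n * n\<close>. The
  term \<open>n * n\<close> outside the product with \<open>l\<close> is absorbed because
  \<open>l\<close> is at least 1.\<close>

lemma amortised_bound:
 fixes n h l m \<nu> :: nat and c1 c2 L :: real
 assumes c: "0 < c1" "0 < c2" and n: "2 \<le> n" and nu: "c1 * real n \<le> real \<nu>" and m: "c2 * (real m / real \<nu>) \<le> real l"
  and l: "0 < l" and h: "real (h + 1) \<le> 8 * L"
 shows "real ((18 * h + 52) * (m * \<nu> + n * n) + l * ((200 * h + 1000) * (\<nu> * \<nu> + n * \<nu> + n * n + n + 1)))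
  \<le> 8 * (60 * (1 / c2 + 1 / c1 ^ 2) + 1000 * (1 + 1 / c1 + 2 / c1 ^ 2)) * real l * real \<nu> ^ 2 * L"
proof -
 define a where "a = 1 / c1"
 define N where "N = real \<nu>"
 define H where "H = real (h + 1)"
 have a: "0 < a" using c by (simp add: a_def)
 have na: "real n \<le> a * N" using nu c by (simp add: a_def N_def field_simps)
 have "0 < c1 * real n" using c n by simp
 then have N: "0 < N" using nu by (simp add: N_def)
 have H: "1 \<le> H" "H \<le> 8 * L" using h by (simp_all add: H_def)
 have l1: "1 \<le> real l" using l by simp
 have mN: "real m * N \<le> real l * N ^ 2 / c2"
 proof -
  have "c2 * real m \<le> real l * N" using m N by (simp add: N_def field_simps)
  then have "real m \<le> real l * N / c2" using c by (simp add: field_simps)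
  from mult_right_mono[OF this, of N] show ?thesis using N by (simp add: power2_eq_square mult.assoc)
 qed
 have nN: "real n * N \<le> a * N ^ 2" using mult_right_mono[OF na, of N] N by (simp add: power2_eq_square mult.assoc)
 have nn: "real n * real n \<le> a ^ 2 * N ^ 2"
  using mult_mono[OF na na] a N by (simp add: power2_eq_square algebra_simps)
 have n1: "real n + 1 \<le> real n * real n"
 proof -
  have "2 * real n \<le> real n * real n" using n by (intro mult_right_mono) simp_all
  moreover have "2 \<le> real n" using n by simp
  ultimately show ?thesis by linarith
 qed
 have k1: "real (18 * h + 52) \<le> 60 * H" "real (200 * h + 1000) \<le> 1000 * H" by (simp_all add: H_def)
 have s1: "real m * N + real n * real n \<le> real l * N ^ 2 * (1 / c2 + a ^ 2)"
 proof -
  have "a ^ 2 * N ^ 2 \<le> real l * (a ^ 2 * N ^ 2)" using l1 mult_right_mono[OF l1, of "a ^ 2 * N ^ 2"] by simp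
  then show ?thesis using mN nn by (simp add: algebra_simps)
 qed
 have s2: "N * N + real n * N + real n * real n + real n + 1 \<le> N ^ 2 * (1 + a + 2 * a ^ 2)"
  using nN nn n1 by (simp add: power2_eq_square algebra_simps)
 have t1: "real (18 * h + 52) * (real m * N + real n * real n) \<le> 60 * H * (real l * N ^ 2 * (1 / c2 + a ^ 2))"
  using N H by (intro mult_mono k1 s1) simp_all
 have t2: "real (200 * h + 1000) * (N * N + real n * N + real n * real n + real n + 1) \<le> 1000 * H * (N ^ 2 * (1 + a + 2 * a ^ 2))"
  using N H by (intro mult_mono k1 s2) simp_all
 define X where "X = 60 * (1 / c2 + a ^ 2) + 1000 * (1 + a + 2 * a ^ 2)"
 have X: "0 \<le> X" using a c by (simp add: X_def)
 have "real ((18 * h + 52) * (m * \<nu> + n * n) + l * ((200 * h + 1000) * (\<nu> * \<nu> + n * \<nu> + n * n + n + 1))) =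
   real (18 * h + 52) * (real m * N + real n * real n) + real l * (real (200 * h + 1000) * (N * N + real n * N + real n * real n + real n + 1))"
  by (simp only: N_def of_nat_add of_nat_mult of_nat_1)
 also have "\<dots> \<le> 60 * H * (real l * N ^ 2 * (1 / c2 + a ^ 2)) + real l * (1000 * H * (N ^ 2 * (1 + a + 2 * a ^ 2)))"
  using l1 by (intro add_mono t1 mult_left_mono t2) simp
 also have "\<dots> = H * (X * (real l * N ^ 2))" by (simp add: X_def algebra_simps)
 also have "\<dots> \<le> 8 * L * (X * (real l * N ^ 2))" using X by (intro mult_right_mono H) simp
 also have "\<dots> = 8 * X * real l * N ^ 2 * L" by (simp only: ac_simps)
 also have "X = 60 * (1 / c2 + 1 / c1 ^ 2) + 1000 * (1 + 1 / c1 + 2 / c1 ^ 2)" by (simp add: X_def a_def power_one_over)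
 finally show ?thesis by (simp only: N_def)
qed

theorem theorem1:
 shows "\<exists>ini upd k. \<forall>c1>0. \<forall>c2>0. \<exists>C::real>0.
  \<forall>n es G w us. valid_instance n es (G, w) us \<longrightarrow>
   (\<exists>T. maintains ini upd ((n + 2) ^ k) n es (G, w) us T \<and>
     (2 \<le> n \<and>
     c1 * real n \<le> real (max_nu_star (G, w) us) \<and>
     c2 * (real (max_m_star (G, w) us) / real (max_nu_star (G, w) us)) \<le> real (length us)
     \<longrightarrow> real (\<Sum>i<length us. T i)
        \<le> C * real (length us) * (real (max_nu_star (G, w) us))^2 * log 2 (real n)))"
\<comment> \<open>The programs are independent of the locale parameters, so they and the exponent
  can be fixed before the constants and the instance.\<close>
proof (rule exI[of _ run.ini], rule exI[of _ run.upd], rule exI[of _ 8], intro allI impI)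
 fix c1 c2 :: real assume c: "0 < c1" "0 < c2"
 define K where "K = 8 * (60 * (1 / c2 + 1 / c1 ^ 2) + 1000 * (1 + 1 / c1 + 2 / c1 ^ 2))"
 have K: "0 < K" unfolding K_def using c by (simp add: add_pos_pos)
 have "\<exists>T. maintains run.ini run.upd ((n + 2) ^ 8) n es (G, w) us T \<and>
   (2 \<le> n \<and> c1 * real n \<le> real (max_nu_star (G, w) us) \<and>
    c2 * (real (max_m_star (G, w) us) / real (max_nu_star (G, w) us)) \<le> real (length us) \<longrightarrow>
    real (\<Sum>i<length us. T i) \<le> K * real (length us) * (real (max_nu_star (G, w) us))^2 * log 2 (real n))"
  if V: "valid_instance n es (G, w) us" for n es G w us
 proof -
  have "\<exists>h. 4 * (n + 1) * (n + 1) \<le> (2::nat) ^ h \<and> (2 \<le> n \<longrightarrow> real (h + 1) \<le> 8 * log 2 (real n))"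
  proof (cases "2 \<le> n")
   case True
   then show ?thesis using tree_height by blast
  next
   case False
   then have "n = 0 \<or> n = 1" by auto
   \<comment> \<open>For \<open>n = 1\<close> the required bound is exactly
     \<open>2 ^ 4\<close>.\<close>
   then show ?thesis by (intro exI[of _ 4]) auto
  qed
  then obtain h where h: "4 * (n + 1) * (n + 1) \<le> (2::nat) ^ h" "2 \<le> n \<Longrightarrow> real (h + 1) \<le> 8 * log 2 (real n)" by blast
  obtain T where T: "maintains run.ini run.upd ((n + 2) ^ 8) n es (G, w) us T"
   "(\<Sum>i<length us. T i) \<le> (18 * h + 52) * (max_m_star (G, w) us * max_nu_star (G, w) us + n * n) +
     length us * ((200 * h + 1000) * (max_nu_star (G, w) us * max_nu_star (G, w) us + n * max_nu_star (G, w) us + n * n + n + 1))"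
   using maintains_bound[OF V h(1)] by blast
  have "real (\<Sum>i<length us. T i) \<le> K * real (length us) * (real (max_nu_star (G, w) us))^2 * log 2 (real n)"
   if a: "2 \<le> n" "c1 * real n \<le> real (max_nu_star (G, w) us)"
    "c2 * (real (max_m_star (G, w) us) / real (max_nu_star (G, w) us)) \<le> real (length us)"
  \<comment> \<open>With no updates both sides are zero.\<close>
  proof (cases "length us = 0")
   case False
   have "real (\<Sum>i<length us. T i) \<le> real ((18 * h + 52) * (max_m_star (G, w) us * max_nu_star (G, w) us + n * n) +
     length us * ((200 * h + 1000) * (max_nu_star (G, w) us * max_nu_star (G, w) us + n * max_nu_star (G, w) us + n * n + n + 1)))"
    by (rule of_nat_mono[OF T(2)])
   also have "\<dots> \<le> K * real (length us) * (real (max_nu_star (G, w) us))^2 * log 2 (real n)"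
    unfolding K_def using False by (intro amortised_bound c a h(2)) simp_all
   finally show ?thesis .
  qed simp
  then show ?thesis using T(1) by blast
 qed
 then show "\<exists>C::real>0. \<forall>n es G w us. valid_instance n es (G, w) us \<longrightarrow>
   (\<exists>T. maintains run.ini run.upd ((n + 2) ^ 8) n es (G, w) us T \<and>
     (2 \<le> n \<and> c1 * real n \<le> real (max_nu_star (G, w) us) \<and>
     c2 * (real (max_m_star (G, w) us) / real (max_nu_star (G, w) us)) \<le> real (length us)
     \<longrightarrow> real (\<Sum>i<length us. T i) \<le> C * real (length us) * (real (max_nu_star (G, w) us))^2 * log 2 (real n)))"
  using K by blast
qed

end
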